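(* Consider the massive MIMO systems described in the context with $M$-ary PAM, PSK or square QAM constellations, the zero-forcing detector, Hermitian Toeplitz channel covariance matrices $\mathbf\Sigma=\mathbf\Sigma_{N_t}$ with entries $[\mathbf\Sigma]_{mn}=\sigma(m-n)$, $N_r=\beta N_t$ with $\beta>1$ fixed, fixed SNR $\eta>0$, and the precoder $$\widetilde{\mathbf F}=\frac1{\sqrt{\mathrm{tr}(\mathbf\Lambda^{-1/2})}}\,\mathbf W\mathbf\Lambda^{-1/4}\widetilde{\mathbf V}_2,$$ where $\mathbf\Sigma=\mathbf W\mathbf\Lambda\mathbf W^H$ is the eigenvalue decomposition ($\mathbf W$ unitary, $\mathbf\Lambda$ diagonal with the eigenvalues of $\mathbf\Sigma$ in nondecreasing order) and $\widetilde{\mathbf V}_2$ is the $N_t\times N_t$ normalized DFT matrix. Let $s_\Sigma(\omega)=\sum_{k=-\infty}^\infty\sigma(k)e^{-jk\omega}$. If the entries of $\mathbf\Sigma$ are absolutely square-summable, i.e. $\sum_{k\ge0}|\sigma(k)|^2<\infty$, and $L_{s_\Sigma}=\operatorname{ess\,inf}_\omega s_\Sigma(\omega)>0$, then the limit of the average SEP, $\lim_{N_t\to\infty}\mathrm P_{N_t}(\widetilde{\mathbf F})=\bar{\mathrm P}_{\mathrm{opt}}$, exists, and with $$\Lambda=\frac1{2\pi}\int_0^{2\pi}\frac{d\omega}{\sqrt{s_\Sigma(\omega)}}$$ it is given by: - for PAM: $\displaystyle\bar{\mathrm P}_{\mathrm{opt,PAM}}=\frac{2(M-1)}MQ\left(\sqrt{\frac{6\eta(\beta-1)}{(M^2-1)\Lambda^2}}\right)$;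 - for PSK: $\displaystyle\bar{\mathrm P}_{\mathrm{opt,PSK}}=\frac1\pi\int_0^{(M-1)\pi/M}\exp\left(-\frac{\eta(\beta-1)\sin^2(\pi/M)}{\Lambda^2\sin^2\theta}\right)d\theta$; - for QAM: $\displaystyle\bar{\mathrm P}_{\mathrm{opt,QAM}}=\frac{4(\sqrt M-1)}{\sqrt M}Q\left(\sqrt{\frac{3\eta(\beta-1)}{(M-1)\Lambda^2}}\right)-\frac{4(\sqrt M-1)^2}{M}Q^2\left(\sqrt{\frac{3\eta(\beta-1)}{(M-1)\Lambda^2}}\right)$.
   Context: System model. The received vector is $\mathbf r=\mathbf H\mathbf F\mathbf s+\boldsymbol\xi\in\mathbb C^{N_r}$, where: $\mathbf H$ is an $N_r\times N_t$ random matrix whose rows $\mathbf h_1^T,\dots,\mathbf h_{N_r}^T$ are i.i.d. zero-mean circularly-symmetric complex Gaussian with $\mathbb E[(\mathbf h_m^T)^H\mathbf h_m^T]=\mathbf\Sigma$; $\mathbf F$ is an $N_t\times N_t$ nonsingular deterministic precoding matrix; $\boldsymbol\xi$ is circularly-symmetric complex Gaussian noise with covariance $\sigma^2\mathbf I$; $\mathbf s=[s_1,\dots,s_{N_t}]^T$ has i.i.d. entries, each uniform on a constellation $\mathcal S\subset\mathbb C$ of size $M$ with unit average energy; $\mathbf H,\mathbf s,\boldsymbol\xi$ are independent. The system SNR is $\eta=1/\sigma^2$ (the noise variance $\sigma^2$ is unrelated to the correlation sequence $\sigma(\cdot)$). Constellations. $M$-PAM ($M\ge2$): $\{\delta(2i-1-M):i=1,\dots,M\}\subset\mathbb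 R$ with $\delta=\sqrt{3/(M^2-1)}$. $M$-PSK ($M\ge2$): $\{e^{2\pi j i/M}:i=0,\dots,M-1\}$ (with $j=\sqrt{-1}$). Square $M$-QAM ($\sqrt M\ge 2$ an integer): $\{a+jb\}$ with $a,b$ ranging over $\{\delta(2i-1-\sqrt M):i=1,\dots,\sqrt M\}$, $\delta=\sqrt{3/(2(M-1))}$. Zero-forcing detection. With $(\mathbf H\mathbf F)^+=(\mathbf F^H\mathbf H^H\mathbf H\mathbf F)^{-1}\mathbf F^H\mathbf H^H$, the receiver forms $\mathbf r'=(\mathbf H\mathbf F)^+\mathbf r$ and decides $\hat s_k=\arg\min_{s\in\mathcal S}|r'_k-s|^2$ for each $k$. Average SEP. $\mathrm P_{N_t}(\mathbf F)=\frac1{N_t}\sum_{k=1}^{N_t}\Pr(\hat s_k\ne s_k)$, the probability being over $\mathbf H$, $\mathbf s$ and $\boldsymbol\xi$. Conventions. $\sigma:\mathbb Z\to\mathbb C$ is a fixed sequence (independent of $N_t$) with $\sigma(-k)=\sigma(k)^*$, and $s_\Sigma$ is the real-valued function with Fourier coefficients $\sigma(k)=\frac1{2\pi}\int_0^{2\pi}s_\Sigma(\omega)e^{jk\omega}d\omega$. $\operatorname{ess\,inf}$ is with respect to Lebesgue measure on $[0,2\pi]$. The limit is over $N_t$ with $N_r=\beta N_t$ (an integer). The normalized DFT matrix has $(m,n)$ entry $N_t^{-1/2}e^{-2\pi j(m-1)(n-1)/N_t}$. $Q(x)=\frac1{\sqrt{2\pi}}\int_x^\infty e^{-t^2/2}dt$,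 and $Q^2(x)=(Q(x))^2$. *)

theory Defs
  imports
    "HOL-Probability.Probability"
    "Jordan_Normal_Form.Gauss_Jordan_Elimination"
    "Jordan_Normal_Form.Schur_Decomposition"
begin

(* Matrices and vectors below are those of Jordan_Normal_Form, with 0-based indices: their size
   has to vary along a limit. *)
hide_type (open) Finite_Cartesian_Product.vec
unbundle no vec_syntax and no inner_syntax


section \<open>Measurable structure on vectors and matrices\<close>

(* The Borel sigma-algebra of C^n, respectively C^(m x n), carried by the vectors and matrices of
   the given size only: a measurable map therefore takes its values in the carrier. *)

definition vec_borel :: "nat \<Rightarrow> complex vec measure" where
  "vec_borel n = vimage_algebra (carrier_vec n)
     (\<lambda>v. \<lambda>i\<in>{..<n}. v $ i) (Pi\<^sub>M {..<n} (\<lambda>_. borel))"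

definition mat_borel :: "nat \<Rightarrow> nat \<Rightarrow> complex mat measure" where
  "mat_borel m n = vimage_algebra (carrier_mat m n)
     (\<lambda>A. \<lambda>p\<in>{..<m} \<times> {..<n}. A $$ p) (Pi\<^sub>M ({..<m} \<times> {..<n}) (\<lambda>_. borel))"

(* indep_vars requires a common value type; for random elements of different types independence is
   stated with indep_sets for these preimage families. *)
definition preimage_sets :: "'a measure \<Rightarrow> ('a \<Rightarrow> 'b) \<Rightarrow> 'b measure \<Rightarrow> 'a set set" where
  "preimage_sets M X N = {X -` A \<inter> space M |A. A \<in> sets N}"


section \<open>Gaussian random vectors\<close>

(* Point masses are included: a linear combination of the components of a Gaussian vector may be
   almost surely constant. *)
definition gaussian_rv :: "'a measure \<Rightarrow> ('a \<Rightarrow> real) \<Rightarrow> bool" where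
  "gaussian_rv M X \<longleftrightarrow> X \<in> borel_measurable M \<and>
     ((\<exists>\<mu>. AE \<omega> in M. X \<omega> = \<mu>) \<or>
      (\<exists>\<mu> \<tau>. 0 < \<tau> \<and> distributed M lborel X (normal_density \<mu> \<tau>)))"

(* Since Re (a z) = Re a Re z - Im a Im z, the second clause ranges over all real linear
   combinations of the real and imaginary parts of the components. *)
definition complex_gaussian_vec :: "'a measure \<Rightarrow> nat \<Rightarrow> ('a \<Rightarrow> complex vec) \<Rightarrow> bool" where
  "complex_gaussian_vec M n Z \<longleftrightarrow> Z \<in> measurable M (vec_borel n) \<and>
     (\<forall>a\<in>carrier_vec n. gaussian_rv M (\<lambda>\<omega>. Re (a \<bullet> Z \<omega>)))"

definition circularly_symmetric :: "'a measure \<Rightarrow> nat \<Rightarrow> ('a \<Rightarrow> complex vec) \<Rightarrow> bool" where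
  "circularly_symmetric M n Z \<longleftrightarrow>
     (\<forall>\<phi>::real. distr M (vec_borel n) (\<lambda>\<omega>. cis \<phi> \<cdot>\<^sub>v Z \<omega>) = distr M (vec_borel n) Z)"

definition cscg :: "'a measure \<Rightarrow> nat \<Rightarrow> ('a \<Rightarrow> complex vec) \<Rightarrow> bool" where
  "cscg M n Z \<longleftrightarrow> complex_gaussian_vec M n Z \<and> circularly_symmetric M n Z \<and>
     (\<forall>i<n. (LINT \<omega>|M. Z \<omega> $ i) = 0)"


section \<open>System model\<close>

locale mimo_system = prob_space P for P :: "'a measure" +
  fixes Nr Nt :: nat
    and \<Sigma> :: "complex mat"
    and noise_var :: real
    and S :: "complex set"
    and H :: "'a \<Rightarrow> complex mat"
    and s \<xi> :: "'a \<Rightarrow> complex vec"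
  assumes H_measurable: "H \<in> measurable P (mat_borel Nr Nt)"
    and rows_indep: "indep_vars (\<lambda>_. vec_borel Nt) (\<lambda>m \<omega>. row (H \<omega>) m) {..<Nr}"
    and rows_cscg: "\<And>m. m < Nr \<Longrightarrow> cscg P Nt (\<lambda>\<omega>. row (H \<omega>) m)"
    and rows_cov: "\<And>m a b. m < Nr \<Longrightarrow> a < Nt \<Longrightarrow> b < Nt \<Longrightarrow>
          expectation (\<lambda>\<omega>. cnj (H \<omega> $$ (m, a)) * H \<omega> $$ (m, b)) = \<Sigma> $$ (a, b)"
    and noise_cscg: "cscg P Nr \<xi>"
    and noise_cov: "\<And>a b. a < Nr \<Longrightarrow> b < Nr \<Longrightarrow>
          expectation (\<lambda>\<omega>. \<xi> \<omega> $ a * cnj (\<xi> \<omega> $ b)) = (if a = b then complex_of_real noise_var else 0)"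
    and s_measurable: "s \<in> measurable P (vec_borel Nt)"
    and symbols_indep: "indep_vars (\<lambda>_. borel) (\<lambda>k \<omega>. s \<omega> $ k) {..<Nt}"
    and symbols_uniform: "\<And>k c. k < Nt \<Longrightarrow> c \<in> S \<Longrightarrow>
          prob {\<omega> \<in> space P. s \<omega> $ k = c} = 1 / real (card S)"
    and indep_H_s_noise: "indep_sets
          (\<lambda>i. [preimage_sets P H (mat_borel Nr Nt),
                preimage_sets P s (vec_borel Nt),
                preimage_sets P \<xi> (vec_borel Nr)] ! i) {..<3}"


section \<open>Constellations\<close>

definition pam :: "nat \<Rightarrow> complex set" where
  "pam M = (let \<delta> = sqrt (3 / ((real M)\<^sup>2 - 1)) in
     {complex_of_real (\<delta> * (2 * real i - 1 - real M)) |i. i \<in> {1..M}})"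

definition psk :: "nat \<Rightarrow> complex set" where
  "psk M = {cis (2 * pi * real i / real M) |i. i < M}"

definition qam :: "nat \<Rightarrow> complex set" where
  "qam M = (let \<delta> = sqrt (3 / (2 * (real M - 1)));
                lev = {\<delta> * (2 * real i - 1 - sqrt (real M)) |i::nat. 1 \<le> i \<and> real i \<le> sqrt (real M)}
            in {Complex a b |a b. a \<in> lev \<and> b \<in> lev})"


section \<open>Zero-forcing detection and symbol error probability\<close>

(* Totalised by the zero matrix at singular arguments. *)
definition mat_inv :: "complex mat \<Rightarrow> complex mat" where
  "mat_inv A = (case mat_inverse A of Some B \<Rightarrow> B | None \<Rightarrow> 0\<^sub>m (dim_row A) (dim_row A))"

definition zf_matrix :: "complex mat \<Rightarrow> complex mat" where
  "zf_matrix A = mat_inv (mat_adjoint A * A) * mat_adjoint A"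

definition received :: "complex mat \<Rightarrow> complex mat \<Rightarrow> complex vec \<Rightarrow> complex vec \<Rightarrow> complex vec" where
  "received H F s \<xi> = (H * F) *\<^sub>v s + \<xi>"

definition zf_output :: "complex mat \<Rightarrow> complex mat \<Rightarrow> complex vec \<Rightarrow> complex vec \<Rightarrow> complex vec" where
  "zf_output H F s \<xi> = zf_matrix (H * F) *\<^sub>v received H F s \<xi>"

(* Ties are broken by the fixed choice function inside arg_min_on. *)
definition nearest :: "complex set \<Rightarrow> complex \<Rightarrow> complex" where
  "nearest S z = arg_min_on (\<lambda>c. (cmod (z - c))\<^sup>2) S"

definition avg_sep :: "'a measure \<Rightarrow> nat \<Rightarrow> complex set \<Rightarrow> ('a \<Rightarrow> complex mat) \<Rightarrow>
    ('a \<Rightarrow> complex vec) \<Rightarrow> ('a \<Rightarrow> complex vec) \<Rightarrow> complex mat \<Rightarrow> real" where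
  "avg_sep P Nt S H s \<xi> F = (1 / real Nt) *
     (\<Sum>k<Nt. measure P {\<omega> \<in> space P. nearest S (zf_output (H \<omega>) F (s \<omega>) (\<xi> \<omega>) $ k) \<noteq> s \<omega> $ k})"


section \<open>Covariance matrices and precoder\<close>

definition toeplitz :: "(int \<Rightarrow> complex) \<Rightarrow> nat \<Rightarrow> complex mat" where
  "toeplitz \<sigma> n = mat n n (\<lambda>(a, b). \<sigma> (int a - int b))"

definition dft_matrix :: "nat \<Rightarrow> complex mat" where
  "dft_matrix n = mat n n (\<lambda>(a, b).
     exp (- (2 * complex_of_real pi * \<i> * of_nat a * of_nat b / of_nat n)) / complex_of_real (sqrt (real n)))"

(* The diagonal matrix D^p for D = diag (d 0, ..., d (n - 1)) with positive real entries. *)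
definition diag_powr :: "nat \<Rightarrow> (nat \<Rightarrow> real) \<Rightarrow> real \<Rightarrow> complex mat" where
  "diag_powr n d p = mat_diag n (\<lambda>i. complex_of_real (d i powr p))"

definition eigen_decomposition :: "nat \<Rightarrow> complex mat \<Rightarrow> complex mat \<Rightarrow> (nat \<Rightarrow> real) \<Rightarrow> bool" where
  "eigen_decomposition n A W d \<longleftrightarrow>
     W \<in> carrier_mat n n \<and>
     mat_adjoint W * W = 1\<^sub>m n \<and> W * mat_adjoint W = 1\<^sub>m n \<and>
     mono_on {..<n} d \<and>
     A = W * mat_diag n (\<lambda>i. complex_of_real (d i)) * mat_adjoint W"

(* The sum is the trace of D^(-1/2). *)
definition precoder :: "nat \<Rightarrow> complex mat \<Rightarrow> (nat \<Rightarrow> real) \<Rightarrow> complex mat" where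
  "precoder n W d = complex_of_real (1 / sqrt (\<Sum>i<n. d i powr (- 1 / 2))) \<cdot>\<^sub>m
     (W * diag_powr n d (- 1 / 4) * dft_matrix n)"


section \<open>Symbol of the covariance sequence\<close>

(* A representative of the function with the formal Fourier series given by the sum of
   \<sigma> k * exp (-i k \<omega>) over all integers k; it is determined up to a null set. *)
definition has_fourier_coeffs :: "(real \<Rightarrow> real) \<Rightarrow> (int \<Rightarrow> complex) \<Rightarrow> bool" where
  "has_fourier_coeffs f \<sigma> \<longleftrightarrow> integrable (lebesgue_on {0..2 * pi}) f \<and>
     (\<forall>k. \<sigma> k = 1 / (2 * complex_of_real pi) *
        (LINT \<omega>|lebesgue_on {0..2 * pi}. complex_of_real (f \<omega>) * exp (\<i> * of_int k * complex_of_real \<omega>)))"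

definition essinf :: "'a measure \<Rightarrow> ('a \<Rightarrow> ereal) \<Rightarrow> ereal" where
  "essinf M f = - esssup M (\<lambda>x. - f x)"


section \<open>Limit formulas and system sizes\<close>

definition gaussian_Q :: "real \<Rightarrow> real" where
  "gaussian_Q x = 1 / sqrt (2 * pi) * (LINT t:{x..}|lborel. exp (- t\<^sup>2 / 2))"

(* Numbers Nt of transmit antennas for which \<beta> Nt is an integer. *)
definition admissible :: "real \<Rightarrow> nat set" where
  "admissible \<beta> = {n. 0 < n \<and> \<beta> * real n \<in> \<nat>}"

definition rx_antennas :: "real \<Rightarrow> nat \<Rightarrow> nat" where
  "rx_antennas \<beta> n = nat \<lfloor>\<beta> * real n\<rfloor>"

(* n tends to infinity through the admissible sizes. *)
definition size_filter :: "real \<Rightarrow> nat filter" where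
  "size_filter \<beta> = inf sequentially (principal (admissible \<beta>))"

lemma real_rx_antennas: "n \<in> admissible \<beta> \<Longrightarrow> real (rx_antennas \<beta> n) = \<beta> * real n"
  by (auto simp: admissible_def rx_antennas_def Nats_def)

lemma size_filter_neq_bot:
  assumes "\<beta> \<in> \<rat>" "0 < \<beta>"
  shows "size_filter \<beta> \<noteq> bot"
proof -
  obtain p q :: nat where q: "q \<noteq> 0" and pq: "\<bar>\<beta>\<bar> = real p / real q"
    using Rats_abs_nat_div_natE[OF assms(1)] by metis
  have adm: "(k + 1) * q \<in> admissible \<beta>" for k :: nat
  proof -
    have "\<beta> * real ((k + 1) * q) = real ((k + 1) * p)"
      using q pq assms(2) by (simp add: field_simps)
    then show ?thesis using q by (simp only: admissible_def) auto
  qed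
  have "\<exists>n\<ge>N. n \<in> admissible \<beta>" for N
    using adm[of N] q by (intro exI[of _ "(N + 1) * q"] conjI) (cases q, auto)
  then show ?thesis
    unfolding size_filter_def trivial_limit_def eventually_inf_principal eventually_sequentially
    by blast
qed

end

theory Submission
  imports Defs
begin

text \<open>
  Write the precoder as \<open>T N\<close>, where \<open>T\<close> whitens the covariance matrix. Its freedom (a unitary factor)
  can be spent so that the \<open>k\<close>-th row of \<open>N\<inverse>\<close> is supported on the last coordinate, with entry
  \<open>\<rho> = n\<^bsup>-1/2\<^esup> tr D\<^bsup>-1/2\<^esup>\<close>; all entries of the DFT matrix having the same modulus, \<open>\<rho>\<close> does not depend
  on \<open>k\<close>. The noise seen by the \<open>k\<close>-th symbol is then a standard complex Gaussian scaled by
  \<open>\<rho> (noise_var / q)\<^bsup>1/2\<^esup>\<close>, where \<open>q\<close> is the squared norm of the last Gram-Schmidt residual of a Gaussian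
  \<open>Nr \<times> n\<close> matrix. As a quadratic form in an independent column, \<open>q\<close> has mean and variance equal to the
  rank \<open>Nr - n + 1\<close>, so \<open>q / n\<close> concentrates at \<open>\<beta> - 1\<close> by Chebyshev's inequality. A Szego type theorem
  gives \<open>tr D\<^bsup>-1/2\<^esup> / n \<longlonglongrightarrow> \<Lambda>\<close>, hence the effective noise variance tends to \<open>noise_var \<Lambda>\<^sup>2 / (\<beta> - 1)\<close>, and
  it remains to compute the symbol error probability of each constellation in Gaussian noise.
\<close>


section \<open>Characteristic functions and product measures\<close>

text \<open>Three obstacles shape the proof. Gaussian vectors are given only through the laws of
  their real linear forms, so joint laws have to be recovered from characteristic functions, one
  coordinate at a time; conditioning on the transmitted symbol is carried along as an indicator
  factor, which yields the law of channel and noise given that symbol. The unitary factor that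
  aligns \<open>N\<close> with the last coordinate depends on \<open>k\<close>. This is harmless
  because the average involves only the separate error event of each \<open>k\<close>, and the
  resulting integral is the same for every \<open>k\<close>. Both one-sided bounds come instead from
  the cubic inequality \<open>inverse_sqrt_ge\<close>, which is affine in the eigenvalue and
  therefore asks only for weak convergence of the Fejer means of the symbol. Since error
  probabilities lie in [0, 1], convergence in probability of the effective noise variance is enough
  for the final passage to the limit.\<close>

lemma integral_complex_lincomb:
  fixes f g :: "'a \<Rightarrow> complex"
  assumes "integrable M f" "integrable M g"
  shows "(CLINT x|M. a * f x + b * g x) = a * (CLINT x|M. f x) + b * (CLINT x|M. g x)"
  using assms by simp

text \<open>Adding \<open>K + 1\<close> to \<open>g\<close> and dividing by the mean makes a
  positive density. Under the reweighted measure \<open>Y\<close> still has the characteristic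
  function of \<nu>, so the one-dimensional uniqueness theorem gives \<open>Y\<close> the law \<nu>
  under both measures; comparing the two statements isolates the weight \<open>g\<close>.\<close>

lemma (in prob_space) Levy_uniqueness_weighted_real:
  fixes Y g :: "'a \<Rightarrow> real"
  assumes [measurable]: "Y \<in> borel_measurable M" "g \<in> borel_measurable M"
    and K: "\<And>x. \<bar>g x\<bar> \<le> K"
    and \<nu>: "real_distribution \<nu>"
    and charY: "\<And>s. (CLINT \<omega>|M. iexp (s * Y \<omega>)) = char \<nu> s"
    and charg: "\<And>s. (CLINT \<omega>|M. of_real (g \<omega>) * iexp (s * Y \<omega>)) = of_real c * char \<nu> s"
    and A: "A \<in> sets borel"
  shows "(LINT \<omega>|M. g \<omega> * indicator A (Y \<omega>)) = c * measure \<nu> A"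
proof -
  interpret \<nu>: real_distribution \<nu> by fact
  have ig: "integrable M g"
    by (rule integrable_const_bound[of _ K]) (auto simp: K)
  \<comment> \<open>Frequency 0 in \<open>charg\<close> identifies the constant.\<close>
  have c: "c = expectation g"
  proof -
    have "complex_of_real c = (CLINT \<omega>|M. of_real (g \<omega>))"
      using charg[of 0] \<nu>.char_zero by simp
    also have "\<dots> = of_real (expectation g)" by (rule integral_complex_of_real)
    finally show ?thesis by (simp only: of_real_eq_iff)
  qed
  have "\<bar>c\<bar> \<le> K"
  proof -
    have "c \<le> K" unfolding c using ig by (intro integral_le_const) (auto intro!: AE_I2 abs_le_D1[OF K])
    moreover have "-K \<le> c" unfolding c using ig K by (intro integral_ge_const) (auto intro!: AE_I2 simp: abs_le_iff minus_le_iff)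
    ultimately show ?thesis by linarith
  qed
  \<comment> \<open>The mean of \<open>K + 1 + g\<close>; the extra 1 keeps it positive even when
    \<open>c = - K\<close>.\<close>
  define D where "D = K + 1 + c"
  have D: "D > 0" using \<open>\<bar>c\<bar> \<le> K\<close> unfolding D_def by linarith
  define h where "h \<omega> = (K + 1 + g \<omega>) / D" for \<omega>
  have [measurable]: "h \<in> borel_measurable M" unfolding h_def by simp
  have h0: "0 \<le> h \<omega>" for \<omega> using K[of \<omega>] D unfolding h_def by (auto simp: field_simps)
  have ih: "integrable M h" unfolding h_def using ig by auto
  have Eh: "expectation h = 1"
    unfolding h_def using ig D by (simp add: c[symmetric] prob_space add_ac) (simp add: D_def)
  define N where "N = density M h"
  have "emeasure N (space N) = 1"
    unfolding N_def using ih h0 Eh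
    by (simp add: emeasure_density nn_integral_eq_integral cong: nn_integral_cong)
  then interpret N: prob_space N by (rule prob_spaceI)
  have iI: "integrable M (\<lambda>\<omega>. iexp (s * Y \<omega>))" for s
    by (rule integrable_const_bound[of _ 1]) auto
  have iG: "integrable M (\<lambda>\<omega>. of_real (g \<omega>) * iexp (s * Y \<omega>))" for s
    by (rule integrable_const_bound[of _ K]) (auto simp: norm_mult K)
  have [measurable]: "Y \<in> borel_measurable N" unfolding N_def by simp
  have rN: "real_distribution (distr N borel Y)"
    by (auto intro!: N.prob_space_distr simp: real_distribution_def real_distribution_axioms_def)
  have rM: "real_distribution (distr M borel Y)"
    by (auto intro!: prob_space_distr simp: real_distribution_def real_distribution_axioms_def)
  have "char (distr N borel Y) s = char \<nu> s" for s
  proof -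
    have "char (distr N borel Y) s = (CLINT \<omega>|N. iexp (s * Y \<omega>))"
      unfolding char_def by (subst integral_distr) auto
    also have "\<dots> = (CLINT \<omega>|M. h \<omega> *\<^sub>R iexp (s * Y \<omega>))"
      unfolding N_def using h0 by (subst integral_density) auto
    also have "\<dots> = (CLINT \<omega>|M. (of_real ((K+1)/D) * iexp (s * Y \<omega>) + of_real (1/D) * (of_real (g \<omega>) * iexp (s * Y \<omega>))))"
      unfolding h_def by (intro Bochner_Integration.integral_cong refl)
         (simp add: scaleR_conv_of_real add_divide_distrib algebra_simps)
    also have "\<dots> = of_real ((K+1)/D) * char \<nu> s + of_real (1/D) * (of_real c * char \<nu> s)"
      unfolding integral_complex_lincomb[OF iI iG] charg charY ..
    also have "\<dots> = of_real ((K+1)/D + 1/D * c) * char \<nu> s"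
      by (simp only: of_real_add of_real_mult distrib_right mult.assoc)
    also have "(K+1)/D + 1/D * c = D/D" by (simp add: D_def flip: add_divide_distrib)
    also have "D/D = 1" using D by simp
    finally show ?thesis by simp
  qed
  then have eqN: "distr N borel Y = \<nu>" by (intro Levy_uniqueness rN \<nu>) auto
  have "char (distr M borel Y) s = char \<nu> s" for s
    unfolding char_def charY[symmetric, unfolded char_def] by (subst integral_distr) auto
  then have eqM: "distr M borel Y = \<nu>" by (intro Levy_uniqueness rM \<nu>) auto
  have [measurable]: "A \<in> sets borel" by fact
  have iA: "integrable M (\<lambda>\<omega>. indicator A (Y \<omega>) :: real)"
    by (rule integrable_const_bound[of _ 1]) (auto simp: indicator_def)
  have igA: "integrable M (\<lambda>\<omega>. g \<omega> * indicator A (Y \<omega>))"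
    by (rule integrable_const_bound[of _ K]) (use K in \<open>auto simp: indicator_def\<close>, metis abs_ge_zero order_trans)
  have 1: "measure \<nu> A = (LINT \<omega>|M. indicator A (Y \<omega>))"
  proof -
    have "measure \<nu> A = (LINT x|distr M borel Y. indicator A x)" unfolding eqM by simp
    also have "\<dots> = (LINT \<omega>|M. indicator A (Y \<omega>))" by (subst integral_distr) auto
    finally show ?thesis .
  qed
  have "measure \<nu> A = (LINT x|distr N borel Y. indicator A x)" unfolding eqN by simp
  also have "\<dots> = (LINT \<omega>|N. indicator A (Y \<omega>))" by (subst integral_distr) auto
  also have "\<dots> = (LINT \<omega>|M. h \<omega> *\<^sub>R indicator A (Y \<omega>))"
    unfolding N_def using h0 by (subst integral_density) auto
  also have "\<dots> = (LINT \<omega>|M. (K+1)/D * indicator A (Y \<omega>) + (1/D) * (g \<omega> * indicator A (Y \<omega>)))"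
    unfolding h_def by (intro Bochner_Integration.integral_cong refl)
       (simp add: add_divide_distrib algebra_simps)
  also have "\<dots> = (K+1)/D * measure \<nu> A + 1/D * (LINT \<omega>|M. g \<omega> * indicator A (Y \<omega>))"
    using iA igA by (simp add: 1)
  finally have *: "measure \<nu> A = (K+1)/D * measure \<nu> A + 1/D * (LINT \<omega>|M. g \<omega> * indicator A (Y \<omega>))" .
  have "D * measure \<nu> A = D * ((K+1)/D * measure \<nu> A + 1/D * (LINT \<omega>|M. g \<omega> * indicator A (Y \<omega>)))"
    using * by simp
  also have "\<dots> = (K+1) * measure \<nu> A + (LINT \<omega>|M. g \<omega> * indicator A (Y \<omega>))"
    using D by (simp only: distrib_left) simp
  finally have "D * measure \<nu> A = (K+1) * measure \<nu> A + (LINT \<omega>|M. g \<omega> * indicator A (Y \<omega>))" .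
  then show ?thesis unfolding D_def by (simp add: algebra_simps)
qed

lemma borel_measurable_cnj [measurable]: "cnj \<in> borel_measurable borel"
  by (intro borel_measurable_continuous_onI continuous_intros)

lemma cnj_char: "cnj (char \<nu> s) = char \<nu> (- s)"
  unfolding char_def by (simp add: exp_cnj flip: Bochner_Integration.integral_cnj)

text \<open>The real case is applied to the real and the imaginary part of \<open>g\<close>. Both
  are combinations of \<open>g\<close> and \<open>cnj g\<close>, and conjugating
  \<open>charg\<close> at \<open>- s\<close> supplies the identity for \<open>cnj g\<close>.\<close>

lemma (in prob_space) Levy_uniqueness_weighted:
  fixes Y :: "'a \<Rightarrow> real" and g :: "'a \<Rightarrow> complex"
  assumes [measurable]: "Y \<in> borel_measurable M" "g \<in> borel_measurable M"
    and K: "\<And>x. norm (g x) \<le> K"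
    and \<nu>: "real_distribution \<nu>"
    and charY: "\<And>s. (CLINT \<omega>|M. iexp (s * Y \<omega>)) = char \<nu> s"
    and charg: "\<And>s. (CLINT \<omega>|M. g \<omega> * iexp (s * Y \<omega>)) = c * char \<nu> s"
    and A: "A \<in> sets borel"
  shows "(CLINT \<omega>|M. g \<omega> * indicator A (Y \<omega>)) = c * measure \<nu> A"
proof -
  have iG: "integrable M (\<lambda>\<omega>. g \<omega> * iexp (s * Y \<omega>))" for s
    by (rule integrable_const_bound[of _ K]) (auto simp: norm_mult K)
  have iG': "integrable M (\<lambda>\<omega>. cnj (g \<omega>) * iexp (s * Y \<omega>))" for s
    by (rule integrable_const_bound[of _ K]) (auto simp: norm_mult K)
  have cnjg: "(CLINT \<omega>|M. cnj (g \<omega>) * iexp (s * Y \<omega>)) = cnj c * char \<nu> s" for s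
  proof -
    have "(CLINT \<omega>|M. cnj (g \<omega>) * iexp (s * Y \<omega>)) = (CLINT \<omega>|M. cnj (g \<omega> * iexp ((-s) * Y \<omega>)))"
      by (intro Bochner_Integration.integral_cong refl) (simp add: exp_cnj)
    also have "\<dots> = cnj (CLINT \<omega>|M. g \<omega> * iexp ((-s) * Y \<omega>))" by (rule Bochner_Integration.integral_cnj)
    also have "\<dots> = cnj c * char \<nu> s" unfolding charg by (simp add: cnj_char)
    finally show ?thesis .
  qed
  have R: "(LINT \<omega>|M. Re (g \<omega>) * indicator A (Y \<omega>)) = Re c * measure \<nu> A"
  proof (rule Levy_uniqueness_weighted_real[OF _ _ _ \<nu> charY _ A])
    fix x show "\<bar>Re (g x)\<bar> \<le> K" using K[of x] abs_Re_le_cmod order_trans by blast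
  next
    fix s
    have "(CLINT \<omega>|M. of_real (Re (g \<omega>)) * iexp (s * Y \<omega>)) =
      (CLINT \<omega>|M. (1/2) * (g \<omega> * iexp (s * Y \<omega>)) + (1/2) * (cnj (g \<omega>) * iexp (s * Y \<omega>)))"
      by (intro Bochner_Integration.integral_cong refl) (simp add: complex_eq_iff field_simps)
    also have "\<dots> = of_real (Re c) * char \<nu> s"
      unfolding integral_complex_lincomb[OF iG iG'] charg cnjg by (simp add: complex_eq_iff field_simps)
    finally show "(CLINT \<omega>|M. of_real (Re (g \<omega>)) * iexp (s * Y \<omega>)) = of_real (Re c) * char \<nu> s" .
  qed simp_all
  have I: "(LINT \<omega>|M. Im (g \<omega>) * indicator A (Y \<omega>)) = Im c * measure \<nu> A"
  proof (rule Levy_uniqueness_weighted_real[OF _ _ _ \<nu> charY _ A])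
    fix x show "\<bar>Im (g x)\<bar> \<le> K" using K[of x] abs_Im_le_cmod order_trans by blast
  next
    fix s
    have "(CLINT \<omega>|M. of_real (Im (g \<omega>)) * iexp (s * Y \<omega>)) =
      (CLINT \<omega>|M. (-\<i>/2) * (g \<omega> * iexp (s * Y \<omega>)) + (\<i>/2) * (cnj (g \<omega>) * iexp (s * Y \<omega>)))"
      by (intro Bochner_Integration.integral_cong refl) (simp add: complex_eq_iff field_simps)
    also have "\<dots> = of_real (Im c) * char \<nu> s"
      unfolding integral_complex_lincomb[OF iG iG'] charg cnjg by (simp add: complex_eq_iff field_simps)
    finally show "(CLINT \<omega>|M. of_real (Im (g \<omega>)) * iexp (s * Y \<omega>)) = of_real (Im c) * char \<nu> s" .
  qed simp_all
  have [measurable]: "A \<in> sets borel" by fact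
  have igA: "integrable M (\<lambda>\<omega>. g \<omega> * indicator A (Y \<omega>))"
    by (rule integrable_const_bound[of _ K]) (use K in \<open>auto simp: indicator_def\<close>, metis norm_ge_zero order_trans)
  have ind: "indicator A y = complex_of_real (indicator A y)" for y by (simp add: indicator_def)
  have 1: "Re (CLINT \<omega>|M. g \<omega> * indicator A (Y \<omega>)) = Re c * measure \<nu> A"
    unfolding R[symmetric] using igA by (subst integral_Re[symmetric]) (auto simp: ind intro!: Bochner_Integration.integral_cong)
  have 2: "Im (CLINT \<omega>|M. g \<omega> * indicator A (Y \<omega>)) = Im c * measure \<nu> A"
    unfolding I[symmetric] using igA by (subst integral_Im[symmetric]) (auto simp: ind intro!: Bochner_Integration.integral_cong)
  from 1 2 show ?thesis by (simp add: complex_eq_iff)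
qed

text \<open>Exponential factors are exchanged for indicators one coordinate at a time, each exchange
  being the one-dimensional uniqueness theorem with all other factors as a bounded weight. After the
  last exchange the identity gives the mass of a box.\<close>

lemma (in prob_space) distr_PiM_eq_of_char:
  fixes X :: "'i \<Rightarrow> 'a \<Rightarrow> real"
  assumes fin: "finite I"
    and X: "\<And>i. i \<in> I \<Longrightarrow> X i \<in> borel_measurable M"
    and \<nu>: "\<And>i. real_distribution (\<nu> i)"
    and char: "\<And>t. (CLINT \<omega>|M. iexp (\<Sum>i\<in>I. t i * X i \<omega>)) = (\<Prod>i\<in>I. char (\<nu> i) (t i))"
  shows "distr M (Pi\<^sub>M I (\<lambda>_. borel)) (\<lambda>\<omega>. \<lambda>i\<in>I. X i \<omega>) = Pi\<^sub>M I \<nu>"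
proof -
  interpret rd: real_distribution "\<nu> i" for i by (rule \<nu>)
  interpret product_sigma_finite \<nu> by standard
  have char1: "(CLINT \<omega>|M. iexp (s * X k \<omega>)) = char (\<nu> k) s" if "k \<in> I" for k s
  proof -
    have "(\<Sum>i\<in>I. (if i = k then s else 0) * X i \<omega>) = s * X k \<omega>" for \<omega>
      using that fin by (simp add: if_distrib[of "\<lambda>x. x * _"] cong: if_cong)
    moreover have "(\<Prod>i\<in>I. char (\<nu> i) (if i = k then s else 0)) = char (\<nu> k) s"
      using that fin by (simp add: if_distrib[of "char _"] rd.char_zero prod.remove[of I k])
    ultimately show ?thesis using char[of "\<lambda>i. if i = k then s else 0"] by simp
  qed
  \<comment> \<open>Coordinates in \<open>J\<close> already carry indicators, the others still
    exponentials: \<open>J = {}\<close> is the hypothesis, \<open>J = I\<close> the product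
    formula.\<close>
  have main: "(CLINT \<omega>|M. (\<Prod>j\<in>J. indicator (A j) (X j \<omega>)) * iexp (\<Sum>i\<in>I - J. t i * X i \<omega>)) =
      (\<Prod>j\<in>J. of_real (measure (\<nu> j) (A j))) * (\<Prod>i\<in>I - J. char (\<nu> i) (t i))"
    if "finite J" "J \<subseteq> I" "\<And>j. j \<in> J \<Longrightarrow> A j \<in> sets borel" for J A t
    using that
  proof (induction J arbitrary: t rule: finite_induct)
    case empty
    then show ?case using char[of t] by simp
  next
    case (insert k J)
    have k: "k \<in> I" "J \<subseteq> I" using insert.prems by auto
    have split: "I - J = insert k (I - insert k J)" using k insert.hyps by auto
    \<comment> \<open>Every factor except that of coordinate \<open>k\<close>; its modulus is at
      most 1, so it can serve as the weight.\<close>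
    define G where "G \<omega> = (\<Prod>j\<in>J. indicator (A j) (X j \<omega>)) * iexp (\<Sum>i\<in>I - insert k J. t i * X i \<omega>)" for \<omega>
    have [measurable]: "X i \<in> borel_measurable M" if "i \<in> I" for i using X that by auto
    have Gm[measurable]: "G \<in> borel_measurable M"
    proof -
      have "(\<lambda>\<omega>. \<Sum>i\<in>I - insert k J. t i * X i \<omega>) \<in> borel_measurable M" by (auto intro!: borel_measurable_sum)
      moreover have "(\<lambda>\<omega>. (\<Prod>j\<in>J. indicator (A j) (X j \<omega>) :: complex)) \<in> borel_measurable M"
        using insert.prems k X
        by (intro borel_measurable_prod) (auto intro!: measurable_compose[OF X borel_measurable_indicator])
      ultimately show ?thesis unfolding G_def by measurable
    qed
    have "(CLINT \<omega>|M. G \<omega> * indicator (A k) (X k \<omega>)) =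
       ((\<Prod>j\<in>J. of_real (measure (\<nu> j) (A j))) * (\<Prod>i\<in>I - insert k J. char (\<nu> i) (t i))) * measure (\<nu> k) (A k)"
    proof (rule Levy_uniqueness_weighted[of "X k" G 1 "\<nu> k", OF X[OF k(1)] Gm _ \<nu> char1[OF k(1)]])
      show "A k \<in> sets borel" using insert.prems by auto
      show "norm (G \<omega>) \<le> 1" for \<omega>
        unfolding G_def norm_mult by (auto intro!: mult_le_one prod_le_1 simp: norm_exp_i_times indicator_def prod_norm[symmetric])
      fix s
      have "(CLINT \<omega>|M. (\<Prod>j\<in>J. indicator (A j) (X j \<omega>)) * iexp (\<Sum>i\<in>I - J. (t(k := s)) i * X i \<omega>)) =
        (\<Prod>j\<in>J. of_real (measure (\<nu> j) (A j))) * (\<Prod>i\<in>I - J. char (\<nu> i) ((t(k := s)) i))"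
        using insert.prems k by (intro insert.IH) auto
      also have "(\<Prod>i\<in>I - J. char (\<nu> i) ((t(k := s)) i)) = char (\<nu> k) s * (\<Prod>i\<in>I - insert k J. char (\<nu> i) (t i))"
        unfolding split using fin by (subst prod.insert) (auto intro!: prod.cong)
      also have "(\<lambda>\<omega>. (\<Sum>i\<in>I - J. (t(k := s)) i * X i \<omega>)) = (\<lambda>\<omega>. s * X k \<omega> + (\<Sum>i\<in>I - insert k J. t i * X i \<omega>))"
        unfolding split using fin by (subst sum.insert) (auto intro!: sum.cong)
      finally show "(CLINT \<omega>|M. G \<omega> * iexp (s * X k \<omega>)) =
         ((\<Prod>j\<in>J. of_real (measure (\<nu> j) (A j))) * (\<Prod>i\<in>I - insert k J. char (\<nu> i) (t i))) * char (\<nu> k) s"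
        unfolding G_def by (simp add: exp_add distrib_left mult_ac)
    qed
    then show ?case using insert.hyps unfolding G_def by (simp add: mult_ac)
  qed
  have sets: "sets (Pi\<^sub>M I \<nu>) = sets (Pi\<^sub>M I (\<lambda>_. borel))" by (rule sets_PiM_cong) auto
  have mX: "(\<lambda>\<omega>. \<lambda>i\<in>I. X i \<omega>) \<in> measurable M (Pi\<^sub>M I (\<lambda>_. borel))"
    using X by (rule measurable_restrict)
  show ?thesis
  proof (rule PiM_eqI[OF fin])
    show "sets (distr M (Pi\<^sub>M I (\<lambda>_. borel)) (\<lambda>\<omega>. \<lambda>i\<in>I. X i \<omega>)) = sets (Pi\<^sub>M I \<nu>)" using sets by simp
    fix A assume "\<And>i. i \<in> I \<Longrightarrow> A i \<in> sets (\<nu> i)"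
    then have A: "\<And>i. i \<in> I \<Longrightarrow> A i \<in> sets borel" by simp
    let ?E = "{\<omega> \<in> space M. \<forall>i\<in>I. X i \<omega> \<in> A i}"
    have E: "(\<lambda>\<omega>. \<lambda>i\<in>I. X i \<omega>) -` Pi\<^sub>E I A \<inter> space M = ?E"
      by (auto simp: PiE_iff)
    have Es: "?E \<in> sets M"
      unfolding E[symmetric] using A fin mX by (intro measurable_sets[OF mX] sets_PiM_I_finite) auto
    have "complex_of_real (measure M ?E) = of_real (LINT \<omega>|M. indicator ?E \<omega>)"
      using Es by simp
    also have "\<dots> = (CLINT \<omega>|M. indicator ?E \<omega>)"
      unfolding integral_complex_of_real[symmetric]
      by (intro Bochner_Integration.integral_cong refl) (simp add: indicator_def)
    also have "\<dots> = (CLINT \<omega>|M. (\<Prod>j\<in>I. indicator (A j) (X j \<omega>)) * iexp (\<Sum>i\<in>I - I. 0 * X i \<omega>))"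
      using fin by (intro Bochner_Integration.integral_cong refl) (auto simp: indicator_def)
    also have "\<dots> = (\<Prod>j\<in>I. of_real (measure (\<nu> j) (A j)))"
      using main[OF fin subset_refl A] by simp
    finally have "measure M ?E = (\<Prod>j\<in>I. measure (\<nu> j) (A j))"
      by (simp only: of_real_prod[symmetric] of_real_eq_iff)
    then show "emeasure (distr M (Pi\<^sub>M I (\<lambda>_. borel)) (\<lambda>\<omega>. \<lambda>i\<in>I. X i \<omega>)) (Pi\<^sub>E I A) = (\<Prod>i\<in>I. emeasure (\<nu> i) (A i))"
      using A fin by (subst emeasure_distr[OF mX])
        (auto simp: E emeasure_eq_measure rd.emeasure_eq_measure prod_ennreal intro!: sets_PiM_I_finite)
  qed
qed

section \<open>The standard complex Gaussian distribution\<close>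

text \<open>Variance 1/2 in each real coordinate gives \<open>cgauss\<close> mean squared modulus 1;
  complex noise of variance \<open>v\<close> is then \<open>sqrt v\<close> times such a
  variable.\<close>

definition half_normal :: "real measure" where
  "half_normal = density lborel (normal_density 0 (1 / sqrt 2))"

definition cgauss :: "complex measure" where
  "cgauss = distr (half_normal \<Otimes>\<^sub>M half_normal) borel (\<lambda>(x, y). Complex x y)"

lemma measurable_Complex [measurable]: "(\<lambda>(x, y). Complex x y) \<in> borel_measurable (borel \<Otimes>\<^sub>M borel)"
proof -
  have "(\<lambda>(x::real, y::real). complex_of_real x + \<i> * complex_of_real y) \<in> borel_measurable (borel \<Otimes>\<^sub>M borel)"
    by measurable
  then show ?thesis by (simp add: complex_eq[symmetric] Complex_eq)
qed

lemma sets_half_normal [simp, measurable_cong]: "sets half_normal = sets borel"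
  unfolding half_normal_def by simp

lemma space_half_normal [simp]: "space half_normal = UNIV"
  unfolding half_normal_def by simp

lemma sets_cgauss [simp, measurable_cong]: "sets cgauss = sets borel"
  unfolding cgauss_def by simp

lemma space_cgauss [simp]: "space cgauss = UNIV"
  unfolding cgauss_def by simp

lemma real_distribution_half_normal: "real_distribution half_normal"
proof -
  interpret prob_space half_normal
    unfolding half_normal_def by (rule prob_space_normal_density) simp
  show ?thesis by unfold_locales simp_all
qed

interpretation half_normal: real_distribution half_normal
  by (rule real_distribution_half_normal)

interpretation half_normal_pair: pair_prob_space half_normal half_normal ..

lemma prob_space_cgauss: "prob_space cgauss"
  unfolding cgauss_def by (intro half_normal_pair.prob_space_distr) measurable

interpretation cgauss: prob_space cgauss by (rule prob_space_cgauss)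

lemma half_normal_eq_distr: "half_normal = distr std_normal_distribution borel (\<lambda>x. x / sqrt 2)"
proof -
  interpret S: prob_space std_normal_distribution by (rule prob_space_normal_density) simp
  have "distributed std_normal_distribution lborel (\<lambda>x. x) std_normal_density"
    by (auto simp: distributed_def intro!: distr_id2)
  from S.normal_density_affine[OF this, of "1 / sqrt 2" 0]
  have "distributed std_normal_distribution lborel (\<lambda>x. x / sqrt 2) (normal_density 0 (1 / sqrt 2))"
    by simp
  then have "distr std_normal_distribution lborel (\<lambda>x. x / sqrt 2) = half_normal"
    by (simp add: distributed_def half_normal_def)
  then show ?thesis by (metis distr_cong sets_lborel)
qed

lemma char_half_normal: "char half_normal t = of_real (exp (- t\<^sup>2 / 4))"
proof -
  have "char half_normal t = (CLINT x|std_normal_distribution. iexp (t * (x / sqrt 2)))"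
    unfolding char_def half_normal_eq_distr by (subst integral_distr) auto
  also have "\<dots> = char std_normal_distribution (t / sqrt 2)"
    unfolding char_def by simp
  also have "\<dots> = of_real (exp (- t\<^sup>2 / 4))"
    by (simp add: char_std_normal_distribution power_divide)
  finally show ?thesis .
qed

lemma char_cgauss: "(CLINT z|cgauss. iexp (Re (cnj a * z))) = of_real (exp (- (cmod a)\<^sup>2 / 4))"
proof -
  have i: "integrable half_normal (\<lambda>x. iexp (t * x))" for t
    by (rule half_normal.integrable_const_bound[of _ 1]) auto
  have "(CLINT z|cgauss. iexp (Re (cnj a * z))) =
      (CLINT p|half_normal \<Otimes>\<^sub>M half_normal. iexp (Re a * fst p) * iexp (Im a * snd p))"
    unfolding cgauss_def
    by (subst integral_distr) (auto simp: case_prod_beta exp_add distrib_left intro!: Bochner_Integration.integral_cong)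
  also have "\<dots> = (CLINT x|half_normal. CLINT y|half_normal. iexp (Re a * x) * iexp (Im a * y))"
    by (subst half_normal_pair.integral_fst'[symmetric])
      (auto intro!: half_normal_pair.P.integrable_const_bound[of _ 1] simp: norm_mult)
  also have "\<dots> = char half_normal (Re a) * char half_normal (Im a)"
    unfolding char_def using i by simp
  also have "\<dots> = of_real (exp (- (cmod a)\<^sup>2 / 4))"
    unfolding char_half_normal by (simp add: cmod_def exp_add[symmetric] field_simps flip: of_real_mult)
  finally show ?thesis .
qed

lemma distr_PiM_half_normal:
  assumes "i \<in> I"
  shows "distr (Pi\<^sub>M I (\<lambda>_. half_normal)) borel (\<lambda>f. f i) = half_normal"
proof -
  have "distr (Pi\<^sub>M I (\<lambda>_. half_normal)) borel (\<lambda>f. f i) = distr (Pi\<^sub>M I (\<lambda>_. half_normal)) half_normal (\<lambda>f. f i)"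
    by (rule distr_cong) auto
  also have "\<dots> = half_normal"
    using assms half_normal.prob_space_axioms by (intro distr_PiM_component) auto
  finally show ?thesis .
qed

text \<open>The forms \<open>Re (cnj a * z)\<close> are exactly the real linear functionals of the
  plane, so the hypothesis is the joint characteristic function of the real and the imaginary
  part.\<close>

lemma (in prob_space) distr_eq_cgauss:
  assumes [measurable]: "Y \<in> borel_measurable M"
    and char: "\<And>a. (CLINT \<omega>|M. iexp (Re (cnj a * Y \<omega>))) = of_real (exp (- (cmod a)\<^sup>2 / 4))"
  shows "distr M borel Y = cgauss"
proof -
  define X where "X = case_bool (\<lambda>\<omega>. Re (Y \<omega>)) (\<lambda>\<omega>. Im (Y \<omega>))"
  have X[measurable]: "X b \<in> borel_measurable M" for b by (cases b) (auto simp: X_def)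
  have "distr M (Pi\<^sub>M UNIV (\<lambda>_. borel)) (\<lambda>\<omega>. \<lambda>b\<in>UNIV. X b \<omega>) = Pi\<^sub>M UNIV (\<lambda>_. half_normal)"
  proof (rule distr_PiM_eq_of_char)
    fix t :: "bool \<Rightarrow> real"
    have "(\<Sum>b\<in>UNIV. t b * X b \<omega>) = Re (cnj (Complex (t True) (t False)) * Y \<omega>)" for \<omega>
      by (simp add: UNIV_bool X_def)
    then show "(CLINT \<omega>|M. iexp (\<Sum>b\<in>UNIV. t b * X b \<omega>)) = (\<Prod>b\<in>UNIV. char half_normal (t b))"
      using char[of "Complex (t True) (t False)"]
      by (simp add: UNIV_bool char_half_normal cmod_def exp_add[symmetric] field_simps flip: of_real_mult)
  qed (auto intro: real_distribution_half_normal)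
  note PI = this
  have marg: "distr M borel (X b) = half_normal" for b
  proof -
    have "distr M borel (X b) = distr (distr M (Pi\<^sub>M UNIV (\<lambda>_. borel)) (\<lambda>\<omega>. \<lambda>b\<in>UNIV. X b \<omega>)) borel (\<lambda>f. f b)"
      by (subst distr_distr) (auto simp: comp_def intro!: distr_cong)
    also have "\<dots> = half_normal"
      unfolding PI by (rule distr_PiM_half_normal) simp
    finally show ?thesis .
  qed
  have "indep_vars (\<lambda>_. borel) X UNIV"
    by (subst indep_vars_iff_distr_eq_PiM') (auto simp: marg PI)
  then have "indep_var borel (\<lambda>\<omega>. Re (Y \<omega>)) borel (\<lambda>\<omega>. Im (Y \<omega>))"
    unfolding indep_var_def X_def by (subst (asm) indep_vars_cong[where N'="case_bool borel borel" and J=UNIV]) (auto split: bool.split)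
  then have eq: "half_normal \<Otimes>\<^sub>M half_normal = distr M (borel \<Otimes>\<^sub>M borel) (\<lambda>\<omega>. (Re (Y \<omega>), Im (Y \<omega>)))"
    unfolding indep_var_distribution_eq using marg[of True] marg[of False] by (simp add: X_def)
  show ?thesis unfolding cgauss_def eq
    by (subst distr_distr) (auto simp: comp_def intro!: distr_cong)
qed

text \<open>Real and imaginary parts of all components are treated as one family indexed by pairs
  from \<open>K\<close> and \<open>bool\<close>, independent by the real criterion, and are then
  regrouped into complex numbers.\<close>

lemma (in prob_space) distr_eq_PiM_cgauss:
  fixes Y :: "'i \<Rightarrow> 'a \<Rightarrow> complex"
  assumes fin: "finite K" and Y: "\<And>k. k \<in> K \<Longrightarrow> Y k \<in> borel_measurable M"
    and char: "\<And>a. (CLINT \<omega>|M. iexp (\<Sum>k\<in>K. Re (cnj (a k) * Y k \<omega>))) = of_real (exp (- (\<Sum>k\<in>K. (cmod (a k))\<^sup>2) / 4))"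
  shows "distr M (Pi\<^sub>M K (\<lambda>_. borel)) (\<lambda>\<omega>. \<lambda>k\<in>K. Y k \<omega>) = Pi\<^sub>M K (\<lambda>_. cgauss)"
proof (cases "K = {}")
  \<comment> \<open>The criterion for independence through the joint law is applied to nonempty
    index sets, so the one-point product is treated by hand.\<close>
  case True
  note one = emeasure_space_1
  interpret product_prob_space "\<lambda>_::'i. cgauss" K ..
  show ?thesis unfolding True
  proof (rule PiM_eqI)
    fix A assume "\<And>i. i \<in> ({}::'i set) \<Longrightarrow> A i \<in> sets cgauss"
    have "(\<lambda>\<omega>. \<lambda>k\<in>({}::'i set). Y k \<omega>) \<in> measurable M (Pi\<^sub>M {} (\<lambda>_. borel :: complex measure))"
      by (intro measurable_restrict) auto
    then show "emeasure (distr M (Pi\<^sub>M {} (\<lambda>_. borel)) (\<lambda>\<omega>. \<lambda>k\<in>{}. Y k \<omega>)) (Pi\<^sub>E {} A) = (\<Prod>i\<in>{}. emeasure cgauss (A i))"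
      by (subst emeasure_distr)
        (auto simp: space_PiM sets_PiM_empty restrict_def one)
  qed (auto simp: sets_PiM_empty)
next
  case False
  define X where "X = (\<lambda>(k, b) \<omega>. if b then Re (Y k \<omega>) else Im (Y k \<omega>))"
  have X: "X p \<in> borel_measurable M" if "p \<in> K \<times> UNIV" for p
    using that Y unfolding X_def by (auto simp: case_prod_beta)
  have PI: "distr M (Pi\<^sub>M (K \<times> UNIV) (\<lambda>_. borel)) (\<lambda>\<omega>. \<lambda>p\<in>K \<times> UNIV. X p \<omega>) = Pi\<^sub>M (K \<times> UNIV) (\<lambda>_. half_normal)"
  proof (rule distr_PiM_eq_of_char)
    fix t :: "'i \<times> bool \<Rightarrow> real"
    define a where "a k = Complex (t (k, True)) (t (k, False))" for k
    have s: "(\<Sum>p\<in>K \<times> UNIV. g p) = (\<Sum>k\<in>K. g (k, True) + g (k, False))" for g :: "_ \<Rightarrow> real"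
    proof -
      have "sum g (K \<times> UNIV) = (\<Sum>k\<in>K. \<Sum>b\<in>UNIV. g (k, b))"
        by (simp add: sum.cartesian_product)
      then show ?thesis by (simp add: UNIV_bool add.commute)
    qed
    have "(\<Sum>p\<in>K \<times> UNIV. t p * X p \<omega>) = (\<Sum>k\<in>K. Re (cnj (a k) * Y k \<omega>))" for \<omega>
      unfolding s by (simp add: X_def a_def)
    moreover have "(\<Prod>p\<in>K \<times> UNIV. char half_normal (t p)) = of_real (exp (- (\<Sum>p\<in>K \<times> UNIV. (t p)\<^sup>2) / 4))"
      using fin by (simp add: char_half_normal exp_sum[symmetric] sum_negf sum_divide_distrib flip: of_real_prod)
    moreover have "(\<Sum>p\<in>K \<times> UNIV. (t p)\<^sup>2) = (\<Sum>k\<in>K. (cmod (a k))\<^sup>2)"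
      unfolding s by (simp add: a_def cmod_def)
    ultimately show "(CLINT \<omega>|M. iexp (\<Sum>p\<in>K \<times> UNIV. t p * X p \<omega>)) = (\<Prod>p\<in>K \<times> UNIV. char half_normal (t p))"
      using char[of a] by simp
  qed (use X fin in \<open>auto intro: real_distribution_half_normal\<close>)
  have marg: "distr M borel (X p) = half_normal" if p: "p \<in> K \<times> UNIV" for p
  proof -
    have "distr M borel (X p) = distr (distr M (Pi\<^sub>M (K \<times> UNIV) (\<lambda>_. borel)) (\<lambda>\<omega>. \<lambda>p\<in>K \<times> UNIV. X p \<omega>)) borel (\<lambda>f. f p)"
      using p X by (subst distr_distr) (auto simp: comp_def intro!: distr_cong measurable_restrict)
    also have "\<dots> = half_normal"
      unfolding PI using p by (rule distr_PiM_half_normal)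
    finally show ?thesis .
  qed
  have "indep_vars (\<lambda>_. borel) X (K \<times> UNIV)"
    using False X by (subst indep_vars_iff_distr_eq_PiM') (auto simp: PI marg intro!: PiM_cong)
  then have "indep_vars (\<lambda>k. Pi\<^sub>M ({k} \<times> UNIV) (\<lambda>_. borel)) (\<lambda>k \<omega>. restrict (\<lambda>p. X p \<omega>) ({k} \<times> UNIV)) K"
    by (rule indep_vars_restrict) (auto simp: disjoint_family_on_def)
  then have "indep_vars (\<lambda>k. borel) (\<lambda>k \<omega>. Complex (restrict (\<lambda>p. X p \<omega>) ({k} \<times> UNIV) (k, True)) (restrict (\<lambda>p. X p \<omega>) ({k} \<times> UNIV) (k, False))) K"
    by (rule indep_vars_compose2[where Y = "\<lambda>k f. Complex (f (k, True)) (f (k, False))"])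
      (auto intro!: measurable_compose[OF _ measurable_Complex, where f = "\<lambda>f. (f (_, True), f (_, False))", simplified])
  then have indep: "indep_vars (\<lambda>_. borel) Y K"
    by (subst (asm) indep_vars_cong[where J=K and N'="\<lambda>_. borel" and Y=Y]) (auto simp: X_def)
  have "distr M borel (Y k) = cgauss" if k: "k \<in> K" for k
  proof (rule distr_eq_cgauss[OF Y[OF k]])
    fix a
    have "(\<Sum>i\<in>K. Re (cnj (if i = k then a else 0) * Y i \<omega>)) = Re (cnj a * Y k \<omega>)" for \<omega>
      using k fin by (subst sum.remove[OF fin k]) (auto intro!: sum.neutral)
    moreover have "(\<Sum>i\<in>K. (cmod (if i = k then a else 0))\<^sup>2) = (cmod a)\<^sup>2"
      using k fin by (subst sum.remove[OF fin k]) (auto intro!: sum.neutral)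
    ultimately show "(CLINT \<omega>|M. iexp (Re (cnj a * Y k \<omega>))) = of_real (exp (- (cmod a)\<^sup>2 / 4))"
      using char[of "\<lambda>i. if i = k then a else 0"] by simp
  qed
  then show ?thesis
    using indep False Y by (subst (asm) indep_vars_iff_distr_eq_PiM') (auto intro!: PiM_cong cong: PiM_cong)
qed

section \<open>Modulus and moments of one complex Gaussian\<close>

lemma normal_density_half: "normal_density 0 (1 / sqrt 2) x = exp (- x\<^sup>2) / sqrt pi"
  by (simp add: normal_density_def power_divide)

text \<open>The radial factor in \<open>emeasure_cgauss_radial\<close>. The variable keeps both
  signs because the substitution \<open>y = x u\<close> parametrizes lines, not rays; each half
  contributes \<open>exp (- t) / 2\<close>.\<close>

lemma nn_integral_radial_tail:
  assumes t: "0 \<le> t"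
  shows "(\<integral>\<^sup>+v. ennreal (\<bar>v\<bar> * exp (- v\<^sup>2)) * indicator {s. t \<le> s} (v\<^sup>2) \<partial>lborel) = ennreal (exp (- t))"
proof -
  define h :: "real \<Rightarrow> ennreal" where "h v = ennreal (v * exp (- v\<^sup>2)) * indicator {sqrt t..} v" for v
  have [measurable]: "h \<in> borel_measurable borel" unfolding h_def by measurable
  have lim: "((\<lambda>v::real. - exp (- v\<^sup>2) / 2) \<longlongrightarrow> 0) at_top"
    by real_asymp
  have half: "(\<integral>\<^sup>+v. h v \<partial>lborel) = ennreal (exp (- t) / 2)"
    unfolding h_def
    using t by (subst nn_integral_FTC_atLeast[where F="\<lambda>v. - exp (- v\<^sup>2) / 2" and T=0, OF _ _ _ lim])
      (auto intro!: derivative_eq_intros mult_nonneg_nonneg intro: order_trans[of 0 "sqrt t"])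
  have neg: "(\<integral>\<^sup>+v. h (- v) \<partial>lborel) = ennreal (exp (- t) / 2)"
    using nn_integral_real_affine[of h "-1" 0] half by simp
  have "(\<integral>\<^sup>+v. ennreal (\<bar>v\<bar> * exp (- v\<^sup>2)) * indicator {s. t \<le> s} (v\<^sup>2) \<partial>lborel) = (\<integral>\<^sup>+v. h v + h (- v) \<partial>lborel)"
  proof (rule nn_integral_cong)
    fix v :: real
    consider "v > 0" | "v = 0" | "v < 0" by linarith
    then show "ennreal (\<bar>v\<bar> * exp (- v\<^sup>2)) * indicator {s. t \<le> s} (v\<^sup>2) = h v + h (- v)"
    proof cases
      case 1
      then have "sqrt t \<le> v \<longleftrightarrow> t \<le> v\<^sup>2" using t
        by (metis abs_of_pos real_sqrt_abs real_sqrt_le_iff)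
      moreover have "\<not> sqrt t \<le> - v" using 1 t real_sqrt_ge_zero[OF t] by linarith
      ultimately show ?thesis using 1 by (simp add: h_def indicator_def)
    next
      case 2 then show ?thesis by (simp add: h_def)
    next
      case 3
      then have "sqrt t \<le> - v \<longleftrightarrow> t \<le> v\<^sup>2" using t
        by (metis abs_of_neg real_sqrt_abs real_sqrt_le_iff)
      moreover have "\<not> sqrt t \<le> v" using 3 t real_sqrt_ge_zero[OF t] by linarith
      ultimately show ?thesis using 3 by (simp add: h_def indicator_def)
    qed
  qed
  also have "\<dots> = ennreal (exp (- t) / 2) + ennreal (exp (- t) / 2)"
    by (subst nn_integral_add) (auto simp: half neg)
  also have "\<dots> = ennreal (exp (- t))" by (simp flip: ennreal_plus)
  finally show ?thesis .
qed

text \<open>Substituting \<open>y = x u\<close> and then rescaling \<open>x\<close> separates the two integrals, which leaves an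
  unspecified constant independent of \<open>t\<close>.\<close>
lemma emeasure_cgauss_radial:
  shows "\<exists>C. \<forall>t\<ge>0. emeasure cgauss {z. t \<le> (cmod z)\<^sup>2} = C * ennreal (exp (- t))"
proof (intro exI allI impI)
  fix t :: real assume t: "0 \<le> t"
  define G :: "real \<Rightarrow> ennreal" where "G s = ennreal (exp (- s) / pi) * indicator {s. t \<le> s} s" for s
  have [measurable]: "G \<in> borel_measurable borel" unfolding G_def by measurable
  have dens: "half_normal \<Otimes>\<^sub>M half_normal = density (lborel \<Otimes>\<^sub>M lborel) (\<lambda>(x, y). ennreal (exp (- x\<^sup>2) / sqrt pi) * ennreal (exp (- y\<^sup>2) / sqrt pi))"
    unfolding half_normal_def normal_density_half
    by (subst pair_measure_density) (auto intro!: finite_measure.axioms prob_space.finite_measure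
       prob_space_normal_density simp: half_normal_def[symmetric] normal_density_half[symmetric]
       half_normal.sigma_finite_measure_axioms lborel.sigma_finite_measure_axioms)
  have "{p\<in>space (borel \<Otimes>\<^sub>M borel). t \<le> (fst p)\<^sup>2 + (snd p)\<^sup>2} \<in> sets (borel \<Otimes>\<^sub>M (borel :: real measure))"
    by measurable
  then have mset: "{p. t \<le> (fst p)\<^sup>2 + (snd p)\<^sup>2} \<in> sets (borel \<Otimes>\<^sub>M (borel :: real measure))"
    by (simp add: space_pair_measure)
  have "emeasure cgauss {z. t \<le> (cmod z)\<^sup>2} = emeasure (half_normal \<Otimes>\<^sub>M half_normal) {p. t \<le> (fst p)\<^sup>2 + (snd p)\<^sup>2}"
    unfolding cgauss_def using mset
    by (subst emeasure_distr) (auto simp: cmod_def space_pair_measure case_prod_beta vimage_def)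
  also have "\<dots> = (\<integral>\<^sup>+p. (case p of (x, y) \<Rightarrow> ennreal (exp (- x\<^sup>2) / sqrt pi) * ennreal (exp (- y\<^sup>2) / sqrt pi)) * indicator {p. t \<le> (fst p)\<^sup>2 + (snd p)\<^sup>2} p \<partial>(lborel \<Otimes>\<^sub>M lborel))"
    unfolding dens using mset by (subst emeasure_density) (auto simp: space_pair_measure)
  also have "\<dots> = (\<integral>\<^sup>+p. G ((fst p)\<^sup>2 + (snd p)\<^sup>2) \<partial>(lborel \<Otimes>\<^sub>M lborel))"
    by (intro nn_integral_cong)
      (auto simp: G_def case_prod_beta ennreal_mult[symmetric] exp_add[symmetric] indicator_def)
  also have "\<dots> = (\<integral>\<^sup>+x. \<integral>\<^sup>+y. G (x\<^sup>2 + y\<^sup>2) \<partial>lborel \<partial>lborel)"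
    by (subst lborel.nn_integral_fst[symmetric]) auto
  also have "\<dots> = (\<integral>\<^sup>+x. \<integral>\<^sup>+u. ennreal \<bar>x\<bar> * G (x\<^sup>2 * (1 + u\<^sup>2)) \<partial>lborel \<partial>lborel)"
  proof (rule nn_integral_cong_AE)
    have "AE x in lborel. x \<noteq> (0::real)" by (rule AE_lborel_singleton)
    then show "AE x in lborel. (\<integral>\<^sup>+y. G (x\<^sup>2 + y\<^sup>2) \<partial>lborel) = (\<integral>\<^sup>+u. ennreal \<bar>x\<bar> * G (x\<^sup>2 * (1 + u\<^sup>2)) \<partial>lborel)"
    proof eventually_elim
      case (elim x)
      have "(\<integral>\<^sup>+y. G (x\<^sup>2 + y\<^sup>2) \<partial>lborel) = ennreal \<bar>x\<bar> * (\<integral>\<^sup>+u. G (x\<^sup>2 + (0 + x * u)\<^sup>2) \<partial>lborel)"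
        using elim by (subst nn_integral_real_affine[of _ x 0]) auto
      then show ?case by (simp add: nn_integral_cmult power_mult_distrib distrib_left)
    qed
  qed
  also have "\<dots> = (\<integral>\<^sup>+u. \<integral>\<^sup>+x. ennreal \<bar>x\<bar> * G (x\<^sup>2 * (1 + u\<^sup>2)) \<partial>lborel \<partial>lborel)"
    by (rule lborel_pair.Fubini') measurable
  also have "\<dots> = (\<integral>\<^sup>+u. ennreal (1 / (1 + u\<^sup>2)) * (\<integral>\<^sup>+v. ennreal \<bar>v\<bar> * G (v\<^sup>2) \<partial>lborel) \<partial>lborel)"
  proof (rule nn_integral_cong)
    fix u :: real
    define c where "c = sqrt (1 + u\<^sup>2)"
    have c: "c > 0" "c\<^sup>2 = 1 + u\<^sup>2" unfolding c_def by (auto simp: add_pos_nonneg)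
    have "(\<integral>\<^sup>+x. ennreal \<bar>x\<bar> * G (x\<^sup>2 * (1 + u\<^sup>2)) \<partial>lborel) =
       ennreal (1 / c) * (\<integral>\<^sup>+v. ennreal \<bar>0 + (1 / c) * v\<bar> * G ((0 + (1 / c) * v)\<^sup>2 * (1 + u\<^sup>2)) \<partial>lborel)"
      using c by (subst nn_integral_real_affine[of _ "1 / c" 0]) auto
    also have "\<dots> = ennreal (1 / c) * (\<integral>\<^sup>+v. ennreal (1 / c) * (ennreal \<bar>v\<bar> * G (v\<^sup>2)) \<partial>lborel)"
      using c by (intro arg_cong[where f="(*) _"] nn_integral_cong)
        (simp add: power_divide abs_mult ennreal_mult[symmetric] mult.assoc[symmetric] flip: c(2))
    also have "\<dots> = (ennreal (1 / c) * ennreal (1 / c)) * (\<integral>\<^sup>+v. ennreal \<bar>v\<bar> * G (v\<^sup>2) \<partial>lborel)"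
      by (subst nn_integral_cmult) (auto simp: mult.assoc)
    also have "ennreal (1 / c) * ennreal (1 / c) = ennreal (1 / (1 + u\<^sup>2))"
      using c by (simp add: ennreal_mult[symmetric] power2_eq_square flip: c(2))
    finally show "(\<integral>\<^sup>+x. ennreal \<bar>x\<bar> * G (x\<^sup>2 * (1 + u\<^sup>2)) \<partial>lborel) = ennreal (1 / (1 + u\<^sup>2)) * (\<integral>\<^sup>+v. ennreal \<bar>v\<bar> * G (v\<^sup>2) \<partial>lborel)" .
  qed
  also have "(\<integral>\<^sup>+v. ennreal \<bar>v\<bar> * G (v\<^sup>2) \<partial>lborel) = (\<integral>\<^sup>+v. ennreal (1 / pi) * (ennreal (\<bar>v\<bar> * exp (- v\<^sup>2)) * indicator {s. t \<le> s} (v\<^sup>2)) \<partial>lborel)"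
    by (intro nn_integral_cong) (auto simp: G_def indicator_def ennreal_mult[symmetric])
  also have "\<dots> = ennreal (1 / pi) * ennreal (exp (- t))"
    using nn_integral_radial_tail[OF t] by (subst nn_integral_cmult) auto
  also have "(\<integral>\<^sup>+u. ennreal (1 / (1 + u\<^sup>2)) * (ennreal (1 / pi) * ennreal (exp (- t))) \<partial>lborel) =
     ((\<integral>\<^sup>+u. ennreal (1 / (1 + u\<^sup>2)) \<partial>lborel) * ennreal (1 / pi)) * ennreal (exp (- t))"
    by (subst nn_integral_multc) (auto simp: mult.assoc)
  finally show "emeasure cgauss {z. t \<le> (cmod z)\<^sup>2} = ((\<integral>\<^sup>+u. ennreal (1 / (1 + u\<^sup>2)) \<partial>lborel) * ennreal (1 / pi)) * ennreal (exp (- t))" .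
qed

text \<open>At \<open>t = 0\<close> the event is the whole space, so total mass 1 determines the
  constant.\<close>

lemma measure_cgauss_radial:
  assumes "0 \<le> t"
  shows "measure cgauss {z. t \<le> (cmod z)\<^sup>2} = exp (- t)"
proof -
  obtain C where C: "\<And>t. t \<ge> 0 \<Longrightarrow> emeasure cgauss {z. t \<le> (cmod z)\<^sup>2} = C * ennreal (exp (- t))"
    using emeasure_cgauss_radial by blast
  have "C = 1" using C[of 0] cgauss.emeasure_space_1 by (simp add: )
  then show ?thesis using C[OF assms] by (simp add: measure_def)
qed

text \<open>The tails for \<open>s > t\<close> lie inside the event and their masses tend to
  \<open>exp (- t)\<close>: the modulus has no atoms.\<close>

lemma measure_cgauss_radial_less:
  assumes "0 \<le> t"
  shows "measure cgauss {z. t < (cmod z)\<^sup>2} = exp (- t)"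
proof (rule antisym)
  show "measure cgauss {z. t < (cmod z)\<^sup>2} \<le> exp (- t)"
    unfolding measure_cgauss_radial[OF assms, symmetric]
    by (intro cgauss.finite_measure_mono) auto
  have "exp (- s) \<le> measure cgauss {z. t < (cmod z)\<^sup>2}" if "s > t" for s
    using that assms measure_cgauss_radial[of s, symmetric]
    by (auto intro!: cgauss.finite_measure_mono)
  then have ev: "\<forall>\<^sub>F s in at_right t. exp (- s) \<le> measure cgauss {z. t < (cmod z)\<^sup>2}"
    by (auto simp: eventually_at_filter)
  have "((\<lambda>s::real. exp (- s)) \<longlongrightarrow> exp (- t)) (at_right t)"
    by (intro tendsto_intros)
  then show "exp (- t) \<le> measure cgauss {z. t < (cmod z)\<^sup>2}"
    by (rule tendsto_upperbound[OF _ ev]) simp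
qed

lemma AE_cgauss_nonzero: "AE z in cgauss. z \<noteq> 0"
proof -
  have "cgauss.prob {z \<in> space cgauss. z \<noteq> 0} = 1"
    using measure_cgauss_radial_less[of 0] by simp
  then show ?thesis by (subst cgauss.prob_Collect_eq_1[symmetric]) auto
qed

lemma exponential_distributed_cgauss: "distributed cgauss lborel (\<lambda>z. (cmod z)\<^sup>2) (exponential_density 1)"
proof (subst cgauss.exponential_distributed_iff)
  have "measure cgauss {x. (cmod x)\<^sup>2 \<le> a} = 1 - exp (- a)" if "a \<ge> 0" for a
  proof -
    have "UNIV - {z. a < (cmod z)\<^sup>2} = {x. (cmod x)\<^sup>2 \<le> a}" by auto
    then show ?thesis
      using cgauss.prob_compl[of "{z. a < (cmod z)\<^sup>2}"] measure_cgauss_radial_less[OF that] by auto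
  qed
  then show "(\<lambda>z. (cmod z)\<^sup>2) \<in> borel_measurable cgauss \<and> (\<forall>a\<ge>0. \<P>(x in cgauss. (cmod x)\<^sup>2 \<le> a) = 1 - exp (- a * 1))"
    by auto
qed simp

text \<open>The squared modulus is exponential of rate 1, an Erlang law of shape 0, whose
  \<open>i\<close>-th moment is \<open>fact i\<close>.\<close>

lemma cgauss_even_moment:
  "has_bochner_integral cgauss (\<lambda>z. (cmod z) ^ (2 * i)) (fact i)"
  using cgauss.has_bochner_integral_erlang_ith_moment[OF _ exponential_distributed_cgauss, of i]
  by (simp add: power_mult)

lemma distr_cgauss_rotate:
  assumes "cmod c = 1"
  shows "distr cgauss borel (\<lambda>z. c * z) = cgauss"
proof (rule cgauss.distr_eq_cgauss)
  fix a
  have *: "cnj a * (c * z) = cnj (cnj c * a) * z" for z by simp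
  show "(CLINT z|cgauss. iexp (Re (cnj a * (c * z)))) = of_real (exp (- (cmod a)\<^sup>2 / 4))"
    unfolding * char_cgauss using assms by (simp add: norm_mult)
qed simp

lemma integrable_cgauss_monomial: "integrable cgauss (\<lambda>z. z ^ a * cnj z ^ b)"
proof (rule Bochner_Integration.integrable_bound)
  show "integrable cgauss (\<lambda>z. 1 + (cmod z) ^ (2 * (a + b)))"
    using cgauss_even_moment[of "a + b"] by (auto simp: has_bochner_integral_iff)
  have "x ^ k \<le> 1 + x ^ (2 * k)" if "x \<ge> 0" for x :: real and k
  proof (cases "x \<le> 1")
    case True then show ?thesis using that power_le_one[of x k] by (simp add: add_increasing2)
  next
    case False then have "x ^ k \<le> x ^ (2 * k)" by (intro power_increasing) auto
    then show ?thesis by simp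
  qed
  then show "AE z in cgauss. norm (z ^ a * cnj z ^ b) \<le> norm (1 + (cmod z) ^ (2 * (a + b)))"
    by (auto simp: norm_mult norm_power power_add[symmetric] simp del: distrib_left_numeral intro!: AE_I2 order_trans[OF _ abs_ge_self])
qed simp

text \<open>Rotating by an angle \<phi> multiplies the monomial by
  \<open>cis ((a - b) * \<phi>)\<close> without changing the law; the angle chosen below makes this
  factor -1.\<close>

lemma integral_cgauss_monomial_diff:
  assumes "a \<noteq> b"
  shows "(CLINT z|cgauss. z ^ a * cnj z ^ b) = 0"
proof -
  define \<phi> where "\<phi> = pi / (real a - real b)"
  define c where "c = cis \<phi>"
  have "c ^ a * cnj c ^ b = cis \<phi> ^ a * cis (- \<phi>) ^ b"
    by (simp only: c_def cis_cnj)
  also have "\<dots> = cis (real a * \<phi>) * cis (real b * - \<phi>)"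
    by (simp only: Complex.DeMoivre)
  also have "\<dots> = cis (real a * \<phi> - real b * \<phi>)"
    by (simp only: cis_mult mult_minus_right diff_conv_add_uminus)
  also have "real a * \<phi> - real b * \<phi> = pi"
  proof -
    have "real a - real b \<noteq> 0" using assms by simp
    then have "(real a - real b) * \<phi> = pi" by (simp add: \<phi>_def)
    then show ?thesis by (simp only: left_diff_distrib)
  qed
  finally have c: "c ^ a * cnj c ^ b = -1" by simp
  have "(CLINT z|cgauss. z ^ a * cnj z ^ b) = (CLINT z|distr cgauss borel (\<lambda>z. c * z). z ^ a * cnj z ^ b)"
    by (subst distr_cgauss_rotate) (auto simp: c_def)
  also have "\<dots> = (CLINT z|cgauss. (c ^ a * cnj c ^ b) * (z ^ a * cnj z ^ b))"
    by (subst integral_distr) (auto simp: power_mult_distrib mult_ac)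
  also have "\<dots> = - (CLINT z|cgauss. z ^ a * cnj z ^ b)" unfolding c by simp
  finally have "(CLINT z|cgauss. z ^ a * cnj z ^ b) + (CLINT z|cgauss. z ^ a * cnj z ^ b) = 0"
    by (metis add.right_inverse)
  then show ?thesis by (simp only: mult_2[symmetric]) simp
qed

lemma integral_cgauss_monomial: "(CLINT z|cgauss. z ^ a * cnj z ^ b) = (if a = b then fact a else 0)"
proof (cases "a = b")
  case True
  have "z ^ a * cnj z ^ b = of_real ((cmod z) ^ (2 * a))" for z
  proof -
    have "z ^ a * cnj z ^ b = (z * cnj z) ^ a" using True by (simp only: power_mult_distrib)
    also have "\<dots> = of_real ((cmod z)\<^sup>2) ^ a" by (simp only: complex_norm_square)
    also have "\<dots> = of_real ((cmod z) ^ (2 * a))" by (simp only: of_real_power power_mult)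
    finally show ?thesis .
  qed
  then have "(CLINT z|cgauss. z ^ a * cnj z ^ b) = of_real (LINT z|cgauss. (cmod z) ^ (2 * a))"
    by (simp only: integral_complex_of_real)
  also have "(LINT z|cgauss. (cmod z) ^ (2 * a)) = fact a"
    using cgauss_even_moment[of a] by (simp add: has_bochner_integral_iff)
  finally show ?thesis using True by simp
qed (simp add: integral_cgauss_monomial_diff)

section \<open>Linear and quadratic forms in independent complex Gaussians\<close>

interpretation PiM_cgauss: product_prob_space "\<lambda>_. cgauss" I for I :: "'i set" ..

lemma measurable_PiM_cgauss: "k \<in> K \<Longrightarrow> (\<lambda>z. z k) \<in> borel_measurable (Pi\<^sub>M K (\<lambda>_. cgauss))"
  using measurable_component_singleton[of k K "\<lambda>_. cgauss"] by (simp cong: measurable_cong_sets)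

lemma char_PiM_cgauss:
  assumes "finite K"
  shows "(CLINT z|Pi\<^sub>M K (\<lambda>_. cgauss). iexp (\<Sum>k\<in>K. Re (cnj (a k) * z k))) = of_real (exp (- (\<Sum>k\<in>K. (cmod (a k))\<^sup>2) / 4))"
proof -
  have "(CLINT z|Pi\<^sub>M K (\<lambda>_. cgauss). iexp (\<Sum>k\<in>K. Re (cnj (a k) * z k))) =
     (CLINT z|Pi\<^sub>M K (\<lambda>_. cgauss). (\<Prod>k\<in>K. iexp (Re (cnj (a k) * z k))))"
    using assms by (simp only: of_real_sum sum_distrib_left exp_sum)
  also have "\<dots> = (\<Prod>k\<in>K. CLINT z|cgauss. iexp (Re (cnj (a k) * z)))"
    using assms by (intro PiM_cgauss.product_integral_prod) (auto intro!: cgauss.integrable_const_bound[of _ 1])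
  also have "\<dots> = of_real (\<Prod>k\<in>K. exp (- (cmod (a k))\<^sup>2 / 4))"
    by (simp only: char_cgauss of_real_prod)
  also have "(\<Prod>k\<in>K. exp (- (cmod (a k))\<^sup>2 / 4)) = exp (- (\<Sum>k\<in>K. (cmod (a k))\<^sup>2) / 4)"
    using assms by (simp add: exp_sum[symmetric] sum_negf sum_divide_distrib)
  finally show ?thesis .
qed

text \<open>A unit vector \<open>v\<close> preserves the quadratic exponent of the characteristic
  function.\<close>

lemma distr_PiM_cgauss_linear:
  assumes K: "finite K" and v: "(\<Sum>k\<in>K. (cmod (v k))\<^sup>2) = 1"
  shows "distr (Pi\<^sub>M K (\<lambda>_. cgauss)) borel (\<lambda>z. \<Sum>k\<in>K. v k * z k) = cgauss"
proof -
  have P: "prob_space (Pi\<^sub>M K (\<lambda>_. cgauss))"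
    by (intro prob_space_PiM prob_space_cgauss)
  show ?thesis
  proof (rule prob_space.distr_eq_cgauss[OF P])
    show "(\<lambda>z. \<Sum>k\<in>K. v k * z k) \<in> borel_measurable (Pi\<^sub>M K (\<lambda>_. cgauss))"
      by (intro borel_measurable_sum borel_measurable_times borel_measurable_const measurable_PiM_cgauss)
    fix a
    have "cnj a * (\<Sum>k\<in>K. v k * z k) = (\<Sum>k\<in>K. cnj (a * cnj (v k)) * z k)" for z
      by (simp add: sum_distrib_left mult.assoc)
    then have "Re (cnj a * (\<Sum>k\<in>K. v k * z k)) = (\<Sum>k\<in>K. Re (cnj (a * cnj (v k)) * z k))" for z
      by (simp only: Re_sum)
    moreover have "(\<Sum>k\<in>K. (cmod (a * cnj (v k)))\<^sup>2) = (cmod a)\<^sup>2"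
      using v by (simp add: norm_mult power_mult_distrib sum_distrib_left[symmetric])
    ultimately show "(CLINT z|Pi\<^sub>M K (\<lambda>_. cgauss). iexp (Re (cnj a * (\<Sum>k\<in>K. v k * z k)))) = of_real (exp (- (cmod a)\<^sup>2 / 4))"
      using char_PiM_cgauss[OF K, of "\<lambda>k. a * cnj (v k)"] by (simp only:)
  qed
qed

lemma PiM_cgauss_moment:
  fixes \<alpha> \<beta> :: "'i \<Rightarrow> nat"
  assumes "finite K"
  shows "has_bochner_integral (Pi\<^sub>M K (\<lambda>_. cgauss)) (\<lambda>e. \<Prod>p\<in>K. e p ^ \<alpha> p * cnj (e p) ^ \<beta> p)
    (\<Prod>p\<in>K. if \<alpha> p = \<beta> p then fact (\<alpha> p) else 0)"
  using PiM_cgauss.product_integrable_prod[OF assms, of "\<lambda>p z. z ^ \<alpha> p * cnj z ^ \<beta> p"]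
    PiM_cgauss.product_integral_prod[OF assms, of "\<lambda>p z. z ^ \<alpha> p * cnj z ^ \<beta> p"]
  by (simp add: has_bochner_integral_iff integrable_cgauss_monomial integral_cgauss_monomial)

lemma PiM_cgauss_second_moment:
  assumes K: "finite K" "i \<in> K" "j \<in> K"
  shows "has_bochner_integral (Pi\<^sub>M K (\<lambda>_. cgauss)) (\<lambda>e. cnj (e i) * e j) (of_bool (i = j))"
proof -
  let ?\<alpha> = "\<lambda>p. of_bool (p = j) :: nat" and ?\<beta> = "\<lambda>p. of_bool (p = i) :: nat"
  have pw: "x ^ of_bool b = (if b then x else 1)" for x :: complex and b by simp
  have "(\<Prod>p\<in>K. e p ^ ?\<alpha> p * cnj (e p) ^ ?\<beta> p) = cnj (e i) * e j" for e :: "'a \<Rightarrow> complex"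
    using K by (simp add: prod.distrib pw prod.delta mult.commute)
  moreover have "(\<Prod>p\<in>K. if ?\<alpha> p = ?\<beta> p then fact (?\<alpha> p) else 0) = (of_bool (i = j) :: complex)"
  proof (cases "i = j")
    case False
    have "\<exists>p\<in>K. (if ?\<alpha> p = ?\<beta> p then fact (?\<alpha> p) else 0) = (0::complex)"
      using False K by (intro bexI[of _ i]) auto
    then show ?thesis using False K prod_zero[of K] by simp
  qed (auto intro!: prod.neutral)
  ultimately show ?thesis using PiM_cgauss_moment[OF K(1), of ?\<alpha> ?\<beta>] by simp
qed

text \<open>Wick's formula for circular Gaussians: only pairings of a conjugated with an
  unconjugated factor survive. The exponents \<alpha> and \<beta> count the unconjugated and the
  conjugated occurrences of an index; when all four indices agree, both pairings hold and
  \<open>fact 2 = 2\<close> accounts for them.\<close>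

lemma PiM_cgauss_fourth_moment:
  assumes K: "finite K" "i \<in> K" "j \<in> K" "k \<in> K" "l \<in> K"
  shows "has_bochner_integral (Pi\<^sub>M K (\<lambda>_. cgauss)) (\<lambda>e. cnj (e i) * e j * (e k * cnj (e l)))
    (of_bool (i = j \<and> k = l) + of_bool (i = k \<and> j = l))"
proof -
  define \<alpha> where "\<alpha> p = (of_bool (p = j) + of_bool (p = k) :: nat)" for p
  define \<beta> where "\<beta> p = (of_bool (p = i) + of_bool (p = l) :: nat)" for p
  have pw: "x ^ (of_bool b + of_bool c) = (if b then x else 1) * (if c then x else 1)" for x :: complex and b c
    by auto
  have 1: "(\<Prod>p\<in>K. e p ^ \<alpha> p * cnj (e p) ^ \<beta> p) = cnj (e i) * e j * (e k * cnj (e l))" for e :: "'a \<Rightarrow> complex"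
    using K unfolding \<alpha>_def \<beta>_def pw prod.distrib by (simp add: prod.delta)
  have 2: "(\<Prod>p\<in>K. if \<alpha> p = \<beta> p then fact (\<alpha> p) else 0) = (of_bool (i = j \<and> k = l) + of_bool (i = k \<and> j = l) :: complex)"
  proof (cases "(i = j \<and> k = l) \<or> (i = k \<and> j = l)")
    case True
    then have eq: "\<alpha> p = \<beta> p" for p by (auto simp: \<alpha>_def \<beta>_def)
    show ?thesis
    proof (cases "j = k")
      case True
      then have "(\<Prod>p\<in>K. fact (\<alpha> p) :: complex) = (\<Prod>p\<in>K. if p = j then 2 else 1)"
        by (intro prod.cong) (auto simp: \<alpha>_def fact_2)
      then show ?thesis using K True \<open>(i = j \<and> k = l) \<or> (i = k \<and> j = l)\<close> by (auto simp: eq prod.delta)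
    next
      case False
      then have "(\<Prod>p\<in>K. fact (\<alpha> p) :: complex) = 1"
        by (intro prod.neutral) (auto simp: \<alpha>_def)
      then show ?thesis using False \<open>(i = j \<and> k = l) \<or> (i = k \<and> j = l)\<close> by (auto simp: eq)
    qed
  next
    case False
    have "\<exists>p\<in>K. \<alpha> p \<noteq> \<beta> p"
    proof (rule ccontr)
      assume "\<not> (\<exists>p\<in>K. \<alpha> p \<noteq> \<beta> p)"
      then have "\<alpha> i = \<beta> i" "\<alpha> j = \<beta> j" "\<alpha> k = \<beta> k" "\<alpha> l = \<beta> l" using K by auto
      then show False using False unfolding \<alpha>_def \<beta>_def of_bool_def by (auto split: if_splits)
    qed
    then have "\<exists>p\<in>K. (if \<alpha> p = \<beta> p then fact (\<alpha> p) else 0) = (0::complex)" by auto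
    then show ?thesis using False K prod_zero[of K] by auto
  qed
  show ?thesis using PiM_cgauss_moment[OF K(1), of \<alpha> \<beta>] unfolding 1 2 .
qed

text \<open>The centred products \<open>D i j\<close> are orthonormal in mean square by Wick's
  formula, so the variance is the squared Frobenius norm of \<open>Q\<close>. For a self-adjoint
  idempotent this equals the trace.\<close>

lemma quadratic_form_variance:
  fixes Q :: "'i \<Rightarrow> 'i \<Rightarrow> complex"
  assumes K: "finite K"
    and herm: "\<And>i j. i \<in> K \<Longrightarrow> j \<in> K \<Longrightarrow> Q j i = cnj (Q i j)"
    and idem: "\<And>i k. i \<in> K \<Longrightarrow> k \<in> K \<Longrightarrow> (\<Sum>j\<in>K. Q i j * Q j k) = Q i k"
    and trace: "(\<Sum>i\<in>K. Q i i) = of_real r"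
  shows "has_bochner_integral (Pi\<^sub>M K (\<lambda>_. cgauss)) (\<lambda>e. (cmod ((\<Sum>i\<in>K. \<Sum>j\<in>K. cnj (e i) * Q i j * e j) - of_real r))\<^sup>2) r"
proof -
  define D where "D i j e = cnj (e i) * e j - of_bool (i = j)" for i j and e :: "'i \<Rightarrow> complex"
  have D: "has_bochner_integral (Pi\<^sub>M K (\<lambda>_. cgauss)) (\<lambda>e. D i j e * cnj (D k l e)) (of_bool (i = k \<and> j = l))"
    if "i \<in> K" "j \<in> K" "k \<in> K" "l \<in> K" for i j k l
  proof -
    let ?d = "\<lambda>a b. of_bool (a = b) :: complex"
    have P: "measure (Pi\<^sub>M K (\<lambda>_. cgauss)) (space (Pi\<^sub>M K (\<lambda>_. cgauss))) = 1"
      by (intro prob_space.prob_space prob_space_PiM prob_space_cgauss)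
    have F: "finite_measure (Pi\<^sub>M K (\<lambda>_. cgauss))"
      by (intro prob_space.finite_measure prob_space_PiM prob_space_cgauss)
    have one: "has_bochner_integral (Pi\<^sub>M K (\<lambda>_. cgauss)) (\<lambda>e. ?d i j * ?d k l) (?d i j * ?d k l)"
      using P F by (simp add: has_bochner_integral_iff finite_measure.integrable_const del: of_bool_eq)
    have "has_bochner_integral (Pi\<^sub>M K (\<lambda>_. cgauss))
       (\<lambda>e. cnj (e i) * e j * (e k * cnj (e l)) - ?d i j * (cnj (e l) * e k) - ?d k l * (cnj (e i) * e j) + ?d i j * ?d k l)
       ((of_bool (i = j \<and> k = l) + of_bool (i = k \<and> j = l)) - ?d i j * ?d l k - ?d k l * ?d i j + ?d i j * ?d k l)"
      using that K
      by (intro has_bochner_integral_add has_bochner_integral_diff has_bochner_integral_mult_right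
         PiM_cgauss_fourth_moment PiM_cgauss_second_moment one)
    moreover have "cnj (e i) * e j * (e k * cnj (e l)) - ?d i j * (cnj (e l) * e k) - ?d k l * (cnj (e i) * e j) + ?d i j * ?d k l
        = D i j e * cnj (D k l e)" for e
      unfolding D_def by (simp add: algebra_simps)
    moreover have "(of_bool (i = j \<and> k = l) + of_bool (i = k \<and> j = l)) - ?d i j * ?d l k - ?d k l * ?d i j + ?d i j * ?d k l
       = of_bool (i = k \<and> j = l)"
      by auto
    ultimately show ?thesis by simp
  qed
  define q where "q e = (\<Sum>i\<in>K. \<Sum>j\<in>K. cnj (e i) * Q i j * e j) - of_real r" for e
  have q: "q e = (\<Sum>i\<in>K. \<Sum>j\<in>K. Q i j * D i j e)" for e
  proof -
    have "(\<Sum>i\<in>K. \<Sum>j\<in>K. Q i j * of_bool (i = j)) = (\<Sum>i\<in>K. Q i i)"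
      using K by (intro sum.cong refl) (simp add: of_bool_def if_distrib[of "\<lambda>x. _ * x"] cong: if_cong)
    then show ?thesis
      unfolding q_def D_def trace[symmetric] by (simp add: algebra_simps sum_subtractf)
  qed
  have qq: "q e * cnj (q e) = (\<Sum>i\<in>K. \<Sum>j\<in>K. \<Sum>k\<in>K. \<Sum>l\<in>K. (Q i j * cnj (Q k l)) * (D i j e * cnj (D k l e)))" for e
    by (simp only: q cnj_sum sum_distrib_right) (simp only: sum_distrib_left complex_cnj_mult mult_ac)
  have "has_bochner_integral (Pi\<^sub>M K (\<lambda>_. cgauss)) (\<lambda>e. q e * cnj (q e))
     (\<Sum>i\<in>K. \<Sum>j\<in>K. \<Sum>k\<in>K. \<Sum>l\<in>K. (Q i j * cnj (Q k l)) * of_bool (i = k \<and> j = l))"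
    unfolding qq by (intro has_bochner_integral_sum has_bochner_integral_mult_right D)
  also have "(\<Sum>i\<in>K. \<Sum>j\<in>K. \<Sum>k\<in>K. \<Sum>l\<in>K. (Q i j * cnj (Q k l)) * of_bool (i = k \<and> j = l)) = of_real r"
  proof -
    have "(\<Sum>k\<in>K. \<Sum>l\<in>K. (Q i j * cnj (Q k l)) * of_bool (i = k \<and> j = l)) = Q i j * Q j i"
      if "i \<in> K" "j \<in> K" for i j
    proof -
      have "(\<Sum>k\<in>K. \<Sum>l\<in>K. (Q i j * cnj (Q k l)) * of_bool (i = k \<and> j = l))
        = (\<Sum>k\<in>K. if k = i then \<Sum>l\<in>K. if l = j then Q i j * cnj (Q k l) else 0 else 0)"
        by (intro sum.cong refl) (auto intro!: sum.cong sum.neutral)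
      also have "\<dots> = Q i j * cnj (Q i j)" using K that by simp
      finally show ?thesis using herm[OF that] by simp
    qed
    then have "(\<Sum>i\<in>K. \<Sum>j\<in>K. \<Sum>k\<in>K. \<Sum>l\<in>K. (Q i j * cnj (Q k l)) * of_bool (i = k \<and> j = l))
       = (\<Sum>i\<in>K. \<Sum>j\<in>K. Q i j * Q j i)" by (intro sum.cong refl) auto
    also have "\<dots> = of_real r" using idem by (simp add: trace)
    finally show ?thesis .
  qed
  finally have "has_bochner_integral (Pi\<^sub>M K (\<lambda>_. cgauss)) (\<lambda>e. of_real ((cmod (q e))\<^sup>2)) (complex_of_real r)"
    by (simp only: complex_norm_square)
  from has_bochner_integral_bounded_linear[OF bounded_linear_Re this]
  show ?thesis unfolding q_def[symmetric] by simp
qed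

section \<open>Gram-Schmidt residuals of a Gaussian matrix\<close>

text \<open>The projection onto the orthogonal complement of the first \<open>j\<close> columns of \<open>z\<close>; a column that depends
  on the previous ones has \<open>w = 0\<close> and contributes \<open>0 / 0 = 0\<close>.\<close>
primrec gs_proj :: "nat \<Rightarrow> nat \<Rightarrow> (nat \<times> nat \<Rightarrow> complex) \<Rightarrow> nat \<Rightarrow> nat \<Rightarrow> complex" where
  "gs_proj N 0 z = (\<lambda>i l. of_bool (i = l))"
| "gs_proj N (Suc j) z = (let w = (\<lambda>i. \<Sum>l<N. gs_proj N j z i l * z (l, j)) in
     (\<lambda>i l. gs_proj N j z i l - w i * cnj (w l) / of_real (\<Sum>m<N. (cmod (w m))\<^sup>2)))"

definition gs_resid :: "nat \<Rightarrow> nat \<Rightarrow> (nat \<times> nat \<Rightarrow> complex) \<Rightarrow> nat \<Rightarrow> complex" where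
  "gs_resid N j z i = (\<Sum>l<N. gs_proj N j z i l * z (l, j))"

definition gs_norm :: "nat \<Rightarrow> nat \<Rightarrow> (nat \<times> nat \<Rightarrow> complex) \<Rightarrow> real" where
  "gs_norm N j z = (\<Sum>m<N. (cmod (gs_resid N j z m))\<^sup>2)"

lemma gs_proj_Suc:
  "gs_proj N (Suc j) z i l = gs_proj N j z i l - gs_resid N j z i * cnj (gs_resid N j z l) / of_real (gs_norm N j z)"
  by (simp add: gs_resid_def gs_norm_def Let_def)

declare gs_proj.simps(2) [simp del]

lemma gs_norm_nonneg: "0 \<le> gs_norm N j z"
  unfolding gs_norm_def by (intro sum_nonneg) auto

lemma gs_norm_eq_0: "gs_norm N j z = 0 \<Longrightarrow> i < N \<Longrightarrow> gs_resid N j z i = 0"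
  unfolding gs_norm_def by (subst (asm) sum_nonneg_eq_0_iff) auto

lemma of_real_gs_norm: "of_real (gs_norm N j z) = (\<Sum>l<N. cnj (gs_resid N j z l) * gs_resid N j z l)"
  unfolding gs_norm_def of_real_sum by (intro sum.cong refl) (simp only: complex_norm_square mult.commute)

lemma gs_proj_hermitian: "gs_proj N j z l i = cnj (gs_proj N j z i l)"
proof (induction j arbitrary: i l)
  case (Suc j)
  show ?case by (simp add: gs_proj_Suc Suc.IH[of l i] mult.commute)
qed simp

text \<open>The residual lies in the range of the old projection. Subtracting the projection onto
  its line therefore leaves a projection; when the residual vanishes, nothing is subtracted.\<close>

lemma gs_proj_idem:
  assumes "i < N" "k < N"
  shows "(\<Sum>l<N. gs_proj N j z i l * gs_proj N j z l k) = gs_proj N j z i k"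
  using assms
proof (induction j arbitrary: i k)
  case 0
  then show ?case by (simp add: of_bool_def if_distrib[of "\<lambda>x. x * _"] cong: if_cong)
next
  case (Suc j)
  let ?P = "gs_proj N j z" and ?w = "gs_resid N j z" and ?s = "gs_norm N j z"
  have Pw: "(\<Sum>l<N. ?P i l * ?w l) = ?w i" if "i < N" for i
  proof -
    have "(\<Sum>l<N. ?P i l * ?w l) = (\<Sum>l<N. \<Sum>m<N. ?P i l * ?P l m * z (m, j))"
      by (simp add: gs_resid_def sum_distrib_left mult.assoc)
    also have "\<dots> = (\<Sum>m<N. (\<Sum>l<N. ?P i l * ?P l m) * z (m, j))"
      by (subst sum.swap) (simp add: sum_distrib_right)
    also have "\<dots> = ?w i" using Suc.IH[OF that] by (simp add: gs_resid_def)
    finally show ?thesis .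
  qed
  have wP: "(\<Sum>l<N. cnj (?w l) * ?P l k) = cnj (?w k)" if "k < N" for k
  proof -
    have "(\<Sum>l<N. cnj (?w l) * ?P l k) = cnj (\<Sum>l<N. ?P k l * ?w l)"
      by (simp add: gs_proj_hermitian[of N j z _ k] mult.commute)
    then show ?thesis using Pw[OF that] by simp
  qed
  show ?case
  proof (cases "?s = 0")
    case True
    then show ?thesis using Suc by (simp add: gs_proj_Suc)
  next
    case False
    have "(\<Sum>l<N. gs_proj N (Suc j) z i l * gs_proj N (Suc j) z l k) =
      (\<Sum>l<N. ?P i l * ?P l k) - (\<Sum>l<N. ?P i l * ?w l) * (cnj (?w k) / of_real ?s)
       - (?w i / of_real ?s) * (\<Sum>l<N. cnj (?w l) * ?P l k)
       + (?w i / of_real ?s) * (\<Sum>l<N. cnj (?w l) * ?w l) * (cnj (?w k) / of_real ?s)"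
      by (simp add: gs_proj_Suc algebra_simps sum.distrib sum_subtractf sum_distrib_left sum_distrib_right sum_divide_distrib)
    also have "\<dots> = gs_proj N (Suc j) z i k"
      using False Suc by (simp add: Suc.IH Pw wP of_real_gs_norm[symmetric] gs_proj_Suc)
    finally show ?thesis .
  qed
qed

lemma gs_proj_resid:
  assumes "i < N" shows "(\<Sum>l<N. gs_proj N j z i l * gs_resid N j z l) = gs_resid N j z i"
proof -
  have "(\<Sum>l<N. gs_proj N j z i l * gs_resid N j z l) = (\<Sum>l<N. \<Sum>m<N. gs_proj N j z i l * gs_proj N j z l m * z (m, j))"
    by (simp add: gs_resid_def sum_distrib_left mult.assoc)
  also have "\<dots> = (\<Sum>m<N. (\<Sum>l<N. gs_proj N j z i l * gs_proj N j z l m) * z (m, j))"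
    by (subst sum.swap) (simp add: sum_distrib_right)
  also have "\<dots> = gs_resid N j z i" using gs_proj_idem[OF assms] by (simp add: gs_resid_def)
  finally show ?thesis .
qed

lemma gs_resid_proj:
  "k < N \<Longrightarrow> (\<Sum>l<N. cnj (gs_resid N j z l) * gs_proj N j z l k) = cnj (gs_resid N j z k)"
proof -
  assume k: "k < N"
  have "(\<Sum>l<N. cnj (gs_resid N j z l) * gs_proj N j z l k) = cnj (\<Sum>l<N. gs_proj N j z k l * gs_resid N j z l)"
    by (simp add: gs_proj_hermitian[of N j z _ k] mult.commute)
  then show ?thesis using gs_proj_resid[OF k] by simp
qed

lemma gs_proj_Suc_apply:
  "(\<Sum>l<N. gs_proj N (Suc j) z i l * u l) = (\<Sum>l<N. gs_proj N j z i l * u l)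
    - gs_resid N j z i / of_real (gs_norm N j z) * (\<Sum>l<N. cnj (gs_resid N j z l) * u l)"
  by (simp add: gs_proj_Suc algebra_simps sum_subtractf sum_distrib_left sum_divide_distrib)

text \<open>The residual is fixed by the self-adjoint projection, so an inner product with it sees
  only the projected part of \<open>u\<close>.\<close>

lemma gs_resid_inner:
  "(\<Sum>l<N. cnj (gs_resid N j z l) * u l) = (\<Sum>l<N. cnj (gs_resid N j z l) * (\<Sum>m<N. gs_proj N j z l m * u m))"
proof -
  have "(\<Sum>l<N. cnj (gs_resid N j z l) * (\<Sum>m<N. gs_proj N j z l m * u m)) =
      (\<Sum>m<N. (\<Sum>l<N. cnj (gs_resid N j z l) * gs_proj N j z l m) * u m)"
    by (simp add: sum_distrib_left sum_distrib_right mult.assoc) (rule sum.swap)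
  then show ?thesis by (simp add: gs_resid_proj)
qed

lemma gs_resid_inner_self: "(\<Sum>l<N. cnj (gs_resid N j z l) * z (l, j)) = of_real (gs_norm N j z)"
  by (subst gs_resid_inner) (simp add: of_real_gs_norm gs_resid_def[symmetric])

text \<open>The matrix of this form involves the columns before \<open>j\<close> only. Given those
  columns it is a fixed quadratic form in an independent Gaussian vector.\<close>

lemma gs_norm_quadratic:
  "of_real (gs_norm N j z) = (\<Sum>i<N. \<Sum>l<N. cnj (z (i, j)) * gs_proj N j z i l * z (l, j))"
proof -
  have "of_real (gs_norm N j z) = cnj (\<Sum>l<N. cnj (gs_resid N j z l) * z (l, j))"
    by (subst gs_resid_inner_self) simp
  also have "\<dots> = (\<Sum>i<N. \<Sum>l<N. cnj (z (i, j)) * gs_proj N j z i l * z (l, j))"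
    by (simp add: gs_resid_def sum_distrib_left sum_distrib_right mult_ac)
  finally show ?thesis .
qed

text \<open>Each nonvanishing residual removes a rank-one projection, of trace 1.\<close>

lemma gs_proj_trace:
  assumes "\<And>a. a < j \<Longrightarrow> gs_norm N a z \<noteq> 0"
  shows "(\<Sum>i<N. gs_proj N j z i i) = of_real (real N - real j)"
  using assms
proof (induction j)
  case (Suc j)
  have "(\<Sum>i<N. gs_resid N j z i * cnj (gs_resid N j z i) / of_real (gs_norm N j z)) = 1"
  proof -
    have "(\<Sum>i<N. gs_resid N j z i * cnj (gs_resid N j z i) / of_real (gs_norm N j z)) =
       (\<Sum>i<N. cnj (gs_resid N j z i) * gs_resid N j z i) / of_real (gs_norm N j z)"
      by (simp add: sum_divide_distrib mult.commute)
    also have "\<dots> = 1" unfolding of_real_gs_norm[symmetric] using Suc.prems[of j] by simp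
    finally show ?thesis .
  qed
  then show ?case using Suc by (simp add: gs_proj_Suc sum_subtractf)
qed simp

lemma gs_proj_kills:
  assumes "a < j" "i < N"
  shows "(\<Sum>l<N. gs_proj N j z i l * z (l, a)) = 0"
  using assms
proof (induction j arbitrary: i)
  case (Suc j)
  have "(\<Sum>l<N. gs_proj N (Suc j) z i l * z (l, a)) = (\<Sum>l<N. gs_proj N j z i l * z (l, a))
      - gs_resid N j z i / of_real (gs_norm N j z) * (\<Sum>l<N. cnj (gs_resid N j z l) * z (l, a))"
    by (rule gs_proj_Suc_apply)
  also have "\<dots> = 0"
  proof (cases "a < j")
    case True
    then show ?thesis by (subst gs_resid_inner) (simp add: Suc.IH Suc.prems)
  next
    case False
    then have [simp]: "a = j" using Suc.prems by simp
    \<comment> \<open>Otherwise the two terms cancel; if the residual vanishes, column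
      \<open>j\<close> was already annihilated and the division by 0 contributes nothing.\<close>
    show ?thesis using gs_norm_eq_0[of N j z i] Suc.prems
      by (cases "gs_norm N j z = 0") (simp_all add: gs_resid_inner_self gs_resid_def[symmetric])
  qed
  finally show ?case .
qed simp

lemma gs_proj_span:
  "\<exists>x. \<forall>i<N. (\<Sum>l<N. gs_proj N j z i l * u l) = u i - (\<Sum>a<j. z (i, a) * x a)"
proof (induction j arbitrary: u)
  case 0
  show ?case by (simp add: of_bool_def if_distrib[of "\<lambda>x. x * _"] cong: if_cong)
next
  case (Suc j)
  obtain x where x: "\<And>i. i < N \<Longrightarrow> (\<Sum>l<N. gs_proj N j z i l * u l) = u i - (\<Sum>a<j. z (i, a) * x a)"
    using Suc.IH[of u] by auto
  obtain y where y: "\<And>i. i < N \<Longrightarrow> gs_resid N j z i = z (i, j) - (\<Sum>a<j. z (i, a) * y a)"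
    using Suc.IH[of "\<lambda>l. z (l, j)"] unfolding gs_resid_def by auto
  define c where "c = (\<Sum>l<N. cnj (gs_resid N j z l) * u l) / of_real (gs_norm N j z)"
  show ?case
  proof (intro exI allI impI)
    fix i assume i: "i < N"
    have "(\<Sum>l<N. gs_proj N (Suc j) z i l * u l) = (\<Sum>l<N. gs_proj N j z i l * u l) - gs_resid N j z i * c"
      by (simp add: gs_proj_Suc_apply c_def)
    also have "\<dots> = u i - (\<Sum>a<Suc j. z (i, a) * (if a = j then c else x a - y a * c))"
      unfolding x[OF i] y[OF i] by (simp add: algebra_simps sum_subtractf sum_distrib_left sum_distrib_right)
    finally show "(\<Sum>l<N. gs_proj N (Suc j) z i l * u l) = u i - (\<Sum>a<Suc j. z (i, a) * (if a = j then c else x a - y a * c))" .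
  qed
qed

text \<open>Columns from \<open>j\<close> on do not enter, which is what allows conditioning on the
  earlier ones through \<open>add_col\<close>.\<close>

lemma gs_proj_cong:
  "(\<And>i a. i < N \<Longrightarrow> a < j \<Longrightarrow> z (i, a) = z' (i, a)) \<Longrightarrow> gs_proj N j z = gs_proj N j z'"
proof (induction j)
  case (Suc j)
  then have IH: "gs_proj N j z = gs_proj N j z'" by simp
  have "gs_resid N j z = gs_resid N j z'"
    using Suc.prems by (auto simp: gs_resid_def IH fun_eq_iff)
  then show ?case by (simp add: fun_eq_iff gs_proj_Suc IH gs_norm_def)
qed simp

lemma gs_resid_cong:
  "(\<And>i a. i < N \<Longrightarrow> a \<le> j \<Longrightarrow> z (i, a) = z' (i, a)) \<Longrightarrow> gs_resid N j z = gs_resid N j z'"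
  using gs_proj_cong[of N j z z'] by (auto simp: gs_resid_def fun_eq_iff)

lemma gs_norm_cong:
  "(\<And>i a. i < N \<Longrightarrow> a \<le> j \<Longrightarrow> z (i, a) = z' (i, a)) \<Longrightarrow> gs_norm N j z = gs_norm N j z'"
  using gs_resid_cong[of N j z z'] by (simp add: gs_norm_def)

section \<open>Gaussian matrices, column by column\<close>

abbreviation cgmat :: "nat \<Rightarrow> nat \<Rightarrow> (nat \<times> nat \<Rightarrow> complex) measure" where
  "cgmat N j \<equiv> Pi\<^sub>M ({..<N} \<times> {..<j}) (\<lambda>_. cgauss)"

abbreviation cgvec :: "nat \<Rightarrow> (nat \<Rightarrow> complex) measure" where
  "cgvec N \<equiv> Pi\<^sub>M {..<N} (\<lambda>_. cgauss)"

lemma prob_space_cgmat: "prob_space (cgmat N j)" and prob_space_cgvec: "prob_space (cgvec N)"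
  by (intro prob_space_PiM prob_space_cgauss)+

lemma measurable_gs_proj:
  "j \<le> n \<Longrightarrow> (\<lambda>z. gs_proj N j z i l) \<in> borel_measurable (cgmat N n)"
proof (induction j arbitrary: i l)
  case (Suc j)
  have [measurable]: "(\<lambda>z. gs_proj N j z i l) \<in> borel_measurable (cgmat N n)" for i l using Suc by auto
  have "(\<lambda>z. z (l, j)) \<in> borel_measurable (cgmat N n)" if "l < N" for l
    using that Suc.prems by (intro measurable_PiM_cgauss) auto
  then have [measurable]: "(\<lambda>z. gs_resid N j z i) \<in> borel_measurable (cgmat N n)" for i
    unfolding gs_resid_def by (intro borel_measurable_sum borel_measurable_times) auto
  show ?case unfolding gs_proj_Suc gs_norm_def by measurable
qed simp

lemma measurable_gs_resid:
  assumes "j < n" shows "(\<lambda>z. gs_resid N j z i) \<in> borel_measurable (cgmat N n)"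
proof -
  have "(\<lambda>z. z (l, j)) \<in> borel_measurable (cgmat N n)" if "l < N" for l
    using that assms by (intro measurable_PiM_cgauss) auto
  then show ?thesis
    unfolding gs_resid_def using assms by (intro borel_measurable_sum borel_measurable_times measurable_gs_proj) auto
qed

lemma measurable_gs_norm:
  assumes "j < n" shows "gs_norm N j \<in> borel_measurable (cgmat N n)"
proof -
  have [measurable]: "(\<lambda>z. gs_resid N j z i) \<in> borel_measurable (cgmat N n)" for i
    using measurable_gs_resid[OF assms] .
  have "(\<lambda>z. gs_norm N j z) \<in> borel_measurable (cgmat N n)"
    unfolding gs_norm_def by measurable
  then show ?thesis by simp
qed

text \<open>The restriction keeps the value extensional, as points of the larger product space have
  to be.\<close>

definition add_col :: "nat \<Rightarrow> nat \<Rightarrow> (nat \<times> nat \<Rightarrow> complex) \<Rightarrow> (nat \<Rightarrow> complex) \<Rightarrow> nat \<times> nat \<Rightarrow> complex" where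
  "add_col N j z y = (\<lambda>p\<in>{..<N} \<times> {..<Suc j}. if snd p = j then y (fst p) else z p)"

lemma measurable_add_col:
  "(\<lambda>(z, y). add_col N j z y) \<in> measurable (cgmat N j \<Otimes>\<^sub>M cgvec N) (cgmat N (Suc j))"
  unfolding add_col_def case_prod_beta
proof (rule measurable_restrict)
  fix p assume p: "p \<in> {..<N} \<times> {..<Suc j}"
  show "(\<lambda>x. if snd p = j then snd x (fst p) else fst x p) \<in> measurable (cgmat N j \<Otimes>\<^sub>M cgvec N) cgauss"
  proof (cases "snd p = j")
    case True
    then show ?thesis using p
      by (auto intro!: measurable_compose[OF measurable_snd measurable_component_singleton])
  next
    case False
    then show ?thesis using p
      by (auto intro!: measurable_compose[OF measurable_fst measurable_component_singleton])
  qed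
qed

text \<open>Product measures are determined by boxes, and a box splits into its old entries and
  those of the new column.\<close>

lemma distr_add_col:
  "distr (cgmat N j \<Otimes>\<^sub>M cgvec N) (cgmat N (Suc j)) (\<lambda>(z, y). add_col N j z y) = cgmat N (Suc j)"
proof (rule PiM_cgauss.PiM_eqI)
  fix A assume A: "\<And>i. i \<in> {..<N} \<times> {..<Suc j} \<Longrightarrow> A i \<in> sets cgauss"
  have vim: "(\<lambda>(z, y). add_col N j z y) -` Pi\<^sub>E ({..<N} \<times> {..<Suc j}) A \<inter> space (cgmat N j \<Otimes>\<^sub>M cgvec N)
     = Pi\<^sub>E ({..<N} \<times> {..<j}) A \<times> Pi\<^sub>E {..<N} (\<lambda>i. A (i, j))"
  proof (rule Set.equalityI; rule subsetI)
    fix p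
    assume "p \<in> (\<lambda>(z, y). add_col N j z y) -` Pi\<^sub>E ({..<N} \<times> {..<Suc j}) A \<inter> space (cgmat N j \<Otimes>\<^sub>M cgvec N)"
    then obtain z y where p: "p = (z, y)" and mem: "\<And>i a. i < N \<Longrightarrow> a < Suc j \<Longrightarrow> add_col N j z y (i, a) \<in> A (i, a)"
      and ext: "z \<in> extensional ({..<N} \<times> {..<j})" "y \<in> extensional {..<N}"
      by (cases p) (auto simp: space_pair_measure space_PiM PiE_iff)
    have "z (i, a) \<in> A (i, a)" if "i < N" "a < j" for i a
      using mem[of i a] that by (simp add: add_col_def)
    moreover have "y i \<in> A (i, j)" if "i < N" for i
      using mem[of i j] that by (simp add: add_col_def)
    ultimately show "p \<in> Pi\<^sub>E ({..<N} \<times> {..<j}) A \<times> Pi\<^sub>E {..<N} (\<lambda>i. A (i, j))"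
      using ext by (auto simp: p PiE_iff)
  next
    fix p
    assume "p \<in> Pi\<^sub>E ({..<N} \<times> {..<j}) A \<times> Pi\<^sub>E {..<N} (\<lambda>i. A (i, j))"
    then obtain z y where p: "p = (z, y)" and z: "\<And>i a. i < N \<Longrightarrow> a < j \<Longrightarrow> z (i, a) \<in> A (i, a)"
      and y: "\<And>i. i < N \<Longrightarrow> y i \<in> A (i, j)"
      and ext: "z \<in> extensional ({..<N} \<times> {..<j})" "y \<in> extensional {..<N}"
      by (cases p) (auto simp: PiE_iff)
    have "add_col N j z y (i, a) \<in> A (i, a)" if "i < N" "a < Suc j" for i a
      using that z[of i a] y[of i] by (cases "a = j") (auto simp: add_col_def)
    then have "add_col N j z y \<in> Pi\<^sub>E ({..<N} \<times> {..<Suc j}) A"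
      unfolding PiE_iff by (auto simp: add_col_def)
    then show "p \<in> (\<lambda>(z, y). add_col N j z y) -` Pi\<^sub>E ({..<N} \<times> {..<Suc j}) A \<inter> space (cgmat N j \<Otimes>\<^sub>M cgvec N)"
      using ext by (auto simp: p space_pair_measure space_PiM PiE_iff)
  qed
  have "emeasure (distr (cgmat N j \<Otimes>\<^sub>M cgvec N) (cgmat N (Suc j)) (\<lambda>(z, y). add_col N j z y)) (Pi\<^sub>E ({..<N} \<times> {..<Suc j}) A)
     = emeasure (cgmat N j) (Pi\<^sub>E ({..<N} \<times> {..<j}) A) * emeasure (cgvec N) (Pi\<^sub>E {..<N} (\<lambda>i. A (i, j)))"
    using A by (subst emeasure_distr[OF measurable_add_col])
      (auto simp: vim intro!: sets_PiM_I_finite sigma_finite_measure.emeasure_pair_measure_Times[OF prob_space_imp_sigma_finite[OF prob_space_cgvec]])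
  also have "\<dots> = (\<Prod>p\<in>{..<N} \<times> {..<j}. emeasure cgauss (A p)) * (\<Prod>i<N. emeasure cgauss (A (i, j)))"
    using A by (subst (1 2) PiM_cgauss.emeasure_PiM) auto
  also have "\<dots> = (\<Prod>p\<in>{..<N} \<times> {..<Suc j}. emeasure cgauss (A p))"
  proof -
    have "{..<N} \<times> {..<Suc j} = ({..<N} \<times> {..<j}) \<union> (\<lambda>i. (i, j)) ` {..<N}" by (auto simp: less_Suc_eq)
    then have "(\<Prod>p\<in>{..<N} \<times> {..<Suc j}. emeasure cgauss (A p)) =
       (\<Prod>p\<in>{..<N} \<times> {..<j}. emeasure cgauss (A p)) * (\<Prod>p\<in>(\<lambda>i. (i, j)) ` {..<N}. emeasure cgauss (A p))"
      by (auto intro!: prod.union_disjoint)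
    then show ?thesis by (simp add: prod.reindex inj_on_def)
  qed
  finally show "emeasure (distr (cgmat N j \<Otimes>\<^sub>M cgvec N) (cgmat N (Suc j)) (\<lambda>(z, y). add_col N j z y)) (Pi\<^sub>E ({..<N} \<times> {..<Suc j}) A)
     = (\<Prod>p\<in>{..<N} \<times> {..<Suc j}. emeasure cgauss (A p))" .
qed auto

text \<open>Fubini with the last column inside: for fixed earlier columns the projection
  \<open>gs_proj N j\<close> is deterministic and the new column is Gaussian. All conditioning on
  earlier columns goes through this identity.\<close>

lemma emeasure_cgmat_Suc:
  assumes E: "E \<in> sets (cgmat N (Suc j))"
  shows "emeasure (cgmat N (Suc j)) E = (\<integral>\<^sup>+z. emeasure (cgvec N) {y \<in> space (cgvec N). add_col N j z y \<in> E} \<partial>cgmat N j)"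
proof -
  have "emeasure (cgmat N (Suc j)) E = emeasure (cgmat N j \<Otimes>\<^sub>M cgvec N) ((\<lambda>(z, y). add_col N j z y) -` E \<inter> space (cgmat N j \<Otimes>\<^sub>M cgvec N))"
    by (subst distr_add_col[symmetric]) (rule emeasure_distr[OF measurable_add_col E])
  also have "\<dots> = (\<integral>\<^sup>+z. emeasure (cgvec N) (Pair z -` ((\<lambda>(z, y). add_col N j z y) -` E \<inter> space (cgmat N j \<Otimes>\<^sub>M cgvec N))) \<partial>cgmat N j)"
    by (rule sigma_finite_measure.emeasure_pair_measure_alt[OF prob_space_imp_sigma_finite[OF prob_space_cgvec]]) (rule measurable_sets[OF measurable_add_col E])
  also have "\<dots> = (\<integral>\<^sup>+z. emeasure (cgvec N) {y \<in> space (cgvec N). add_col N j z y \<in> E} \<partial>cgmat N j)"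
    by (intro nn_integral_cong arg_cong[where f="emeasure _"]) (auto simp: space_pair_measure)
  finally show ?thesis .
qed

lemma add_col_simps:
  assumes "i < N"
  shows "a < j \<Longrightarrow> add_col N j z y (i, a) = z (i, a)" "add_col N j z y (i, j) = y i"
  using assms by (simp_all add: add_col_def)

lemma gs_add_col:
  "a < j \<Longrightarrow> gs_norm N a (add_col N j z y) = gs_norm N a z"
  "a < j \<Longrightarrow> gs_resid N a (add_col N j z y) = gs_resid N a z"
  "gs_proj N j (add_col N j z y) = gs_proj N j z"
  "gs_resid N j (add_col N j z y) i = (\<Sum>l<N. gs_proj N j z i l * y l)"
proof -
  show 3: "gs_proj N j (add_col N j z y) = gs_proj N j z"
    by (rule gs_proj_cong) (simp add: add_col_simps)
  show "gs_resid N j (add_col N j z y) i = (\<Sum>l<N. gs_proj N j z i l * y l)"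
    unfolding gs_resid_def 3 by (simp add: add_col_simps)
qed (auto intro!: gs_norm_cong gs_resid_cong simp: add_col_simps)

text \<open>Dividing by the length \<open>t\<close> reduces to a unit vector, whose linear form is
  again standard.\<close>

lemma emeasure_cgvec_linear:
  assumes v: "(\<Sum>k<N. (cmod (v k))\<^sup>2) = t\<^sup>2" "t > 0" and B: "B \<in> sets borel"
  shows "emeasure (cgvec N) {y \<in> space (cgvec N). (\<Sum>k<N. v k * y k) \<in> B} = emeasure cgauss {w. of_real t * w \<in> B}"
proof -
  let ?f = "\<lambda>y. \<Sum>k<N. v k / of_real t * y k"
  have m: "?f \<in> measurable (cgvec N) borel"
    by (intro borel_measurable_sum borel_measurable_times borel_measurable_const measurable_PiM_cgauss) auto
  have "(\<Sum>k<N. (cmod (v k / of_real t))\<^sup>2) = 1"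
    using v by (simp add: norm_divide power_divide sum_divide_distrib[symmetric])
  note d = distr_PiM_cgauss_linear[OF _ this]
  have Bt: "{w. of_real t * w \<in> B} \<in> sets borel"
    using measurable_sets[of "\<lambda>w::complex. of_real t * w" borel borel B] B by (simp add: vimage_def)
  have "emeasure cgauss {w. of_real t * w \<in> B} = emeasure (distr (cgvec N) borel ?f) {w. of_real t * w \<in> B}"
    by (subst d) auto
  also have "\<dots> = emeasure (cgvec N) (?f -` {w. of_real t * w \<in> B} \<inter> space (cgvec N))"
    by (rule emeasure_distr[OF m Bt])
  also have "?f -` {w. of_real t * w \<in> B} \<inter> space (cgvec N) = {y \<in> space (cgvec N). (\<Sum>k<N. v k * y k) \<in> B}"
    using v(2) by (auto simp: sum_distrib_left)
  finally show ?thesis by simp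
qed

text \<open>Given nondegenerate earlier columns, the projection has trace \<open>N - j > 0\<close>
  and hence a nonzero diagonal entry. The corresponding entry of the new residual is a nonzero
  linear form in the new column, and such a form has no atom at 0.\<close>

lemma AE_gs_norm_nonzero:
  "j \<le> N \<Longrightarrow> AE z in cgmat N j. \<forall>a<j. gs_norm N a z \<noteq> 0"
proof (induction j)
  case (Suc j)
  let ?E = "{z \<in> space (cgmat N (Suc j)). \<exists>a<Suc j. gs_norm N a z = 0}"
  have E: "?E \<in> sets (cgmat N (Suc j))"
  proof -
    have "?E = (\<Union>a<Suc j. {z \<in> space (cgmat N (Suc j)). gs_norm N a z = 0})" by auto
    also have "\<dots> \<in> sets (cgmat N (Suc j))"
      using measurable_gs_norm[of _ "Suc j" N] by (intro sets.finite_UN) (auto intro!: borel_measurable_eq)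
    finally show ?thesis .
  qed
  have "emeasure (cgmat N (Suc j)) ?E = (\<integral>\<^sup>+z. 0 \<partial>cgmat N j)"
    unfolding emeasure_cgmat_Suc[OF E]
  proof (rule nn_integral_cong_AE)
    have "AE z in cgmat N j. \<forall>a<j. gs_norm N a z \<noteq> 0" using Suc by auto
    then show "AE z in cgmat N j. emeasure (cgvec N) {y \<in> space (cgvec N). add_col N j z y \<in> ?E} = 0"
    proof eventually_elim
      case (elim z)
      have "(\<Sum>i<N. gs_proj N j z i i) \<noteq> 0"
        using gs_proj_trace[of j N z] elim Suc.prems by auto
      then obtain i where i: "i < N" "gs_proj N j z i i \<noteq> 0" by (meson lessThan_iff sum.neutral)
      define t where "t = sqrt (\<Sum>k<N. (cmod (gs_proj N j z i k))\<^sup>2)"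
      have "(\<Sum>k<N. (cmod (gs_proj N j z i k))\<^sup>2) > 0"
        using i by (intro sum_pos2[of _ i]) auto
      then have t: "(\<Sum>k<N. (cmod (gs_proj N j z i k))\<^sup>2) = t\<^sup>2" "t > 0" by (auto simp: t_def)
      have "emeasure (cgvec N) {y \<in> space (cgvec N). add_col N j z y \<in> ?E} \<le>
        emeasure (cgvec N) {y \<in> space (cgvec N). (\<Sum>k<N. gs_proj N j z i k * y k) \<in> {0}}"
      proof (rule emeasure_mono)
        have "(\<lambda>y. \<Sum>k<N. gs_proj N j z i k * y k) \<in> borel_measurable (cgvec N)"
          by (intro borel_measurable_sum borel_measurable_times borel_measurable_const measurable_PiM_cgauss) auto
        then show "{y \<in> space (cgvec N). (\<Sum>k<N. gs_proj N j z i k * y k) \<in> {0}} \<in> sets (cgvec N)"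
          by (auto intro!: borel_measurable_eq)
        show "{y \<in> space (cgvec N). add_col N j z y \<in> ?E} \<subseteq> {y \<in> space (cgvec N). (\<Sum>k<N. gs_proj N j z i k * y k) \<in> {0}}"
        proof safe
          fix y a assume a: "a < Suc j" "gs_norm N a (add_col N j z y) = 0"
          have "a = j" using a elim gs_add_col(1)[of a j N z y] by (cases "a < j") auto
          then show "(\<Sum>k<N. gs_proj N j z i k * y k) = 0"
            using gs_norm_eq_0[OF a(2) i(1)] by (simp add: gs_add_col)
        qed
      qed
      also have "\<dots> = emeasure cgauss {w. of_real t * w \<in> {0}}"
        by (rule emeasure_cgvec_linear[OF t]) simp
      also have "{w. of_real t * w \<in> {0}} = {0::complex}" using t(2) by auto
      also have "emeasure cgauss {0} = 0"
        using AE_cgauss_nonzero by (subst (asm) AE_iff_measurable[of "{0}"]) auto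
      finally show ?case by simp
    qed
  qed
  then have "emeasure (cgmat N (Suc j)) ?E = 0" by simp
  then show ?case by (intro AE_I[OF _ _ E]) auto
qed simp

text \<open>For almost all earlier columns the second moment bound depends on them only through the
  rank \<open>N - j\<close>, so integrating over them leaves it unchanged.\<close>

lemma gs_norm_concentration:
  assumes j: "j < N" and \<delta>: "\<delta> > 0"
  shows "measure (cgmat N (Suc j)) {z \<in> space (cgmat N (Suc j)). \<delta> * (real N - real j) \<le> \<bar>gs_norm N j z - (real N - real j)\<bar>}
     \<le> 1 / (\<delta>\<^sup>2 * (real N - real j))" (is "measure _ ?E \<le> _")
proof -
  define r where "r = real N - real j"
  have r: "r > 0" using j by (simp add: r_def)
  have [measurable]: "gs_norm N j \<in> borel_measurable (cgmat N (Suc j))" by (rule measurable_gs_norm) simp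
  have E: "?E \<in> sets (cgmat N (Suc j))" by measurable
  have "emeasure (cgmat N (Suc j)) ?E \<le> (\<integral>\<^sup>+z. ennreal (1 / (\<delta>\<^sup>2 * r)) \<partial>cgmat N j)"
    unfolding emeasure_cgmat_Suc[OF E]
  proof (rule nn_integral_mono_AE)
    have "AE z in cgmat N j. \<forall>a<j. gs_norm N a z \<noteq> 0" using AE_gs_norm_nonzero[of j N] j by auto
    then show "AE z in cgmat N j. emeasure (cgvec N) {y \<in> space (cgvec N). add_col N j z y \<in> ?E} \<le> ennreal (1 / (\<delta>\<^sup>2 * r))"
    proof eventually_elim
      case (elim z)
      define f where "f y = (cmod ((\<Sum>i<N. \<Sum>l<N. cnj (y i) * gs_proj N j z i l * y l) - of_real r))\<^sup>2" for y
      have "has_bochner_integral (cgvec N) f r"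
        unfolding f_def using gs_proj_trace[of j N z] elim
        by (intro quadratic_form_variance) (auto simp: gs_proj_idem r_def intro: gs_proj_hermitian)
      then have f: "integrable (cgvec N) f" "integral\<^sup>L (cgvec N) f = r"
        by (auto simp: has_bochner_integral_iff)
      have f0: "0 \<le> f y" for y by (simp add: f_def)
      have ff: "f y = \<bar>gs_norm N j (add_col N j z y) - r\<bar>\<^sup>2" for y
      proof -
        have "(\<Sum>i<N. \<Sum>l<N. cnj (y i) * gs_proj N j z i l * y l) = of_real (gs_norm N j (add_col N j z y))"
          unfolding gs_norm_quadratic by (simp add: gs_add_col add_col_simps)
        then show ?thesis by (simp add: f_def flip: of_real_diff)
      qed
      have "{y \<in> space (cgvec N). add_col N j z y \<in> ?E} \<subseteq> {y \<in> space (cgvec N). f y \<ge> (\<delta> * r)\<^sup>2}"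
      proof safe
        fix y assume "\<delta> * (real N - real j) \<le> \<bar>gs_norm N j (add_col N j z y) - (real N - real j)\<bar>"
        then show "(\<delta> * r)\<^sup>2 \<le> f y"
          unfolding ff r_def[symmetric] using \<delta> r by (intro power_mono) auto
      qed
      then have "emeasure (cgvec N) {y \<in> space (cgvec N). add_col N j z y \<in> ?E} \<le> emeasure (cgvec N) {y \<in> space (cgvec N). f y \<ge> (\<delta> * r)\<^sup>2}"
        using f by (intro emeasure_mono) auto
      also have "\<dots> = ennreal (measure (cgvec N) {y \<in> space (cgvec N). f y \<ge> (\<delta> * r)\<^sup>2})"
        by (rule finite_measure.emeasure_eq_measure[OF prob_space.finite_measure[OF prob_space_cgvec]])
      also have "measure (cgvec N) {y \<in> space (cgvec N). f y \<ge> (\<delta> * r)\<^sup>2} \<le> r / (\<delta> * r)\<^sup>2"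
        using integral_Markov_inequality_measure[OF f(1), of "{}" "(\<delta> * r)\<^sup>2"] \<delta> r f(2) f0 by simp
      also have "r / (\<delta> * r)\<^sup>2 = 1 / (\<delta>\<^sup>2 * r)" using r \<delta> by (simp add: power2_eq_square field_simps)
      finally show ?case by (simp add: ennreal_leI)
    qed
  qed
  also have "\<dots> = ennreal (1 / (\<delta>\<^sup>2 * r))" by (simp add: prob_space.emeasure_space_1[OF prob_space_cgmat])
  finally show ?thesis using r \<delta> by (simp add: finite_measure.emeasure_eq_measure[OF prob_space.finite_measure[OF prob_space_cgmat]] r_def)
qed

section \<open>Entrywise form of adjoints, products and eigendecompositions\<close>

lemma mat_adjoint_carrier: "A \<in> carrier_mat m n \<Longrightarrow> mat_adjoint A \<in> carrier_mat n m"
  unfolding mat_adjoint_def by auto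

lemma mat_adjoint_index:
  assumes "A \<in> carrier_mat m n" "i < n" "j < m"
  shows "mat_adjoint A $$ (i, j) = cnj (A $$ (j, i))"
  using assms unfolding mat_adjoint_def by (simp add: mat_of_rows_index conjugate_complex_def)

lemma mat_mult_index:
  assumes "A \<in> carrier_mat m n" "B \<in> carrier_mat n k" "i < m" "j < k"
  shows "(A * B) $$ (i, j) = (\<Sum>l<n. A $$ (i, l) * B $$ (l, j))"
  using assms by (simp add: scalar_prod_def lessThan_atLeast0)

lemma eigen_decompositionD:
  assumes "eigen_decomposition n A W d"
  shows "W \<in> carrier_mat n n"
    and "\<And>i l. i < n \<Longrightarrow> l < n \<Longrightarrow> (\<Sum>a<n. cnj (W $$ (a, i)) * W $$ (a, l)) = of_bool (i = l)"
    and "\<And>a b. a < n \<Longrightarrow> b < n \<Longrightarrow> (\<Sum>i<n. W $$ (a, i) * cnj (W $$ (b, i))) = of_bool (a = b)"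
    and "\<And>a b. a < n \<Longrightarrow> b < n \<Longrightarrow> A $$ (a, b) = (\<Sum>i<n. W $$ (a, i) * of_real (d i) * cnj (W $$ (b, i)))"
proof -
  show W: "W \<in> carrier_mat n n" using assms by (simp add: eigen_decomposition_def)
  note W' = mat_adjoint_carrier[OF W]
  have 1: "mat_adjoint W * W = 1\<^sub>m n" "W * mat_adjoint W = 1\<^sub>m n"
    and 2: "A = W * mat_diag n (\<lambda>i. complex_of_real (d i)) * mat_adjoint W"
    using assms by (simp_all add: eigen_decomposition_def)
  {
    fix i l assume il: "i < n" "l < n"
    have "(mat_adjoint W * W) $$ (i, l) = of_bool (i = l)" using il by (simp add: 1)
    then show "(\<Sum>a<n. cnj (W $$ (a, i)) * W $$ (a, l)) = of_bool (i = l)"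
      unfolding mat_mult_index[OF W' W il] using il by (simp add: mat_adjoint_index[OF W])
  next
    fix a b assume ab: "a < n" "b < n"
    have "(W * mat_adjoint W) $$ (a, b) = of_bool (a = b)" using ab by (simp add: 1)
    then show "(\<Sum>i<n. W $$ (a, i) * cnj (W $$ (b, i))) = of_bool (a = b)"
      unfolding mat_mult_index[OF W W' ab] using ab by (simp add: mat_adjoint_index[OF W])
    have D: "mat_diag n (\<lambda>i. complex_of_real (d i)) \<in> carrier_mat n n" by simp
    have WD: "W * mat_diag n (\<lambda>i. complex_of_real (d i)) \<in> carrier_mat n n" using W by simp
    have "A $$ (a, b) = (\<Sum>i<n. (W * mat_diag n (\<lambda>i. complex_of_real (d i))) $$ (a, i) * cnj (W $$ (b, i)))"
      unfolding 2 mat_mult_index[OF WD W' ab] using ab by (intro sum.cong refl) (simp add: mat_adjoint_index[OF W])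
    also have "\<dots> = (\<Sum>i<n. W $$ (a, i) * of_real (d i) * cnj (W $$ (b, i)))"
      using ab W by (intro sum.cong refl) (simp add: mat_diag_mult_right[OF W])
    finally show "A $$ (a, b) = (\<Sum>i<n. W $$ (a, i) * of_real (d i) * cnj (W $$ (b, i)))" .
  }
qed

section \<open>Eigenvalues of Toeplitz matrices\<close>

abbreviation circ :: "real measure" where
  "circ \<equiv> lebesgue_on {0..2 * pi}"

lemma finite_measure_circ: "finite_measure circ"
  by (rule finite_measure_lebesgue_on) simp

lemma integrable_circ_continuous:
  fixes f :: "real \<Rightarrow> 'b::euclidean_space"
  shows "continuous_on UNIV f \<Longrightarrow> integrable circ f"
  by (rule continuous_imp_integrable_real) (auto intro: continuous_on_subset)

lemma measurable_circ_continuous: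
  fixes f :: "real \<Rightarrow> 'b::euclidean_space"
  shows "continuous_on UNIV f \<Longrightarrow> f \<in> borel_measurable circ"
  by (intro borel_measurable_integrable integrable_circ_continuous)

lemma integral_circ_cis:
  "(CLINT \<theta>|circ. cis (of_int k * \<theta>)) = (if k = 0 then 2 * pi else 0)"
proof (cases "k = 0")
  case True
  have "(CLINT \<theta>|circ. 1) = of_real (measure circ (space circ))" by (simp add: scaleR_conv_of_real)
  also have "\<dots> = 2 * pi" by (simp add: measure_restrict_space)
  finally show ?thesis using True by simp
next
  case False
  have int: "integrable circ (\<lambda>\<theta>. cis (of_int k * \<theta>))"
    by (intro integrable_circ_continuous continuous_intros)
  have "((\<lambda>x. - \<i> / of_int k * exp (\<i> * of_int k * of_real x)) has_vector_derivative cis (of_int k * x)) (at x within {0..2 * pi})" for x :: real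
    using False
    by (intro has_vector_derivative_real_field) (auto intro!: derivative_eq_intros simp: cis_conv_exp mult.assoc)
  then have "((\<lambda>\<theta>. cis (of_int k * \<theta>)) has_integral
      (- \<i> / of_int k * exp (\<i> * of_int k * of_real (2 * pi)) - (- \<i> / of_int k * exp (\<i> * of_int k * of_real 0)))) {0..2 * pi}"
    by (intro fundamental_theorem_of_calculus) auto
  moreover have "exp (\<i> * of_int k * of_real (2 * pi)) = 1"
    using exp_integer_2pi[of "of_int k"] by (simp add: mult_ac)
  ultimately have "((\<lambda>\<theta>. cis (of_int k * \<theta>)) has_integral 0) {0..2 * pi}" by simp
  then have "integral {0..2 * pi} (\<lambda>\<theta>. cis (of_int k * \<theta>)) = 0" by (rule integral_unique)
  then show ?thesis using False lebesgue_integral_eq_integral[OF int] by simp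
qed

text \<open>Only the linear operations are generators, so that a statement linear in the function
  has a single base case; products are recovered in \<open>trig_poly_mult\<close>.\<close>

inductive trig_poly :: "(real \<Rightarrow> complex) \<Rightarrow> bool" where
  cis: "trig_poly (\<lambda>\<theta>. cis (of_int k * \<theta>))"
| add: "trig_poly f \<Longrightarrow> trig_poly g \<Longrightarrow> trig_poly (\<lambda>\<theta>. f \<theta> + g \<theta>)"
| cmult: "trig_poly f \<Longrightarrow> trig_poly (\<lambda>\<theta>. c * f \<theta>)"

lemma trig_poly_const: "trig_poly (\<lambda>\<theta>. c)"
  using trig_poly.cmult[OF trig_poly.cis[of 0], of c] by simp

lemma trig_poly_mult:
  assumes "trig_poly f" "trig_poly g"
  shows "trig_poly (\<lambda>\<theta>. f \<theta> * g \<theta>)"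
  using assms
proof (induction f rule: trig_poly.induct)
  case (cis k)
  then show ?case
  proof (induction g rule: trig_poly.induct)
    case (cis l)
    then show ?case using trig_poly.cis[of "k + l"] by (simp add: cis_mult distrib_right)
  next
    case (add f g)
    then show ?case using trig_poly.add by (fastforce simp: distrib_left)
  next
    case (cmult f c)
    then show ?case using trig_poly.cmult[of _ c] by (fastforce simp: mult.left_commute)
  qed
next
  case (add f1 f2)
  then show ?case using trig_poly.add by (fastforce simp: distrib_right)
next
  case (cmult f c)
  then show ?case using trig_poly.cmult[of _ c] by (fastforce simp: mult.assoc)
qed

lemma trig_poly_continuous: "trig_poly f \<Longrightarrow> continuous_on UNIV f"
  by (induction rule: trig_poly.induct) (auto intro!: continuous_intros)

text \<open>A real linear functional restricted to the circle is a combination of cosine and sine,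
  hence of \<open>cis \<theta>\<close> and its conjugate. This links the polynomials of the
  Stone-Weierstrass theorem with Fourier coefficients.\<close>

lemma trig_poly_real_polynomial:
  fixes g :: "complex \<Rightarrow> real"
  assumes "real_polynomial_function g"
  shows "trig_poly (\<lambda>\<theta>. of_real (g (cis \<theta>)))"
  using assms
proof (induction g rule: real_polynomial_function.induct)
  case (linear f)
  interpret f: bounded_linear f by fact
  have "cis \<theta> = cos \<theta> *\<^sub>R 1 + sin \<theta> *\<^sub>R \<i>" for \<theta> by (simp add: complex_eq_iff)
  then have "f (cis \<theta>) = cos \<theta> * f 1 + sin \<theta> * f \<i>" for \<theta>
    by (simp only: f.add f.scaleR real_scaleR_def)
  then have "of_real (f (cis \<theta>)) = (of_real (f 1) / 2 + of_real (f \<i>) / (2 * \<i>)) * cis (of_int 1 * \<theta>)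
     + (of_real (f 1) / 2 - of_real (f \<i>) / (2 * \<i>)) * cis (of_int (-1) * \<theta>)" for \<theta>
    by (simp add: complex_eq_iff field_simps)
  moreover have "trig_poly (\<lambda>\<theta>. (of_real (f 1) / 2 + of_real (f \<i>) / (2 * \<i>)) * cis (of_int 1 * \<theta>)
     + (of_real (f 1) / 2 - of_real (f \<i>) / (2 * \<i>)) * cis (of_int (-1) * \<theta>))"
    by (intro trig_poly.intros)
  ultimately show ?case by simp
next
  case (const c) show ?case by (rule trig_poly_const)
next
  case (add f g) then show ?case using trig_poly.add by simp
next
  case (mult f g) then show ?case using trig_poly_mult by simp
qed

text \<open>The squared modulus of the trigonometric polynomial whose coefficients form the
  \<open>i\<close>-th eigenvector; since the eigenvector has length 1, its mean over the circle is
  1.\<close>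

definition eig_weight :: "nat \<Rightarrow> complex mat \<Rightarrow> nat \<Rightarrow> real \<Rightarrow> real" where
  "eig_weight n W i \<theta> = (cmod (\<Sum>a<n. W $$ (a, i) * cis (- real a * \<theta>)))\<^sup>2"

lemma eig_weight_nonneg: "0 \<le> eig_weight n W i \<theta>"
  by (simp add: eig_weight_def)

lemma eig_weight_continuous: "continuous_on UNIV (eig_weight n W i)"
  unfolding eig_weight_def by (intro continuous_intros)

lemma eig_weight_expand:
  "of_real (eig_weight n W i \<theta>) = (\<Sum>a<n. \<Sum>b<n. W $$ (a, i) * cnj (W $$ (b, i)) * cis (of_int (int b - int a) * \<theta>))"
proof -
  have c: "cis (- real a * \<theta>) * cnj (cis (- real b * \<theta>)) = cis (of_int (int b - int a) * \<theta>)" for a b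
    unfolding cis_cnj cis_mult by (simp add: algebra_simps)
  have "of_real (eig_weight n W i \<theta>) = (\<Sum>a<n. W $$ (a, i) * cis (- real a * \<theta>)) * cnj (\<Sum>b<n. W $$ (b, i) * cis (- real b * \<theta>))"
    unfolding eig_weight_def by (rule complex_norm_square)
  also have "\<dots> = (\<Sum>a<n. \<Sum>b<n. W $$ (a, i) * cnj (W $$ (b, i)) * (cis (- real a * \<theta>) * cnj (cis (- real b * \<theta>))))"
    unfolding cnj_sum sum_product by (simp only: complex_cnj_mult mult_ac)
  finally show ?thesis unfolding c .
qed

text \<open>A positive real lower bound takes the place of the extended real essential infimum;
  \<open>toeplitz_symbol_of_essinf\<close> provides it.\<close>

locale toeplitz_symbol =
  fixes f :: "real \<Rightarrow> real" and \<sigma> :: "int \<Rightarrow> complex" and m :: real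
  assumes fourier: "has_fourier_coeffs f \<sigma>"
    and m_pos: "0 < m"
    and f_ge: "AE \<theta> in circ. m \<le> f \<theta>"
begin

lemma f_integrable: "integrable circ f"
  using fourier by (simp add: has_fourier_coeffs_def)

lemma f_measurable: "f \<in> borel_measurable circ"
  using f_integrable by (rule borel_measurable_integrable)

lemma f_mult_integrable:
  fixes g :: "real \<Rightarrow> real"
  assumes "g \<in> borel_measurable circ" "\<And>\<theta>. \<theta> \<in> {0..2 * pi} \<Longrightarrow> \<bar>g \<theta>\<bar> \<le> B"
  shows "integrable circ (\<lambda>\<theta>. f \<theta> * g \<theta>)"
proof (rule Bochner_Integration.integrable_bound)
  show "integrable circ (\<lambda>\<theta>. f \<theta> * B)" using f_integrable by simp
  show "(\<lambda>\<theta>. f \<theta> * g \<theta>) \<in> borel_measurable circ" using f_measurable assms by simp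
  show "AE \<theta> in circ. norm (f \<theta> * g \<theta>) \<le> norm (f \<theta> * B)"
    using assms(2) by (intro AE_I2) (auto simp: abs_mult intro!: mult_left_mono intro: order_trans[OF _ abs_ge_self])
qed

lemma f_mult_continuous_integrable:
  fixes g :: "real \<Rightarrow> real"
  assumes g: "continuous_on UNIV g"
  shows "integrable circ (\<lambda>\<theta>. f \<theta> * g \<theta>)"
proof -
  have "compact (g ` {0..2 * pi})"
    using g by (intro compact_continuous_image continuous_on_subset[OF g]) auto
  then obtain B where "\<forall>x\<in>g ` {0..2 * pi}. norm x \<le> B" using compact_imp_bounded bounded_iff by blast
  then show ?thesis by (intro f_mult_integrable[where B=B] measurable_circ_continuous g) auto
qed

lemma cf_mult_continuous_integrable:
  fixes g :: "real \<Rightarrow> complex"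
  assumes g: "continuous_on UNIV g"
  shows "integrable circ (\<lambda>\<theta>. of_real (f \<theta>) * g \<theta>)"
proof (rule Bochner_Integration.integrable_bound)
  show "integrable circ (\<lambda>\<theta>. f \<theta> * norm (g \<theta>))"
    by (intro f_mult_continuous_integrable continuous_intros g)
  show "(\<lambda>\<theta>. of_real (f \<theta>) * g \<theta>) \<in> borel_measurable circ"
    using f_measurable measurable_circ_continuous[OF g] by simp
qed (auto simp: norm_mult)

lemma fourier_integral: "(CLINT \<theta>|circ. of_real (f \<theta>) * cis (of_int k * \<theta>)) = 2 * pi * \<sigma> k"
  using fourier by (simp add: has_fourier_coeffs_def cis_conv_exp mult_ac)

context
  fixes n :: nat and W :: "complex mat" and d :: "nat \<Rightarrow> real"
  assumes eig: "eigen_decomposition n (toeplitz \<sigma> n) W d"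
begin

lemma toeplitz_entry:
  "a < n \<Longrightarrow> b < n \<Longrightarrow> \<sigma> (int a - int b) = (\<Sum>i<n. W $$ (a, i) * of_real (d i) * cnj (W $$ (b, i)))"
  using eigen_decompositionD(4)[OF eig, of a b] by (simp add: toeplitz_def)

text \<open>Expanding the weight turns the integral into \<open>2 * pi\<close> times the Rayleigh
  quotient of the \<open>i\<close>-th eigenvector, because the Fourier coefficients of
  \<open>f\<close> are the matrix entries.\<close>

lemma eigenvalue_integral:
  assumes i: "i < n"
  shows "(LINT \<theta>|circ. f \<theta> * eig_weight n W i \<theta>) = 2 * pi * d i"
proof -
  have "of_real (LINT \<theta>|circ. f \<theta> * eig_weight n W i \<theta>) = (CLINT \<theta>|circ. of_real (f \<theta> * eig_weight n W i \<theta>))"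
    by (rule integral_complex_of_real[symmetric])
  also have "\<dots> = (CLINT \<theta>|circ. \<Sum>a<n. \<Sum>b<n. W $$ (a, i) * cnj (W $$ (b, i)) * (of_real (f \<theta>) * cis (of_int (int b - int a) * \<theta>)))"
    unfolding of_real_mult eig_weight_expand by (simp only: sum_distrib_left mult_ac)
  also have "\<dots> = (\<Sum>a<n. \<Sum>b<n. W $$ (a, i) * cnj (W $$ (b, i)) * (2 * pi * \<sigma> (int b - int a)))"
    by (subst Bochner_Integration.integral_sum Bochner_Integration.integral_mult_right_zero fourier_integral[symmetric] |
        intro sum.cong refl Bochner_Integration.integrable_sum integrable_mult_right cf_mult_continuous_integrable continuous_intros)+
  also have "\<dots> = 2 * pi * (\<Sum>a<n. \<Sum>b<n. \<Sum>j<n. (cnj (W $$ (b, i)) * W $$ (b, j)) * of_real (d j) * (cnj (W $$ (a, j)) * W $$ (a, i)))"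
    by (simp add: toeplitz_entry sum_distrib_left mult_ac)
  also have "(\<Sum>a<n. \<Sum>b<n. \<Sum>j<n. (cnj (W $$ (b, i)) * W $$ (b, j)) * of_real (d j) * (cnj (W $$ (a, j)) * W $$ (a, i)))
     = (\<Sum>j<n. (\<Sum>b<n. cnj (W $$ (b, i)) * W $$ (b, j)) * of_real (d j) * (\<Sum>a<n. cnj (W $$ (a, j)) * W $$ (a, i)))"
    unfolding sum_distrib_left sum_distrib_right
    by (subst sum.swap[of _ "{..<n}" "{..<n}"], subst (2) sum.swap, subst sum.swap) (rule sum.cong[OF refl], rule sum.swap)
  also have "\<dots> = of_real (d i)"
    using i by (simp add: eigen_decompositionD(2)[OF eig] of_bool_def if_distrib[of "\<lambda>x. x * _"] cong: if_cong)
  finally show ?thesis by (metis of_real_eq_iff of_real_mult of_real_numeral)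
qed

text \<open>Integration keeps the terms with \<open>a = b\<close>, and the eigenvector has length
  1.\<close>

lemma eig_weight_integral:
  assumes i: "i < n"
  shows "(LINT \<theta>|circ. eig_weight n W i \<theta>) = 2 * pi"
proof -
  have "of_real (LINT \<theta>|circ. eig_weight n W i \<theta>) = (CLINT \<theta>|circ. of_real (eig_weight n W i \<theta>))"
    by (rule integral_complex_of_real[symmetric])
  also have "\<dots> = (\<Sum>a<n. \<Sum>b<n. W $$ (a, i) * cnj (W $$ (b, i)) * (if int b - int a = 0 then 2 * pi else 0))"
    unfolding eig_weight_expand
    by (subst Bochner_Integration.integral_sum Bochner_Integration.integral_mult_right_zero integral_circ_cis[symmetric] |
        intro sum.cong refl Bochner_Integration.integrable_sum integrable_mult_right integrable_circ_continuous continuous_intros)+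
  also have "\<dots> = 2 * pi * (\<Sum>a<n. cnj (W $$ (a, i)) * W $$ (a, i))"
    by (simp add: sum_distrib_left if_distrib[of complex_of_real] if_distrib[of "\<lambda>x. _ * x"] mult_ac cong: if_cong)
  also have "\<dots> = 2 * pi" using eigen_decompositionD(2)[OF eig i i] by simp
  finally show ?thesis by (metis of_real_eq_iff of_real_mult of_real_numeral)
qed

text \<open>Orthonormal rows of \<open>W\<close> leave only the terms with \<open>a = b\<close>, so
  at every angle the weights add up to the same constant. Sums over eigenvalues of weighted averages
  thereby become plain integrals.\<close>

lemma eig_weight_sum: "(\<Sum>i<n. eig_weight n W i \<theta>) = real n"
proof -
  have "of_real (\<Sum>i<n. eig_weight n W i \<theta>) = (\<Sum>i<n. \<Sum>a<n. \<Sum>b<n. W $$ (a, i) * cnj (W $$ (b, i)) * cis (of_int (int b - int a) * \<theta>))"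
    unfolding of_real_sum eig_weight_expand ..
  also have "\<dots> = (\<Sum>a<n. \<Sum>b<n. (\<Sum>i<n. W $$ (a, i) * cnj (W $$ (b, i))) * cis (of_int (int b - int a) * \<theta>))"
    unfolding sum_distrib_right by (subst sum.swap, subst (2) sum.swap) (rule refl)
  also have "\<dots> = (\<Sum>a<n. 1)"
    by (intro sum.cong refl) (simp add: eigen_decompositionD(3)[OF eig] of_bool_def if_distrib[of "\<lambda>x. x * _"] cong: if_cong)
  also have "\<dots> = of_real (real n)" by simp
  finally show ?thesis by (simp only: of_real_eq_iff)
qed

lemma eigenvalue_ge: "i < n \<Longrightarrow> m \<le> d i"
proof -
  assume i: "i < n"
  have "(LINT \<theta>|circ. m * eig_weight n W i \<theta>) \<le> (LINT \<theta>|circ. f \<theta> * eig_weight n W i \<theta>)"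
  proof (rule integral_mono_AE)
    show "AE \<theta> in circ. m * eig_weight n W i \<theta> \<le> f \<theta> * eig_weight n W i \<theta>"
      using f_ge by eventually_elim (auto intro!: mult_right_mono eig_weight_nonneg)
  qed (auto intro!: integrable_mult_right integrable_circ_continuous f_mult_continuous_integrable eig_weight_continuous)
  then show ?thesis using i by (simp add: eigenvalue_integral eig_weight_integral)
qed

text \<open>Summing over \<open>i\<close> reassembles the matrix entries, and no eigenvector is
  left: the sum is \<open>n\<close> times a Fejer mean of \<open>f\<close>, and its
  \<open>k\<close>-th Fourier coefficient is that of \<open>f\<close> times the length of the
  \<open>k\<close>-th diagonal.\<close>

lemma weighted_trig_integral:
  "(CLINT \<theta>|circ. of_real (\<Sum>i<n. d i * eig_weight n W i \<theta>) * cis (of_int k * \<theta>)) =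
     2 * pi * \<sigma> k * of_nat (card {(a, b). a < n \<and> b < n \<and> int a - int b = k})"
proof -
  have "of_real (\<Sum>i<n. d i * eig_weight n W i \<theta>) * cis (of_int k * \<theta>)
     = (\<Sum>a<n. \<Sum>b<n. \<sigma> (int a - int b) * cis (of_int (int b - int a + k) * \<theta>))" for \<theta>
  proof -
    have "of_real (\<Sum>i<n. d i * eig_weight n W i \<theta>) = (\<Sum>i<n. \<Sum>a<n. \<Sum>b<n. W $$ (a, i) * of_real (d i) * cnj (W $$ (b, i)) * cis (of_int (int b - int a) * \<theta>))"
      unfolding of_real_sum of_real_mult eig_weight_expand by (simp only: sum_distrib_left mult_ac)
    also have "\<dots> = (\<Sum>a<n. \<Sum>b<n. (\<Sum>i<n. W $$ (a, i) * of_real (d i) * cnj (W $$ (b, i))) * cis (of_int (int b - int a) * \<theta>))"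
      unfolding sum_distrib_right by (subst sum.swap, subst (2) sum.swap) (rule refl)
    also have "\<dots> = (\<Sum>a<n. \<Sum>b<n. \<sigma> (int a - int b) * cis (of_int (int b - int a) * \<theta>))"
      by (simp add: toeplitz_entry)
    finally have "of_real (\<Sum>i<n. d i * eig_weight n W i \<theta>) * cis (of_int k * \<theta>)
      = (\<Sum>a<n. \<Sum>b<n. \<sigma> (int a - int b) * (cis (of_int (int b - int a) * \<theta>) * cis (of_int k * \<theta>)))"
      by (simp only: sum_distrib_right mult.assoc)
    then show ?thesis by (simp only: cis_mult distrib_right of_int_add)
  qed
  then have "(CLINT \<theta>|circ. of_real (\<Sum>i<n. d i * eig_weight n W i \<theta>) * cis (of_int k * \<theta>)) =
     (CLINT \<theta>|circ. \<Sum>a<n. \<Sum>b<n. \<sigma> (int a - int b) * cis (of_int (int b - int a + k) * \<theta>))"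
    by (simp only:)
  also have "\<dots> = (\<Sum>a<n. \<Sum>b<n. \<sigma> (int a - int b) * (if int b - int a + k = 0 then 2 * pi else 0))"
    by (subst Bochner_Integration.integral_sum Bochner_Integration.integral_mult_right_zero integral_circ_cis[symmetric] |
        intro sum.cong refl Bochner_Integration.integrable_sum integrable_mult_right integrable_circ_continuous continuous_intros)+
  also have "\<dots> = (\<Sum>p\<in>{..<n} \<times> {..<n}. if int (fst p) - int (snd p) = k then \<sigma> k * (2 * pi) else 0)"
    unfolding sum.cartesian_product by (intro sum.cong refl) (auto simp: case_prod_beta)
  also have "\<dots> = (\<Sum>p\<in>{p\<in>{..<n} \<times> {..<n}. int (fst p) - int (snd p) = k}. \<sigma> k * (2 * pi))"
    by (rule sum.inter_filter[symmetric]) auto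
  also have "{p\<in>{..<n} \<times> {..<n}. int (fst p) - int (snd p) = k} = {(a, b). a < n \<and> b < n \<and> int a - int b = k}"
    by auto
  finally show ?thesis by simp
qed

end

end

text \<open>Approximation takes place on the unit circle, where polynomials are available.
  \<open>Arg2pi\<close> jumps at 1, so continuity is proved through closed preimages: each is the
  image under \<open>cis\<close> of a compact subset of the interval.\<close>

lemma circle_factor:
  fixes c :: "real \<Rightarrow> real"
  assumes c: "continuous_on {0..2 * pi} c" and per: "c 0 = c (2 * pi)"
  obtains P where "continuous_on (sphere 0 1) P" "\<And>\<theta>. \<theta> \<in> {0..2 * pi} \<Longrightarrow> P (cis \<theta>) = c \<theta>"
proof
  let ?P = "\<lambda>z. c (Arg2pi z)"
  show P: "?P (cis \<theta>) = c \<theta>" if "\<theta> \<in> {0..2 * pi}" for \<theta>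
  proof (cases "\<theta> = 2 * pi")
    \<comment> \<open>The one angle of the interval that \<open>Arg2pi\<close> never returns;
      periodicity covers it.\<close>
    case True
    have "cis (2 * pi) = 1" by (simp add: complex_eq_iff)
    moreover have "Arg2pi 1 = 0" by (rule Arg2pi_unique[of 1]) auto
    ultimately show ?thesis using True per by simp
  next
    case False
    then have "Arg2pi (cis \<theta>) = \<theta>"
      using that by (intro Arg2pi_unique[of 1]) (auto simp: cis_conv_exp)
    then show ?thesis by simp
  qed
  have "closed (?P -` B \<inter> sphere 0 1)" if "closed B" for B
  proof -
    have "?P -` B \<inter> sphere 0 1 = cis ` ({0..2 * pi} \<inter> c -` B)"
    proof (rule Set.equalityI; rule subsetI)
      fix z assume z: "z \<in> ?P -` B \<inter> sphere 0 1"
      then have "z = cis (Arg2pi z)" using Arg2pi_eq[of z] by (simp add: cis_conv_exp)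
      moreover have "Arg2pi z \<in> {0..2 * pi} \<inter> c -` B"
        using z Arg2pi_ge_0[of z] Arg2pi_lt_2pi[of z] by auto
      ultimately show "z \<in> cis ` ({0..2 * pi} \<inter> c -` B)" by blast
    next
      fix z assume "z \<in> cis ` ({0..2 * pi} \<inter> c -` B)"
      then obtain \<theta> where "z = cis \<theta>" "\<theta> \<in> {0..2 * pi}" "c \<theta> \<in> B" by auto
      then show "z \<in> ?P -` B \<inter> sphere 0 1" using P[of \<theta>] by simp
    qed
    moreover have "compact ({0..2 * pi} \<inter> c -` B)"
      using continuous_closed_preimage[OF c closed_atLeastAtMost that]
      by (metis bounded_Int bounded_closed_interval compact_eq_bounded_closed)
    then have "compact (cis ` ({0..2 * pi} \<inter> c -` B))"
      by (intro compact_continuous_image continuous_intros)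
    ultimately show ?thesis by (simp add: compact_imp_closed)
  qed
  then show "continuous_on (sphere 0 1) ?P"
    by (subst continuous_on_closed_vimage) auto
qed

lemma AE_circI:
  assumes "negligible N" "\<And>\<theta>. \<theta> \<notin> N \<Longrightarrow> 0 < \<theta> \<Longrightarrow> \<theta> < 2 * pi \<Longrightarrow> P \<theta>"
  shows "AE \<theta> in circ. P \<theta>"
proof -
  have "negligible (N \<union> {0, 2 * pi})" using assms(1) by (simp add: negligible_Un)
  then have "N \<union> {0, 2 * pi} \<in> null_sets lebesgue" by (simp add: negligible_iff_null_sets)
  then have "AE \<theta> in lebesgue. \<theta> \<notin> N \<union> {0, 2 * pi}" by (rule AE_not_in)
  then have "AE \<theta> in lebesgue. \<theta> \<in> {0..2 * pi} \<longrightarrow> P \<theta>"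
    by eventually_elim (use assms(2) in \<open>auto simp: less_le\<close>)
  then show ?thesis by (subst AE_restrict_space_iff) auto
qed

text \<open>With \<open>a = 1 / sqrt x\<close> the difference of the two sides is a positive
  multiple of \<open>2 a^3 - 3 a^2 p + p^3\<close>, which factors as
  \<open>(a - p)^2 (2 a + p)\<close>. For fixed \<open>p\<close> the lower bound is affine in
  \<open>x\<close> and can be averaged.\<close>

lemma inverse_sqrt_ge:
  fixes x p :: real
  assumes x: "0 < x" and p: "0 \<le> p"
  shows "3 / 2 * p - 1 / 2 * x * p ^ 3 \<le> 1 / sqrt x"
proof -
  define a where "a = 1 / sqrt x"
  have a: "a > 0" "x * a\<^sup>2 = 1" using x by (auto simp: a_def power_divide)
  have "(a - p)\<^sup>2 * (2 * a + p) \<ge> 0" using a p by simp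
  then have "3 * p * a\<^sup>2 \<le> 2 * a * a\<^sup>2 + p ^ 3"
    by (simp add: power2_eq_square power3_eq_cube algebra_simps)
  then have "x * (3 * p * a\<^sup>2) \<le> x * (2 * a * a\<^sup>2 + p ^ 3)" using x by (intro mult_left_mono) auto
  then have "3 * p * (x * a\<^sup>2) \<le> 2 * a * (x * a\<^sup>2) + x * p ^ 3" by (simp add: algebra_simps)
  then show ?thesis unfolding a(2) a_def[symmetric] by simp
qed

lemma card_diagonal_limit:
  "((\<lambda>n. real (card {(a, b). a < n \<and> b < n \<and> int a - int b = k}) / real n) \<longlongrightarrow> 1) sequentially"
proof -
  \<comment> \<open>The absolute value of \<open>k\<close>, since one of the two truncated terms
    vanishes.\<close>
  define K where "K = real (nat k + nat (- k))"
  have "card {(a, b). a < n \<and> b < n \<and> int a - int b = k} = n - nat k - nat (- k)" for n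
  proof -
    have "{(a, b). a < n \<and> b < n \<and> int a - int b = k} = (\<lambda>b. (nat (int b + k), b)) ` {nat (- k)..<n - nat k}"
      by (auto simp: image_iff)
    then show ?thesis by (simp add: card_image inj_on_def)
  qed
  note card = this
  have "\<forall>\<^sub>F n in sequentially. 1 - K / real n = real (card {(a, b). a < n \<and> b < n \<and> int a - int b = k}) / real n"
    using eventually_gt_at_top[of "nat k + nat (- k)"]
  proof eventually_elim
    case (elim n)
    then have "real (n - nat k - nat (- k)) = real n - K" by (simp add: K_def)
    then show ?case using elim unfolding card by (simp add: diff_divide_distrib)
  qed
  moreover have "((\<lambda>n. 1 - K / real n) \<longlongrightarrow> 1) sequentially"
    by real_asymp
  ultimately show ?thesis by (rule Lim_transform_eventually[rotated])
qed

section \<open>Bounds for the trace of the inverse square root\<close>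

context toeplitz_symbol
begin

lemma inverse_sqrt_AE: "AE \<theta> in circ. 0 < f \<theta> \<and> 1 / sqrt (f \<theta>) \<le> 1 / sqrt m"
  using f_ge by eventually_elim (use m_pos in \<open>auto intro!: divide_left_mono\<close>)

lemma inverse_sqrt_mult_integrable:
  fixes g :: "real \<Rightarrow> real"
  assumes g: "continuous_on UNIV g"
  shows "integrable circ (\<lambda>\<theta>. 1 / sqrt (f \<theta>) * g \<theta>)"
proof (rule Bochner_Integration.integrable_bound)
  show "integrable circ (\<lambda>\<theta>. 1 / sqrt m * g \<theta>)"
    by (intro integrable_mult_right integrable_circ_continuous g)
  show "(\<lambda>\<theta>. 1 / sqrt (f \<theta>) * g \<theta>) \<in> borel_measurable circ"
    using f_measurable measurable_circ_continuous[OF g] by simp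
  show "AE \<theta> in circ. norm (1 / sqrt (f \<theta>) * g \<theta>) \<le> norm (1 / sqrt m * g \<theta>)"
    using inverse_sqrt_AE
  proof eventually_elim
    case (elim \<theta>)
    then have "norm (1 / sqrt (f \<theta>)) \<le> norm (1 / sqrt m)" using m_pos by simp
    then show ?case unfolding norm_mult by (rule mult_right_mono) simp
  qed
qed

definition inv_sqrt_mean :: real where
  "inv_sqrt_mean = 1 / (2 * pi) * (LINT \<theta>|circ. 1 / sqrt (f \<theta>))"

text \<open>Jensen's inequality: each eigenvalue is an average of the symbol with weight \<open>eig_weight\<close>.\<close>
lemma trace_le:
  assumes eig: "eigen_decomposition n (toeplitz \<sigma> n) W d"
  shows "(\<Sum>i<n. 1 / sqrt (d i)) \<le> real n * inv_sqrt_mean"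
proof -
  have "2 * pi * (1 / sqrt (d i)) \<le> (LINT \<theta>|circ. 1 / sqrt (f \<theta>) * eig_weight n W i \<theta>)" if i: "i < n" for i
  proof -
    \<comment> \<open>The value of \<open>p\<close> at which \<open>inverse_sqrt_ge\<close> is sharp
      for \<open>x = d i\<close>: averaging the bound against the weight returns exactly
      \<open>q\<close>.\<close>
    define q where "q = 1 / sqrt (d i)"
    have di: "d i > 0" using eigenvalue_ge[OF eig i] m_pos by simp
    then have q: "q \<ge> 0" "d i * q\<^sup>2 = 1" by (auto simp: q_def power_divide)
    have "2 * pi * q = 2 * pi * (3 / 2 * q - 1 / 2 * (d i * q\<^sup>2) * q)" unfolding q(2) by simp
    also have "\<dots> = 3 / 2 * q * (2 * pi) - 1 / 2 * q ^ 3 * (2 * pi * d i)"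
      by (simp add: power3_eq_cube power2_eq_square algebra_simps)
    also have "\<dots> = (LINT \<theta>|circ. 3 / 2 * q * eig_weight n W i \<theta> - 1 / 2 * q ^ 3 * (f \<theta> * eig_weight n W i \<theta>))"
    proof -
      have 1: "integrable circ (\<lambda>\<theta>. 3 / 2 * q * eig_weight n W i \<theta>)"
        by (intro integrable_mult_right integrable_circ_continuous eig_weight_continuous)
      have 2: "integrable circ (\<lambda>\<theta>. 1 / 2 * q ^ 3 * (f \<theta> * eig_weight n W i \<theta>))"
        by (intro integrable_mult_right f_mult_continuous_integrable eig_weight_continuous)
      show ?thesis
        by (simp only: Bochner_Integration.integral_diff[OF 1 2] integral_mult_right_zero
          eigenvalue_integral[OF eig i] eig_weight_integral[OF eig i])
    qed
    also have "\<dots> \<le> (LINT \<theta>|circ. 1 / sqrt (f \<theta>) * eig_weight n W i \<theta>)"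
    proof (rule integral_mono_AE)
      show "AE \<theta> in circ. 3 / 2 * q * eig_weight n W i \<theta> - 1 / 2 * q ^ 3 * (f \<theta> * eig_weight n W i \<theta>) \<le> 1 / sqrt (f \<theta>) * eig_weight n W i \<theta>"
        using inverse_sqrt_AE
      proof eventually_elim
        case (elim \<theta>)
        have "(3 / 2 * q - 1 / 2 * f \<theta> * q ^ 3) * eig_weight n W i \<theta> \<le> 1 / sqrt (f \<theta>) * eig_weight n W i \<theta>"
          using elim q by (intro mult_right_mono inverse_sqrt_ge eig_weight_nonneg) auto
        then show ?case by (simp add: algebra_simps)
      qed
    qed (intro Bochner_Integration.integrable_diff integrable_mult_right integrable_circ_continuous f_mult_continuous_integrable
        eig_weight_continuous inverse_sqrt_mult_integrable)+
    finally show ?thesis unfolding q_def .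
  qed
  then have "(\<Sum>i<n. 2 * pi * (1 / sqrt (d i))) \<le> (\<Sum>i<n. (LINT \<theta>|circ. 1 / sqrt (f \<theta>) * eig_weight n W i \<theta>))"
    by (intro sum_mono) auto
  also have "\<dots> = (LINT \<theta>|circ. (\<Sum>i<n. 1 / sqrt (f \<theta>) * eig_weight n W i \<theta>))"
    by (intro Bochner_Integration.integral_sum[symmetric] inverse_sqrt_mult_integrable eig_weight_continuous)
  also have "\<dots> = (LINT \<theta>|circ. 1 / sqrt (f \<theta>) * real n)"
    by (simp only: sum_distrib_left[symmetric] eig_weight_sum[OF eig])
  also have "\<dots> = 2 * pi * (real n * inv_sqrt_mean)" by (simp only: integral_mult_left_zero inv_sqrt_mean_def) simp
  finally have "2 * pi * (\<Sum>i<n. 1 / sqrt (d i)) \<le> 2 * pi * (real n * inv_sqrt_mean)"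
    by (simp only: sum_distrib_left)
  then show ?thesis by (subst (asm) mult_le_cancel_left_pos) auto
qed

text \<open>The tangent bound \<open>x\<^bsup>-1/2\<^esup> \<ge> 3/2 p - 1/2 x p\<^sup>3\<close>, an equality for \<open>p = x\<^bsup>-1/2\<^esup>\<close>, is linear in the
  eigenvalue \<open>x\<close>.\<close>
lemma trace_ge:
  assumes eig: "eigen_decomposition n (toeplitz \<sigma> n) W d"
    and p: "continuous_on UNIV p" "\<And>\<theta>. 0 \<le> p \<theta>"
  shows "real n * (LINT \<theta>|circ. 3 / 2 * p \<theta>) - 1 / 2 * (LINT \<theta>|circ. (\<Sum>i<n. d i * eig_weight n W i \<theta>) * p \<theta> ^ 3)
    \<le> 2 * pi * (\<Sum>i<n. 1 / sqrt (d i))"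
proof -
  have int: "integrable circ (\<lambda>\<theta>. 3 / 2 * p \<theta> * eig_weight n W i \<theta>)" "integrable circ (\<lambda>\<theta>. 1 / 2 * (d i * eig_weight n W i \<theta> * p \<theta> ^ 3))" for i
    by (intro integrable_circ_continuous continuous_intros p eig_weight_continuous)+
  have "(LINT \<theta>|circ. 3 / 2 * p \<theta> * eig_weight n W i \<theta> - 1 / 2 * (d i * eig_weight n W i \<theta> * p \<theta> ^ 3)) \<le> 2 * pi * (1 / sqrt (d i))"
    if i: "i < n" for i
  proof -
    have di: "d i > 0" using eigenvalue_ge[OF eig i] m_pos by simp
    have "(LINT \<theta>|circ. 3 / 2 * p \<theta> * eig_weight n W i \<theta> - 1 / 2 * (d i * eig_weight n W i \<theta> * p \<theta> ^ 3)) \<le> (LINT \<theta>|circ. 1 / sqrt (d i) * eig_weight n W i \<theta>)"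
    proof (rule integral_mono)
      fix \<theta>
      have "(3 / 2 * p \<theta> - 1 / 2 * d i * p \<theta> ^ 3) * eig_weight n W i \<theta> \<le> 1 / sqrt (d i) * eig_weight n W i \<theta>"
        using di p by (intro mult_right_mono inverse_sqrt_ge eig_weight_nonneg) auto
      then show "3 / 2 * p \<theta> * eig_weight n W i \<theta> - 1 / 2 * (d i * eig_weight n W i \<theta> * p \<theta> ^ 3) \<le> 1 / sqrt (d i) * eig_weight n W i \<theta>"
        by (simp add: algebra_simps)
    qed (intro Bochner_Integration.integrable_diff int integrable_mult_right integrable_circ_continuous eig_weight_continuous)+
    then show ?thesis by (simp add: eig_weight_integral[OF eig i])
  qed
  then have "(\<Sum>i<n. (LINT \<theta>|circ. 3 / 2 * p \<theta> * eig_weight n W i \<theta> - 1 / 2 * (d i * eig_weight n W i \<theta> * p \<theta> ^ 3))) \<le> (\<Sum>i<n. 2 * pi * (1 / sqrt (d i)))"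
    by (intro sum_mono) auto
  also have "(\<Sum>i<n. (LINT \<theta>|circ. 3 / 2 * p \<theta> * eig_weight n W i \<theta> - 1 / 2 * (d i * eig_weight n W i \<theta> * p \<theta> ^ 3))) =
     (LINT \<theta>|circ. (\<Sum>i<n. 3 / 2 * p \<theta> * eig_weight n W i \<theta> - 1 / 2 * (d i * eig_weight n W i \<theta> * p \<theta> ^ 3)))"
    by (intro Bochner_Integration.integral_sum[symmetric] Bochner_Integration.integrable_diff int)
  also have "\<dots> = (LINT \<theta>|circ. real n * (3 / 2 * p \<theta>) - 1 / 2 * ((\<Sum>i<n. d i * eig_weight n W i \<theta>) * p \<theta> ^ 3))"
    by (simp only: sum_subtractf sum_distrib_left[symmetric] sum_distrib_right[symmetric] eig_weight_sum[OF eig] mult.commute[of _ "real n"])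
  also have "\<dots> = real n * (LINT \<theta>|circ. 3 / 2 * p \<theta>) - 1 / 2 * (LINT \<theta>|circ. (\<Sum>i<n. d i * eig_weight n W i \<theta>) * p \<theta> ^ 3)"
    by (subst Bochner_Integration.integral_diff)
      (auto intro!: integrable_circ_continuous continuous_intros p eig_weight_continuous simp del: integral_mult_right_zero simp: integral_mult_right_zero[symmetric])
  finally show ?thesis by (simp only: sum_distrib_left)
qed

section \<open>Weak convergence of the spectral averages\<close>

context
  fixes F :: "nat filter" and W :: "nat \<Rightarrow> complex mat" and d :: "nat \<Rightarrow> nat \<Rightarrow> real"
  assumes F: "F \<le> sequentially"
    and eig: "\<forall>\<^sub>F n in F. eigen_decomposition n (toeplitz \<sigma> n) (W n) (d n)"
begin

abbreviation spectral_average :: "nat \<Rightarrow> real \<Rightarrow> real" where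
  "spectral_average n \<theta> \<equiv> (\<Sum>i<n. d n i * eig_weight n (W n) i \<theta>)"

lemma spectral_average_continuous: "continuous_on UNIV (spectral_average n)"
  by (intro continuous_intros eig_weight_continuous)

text \<open>By linearity only exponentials have to be checked. There the two sides differ by the
  ratio of the length of a diagonal to \<open>n\<close>, which tends to 1.\<close>

lemma trig_limit:
  assumes "trig_poly g"
  shows "((\<lambda>n. (CLINT \<theta>|circ. of_real (spectral_average n \<theta>) * g \<theta>) / of_nat n) \<longlongrightarrow> (CLINT \<theta>|circ. of_real (f \<theta>) * g \<theta>)) F"
  using assms
proof (induction g rule: trig_poly.induct)
  case (cis k)
  have "((\<lambda>n. 2 * pi * \<sigma> k * of_real (real (card {(a, b). a < n \<and> b < n \<and> int a - int b = k}) / real n)) \<longlongrightarrow> 2 * pi * \<sigma> k * of_real 1) sequentially"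
    by (intro tendsto_intros card_diagonal_limit)
  then have "((\<lambda>n. 2 * pi * \<sigma> k * of_real (real (card {(a, b). a < n \<and> b < n \<and> int a - int b = k}) / real n)) \<longlongrightarrow> 2 * pi * \<sigma> k * of_real 1) F"
    by (rule tendsto_mono[OF F])
  moreover have "\<forall>\<^sub>F n in F. 2 * pi * \<sigma> k * of_real (real (card {(a, b). a < n \<and> b < n \<and> int a - int b = k}) / real n) = (CLINT \<theta>|circ. of_real (spectral_average n \<theta>) * cis (of_int k * \<theta>)) / of_nat n"
    using eig by eventually_elim (subst weighted_trig_integral, auto)
  ultimately have "((\<lambda>n. (CLINT \<theta>|circ. of_real (spectral_average n \<theta>) * cis (of_int k * \<theta>)) / of_nat n) \<longlongrightarrow> 2 * pi * \<sigma> k * of_real 1) F"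
    by (rule Lim_transform_eventually)
  then show ?case unfolding fourier_integral by simp
next
  case (add g h)
  have "(CLINT \<theta>|circ. of_real (spectral_average n \<theta>) * (g \<theta> + h \<theta>)) = (CLINT \<theta>|circ. of_real (spectral_average n \<theta>) * g \<theta>) + (CLINT \<theta>|circ. of_real (spectral_average n \<theta>) * h \<theta>)" for n
    unfolding distrib_left using add.hyps
    by (intro Bochner_Integration.integral_add integrable_circ_continuous continuous_intros spectral_average_continuous trig_poly_continuous)
  moreover have "(CLINT \<theta>|circ. of_real (f \<theta>) * (g \<theta> + h \<theta>)) = (CLINT \<theta>|circ. of_real (f \<theta>) * g \<theta>) + (CLINT \<theta>|circ. of_real (f \<theta>) * h \<theta>)"
    unfolding distrib_left using add.hyps
    by (intro Bochner_Integration.integral_add cf_mult_continuous_integrable trig_poly_continuous)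
  ultimately show ?case using tendsto_add[OF add.IH] by (simp only: add_divide_distrib)
next
  case (cmult g c)
  have "(CLINT \<theta>|circ. of_real (a \<theta>) * (c * g \<theta>)) = c * (CLINT \<theta>|circ. of_real (a \<theta>) * g \<theta>)" for a :: "real \<Rightarrow> real"
  proof -
    have "(CLINT \<theta>|circ. of_real (a \<theta>) * (c * g \<theta>)) = (CLINT \<theta>|circ. c * (of_real (a \<theta>) * g \<theta>))"
      by (intro Bochner_Integration.integral_cong refl) (rule mult.left_commute)
    also have "\<dots> = c * (CLINT \<theta>|circ. of_real (a \<theta>) * g \<theta>)" by (rule integral_mult_right_zero)
    finally show ?thesis .
  qed
  then show ?case using tendsto_mult_left[OF cmult.IH, of c] by (simp only: times_divide_eq_right)
qed

lemma polynomial_limit: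
  assumes g: "real_polynomial_function g"
  shows "((\<lambda>n. (LINT \<theta>|circ. spectral_average n \<theta> * g (cis \<theta>)) / real n) \<longlongrightarrow> (LINT \<theta>|circ. f \<theta> * g (cis \<theta>))) F"
proof -
  have "((\<lambda>n. Re ((CLINT \<theta>|circ. of_real (spectral_average n \<theta>) * of_real (g (cis \<theta>))) / of_nat n)) \<longlongrightarrow> Re (CLINT \<theta>|circ. of_real (f \<theta>) * of_real (g (cis \<theta>)))) F"
    by (intro tendsto_Re trig_limit trig_poly_real_polynomial g)
  moreover have "Re (of_real a / of_nat n) = a / real n" for a n
    by (metis Re_complex_of_real of_real_divide of_real_of_nat_eq)
  ultimately show ?thesis by (simp only: of_real_mult[symmetric] integral_complex_of_real Re_complex_of_real)
qed

lemma spectral_average_nonneg: "\<forall>\<^sub>F n in F. \<forall>\<theta>. 0 \<le> spectral_average n \<theta>"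
  using eig
proof eventually_elim
  case (elim n)
  have "0 \<le> d n i" if "i < n" for i using eigenvalue_ge[OF elim that] m_pos by simp
  then show ?case by (auto intro!: sum_nonneg mult_nonneg_nonneg eig_weight_nonneg)
qed

text \<open>Polynomials approximate \<open>P\<close> uniformly on the circle. The error is
  controlled because the normalized spectral average and \<open>f\<close> are nonnegative with
  bounded integral, so a uniform error \<delta> costs at most \<delta> times the mass.\<close>

lemma continuous_limit:
  assumes P: "continuous_on (sphere 0 1) (P :: complex \<Rightarrow> real)"
  shows "((\<lambda>n. (LINT \<theta>|circ. spectral_average n \<theta> * P (cis \<theta>)) / real n) \<longlongrightarrow> (LINT \<theta>|circ. f \<theta> * P (cis \<theta>))) F"
proof (rule tendstoI)
  fix e :: real assume e: "e > 0"
  have cP: "continuous_on UNIV (\<lambda>\<theta>. P (cis \<theta>))"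
    by (intro continuous_on_compose2[OF P] continuous_intros) auto
  have f0: "AE \<theta> in circ. 0 \<le> f \<theta>" using f_ge by eventually_elim (use m_pos in auto)
  define C where "C = (LINT \<theta>|circ. f \<theta>)"
  have C: "C \<ge> 0" unfolding C_def by (intro integral_nonneg_AE f0)
  \<comment> \<open>\<open>C + 1\<close> eventually bounds the mass of the normalized spectral
    average, so each of the two replacements of \<open>P\<close> by a polynomial costs at most
    \<open>e / 3\<close>.\<close>
  define \<delta> where "\<delta> = e / (3 * (C + 1))"
  have \<delta>: "\<delta> > 0" "\<delta> * (C + 1) = e / 3" using e C by (auto simp: \<delta>_def add_nonneg_pos less_imp_neq[symmetric] simp del: distrib_left_numeral)
  obtain g where g: "real_polynomial_function g" "\<And>z. z \<in> sphere 0 1 \<Longrightarrow> \<bar>P z - g z\<bar> < \<delta>"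
    using Stone_Weierstrass_real_polynomial_function[OF compact_sphere P \<delta>(1)] by blast
  have cg: "continuous_on UNIV (\<lambda>\<theta>. g (cis \<theta>))"
  proof -
    have "continuous_on UNIV g" using g(1) by (intro continuous_on_polymonial_function) (simp add: real_polynomial_function_eq)
    moreover have "continuous_on UNIV cis" by (intro continuous_intros)
    ultimately show ?thesis by (rule continuous_on_compose2) simp
  qed
  have Pg: "\<bar>P (cis \<theta>) - g (cis \<theta>)\<bar> \<le> \<delta>" for \<theta> using g(2)[of "cis \<theta>"] by simp
  have diff: "\<bar>(LINT \<theta>|circ. y \<theta> * P (cis \<theta>)) - (LINT \<theta>|circ. y \<theta> * g (cis \<theta>))\<bar> \<le> \<delta> * (LINT \<theta>|circ. y \<theta>)"
    if y: "AE \<theta> in circ. 0 \<le> y \<theta>" and i: "integrable circ y"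
      "integrable circ (\<lambda>\<theta>. y \<theta> * P (cis \<theta>))" "integrable circ (\<lambda>\<theta>. y \<theta> * g (cis \<theta>))" for y
  proof -
    have "\<bar>(LINT \<theta>|circ. y \<theta> * P (cis \<theta>)) - (LINT \<theta>|circ. y \<theta> * g (cis \<theta>))\<bar> = \<bar>LINT \<theta>|circ. y \<theta> * P (cis \<theta>) - y \<theta> * g (cis \<theta>)\<bar>"
      using i by simp
    also have "\<dots> \<le> (LINT \<theta>|circ. \<bar>y \<theta> * P (cis \<theta>) - y \<theta> * g (cis \<theta>)\<bar>)"
      by (rule integral_abs_bound)
    also have "\<dots> \<le> (LINT \<theta>|circ. \<delta> * y \<theta>)"
    proof (rule integral_mono_AE)
      show "AE \<theta> in circ. \<bar>y \<theta> * P (cis \<theta>) - y \<theta> * g (cis \<theta>)\<bar> \<le> \<delta> * y \<theta>"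
        using y
      proof eventually_elim
        case (elim \<theta>)
        then show ?case using mult_left_mono[OF Pg, of "y \<theta>" \<theta>] by (simp add: abs_mult right_diff_distrib[symmetric] mult.commute)
      qed
    qed (use i in auto)
    finally show ?thesis by simp
  qed
  have xm: "((\<lambda>n. (LINT \<theta>|circ. spectral_average n \<theta>) / real n) \<longlongrightarrow> C) F"
    using polynomial_limit[of "\<lambda>_. 1"] unfolding C_def by (simp add: real_polynomial_function.intros)
  have ev1: "\<forall>\<^sub>F n in F. (LINT \<theta>|circ. spectral_average n \<theta>) / real n < C + 1"
    using order_tendstoD(2)[OF xm, of "C + 1"] by simp
  have ev2: "\<forall>\<^sub>F n in F. \<bar>(LINT \<theta>|circ. spectral_average n \<theta> * g (cis \<theta>)) / real n - (LINT \<theta>|circ. f \<theta> * g (cis \<theta>))\<bar> < e / 3"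
    using tendstoD[OF polynomial_limit[OF g(1)], of "e / 3"] e by (simp add: dist_real_def)
  have "\<bar>(LINT \<theta>|circ. f \<theta> * P (cis \<theta>)) - (LINT \<theta>|circ. f \<theta> * g (cis \<theta>))\<bar> \<le> \<delta> * C"
    unfolding C_def by (intro diff f0 f_integrable f_mult_continuous_integrable cP cg)
  also have "\<dots> \<le> e / 3" using \<delta> by (simp add: distrib_left)
  finally have b3: "\<bar>(LINT \<theta>|circ. f \<theta> * P (cis \<theta>)) - (LINT \<theta>|circ. f \<theta> * g (cis \<theta>))\<bar> \<le> e / 3" .
  show "\<forall>\<^sub>F n in F. dist ((LINT \<theta>|circ. spectral_average n \<theta> * P (cis \<theta>)) / real n) (LINT \<theta>|circ. f \<theta> * P (cis \<theta>)) < e"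
    using ev1 ev2 spectral_average_nonneg
  proof eventually_elim
    case (elim n)
    have "\<bar>(LINT \<theta>|circ. spectral_average n \<theta> * P (cis \<theta>)) - (LINT \<theta>|circ. spectral_average n \<theta> * g (cis \<theta>))\<bar> \<le> \<delta> * (LINT \<theta>|circ. spectral_average n \<theta>)"
      using elim(3) by (intro diff integrable_circ_continuous continuous_intros cP cg eig_weight_continuous) auto
    then have "\<bar>(LINT \<theta>|circ. spectral_average n \<theta> * P (cis \<theta>)) / real n - (LINT \<theta>|circ. spectral_average n \<theta> * g (cis \<theta>)) / real n\<bar> \<le> \<delta> * ((LINT \<theta>|circ. spectral_average n \<theta>) / real n)"
      by (simp only: diff_divide_distrib[symmetric] abs_divide abs_of_nat times_divide_eq_right) (intro divide_right_mono, auto)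
    also have "\<dots> \<le> \<delta> * (C + 1)" using elim(1) \<delta> by (intro mult_left_mono) auto
    also have "\<dots> = e / 3" by (rule \<delta>)
    finally show ?case using elim(2) b3 unfolding dist_real_def by linarith
  qed
qed

text \<open>After division of \<open>trace_ge\<close> by \<open>n\<close>, the spectral average is
  replaced by \<open>f\<close> through \<open>continuous_limit\<close>. A tolerance of
  \<open>4 * pi * e\<close> there becomes \<open>e\<close> after the factors 1/2 and
  \<open>1 / (2 * pi)\<close>.\<close>

lemma trace_liminf:
  assumes P: "continuous_on (sphere 0 1) P" "\<And>z. z \<in> sphere 0 1 \<Longrightarrow> 0 \<le> (P z :: real)" and e: "e > 0"
  shows "\<forall>\<^sub>F n in F. 1 / (2 * pi) * (LINT \<theta>|circ. 3 / 2 * P (cis \<theta>) - 1 / 2 * (f \<theta> * P (cis \<theta>) ^ 3)) - e \<le> (\<Sum>i<n. 1 / sqrt (d n i)) / real n"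
proof -
  have cP: "continuous_on UNIV (\<lambda>\<theta>. P (cis \<theta>))"
    by (intro continuous_on_compose2[OF P(1)] continuous_intros) auto
  have P3: "continuous_on (sphere 0 1) (\<lambda>z. P z ^ 3)" by (intro continuous_intros P)
  have "\<forall>\<^sub>F n in F. \<bar>(LINT \<theta>|circ. spectral_average n \<theta> * P (cis \<theta>) ^ 3) / real n - (LINT \<theta>|circ. f \<theta> * P (cis \<theta>) ^ 3)\<bar> < 4 * pi * e"
    using tendstoD[OF continuous_limit[OF P3], of "4 * pi * e"] e by (simp add: dist_real_def)
  moreover have "\<forall>\<^sub>F n in F. 0 < n" using eventually_gt_at_top[of 0] F unfolding le_filter_def by blast
  ultimately show ?thesis using eig
  proof eventually_elim
    case (elim n)
    let ?a = "LINT \<theta>|circ. 3 / 2 * P (cis \<theta>)" and ?b = "LINT \<theta>|circ. f \<theta> * P (cis \<theta>) ^ 3"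
      and ?y = "LINT \<theta>|circ. spectral_average n \<theta> * P (cis \<theta>) ^ 3" and ?s = "\<Sum>i<n. 1 / sqrt (d n i)"
    have "real n * ?a - 1 / 2 * ?y \<le> 2 * pi * ?s"
      using P by (intro trace_ge elim cP) auto
    then have "(real n * ?a - 1 / 2 * ?y) / real n \<le> 2 * pi * ?s / real n"
      by (intro divide_right_mono) auto
    then have "?a - 1 / 2 * (?y / real n) \<le> 2 * pi * (?s / real n)"
      using elim by (simp add: diff_divide_distrib)
    then have "?a - 1 / 2 * ?b - 2 * pi * e \<le> 2 * pi * (?s / real n)" using elim(1) by (simp add: abs_if split: if_splits)
    then have "1 / (2 * pi) * (?a - 1 / 2 * ?b - 2 * pi * e) \<le> 1 / (2 * pi) * (2 * pi * (?s / real n))"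
      by (intro mult_left_mono) auto
    moreover have "(LINT \<theta>|circ. 3 / 2 * P (cis \<theta>) - 1 / 2 * (f \<theta> * P (cis \<theta>) ^ 3)) = ?a - 1 / 2 * ?b"
      by (subst Bochner_Integration.integral_diff)
        (intro integrable_mult_right integrable_circ_continuous f_mult_continuous_integrable continuous_intros cP | simp)+
    moreover have "1 / (2 * pi) * (2 * pi * e) = e" "1 / (2 * pi) * (2 * pi * (?s / real n)) = ?s / real n" by simp_all
    ultimately show ?case by (simp only: right_diff_distrib)
  qed
qed

end

text \<open>Measurability yields continuous functions on the line that converge almost everywhere.
  They are clamped to the range of the target and tapered off at the ends of the interval, so that
  they close up on the circle.\<close>

lemma inverse_sqrt_approx:
  "\<exists>P. (\<forall>j::nat. continuous_on (sphere 0 1) (P j) \<and> (\<forall>z. 0 \<le> P j z \<and> P j z \<le> 1 / sqrt m)) \<and>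
     (AE \<theta> in circ. (\<lambda>j. P j (cis \<theta>)) \<longlonglongrightarrow> 1 / sqrt (f \<theta>))"
proof -
  define K where "K = 1 / sqrt m"
  have K: "K > 0" using m_pos by (simp add: K_def)
  have "(\<lambda>\<theta>. 1 / sqrt (f \<theta>)) \<in> borel_measurable circ" using f_measurable by simp
  then have "(\<lambda>\<theta>. 1 / sqrt (f \<theta>)) measurable_on {0..2 * pi}"
    by (simp add: measurable_on_iff_borel_measurable)
  then obtain N g where N: "negligible N" and g: "\<And>j::nat. continuous_on UNIV (g j)"
    and lim: "\<And>\<theta>. \<theta> \<notin> N \<Longrightarrow> (\<lambda>j. g j \<theta>) \<longlonglongrightarrow> (if \<theta> \<in> {0..2 * pi} then 1 / sqrt (f \<theta>) else 0)"
    unfolding measurable_on_def by blast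
  \<comment> \<open>The first factor clamps to \<open>{0..K}\<close>; the second vanishes at both
    ends of the interval and equals 1 at any given interior point for large
    \<open>j\<close>.\<close>
  define c where "c j \<theta> = max 0 (min K (g j \<theta>)) * max 0 (min 1 (real j * min \<theta> (2 * pi - \<theta>)))" for j :: nat and \<theta>
  have cc: "continuous_on {0..2 * pi} (c j)" for j
    unfolding c_def by (intro continuous_intros continuous_on_subset[OF g]) auto
  have "\<exists>P. continuous_on (sphere 0 1) P \<and> (\<forall>\<theta>\<in>{0..2 * pi}. P (cis \<theta>) = c j \<theta>)" for j
  proof -
    have "c j 0 = c j (2 * pi)" by (simp add: c_def)
    from circle_factor[OF cc this] show ?thesis by metis
  qed
  then obtain P where P: "\<And>j. continuous_on (sphere 0 1) (P j)" "\<And>j \<theta>. \<theta> \<in> {0..2 * pi} \<Longrightarrow> P j (cis \<theta>) = c j \<theta>"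
    by metis
  \<comment> \<open>Nothing is known of \<open>P j\<close> off the circle, so the clamp is repeated
    to have the bounds at every \<open>z\<close>.\<close>
  define R where "R j z = max 0 (min K (P j z))" for j z
  have "AE \<theta> in circ. (\<lambda>j. P j (cis \<theta>)) \<longlonglongrightarrow> max 0 (min K (1 / sqrt (f \<theta>)))"
  proof (rule AE_circI[OF N])
    fix \<theta> assume \<theta>: "\<theta> \<notin> N" "0 < \<theta>" "\<theta> < 2 * pi"
    have "(\<lambda>j. g j \<theta>) \<longlonglongrightarrow> 1 / sqrt (f \<theta>)" using lim[OF \<theta>(1)] \<theta> by simp
    moreover have "\<forall>\<^sub>F j in sequentially. max 0 (min K (g j \<theta>)) = P j (cis \<theta>)"
    proof -
      obtain J :: nat where J: "1 / min \<theta> (2 * pi - \<theta>) < real J" using reals_Archimedean2 by blast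
      have "max 0 (min 1 (real j * min \<theta> (2 * pi - \<theta>))) = 1" if "j \<ge> J" for j
      proof -
        have pos: "min \<theta> (2 * pi - \<theta>) > 0" using \<theta> by simp
        then have "1 < real J * min \<theta> (2 * pi - \<theta>)" using J by (simp add: divide_less_eq)
        also have "\<dots> \<le> real j * min \<theta> (2 * pi - \<theta>)" using that pos by (intro mult_right_mono) auto
        finally show ?thesis by simp
      qed
      note one = this
      show ?thesis using eventually_ge_at_top[of J]
      proof eventually_elim
        case (elim j)
        show ?case using P(2)[of \<theta> j] \<theta> one[OF elim] by (simp add: c_def del: max.cobounded1)
      qed
    qed
    moreover note cg = this
    ultimately have "(\<lambda>j. max 0 (min K (g j \<theta>))) \<longlonglongrightarrow> max 0 (min K (1 / sqrt (f \<theta>)))"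
      by (intro tendsto_max tendsto_min tendsto_const)
    then show "(\<lambda>j. P j (cis \<theta>)) \<longlonglongrightarrow> max 0 (min K (1 / sqrt (f \<theta>)))"
      by (rule Lim_transform_eventually) (rule cg)
  qed
  then have "AE \<theta> in circ. (\<lambda>j. R j (cis \<theta>)) \<longlonglongrightarrow> 1 / sqrt (f \<theta>)"
    using inverse_sqrt_AE
  proof eventually_elim
    case (elim \<theta>)
    then have e: "max 0 (min K (1 / sqrt (f \<theta>))) = 1 / sqrt (f \<theta>)" by (simp add: K_def)
    have l: "(\<lambda>j. P j (cis \<theta>)) \<longlonglongrightarrow> 1 / sqrt (f \<theta>)" using elim(1) unfolding e .
    have "(\<lambda>j. max 0 (min K (P j (cis \<theta>)))) \<longlonglongrightarrow> max 0 (min K (1 / sqrt (f \<theta>)))"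
      by (intro tendsto_max tendsto_min tendsto_const l)
    then show ?case unfolding e R_def .
  qed
  moreover have "continuous_on (sphere 0 1) (R j) \<and> (\<forall>z. 0 \<le> R j z \<and> R j z \<le> 1 / sqrt m)" for j
    using K unfolding R_def K_def[symmetric] by (auto intro!: continuous_intros P)
  ultimately show ?thesis by blast
qed

text \<open>The upper bound \<open>trace_le\<close> holds for each \<open>n\<close> separately. For
  the lower bound the cubic inequality is used with a continuous \<open>p\<close> close to the
  inverse square root of \<open>f\<close>, where it is nearly sharp. Since \<open>p\<close> is at
  most \<open>1 / sqrt m\<close>, a constant plus a multiple of \<open>f\<close> dominates the
  integrands, and the loss tends to 0 along the approximation.\<close>

theorem szego_inverse_sqrt:
  fixes F :: "nat filter" and W :: "nat \<Rightarrow> complex mat" and d :: "nat \<Rightarrow> nat \<Rightarrow> real"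
  assumes F: "F \<le> sequentially"
    and eig: "\<forall>\<^sub>F n in F. eigen_decomposition n (toeplitz \<sigma> n) (W n) (d n)"
  shows "((\<lambda>n. (\<Sum>i<n. 1 / sqrt (d n i)) / real n) \<longlongrightarrow> inv_sqrt_mean) F"
proof (rule tendstoI)
  fix e :: real assume e: "e > 0"
  obtain P where P: "\<And>j::nat. continuous_on (sphere 0 1) (P j)" "\<And>j z. 0 \<le> P j z" "\<And>j z. P j z \<le> 1 / sqrt m"
    and lim: "AE \<theta> in circ. (\<lambda>j. P j (cis \<theta>)) \<longlonglongrightarrow> 1 / sqrt (f \<theta>)"
    using inverse_sqrt_approx by blast
  define L where "L j = (LINT \<theta>|circ. 3 / 2 * P j (cis \<theta>) - 1 / 2 * (f \<theta> * P j (cis \<theta>) ^ 3))" for j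
  have cP: "continuous_on UNIV (\<lambda>\<theta>. P j (cis \<theta>))" for j
    by (intro continuous_on_compose2[OF P(1)] continuous_intros) auto
  have "L \<longlonglongrightarrow> (LINT \<theta>|circ. 1 / sqrt (f \<theta>))"
    unfolding L_def
  proof (rule integral_dominated_convergence[where w = "\<lambda>\<theta>. 3 / 2 * (1 / sqrt m) + 1 / 2 * (f \<theta> * (1 / sqrt m) ^ 3)"])
    show "(\<lambda>\<theta>. 1 / sqrt (f \<theta>)) \<in> borel_measurable circ" using f_measurable by simp
    show "(\<lambda>\<theta>. 3 / 2 * P j (cis \<theta>) - 1 / 2 * (f \<theta> * P j (cis \<theta>) ^ 3)) \<in> borel_measurable circ" for j
      using f_measurable measurable_circ_continuous[OF cP[of j]] by simp
    show "integrable circ (\<lambda>\<theta>. 3 / 2 * (1 / sqrt m) + 1 / 2 * (f \<theta> * (1 / sqrt m) ^ 3))"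
      by (intro Bochner_Integration.integrable_add integrable_mult_right integrable_mult_left f_integrable
        finite_measure.integrable_const finite_measure_circ)
    show "AE \<theta> in circ. (\<lambda>j. 3 / 2 * P j (cis \<theta>) - 1 / 2 * (f \<theta> * P j (cis \<theta>) ^ 3)) \<longlonglongrightarrow> 1 / sqrt (f \<theta>)"
      using lim inverse_sqrt_AE
    proof eventually_elim
      case (elim \<theta>)
      have "f \<theta> * (1 / sqrt (f \<theta>)) ^ 3 = (f \<theta> * (1 / sqrt (f \<theta>))\<^sup>2) * (1 / sqrt (f \<theta>))"
        by (simp only: power3_eq_cube power2_eq_square mult.assoc)
      also have "f \<theta> * (1 / sqrt (f \<theta>))\<^sup>2 = 1" using elim by (simp add: power_divide)
      finally have e: "3 / 2 * (1 / sqrt (f \<theta>)) - 1 / 2 * (f \<theta> * (1 / sqrt (f \<theta>)) ^ 3) = 1 / sqrt (f \<theta>)" by simp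
      have "(\<lambda>j. 3 / 2 * P j (cis \<theta>) - 1 / 2 * (f \<theta> * P j (cis \<theta>) ^ 3)) \<longlonglongrightarrow> 3 / 2 * (1 / sqrt (f \<theta>)) - 1 / 2 * (f \<theta> * (1 / sqrt (f \<theta>)) ^ 3)"
        by (intro tendsto_intros elim)
      then show ?case unfolding e .
    qed
    show "AE \<theta> in circ. norm (3 / 2 * P j (cis \<theta>) - 1 / 2 * (f \<theta> * P j (cis \<theta>) ^ 3)) \<le> 3 / 2 * (1 / sqrt m) + 1 / 2 * (f \<theta> * (1 / sqrt m) ^ 3)" for j
      using inverse_sqrt_AE
    proof eventually_elim
      case (elim \<theta>)
      have "P j (cis \<theta>) ^ 3 \<le> (1 / sqrt m) ^ 3" using P by (intro power_mono) auto
      then have "f \<theta> * P j (cis \<theta>) ^ 3 \<le> f \<theta> * (1 / sqrt m) ^ 3" using elim by (intro mult_left_mono) auto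
      moreover have "0 \<le> f \<theta> * P j (cis \<theta>) ^ 3" using elim P by simp
      ultimately show ?case using P(2)[of j "cis \<theta>"] P(3)[of j "cis \<theta>"] unfolding real_norm_def by linarith
    qed
  qed
  then have "(\<lambda>j. 1 / (2 * pi) * L j) \<longlonglongrightarrow> inv_sqrt_mean" unfolding inv_sqrt_mean_def by (intro tendsto_intros)
  then have "\<forall>\<^sub>F j in sequentially. inv_sqrt_mean - e / 2 < 1 / (2 * pi) * L j"
    by (rule order_tendstoD) (use e in auto)
  then obtain j where j: "inv_sqrt_mean - e / 2 < 1 / (2 * pi) * L j" by (auto simp: eventually_sequentially)
  have "\<forall>\<^sub>F n in F. 1 / (2 * pi) * L j - e / 3 \<le> (\<Sum>i<n. 1 / sqrt (d n i)) / real n"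
    unfolding L_def using P e by (intro trace_liminf[OF F eig]) auto
  moreover have "\<forall>\<^sub>F n in F. 0 < n" using eventually_gt_at_top[of 0] F unfolding le_filter_def by blast
  ultimately show "\<forall>\<^sub>F n in F. dist ((\<Sum>i<n. 1 / sqrt (d n i)) / real n) inv_sqrt_mean < e"
    using eig
  proof eventually_elim
    case (elim n)
    have "(\<Sum>i<n. 1 / sqrt (d n i)) / real n \<le> inv_sqrt_mean"
      using trace_le[OF elim(3)] elim(2) by (simp add: divide_le_eq mult.commute)
    then show ?case using elim(1) j e unfolding dist_real_def by linarith
  qed
qed

lemma inv_sqrt_mean_pos: "0 < inv_sqrt_mean"
proof -
  have i: "integrable circ (\<lambda>\<theta>. 1 / sqrt (f \<theta>))"
    using inverse_sqrt_mult_integrable[of "\<lambda>_. 1"] by simp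
  have "0 \<le> (LINT \<theta>|circ. 1 / sqrt (f \<theta>))"
    using inverse_sqrt_AE by (intro integral_nonneg_AE) (auto elim!: eventually_mono)
  moreover have "(LINT \<theta>|circ. 1 / sqrt (f \<theta>)) \<noteq> 0"
  proof
    assume "(LINT \<theta>|circ. 1 / sqrt (f \<theta>)) = 0"
    then have "AE \<theta> in circ. 1 / sqrt (f \<theta>) = 0"
    proof -
      have nn: "AE \<theta> in circ. 0 \<le> 1 / sqrt (f \<theta>)" using inverse_sqrt_AE by eventually_elim auto
      show ?thesis using integral_nonneg_eq_0_iff_AE[OF i nn] \<open>(LINT \<theta>|circ. 1 / sqrt (f \<theta>)) = 0\<close> by blast
    qed
    then have "AE \<theta> in circ. False" using inverse_sqrt_AE by eventually_elim auto
    then have "emeasure circ (space circ) = 0"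
      by (subst (asm) AE_iff_measurable[of "space circ"]) auto
    then show False by (simp add: emeasure_restrict_space)
  qed
  ultimately show ?thesis by (simp add: inv_sqrt_mean_def)
qed

end

section \<open>The law of the whitened channel and noise\<close>

lemma space_vec_borel [simp]: "space (vec_borel n) = carrier_vec n"
  by (simp add: vec_borel_def)

lemma space_mat_borel [simp]: "space (mat_borel m n) = carrier_mat m n"
  by (simp add: mat_borel_def)

lemma measurable_vec_component: "i < n \<Longrightarrow> (\<lambda>v. v $ i) \<in> borel_measurable (vec_borel n)"
proof -
  assume i: "i < n"
  have "(\<lambda>v. \<lambda>i\<in>{..<n}. v $ i) \<in> measurable (vec_borel n) (Pi\<^sub>M {..<n} (\<lambda>_. borel :: complex measure))"
    unfolding vec_borel_def by (rule measurable_vimage_algebra1) (auto simp: space_PiM)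
  from measurable_compose[OF this measurable_component_singleton[of i]] i
  show ?thesis by simp
qed

lemma measurable_mat_component: "i < m \<Longrightarrow> j < n \<Longrightarrow> (\<lambda>A. A $$ (i, j)) \<in> borel_measurable (mat_borel m n)"
proof -
  assume i: "i < m" "j < n"
  have "(\<lambda>A. \<lambda>p\<in>{..<m} \<times> {..<n}. A $$ p) \<in> measurable (mat_borel m n) (Pi\<^sub>M ({..<m} \<times> {..<n}) (\<lambda>_. borel :: complex measure))"
    unfolding mat_borel_def by (rule measurable_vimage_algebra1) (auto simp: space_PiM)
  from measurable_compose[OF this measurable_component_singleton[of "(i, j)"]] i
  show ?thesis by simp
qed

lemma gaussian_rv_cong:
  assumes eq: "\<And>\<omega>. \<omega> \<in> space M \<Longrightarrow> X \<omega> = Y \<omega>"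
  shows "gaussian_rv M X \<longleftrightarrow> gaussian_rv M Y"
proof -
  have 1: "X \<in> borel_measurable M \<longleftrightarrow> Y \<in> borel_measurable M" by (rule measurable_cong) (rule eq)
  have 2: "(AE \<omega> in M. X \<omega> = \<mu>) \<longleftrightarrow> (AE \<omega> in M. Y \<omega> = \<mu>)" for \<mu> by (rule AE_cong) (simp add: eq)
  have 3: "distr M lborel X = distr M lborel Y" by (rule distr_cong) (simp_all add: eq)
  show ?thesis unfolding gaussian_rv_def distributed_def measurable_lborel1 1 2 3 ..
qed

lemma (in prob_space) gaussian_rv_moments:
  assumes "gaussian_rv M X"
  shows "integrable M X" "integrable M (\<lambda>\<omega>. (X \<omega>)\<^sup>2)"
proof -
  have X[measurable]: "X \<in> borel_measurable M" using assms by (simp add: gaussian_rv_def)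
  consider \<mu> where "AE \<omega> in M. X \<omega> = \<mu>" | \<mu> \<tau> where "0 < \<tau>" "distributed M lborel X (normal_density \<mu> \<tau>)"
    using assms by (auto simp: gaussian_rv_def)
  then have "integrable M X \<and> integrable M (\<lambda>\<omega>. (X \<omega>)\<^sup>2)"
  proof cases
    case (1 \<mu>)
    have "integrable M X \<longleftrightarrow> integrable M (\<lambda>_. \<mu>)" by (rule integrable_cong_AE) (use 1 in auto)
    moreover have "integrable M (\<lambda>\<omega>. (X \<omega>)\<^sup>2) \<longleftrightarrow> integrable M (\<lambda>_. \<mu>\<^sup>2)" by (rule integrable_cong_AE) (use 1 in auto)
    ultimately show ?thesis by simp
  next
    case (2 \<mu> \<tau>)
    have a: "integrable M X"
      using integrable_normal_moment_nz_1[OF 2(1), of \<mu>] distributed_integrable[OF 2(2), of "\<lambda>x. x"] by simp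
    have "integrable M (\<lambda>\<omega>. (X \<omega> - \<mu>)\<^sup>2)"
      using integrable_normal_moment[OF 2(1), of \<mu> 2] distributed_integrable[OF 2(2), of "\<lambda>x. (x - \<mu>)\<^sup>2"] by simp
    then have "integrable M (\<lambda>\<omega>. (X \<omega> - \<mu>)\<^sup>2 + 2 * \<mu> * X \<omega> - \<mu>\<^sup>2)" using a by simp
    then show ?thesis using a by (simp add: power2_eq_square algebra_simps)
  qed
  then show "integrable M X" "integrable M (\<lambda>\<omega>. (X \<omega>)\<^sup>2)" by auto
qed

lemma (in prob_space) gaussian_rv_char:
  assumes X: "gaussian_rv M X" and mean: "expectation X = 0"
  shows "(CLINT \<omega>|M. iexp (X \<omega>)) = of_real (exp (- expectation (\<lambda>\<omega>. (X \<omega>)\<^sup>2) / 2))"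
proof -
  have Xm[measurable]: "X \<in> borel_measurable M" using X by (simp add: gaussian_rv_def)
  consider \<mu> where "AE \<omega> in M. X \<omega> = \<mu>" | \<mu> \<tau> where "0 < \<tau>" "distributed M lborel X (normal_density \<mu> \<tau>)"
    using X by (auto simp: gaussian_rv_def)
  then show ?thesis
  proof cases
    case (1 \<mu>)
    \<comment> \<open>A point mass with mean 0 sits at 0 and has variance 0, so the same formula
      covers it.\<close>
    have "expectation X = expectation (\<lambda>_. \<mu>)" by (rule integral_cong_AE) (use 1 in auto)
    then have "AE \<omega> in M. X \<omega> = 0" using mean 1 by (simp add: prob_space)
    then have z: "AE \<omega> in M. X \<omega> = 0" .
    have "(CLINT \<omega>|M. iexp (X \<omega>)) = (CLINT \<omega>|M. 1)"
      by (rule integral_cong_AE) (use z in auto)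
    moreover have "expectation (\<lambda>\<omega>. (X \<omega>)\<^sup>2) = expectation (\<lambda>_. 0)"
      by (rule integral_cong_AE) (use z in auto)
    ultimately show ?thesis by (simp add: prob_space)
  next
    case (2 \<mu> \<tau>)
    have \<mu>: "\<mu> = 0"
      using mean integral_normal_moment_nz_1[OF 2(1), of \<mu>] distributed_integral[OF 2(2), of "\<lambda>x. x"] by simp
    have var: "expectation (\<lambda>\<omega>. (X \<omega>)\<^sup>2) = \<tau>\<^sup>2"
      using integral_normal_moment_even[OF 2(1), of 0 1] distributed_integral[OF 2(2), of "\<lambda>x. x\<^sup>2"] 2(1)
      by (simp add: \<mu> fact_2)
    have "distributed M lborel (\<lambda>\<omega>. X \<omega> / \<tau>) std_normal_density"
      using 2 normal_standard_normal_convert[OF 2(1), of X \<mu>] by (simp add: \<mu>)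
    then have d: "distr M lborel (\<lambda>\<omega>. X \<omega> / \<tau>) = std_normal_distribution"
      by (simp add: distributed_def)
    have "(CLINT \<omega>|M. iexp (X \<omega>)) = (CLINT \<omega>|M. iexp (\<tau> * (X \<omega> / \<tau>)))" using 2(1) by simp
    also have "\<dots> = (CLINT x|distr M lborel (\<lambda>\<omega>. X \<omega> / \<tau>). iexp (\<tau> * x))"
      by (subst integral_distr) auto
    also have "\<dots> = char std_normal_distribution \<tau>" unfolding d char_def ..
    finally show ?thesis by (simp add: char_std_normal_distribution var)
  qed
qed

lemma cscg_components:
  assumes M: "prob_space M" and Z: "cscg M n Z" and i: "i < n"
  shows "(\<lambda>\<omega>. Z \<omega> $ i) \<in> borel_measurable M"
    and "integrable M (\<lambda>\<omega>. Z \<omega> $ i)" and "integrable M (\<lambda>\<omega>. (cmod (Z \<omega> $ i))\<^sup>2)"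
proof -
  have Zm: "Z \<in> measurable M (vec_borel n)" using Z by (simp add: cscg_def complex_gaussian_vec_def)
  show m[measurable]: "(\<lambda>\<omega>. Z \<omega> $ i) \<in> borel_measurable M"
    by (rule measurable_compose[OF Zm measurable_vec_component[OF i]])
  have g: "gaussian_rv M (\<lambda>\<omega>. Re (a * Z \<omega> $ i))" for a
  proof -
    \<comment> \<open>The form with a single coefficient \<open>a\<close> at position
      \<open>i\<close>; \<open>a = 1\<close> and \<open>a = - \<i>\<close> give the real and the
      imaginary part of that component.\<close>
    let ?v = "Matrix.vec n (\<lambda>j. if j = i then a else 0)"
    have g: "gaussian_rv M (\<lambda>\<omega>. Re (?v \<bullet> Z \<omega>))" using Z by (simp add: cscg_def complex_gaussian_vec_def)
    have eq: "?v \<bullet> Z \<omega> = a * Z \<omega> $ i" if "\<omega> \<in> space M" for \<omega>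
    proof -
      have "Z \<omega> \<in> carrier_vec n" using measurable_space[OF Zm that] by simp
      then show ?thesis using i by (simp add: scalar_prod_def if_distrib[of "\<lambda>x. x * _"] cong: if_cong)
    qed
    have "gaussian_rv M (\<lambda>\<omega>. Re (?v \<bullet> Z \<omega>)) \<longleftrightarrow> gaussian_rv M (\<lambda>\<omega>. Re (a * Z \<omega> $ i))"
      by (rule gaussian_rv_cong) (simp only: eq)
    then show ?thesis using g by (simp only:)
  qed
  have re: "integrable M (\<lambda>\<omega>. Re (Z \<omega> $ i))" "integrable M (\<lambda>\<omega>. (Re (Z \<omega> $ i))\<^sup>2)"
    using prob_space.gaussian_rv_moments[OF M g[of 1]] by simp_all
  have im: "integrable M (\<lambda>\<omega>. Im (Z \<omega> $ i))" "integrable M (\<lambda>\<omega>. (Im (Z \<omega> $ i))\<^sup>2)"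
    using prob_space.gaussian_rv_moments[OF M g[of "- \<i>"]] by simp_all
  have "integrable M (\<lambda>\<omega>. of_real (Re (Z \<omega> $ i)) + \<i> * of_real (Im (Z \<omega> $ i)))"
    using re im by (intro Bochner_Integration.integrable_add integrable_mult_right integrable_of_real)
  then show "integrable M (\<lambda>\<omega>. Z \<omega> $ i)" by (simp add: complex_eq[symmetric])
  show "integrable M (\<lambda>\<omega>. (cmod (Z \<omega> $ i))\<^sup>2)" unfolding cmod_power2 using re im by simp
qed

lemma cscg_product_integrable:
  assumes M: "prob_space M" and Z: "cscg M n Z" and ij: "i < n" "j < n"
  shows "integrable M (\<lambda>\<omega>. Z \<omega> $ i * Z \<omega> $ j)" "integrable M (\<lambda>\<omega>. cnj (Z \<omega> $ i) * Z \<omega> $ j)"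
proof -
  note [measurable] = cscg_components(1)[OF M Z ij(1)] cscg_components(1)[OF M Z ij(2)]
  have b: "integrable M (\<lambda>\<omega>. (cmod (Z \<omega> $ i))\<^sup>2 + (cmod (Z \<omega> $ j))\<^sup>2)"
    using cscg_components(3)[OF M Z] ij by simp
  have le: "cmod u * cmod v \<le> norm ((cmod u)\<^sup>2 + (cmod v)\<^sup>2)" for u v :: complex
  proof -
    have "0 \<le> cmod u * cmod v" by simp
    then have "cmod u * cmod v \<le> (cmod u)\<^sup>2 + (cmod v)\<^sup>2" using sum_squares_bound[of "cmod u" "cmod v"] by linarith
    then show ?thesis by simp
  qed
  show "integrable M (\<lambda>\<omega>. Z \<omega> $ i * Z \<omega> $ j)"
    by (rule Bochner_Integration.integrable_bound[OF b]) (auto simp only: norm_mult intro!: AE_I2 le, simp)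
  show "integrable M (\<lambda>\<omega>. cnj (Z \<omega> $ i) * Z \<omega> $ j)"
    by (rule Bochner_Integration.integrable_bound[OF b]) (auto simp only: norm_mult complex_mod_cnj intro!: AE_I2 le, simp)
qed

lemma integral_double_sum:
  fixes g :: "nat \<Rightarrow> nat \<Rightarrow> 'a \<Rightarrow> complex"
  assumes g: "\<And>i j. i < n \<Longrightarrow> j < n \<Longrightarrow> integrable M (g i j)"
  shows "(CLINT \<omega>|M. (\<Sum>i<n. \<Sum>j<n. c i j * g i j \<omega>)) = (\<Sum>i<n. \<Sum>j<n. c i j * (CLINT \<omega>|M. g i j \<omega>))"
proof -
  have "(CLINT \<omega>|M. (\<Sum>i<n. \<Sum>j<n. c i j * g i j \<omega>)) = (\<Sum>i<n. (CLINT \<omega>|M. (\<Sum>j<n. c i j * g i j \<omega>)))"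
    by (rule Bochner_Integration.integral_sum) (intro Bochner_Integration.integrable_sum integrable_mult_right g; simp)
  also have "\<dots> = (\<Sum>i<n. \<Sum>j<n. (CLINT \<omega>|M. c i j * g i j \<omega>))"
    by (intro sum.cong refl Bochner_Integration.integral_sum integrable_mult_right g; simp)
  finally show ?thesis by (simp only: integral_mult_right_zero)
qed

text \<open>Circular symmetry with angle \<open>\<pi> / 2\<close> makes the expectation of the square of a linear form vanish,
  so that the variance of its real part is half of its mean squared modulus.\<close>
lemma cscg_char:
  assumes M: "prob_space M" and Z: "cscg M n Z"
    and cov: "\<And>i j. i < n \<Longrightarrow> j < n \<Longrightarrow> (CLINT \<omega>|M. cnj (Z \<omega> $ i) * Z \<omega> $ j) = C i j"
    and V: "(\<Sum>i<n. \<Sum>j<n. cnj (\<alpha> i) * \<alpha> j * C i j) = of_real V"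
  shows "(CLINT \<omega>|M. iexp (Re (\<Sum>i<n. \<alpha> i * Z \<omega> $ i))) = of_real (exp (- V / 4))"
proof -
  interpret prob_space M by fact
  have Zm: "Z \<in> measurable M (vec_borel n)" using Z by (simp add: cscg_def complex_gaussian_vec_def)
  have Zc: "Z \<omega> \<in> carrier_vec n" if "\<omega> \<in> space M" for \<omega> using measurable_space[OF Zm that] by simp
  note Zi[measurable] = cscg_components(1)[OF M Z]
  define L where "L \<omega> = (\<Sum>i<n. \<alpha> i * Z \<omega> $ i)" for \<omega>
  have Lm[measurable]: "L \<in> borel_measurable M" unfolding L_def by (intro borel_measurable_sum borel_measurable_times) auto
  have g: "gaussian_rv M (\<lambda>\<omega>. Re (L \<omega>))"
  proof -
    have eq: "Matrix.vec n \<alpha> \<bullet> Z \<omega> = L \<omega>" if "\<omega> \<in> space M" for \<omega>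
      using Zc[OF that] by (simp add: L_def scalar_prod_def lessThan_atLeast0)
    have g: "gaussian_rv M (\<lambda>\<omega>. Re (Matrix.vec n \<alpha> \<bullet> Z \<omega>))" using Z by (simp add: cscg_def complex_gaussian_vec_def)
    have "gaussian_rv M (\<lambda>\<omega>. Re (Matrix.vec n \<alpha> \<bullet> Z \<omega>)) \<longleftrightarrow> gaussian_rv M (\<lambda>\<omega>. Re (L \<omega>))"
      by (rule gaussian_rv_cong) (simp only: eq)
    then show ?thesis using g by (simp only:)
  qed
  have Li: "integrable M L" unfolding L_def
    by (intro Bochner_Integration.integrable_sum integrable_mult_right cscg_components(2)[OF M Z]) auto
  have EL: "expectation L = 0"
  proof -
    have "expectation L = (\<Sum>i<n. \<alpha> i * (CLINT \<omega>|M. Z \<omega> $ i))"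
      unfolding L_def by (subst Bochner_Integration.integral_sum) (auto intro!: integrable_mult_right cscg_components(2)[OF M Z])
    also have "\<dots> = 0" using Z by (simp add: cscg_def)
    finally show ?thesis .
  qed
  have EReL: "expectation (\<lambda>\<omega>. Re (L \<omega>)) = 0"
    using Li EL by simp
  have LL: "L \<omega> * L \<omega> = (\<Sum>i<n. \<Sum>j<n. \<alpha> i * \<alpha> j * (Z \<omega> $ i * Z \<omega> $ j))"
    "cnj (L \<omega>) * L \<omega> = (\<Sum>i<n. \<Sum>j<n. cnj (\<alpha> i) * \<alpha> j * (cnj (Z \<omega> $ i) * Z \<omega> $ j))" for \<omega>
    unfolding L_def cnj_sum sum_product by (simp_all only: complex_cnj_mult mult_ac)
  have iLL: "integrable M (\<lambda>\<omega>. L \<omega> * L \<omega>)" "integrable M (\<lambda>\<omega>. cnj (L \<omega>) * L \<omega>)"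
    unfolding LL by (intro Bochner_Integration.integrable_sum integrable_mult_right cscg_product_integrable[OF M Z]; simp)+
  have ELL: "(CLINT \<omega>|M. L \<omega> * L \<omega>) = 0"
  proof -
    define gg where "gg v = (\<Sum>i<n. \<alpha> i * v $ i) * (\<Sum>i<n. \<alpha> i * v $ i)" for v :: "complex vec"
    have ggm: "gg \<in> borel_measurable (vec_borel n)"
      unfolding gg_def by (intro borel_measurable_sum borel_measurable_times measurable_vec_component) auto
    have rot: "(\<lambda>\<omega>. cis (pi / 2) \<cdot>\<^sub>v Z \<omega>) \<in> measurable M (vec_borel n)"
      unfolding vec_borel_def
    proof (rule measurable_vimage_algebra2)
      show "(\<lambda>\<omega>. cis (pi / 2) \<cdot>\<^sub>v Z \<omega>) \<in> space M \<rightarrow> carrier_vec n" using Zc by auto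
      have "(\<lambda>\<omega>. \<lambda>i\<in>{..<n}. cis (pi / 2) * Z \<omega> $ i) \<in> measurable M (Pi\<^sub>M {..<n} (\<lambda>_. borel))"
        by (intro measurable_restrict borel_measurable_times) auto
      then show "(\<lambda>\<omega>. \<lambda>i\<in>{..<n}. (cis (pi / 2) \<cdot>\<^sub>v Z \<omega>) $ i) \<in> measurable M (Pi\<^sub>M {..<n} (\<lambda>_. borel))"
        by (rule measurable_cong[THEN iffD1, rotated]) (auto simp: restrict_def fun_eq_iff dest!: Zc[THEN carrier_vecD])
    qed
    have "(CLINT \<omega>|M. gg (Z \<omega>)) = (CLINT v|distr M (vec_borel n) Z. gg v)"
      by (rule integral_distr[OF Zm ggm, symmetric])
    also have "distr M (vec_borel n) Z = distr M (vec_borel n) (\<lambda>\<omega>. cis (pi / 2) \<cdot>\<^sub>v Z \<omega>)"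
      using Z unfolding cscg_def circularly_symmetric_def by metis
    also have "(CLINT v|distr M (vec_borel n) (\<lambda>\<omega>. cis (pi / 2) \<cdot>\<^sub>v Z \<omega>). gg v) = (CLINT \<omega>|M. gg (cis (pi / 2) \<cdot>\<^sub>v Z \<omega>))"
      by (rule integral_distr[OF rot ggm])
    also have "\<dots> = (CLINT \<omega>|M. - gg (Z \<omega>))"
    proof (intro Bochner_Integration.integral_cong refl)
      fix \<omega> assume "\<omega> \<in> space M"
      then have "(\<Sum>i<n. \<alpha> i * (cis (pi / 2) \<cdot>\<^sub>v Z \<omega>) $ i) = \<i> * (\<Sum>i<n. \<alpha> i * Z \<omega> $ i)"
        using Zc[of \<omega>] by (simp add: sum_distrib_left mult.left_commute)
      moreover have "(\<i> * x) * (\<i> * x) = - (x * x)" for x by (simp add: complex_eq_iff algebra_simps)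
      ultimately show "gg (cis (pi / 2) \<cdot>\<^sub>v Z \<omega>) = - gg (Z \<omega>)" by (simp only: gg_def)
    qed
    also have "\<dots> = - (CLINT \<omega>|M. gg (Z \<omega>))" by simp
    finally have "(CLINT \<omega>|M. gg (Z \<omega>)) + (CLINT \<omega>|M. gg (Z \<omega>)) = 0" by (metis add.right_inverse)
    then have "(CLINT \<omega>|M. gg (Z \<omega>)) = 0" by (simp only: mult_2[symmetric]) simp
    then show ?thesis by (simp add: gg_def L_def)
  qed
  have ELcL: "(CLINT \<omega>|M. cnj (L \<omega>) * L \<omega>) = of_real V"
  proof -
    have "(CLINT \<omega>|M. cnj (L \<omega>) * L \<omega>) = (\<Sum>i<n. \<Sum>j<n. cnj (\<alpha> i) * \<alpha> j * C i j)"
      unfolding LL by (subst integral_double_sum) (auto intro!: cscg_product_integrable[OF M Z] sum.cong simp: cov)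
    then show ?thesis using V by simp
  qed
  have sq: "(Re w)\<^sup>2 = Re (cnj w * w) / 2 + Re (w * w) / 2" for w :: complex
    by (simp add: power2_eq_square field_simps)
  have "expectation (\<lambda>\<omega>. (Re (L \<omega>))\<^sup>2) = Re (CLINT \<omega>|M. cnj (L \<omega>) * L \<omega>) / 2 + Re (CLINT \<omega>|M. L \<omega> * L \<omega>) / 2"
  proof -
    have i: "integrable M (\<lambda>\<omega>. Re (cnj (L \<omega>) * L \<omega>) / 2)" "integrable M (\<lambda>\<omega>. Re (L \<omega> * L \<omega>) / 2)"
      by (intro integrable_divide integrable_Re iLL)+
    show ?thesis unfolding sq Bochner_Integration.integral_add[OF i]
      by (simp only: integral_divide_zero integral_Re[OF iLL(1)] integral_Re[OF iLL(2)])
  qed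
  then have "expectation (\<lambda>\<omega>. (Re (L \<omega>))\<^sup>2) = V / 2" by (simp add: ELL ELcL)
  then show ?thesis using gaussian_rv_char[OF g EReL] unfolding L_def by simp
qed


lemma (in prob_space) integral_uniform_measure_complex:
  fixes f :: "'a \<Rightarrow> complex"
  assumes [measurable]: "f \<in> borel_measurable M" and E: "E \<in> events" "prob E > 0"
  shows "(CLINT x|uniform_measure M E. f x) = (CLINT x|M. indicator E x * f x) / of_real (prob E)"
proof -
  have "uniform_measure M E = density M (\<lambda>x. ennreal (indicator E x / prob E))"
    unfolding uniform_measure_def
    by (rule density_cong) (use E in \<open>auto simp: emeasure_eq_measure indicator_def divide_ennreal[symmetric]\<close>)
  then have "(CLINT x|uniform_measure M E. f x) = (CLINT x|M. (indicator E x / prob E) *\<^sub>R f x)"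
    using E by (simp only:) (rule integral_density, auto)
  also have "\<dots> = (CLINT x|M. (indicator E x * f x) / of_real (prob E))"
    by (intro Bochner_Integration.integral_cong refl) (auto simp: indicator_def scaleR_conv_of_real)
  finally show ?thesis by (simp only: integral_divide_zero)
qed

section \<open>Joint law of whitened channel and noise given one symbol\<close>

context mimo_system
begin

text \<open>Column \<open>Nt\<close> holds the normalized noise, so that channel and noise form a
  single matrix and the noise plays the part of the last column in \<open>add_col\<close>.\<close>

definition whitened :: "complex mat \<Rightarrow> 'a \<Rightarrow> nat \<times> nat \<Rightarrow> complex" where
  "whitened T \<omega> p = (if snd p = Nt then \<xi> \<omega> $ fst p / of_real (sqrt noise_var)
     else (\<Sum>q<Nt. H \<omega> $$ (fst p, q) * T $$ (q, snd p)))"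

lemma H_carrier: "\<omega> \<in> space P \<Longrightarrow> H \<omega> \<in> carrier_mat Nr Nt"
  using measurable_space[OF H_measurable] by simp

lemma H_entry_measurable: "i < Nr \<Longrightarrow> j < Nt \<Longrightarrow> (\<lambda>\<omega>. H \<omega> $$ (i, j)) \<in> borel_measurable P"
  by (rule measurable_compose[OF H_measurable measurable_mat_component])

lemma s_entry_measurable: "k < Nt \<Longrightarrow> (\<lambda>\<omega>. s \<omega> $ k) \<in> borel_measurable P"
  by (rule measurable_compose[OF s_measurable measurable_vec_component])

lemma \<xi>_measurable: "\<xi> \<in> measurable P (vec_borel Nr)"
  using noise_cscg by (simp add: cscg_def complex_gaussian_vec_def)

lemma whitened_measurable:
  assumes p: "p \<in> {..<Nr} \<times> {..<Suc Nt}"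
  shows "(\<lambda>\<omega>. whitened T \<omega> p) \<in> borel_measurable P"
proof -
  have "(\<lambda>\<omega>. \<Sum>q<Nt. H \<omega> $$ (fst p, q) * T $$ (q, snd p)) \<in> borel_measurable P"
    using p by (intro borel_measurable_sum borel_measurable_times H_entry_measurable) auto
  moreover have "(\<lambda>\<omega>. \<xi> \<omega> $ fst p) \<in> borel_measurable P"
    using p by (intro measurable_compose[OF \<xi>_measurable measurable_vec_component]) auto
  ultimately show ?thesis unfolding whitened_def by (cases "snd p = Nt") auto
qed

lemma row_char:
  assumes m: "m < Nr"
    and V: "(\<Sum>i<Nt. \<Sum>j<Nt. cnj (\<alpha> i) * \<alpha> j * \<Sigma> $$ (i, j)) = of_real V"
  shows "(CLINT \<omega>|P. iexp (Re (\<Sum>i<Nt. \<alpha> i * Matrix.row (H \<omega>) m $ i))) = of_real (exp (- V / 4))"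
proof (rule cscg_char[OF prob_space_axioms rows_cscg[OF m] _ V])
  fix i j assume ij: "i < Nt" "j < Nt"
  have "(CLINT \<omega>|P. cnj (Matrix.row (H \<omega>) m $ i) * Matrix.row (H \<omega>) m $ j) = (CLINT \<omega>|P. cnj (H \<omega> $$ (m, i)) * H \<omega> $$ (m, j))"
  proof (intro Bochner_Integration.integral_cong refl)
    fix \<omega> assume "\<omega> \<in> space P"
    then have "H \<omega> \<in> carrier_mat Nr Nt" by (rule H_carrier)
    then have "Matrix.row (H \<omega>) m $ i = H \<omega> $$ (m, i)" "Matrix.row (H \<omega>) m $ j = H \<omega> $$ (m, j)"
      using m ij by auto
    then show "cnj (Matrix.row (H \<omega>) m $ i) * Matrix.row (H \<omega>) m $ j = cnj (H \<omega> $$ (m, i)) * H \<omega> $$ (m, j)" by (simp only:)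
  qed
  then show "(CLINT \<omega>|P. cnj (Matrix.row (H \<omega>) m $ i) * Matrix.row (H \<omega>) m $ j) = \<Sigma> $$ (i, j)"
    using rows_cov[OF m ij] by simp
qed

lemma noise_char:
  "(CLINT \<omega>|P. iexp (Re (\<Sum>i<Nr. \<beta> i * \<xi> \<omega> $ i))) = of_real (exp (- (noise_var * (\<Sum>i<Nr. (cmod (\<beta> i))\<^sup>2)) / 4))"
proof (rule cscg_char[OF prob_space_axioms noise_cscg])
  fix i j assume ij: "i < Nr" "j < Nr"
  show "(CLINT \<omega>|P. cnj (\<xi> \<omega> $ i) * \<xi> \<omega> $ j) = (if i = j then of_real noise_var else 0)"
    using noise_cov[OF ij(2,1)] by (simp add: mult.commute eq_commute)
next
  show "(\<Sum>i<Nr. \<Sum>j<Nr. cnj (\<beta> i) * \<beta> j * (if i = j then of_real noise_var else 0)) = of_real (noise_var * (\<Sum>i<Nr. (cmod (\<beta> i))\<^sup>2))"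
  proof -
    have "(\<Sum>i<Nr. \<Sum>j<Nr. cnj (\<beta> i) * \<beta> j * (if i = j then of_real noise_var else 0)) = (\<Sum>i<Nr. of_real noise_var * (\<beta> i * cnj (\<beta> i)))"
      by (simp add: if_distrib[of "\<lambda>x. _ * x"] mult_ac cong: if_cong)
    then show ?thesis by (simp only: of_real_mult of_real_sum complex_norm_square sum_distrib_left)
  qed
qed

text \<open>The indicator of the symbol event is kept as a factor; division by the probability of
  the event then gives a conditional characteristic function.\<close>

lemma joint_char:
  assumes k: "k < Nt"
    and V: "\<And>m. m < Nr \<Longrightarrow> (\<Sum>i<Nt. \<Sum>j<Nt. cnj (\<alpha> m i) * \<alpha> m j * \<Sigma> $$ (i, j)) = of_real (V m)"
  shows "(CLINT \<omega>|P. indicator {\<omega> \<in> space P. s \<omega> $ k = c} \<omega> *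
      (iexp (\<Sum>m<Nr. Re (\<Sum>i<Nt. \<alpha> m i * H \<omega> $$ (m, i))) * iexp (Re (\<Sum>i<Nr. \<beta> i * \<xi> \<omega> $ i))))
    = of_real (prob {\<omega> \<in> space P. s \<omega> $ k = c} * exp (- ((\<Sum>m<Nr. V m) + noise_var * (\<Sum>i<Nr. (cmod (\<beta> i))\<^sup>2)) / 4))"
proof -
  define f0 where "f0 A = iexp (\<Sum>m<Nr. Re (\<Sum>i<Nt. \<alpha> m i * A $$ (m, i)))" for A :: "complex mat"
  define f1 where "f1 v = (indicator {c} (v $ k) :: complex)" for v :: "complex vec"
  define f2 where "f2 v = iexp (Re (\<Sum>i<Nr. \<beta> i * v $ i))" for v :: "complex vec"
  have f0m: "f0 \<in> borel_measurable (mat_borel Nr Nt)"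
  proof -
    have "(\<lambda>A. \<Sum>m<Nr. Re (\<Sum>i<Nt. \<alpha> m i * A $$ (m, i))) \<in> borel_measurable (mat_borel Nr Nt)"
      by (intro borel_measurable_sum borel_measurable_Re[THEN measurable_compose[rotated]] borel_measurable_times measurable_mat_component) auto
    then show ?thesis unfolding f0_def by measurable
  qed
  have f1m: "f1 \<in> borel_measurable (vec_borel Nt)"
    unfolding f1_def by (intro measurable_compose[OF measurable_vec_component[OF k]]) auto
  have f2m: "f2 \<in> borel_measurable (vec_borel Nr)"
  proof -
    have "(\<lambda>v. Re (\<Sum>i<Nr. \<beta> i * v $ i)) \<in> borel_measurable (vec_borel Nr)"
      by (intro borel_measurable_sum borel_measurable_Re[THEN measurable_compose[rotated]] borel_measurable_times measurable_vec_component) auto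
    then show ?thesis unfolding f2_def by measurable
  qed
  \<comment> \<open>Channel, symbols and noise have different types; composed with bounded complex
    functions they become three variables with a common value type.\<close>
  define X where "X i \<omega> = [f0 (H \<omega>), f1 (s \<omega>), f2 (\<xi> \<omega>)] ! i" for i \<omega>
  have three: "{..<3} = {0, 1, 2::nat}" by auto
  have rv: "X i \<in> borel_measurable P" if "i \<in> {..<3}" for i
    using that measurable_compose[OF H_measurable f0m] measurable_compose[OF s_measurable f1m] measurable_compose[OF \<xi>_measurable f2m]
    unfolding three by (auto simp: X_def[abs_def])
  have pre: "{(\<lambda>\<omega>. g (Z \<omega>)) -` A \<inter> space P |A. A \<in> sets borel} \<subseteq> preimage_sets P Z N"
    if Z: "Z \<in> measurable P N" and g: "g \<in> borel_measurable N" for g :: "'b \<Rightarrow> complex" and Z :: "'a \<Rightarrow> 'b" and N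
  proof safe
    fix A :: "complex set" assume "A \<in> sets borel"
    then have "g -` A \<inter> space N \<in> sets N" using g by (rule measurable_sets[rotated])
    moreover have "(\<lambda>\<omega>. g (Z \<omega>)) -` A \<inter> space P = Z -` (g -` A \<inter> space N) \<inter> space P"
      using measurable_space[OF Z] by auto
    ultimately show "(\<lambda>\<omega>. g (Z \<omega>)) -` A \<inter> space P \<in> preimage_sets P Z N"
      unfolding preimage_sets_def by blast
  qed
  have "indep_sets (\<lambda>i. {X i -` A \<inter> space P |A. A \<in> sets borel}) {..<3}"
  proof (rule indep_sets_mono_sets[OF indep_H_s_noise])
    fix i :: nat assume "i \<in> {..<3}"
    then show "{X i -` A \<inter> space P |A. A \<in> sets borel} \<subseteq>
      [preimage_sets P H (mat_borel Nr Nt), preimage_sets P s (vec_borel Nt), preimage_sets P \<xi> (vec_borel Nr)] ! i"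
      using pre[OF H_measurable f0m] pre[OF s_measurable f1m] pre[OF \<xi>_measurable f2m]
      unfolding three X_def by (elim insertE emptyE) simp_all
  qed
  then have ind: "indep_vars (\<lambda>_. borel) X {..<3}" unfolding indep_vars_def2 using rv by auto
  have bd: "norm (X i \<omega>) \<le> 1" if "i \<in> {..<3}" for i \<omega>
    using that unfolding three by (auto simp: X_def f0_def f1_def f2_def indicator_def)
  have Xi: "integrable P (X i)" if "i \<in> {..<3}" for i
    using rv[OF that] bd[OF that] by (intro integrable_const_bound[of _ 1]) auto
  have "(CLINT \<omega>|P. (\<Prod>i<3. X i \<omega>)) = (\<Prod>i<3. (CLINT \<omega>|P. X i \<omega>))"
    using ind Xi by (intro indep_vars_lebesgue_integral) auto
  then have "(CLINT \<omega>|P. f0 (H \<omega>) * f1 (s \<omega>) * f2 (\<xi> \<omega>)) = (CLINT \<omega>|P. f0 (H \<omega>)) * (CLINT \<omega>|P. f1 (s \<omega>)) * (CLINT \<omega>|P. f2 (\<xi> \<omega>))"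
    by (simp add: numeral_3_eq_3 X_def)
  moreover have "(CLINT \<omega>|P. f1 (s \<omega>)) = of_real (prob {\<omega> \<in> space P. s \<omega> $ k = c})"
  proof -
    have ev: "{\<omega> \<in> space P. s \<omega> $ k = c} \<in> events"
      using s_entry_measurable[OF k] by (auto intro!: borel_measurable_eq)
    have "(CLINT \<omega>|P. f1 (s \<omega>)) = (CLINT \<omega>|P. of_real (indicator {\<omega> \<in> space P. s \<omega> $ k = c} \<omega>))"
      by (intro Bochner_Integration.integral_cong refl) (simp add: f1_def indicator_def)
    also have "\<dots> = of_real (prob {\<omega> \<in> space P. s \<omega> $ k = c})"
      unfolding integral_complex_of_real using ev by simp
    finally show ?thesis .
  qed
  moreover have "(CLINT \<omega>|P. f2 (\<xi> \<omega>)) = of_real (exp (- (noise_var * (\<Sum>i<Nr. (cmod (\<beta> i))\<^sup>2)) / 4))"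
    unfolding f2_def by (rule noise_char)
  moreover have "(CLINT \<omega>|P. f0 (H \<omega>)) = of_real (exp (- (\<Sum>m<Nr. V m) / 4))"
  proof -
    \<comment> \<open>One factor per row, so that independence of the rows turns the expectation
      into a product.\<close>
    define h where "h m v = iexp (Re (\<Sum>i<Nt. \<alpha> m i * v $ i))" for m and v :: "complex vec"
    have hm: "h m \<in> borel_measurable (vec_borel Nt)" for m
    proof -
      have "(\<lambda>v. Re (\<Sum>i<Nt. \<alpha> m i * v $ i)) \<in> borel_measurable (vec_borel Nt)"
        by (intro borel_measurable_sum borel_measurable_Re[THEN measurable_compose[rotated]] borel_measurable_times measurable_vec_component) auto
      then show ?thesis unfolding h_def by measurable
    qed
    have ind: "indep_vars (\<lambda>_. borel) (\<lambda>m \<omega>. h m (Matrix.row (H \<omega>) m)) {..<Nr}"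
      by (rule indep_vars_compose2[OF rows_indep hm])
    have hi: "integrable P (\<lambda>\<omega>. h m (Matrix.row (H \<omega>) m))" if "m \<in> {..<Nr}" for m
      using ind that unfolding indep_vars_def by (intro integrable_const_bound[of _ 1]) (auto simp: h_def)
    have "(CLINT \<omega>|P. f0 (H \<omega>)) = (CLINT \<omega>|P. (\<Prod>m<Nr. h m (Matrix.row (H \<omega>) m)))"
    proof (intro Bochner_Integration.integral_cong refl)
      fix \<omega> assume "\<omega> \<in> space P"
      then have "H \<omega> \<in> carrier_mat Nr Nt" by (rule H_carrier)
      then have "Re (\<Sum>i<Nt. \<alpha> m i * H \<omega> $$ (m, i)) = Re (\<Sum>i<Nt. \<alpha> m i * Matrix.row (H \<omega>) m $ i)" if "m \<in> {..<Nr}" for m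
        using that by (intro arg_cong[where f=Re] sum.cong) auto
      then show "f0 (H \<omega>) = (\<Prod>m<Nr. h m (Matrix.row (H \<omega>) m))"
        unfolding f0_def h_def by (simp only: of_real_sum sum_distrib_left exp_sum[OF finite_lessThan] cong: prod.cong)
    qed
    also have "\<dots> = (\<Prod>m<Nr. (CLINT \<omega>|P. h m (Matrix.row (H \<omega>) m)))"
      using ind hi by (intro indep_vars_lebesgue_integral) auto
    also have "\<dots> = (\<Prod>m<Nr. of_real (exp (- V m / 4)))"
      unfolding h_def by (intro prod.cong refl row_char V) auto
    also have "\<dots> = of_real (\<Prod>m<Nr. exp (- V m / 4))" by (simp only: of_real_prod)
    also have "(\<Prod>m<Nr. exp (- V m / 4)) = exp (- (\<Sum>m<Nr. V m) / 4)"
      by (simp add: exp_sum[symmetric] sum_negf sum_divide_distrib)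
    finally show ?thesis .
  qed
  moreover have "(CLINT \<omega>|P. indicator {\<omega> \<in> space P. s \<omega> $ k = c} \<omega> *
      (iexp (\<Sum>m<Nr. Re (\<Sum>i<Nt. \<alpha> m i * H \<omega> $$ (m, i))) * iexp (Re (\<Sum>i<Nr. \<beta> i * \<xi> \<omega> $ i))))
     = (CLINT \<omega>|P. f0 (H \<omega>) * f1 (s \<omega>) * f2 (\<xi> \<omega>))"
    by (intro Bochner_Integration.integral_cong refl) (simp add: f0_def f1_def f2_def indicator_def)
  moreover have "exp (- ((\<Sum>m<Nr. V m) + noise_var * (\<Sum>i<Nr. (cmod (\<beta> i))\<^sup>2)) / 4)
     = exp (- (\<Sum>m<Nr. V m) / 4) * exp (- (noise_var * (\<Sum>i<Nr. (cmod (\<beta> i))\<^sup>2)) / 4)"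
    by (simp add: exp_add[symmetric] add_divide_distrib)
  ultimately show ?thesis by (simp only: of_real_mult mult_ac)
qed

text \<open>The hypothesis on \<open>T\<close> says that the adjoint of \<open>T\<close>, times
  \<Sigma>, times \<open>T\<close> is the identity, which makes the exponent in
  \<open>joint_char\<close> the squared length of \<open>a\<close>. The uniform measure on the
  symbol event is the conditional probability.\<close>

lemma distr_whitened:
  assumes nv: "0 < noise_var"
    and T: "\<And>a b. a < Nt \<Longrightarrow> b < Nt \<Longrightarrow> (\<Sum>p<Nt. \<Sum>q<Nt. cnj (T $$ (p, a)) * T $$ (q, b) * \<Sigma> $$ (p, q)) = of_bool (a = b)"
    and k: "k < Nt" and c: "prob {\<omega> \<in> space P. s \<omega> $ k = c} > 0"
  shows "distr (uniform_measure P {\<omega> \<in> space P. s \<omega> $ k = c}) (Pi\<^sub>M ({..<Nr} \<times> {..<Suc Nt}) (\<lambda>_. borel))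
     (\<lambda>\<omega>. \<lambda>p\<in>{..<Nr} \<times> {..<Suc Nt}. whitened T \<omega> p) = cgmat Nr (Suc Nt)"
proof -
  let ?E = "{\<omega> \<in> space P. s \<omega> $ k = c}"
  have ev: "?E \<in> events" using s_entry_measurable[OF k] by (auto intro!: borel_measurable_eq)
  have U: "prob_space (uniform_measure P ?E)"
    using c by (intro prob_space_uniform_measure) (auto simp: emeasure_eq_measure)
  show ?thesis
  proof (rule prob_space.distr_eq_PiM_cgauss[OF U])
    fix p assume "p \<in> {..<Nr} \<times> {..<Suc Nt}"
    then show "(\<lambda>\<omega>. whitened T \<omega> p) \<in> borel_measurable (uniform_measure P ?E)"
      using whitened_measurable[of p T] by simp
  next
    fix a :: "nat \<times> nat \<Rightarrow> complex"
    \<comment> \<open>The coefficients of the given form in the whitened matrix, rewritten for the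
      entries of \<open>H\<close>; \<beta> does the same for the noise column.\<close>
    define \<alpha> where "\<alpha> m i = (\<Sum>j<Nt. cnj (a (m, j)) * T $$ (i, j))" for m i
    define \<beta> where "\<beta> m = cnj (a (m, Nt)) / of_real (sqrt noise_var)" for m
    define V where "V m = (\<Sum>j<Nt. (cmod (a (m, j)))\<^sup>2)" for m
    have V: "(\<Sum>i<Nt. \<Sum>j<Nt. cnj (\<alpha> m i) * \<alpha> m j * \<Sigma> $$ (i, j)) = of_real (V m)" for m
    proof -
      have "(\<Sum>i<Nt. \<Sum>j<Nt. cnj (\<alpha> m i) * \<alpha> m j * \<Sigma> $$ (i, j)) =
        (\<Sum>i<Nt. \<Sum>j<Nt. \<Sum>u<Nt. \<Sum>v<Nt. a (m, u) * cnj (a (m, v)) * (cnj (T $$ (i, u)) * T $$ (j, v) * \<Sigma> $$ (i, j)))"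
        by ((simp only: \<alpha>_def cnj_sum sum_product), (simp only: sum_distrib_right), (simp only: complex_cnj_mult complex_cnj_cnj mult_ac))
      also have "\<dots> = (\<Sum>i<Nt. \<Sum>u<Nt. \<Sum>v<Nt. \<Sum>j<Nt. a (m, u) * cnj (a (m, v)) * (cnj (T $$ (i, u)) * T $$ (j, v) * \<Sigma> $$ (i, j)))"
        by (rule sum.cong[OF refl], subst sum.swap, rule sum.cong[OF refl], rule sum.swap)
      also have "\<dots> = (\<Sum>u<Nt. \<Sum>v<Nt. \<Sum>i<Nt. \<Sum>j<Nt. a (m, u) * cnj (a (m, v)) * (cnj (T $$ (i, u)) * T $$ (j, v) * \<Sigma> $$ (i, j)))"
        by (subst sum.swap, rule sum.cong[OF refl], rule sum.swap)
      also have "\<dots> = (\<Sum>u<Nt. \<Sum>v<Nt. a (m, u) * cnj (a (m, v)) * of_bool (u = v))"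
        by (intro sum.cong refl) (simp only: sum_distrib_left[symmetric] T lessThan_iff)
      also have "\<dots> = (\<Sum>u<Nt. a (m, u) * cnj (a (m, u)))"
        by (simp add: of_bool_def if_distrib[of "\<lambda>x. _ * x"] cong: if_cong)
      also have "\<dots> = of_real (V m)" unfolding V_def of_real_sum by (simp only: complex_norm_square)
      finally show ?thesis .
    qed
    have \<beta>: "noise_var * (\<Sum>m<Nr. (cmod (\<beta> m))\<^sup>2) = (\<Sum>m<Nr. (cmod (a (m, Nt)))\<^sup>2)"
      using nv by (simp add: \<beta>_def norm_divide power_divide sum_divide_distrib[symmetric])
    have sumK: "(\<Sum>p\<in>{..<Nr} \<times> {..<Suc Nt}. g p) = (\<Sum>m<Nr. \<Sum>j<Nt. g (m, j)) + (\<Sum>m<Nr. g (m, Nt))" for g :: "nat \<times> nat \<Rightarrow> real"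
    proof -
      have "(\<Sum>p\<in>{..<Nr} \<times> {..<Suc Nt}. g p) = (\<Sum>m<Nr. \<Sum>j<Suc Nt. g (m, j))" by (simp only: sum.cartesian_product) (rule sum.cong[OF refl], auto)
      then show ?thesis by (simp only: sum.lessThan_Suc sum.distrib)
    qed
    have e1: "(\<Sum>p\<in>{..<Nr} \<times> {..<Suc Nt}. Re (cnj (a p) * whitened T \<omega> p)) =
      (\<Sum>m<Nr. Re (\<Sum>i<Nt. \<alpha> m i * H \<omega> $$ (m, i))) + Re (\<Sum>m<Nr. \<beta> m * \<xi> \<omega> $ m)" for \<omega>
    proof -
      have "(\<Sum>j<Nt. Re (cnj (a (m, j)) * whitened T \<omega> (m, j))) = Re (\<Sum>i<Nt. \<alpha> m i * H \<omega> $$ (m, i))" for m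
      proof -
        have "(\<Sum>j<Nt. cnj (a (m, j)) * whitened T \<omega> (m, j)) = (\<Sum>j<Nt. \<Sum>i<Nt. cnj (a (m, j)) * T $$ (i, j) * H \<omega> $$ (m, i))"
          by (intro sum.cong refl) (simp add: whitened_def sum_distrib_left mult_ac)
        also have "\<dots> = (\<Sum>i<Nt. \<alpha> m i * H \<omega> $$ (m, i))"
          by (subst sum.swap) (simp only: \<alpha>_def sum_distrib_right)
        finally show ?thesis by (simp only: Re_sum[symmetric])
      qed
      moreover have "(\<Sum>m<Nr. Re (cnj (a (m, Nt)) * whitened T \<omega> (m, Nt))) = Re (\<Sum>m<Nr. \<beta> m * \<xi> \<omega> $ m)"
        unfolding Re_sum by (intro sum.cong refl arg_cong[where f=Re]) (simp add: whitened_def \<beta>_def)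
      ultimately show ?thesis unfolding sumK by simp
    qed
    have m: "(\<lambda>\<omega>. iexp (\<Sum>p\<in>{..<Nr} \<times> {..<Suc Nt}. Re (cnj (a p) * whitened T \<omega> p))) \<in> borel_measurable P"
    proof -
      have "(\<lambda>\<omega>. \<Sum>p\<in>{..<Nr} \<times> {..<Suc Nt}. Re (cnj (a p) * whitened T \<omega> p)) \<in> borel_measurable P"
        by (intro borel_measurable_sum borel_measurable_Re[THEN measurable_compose[rotated]] borel_measurable_times whitened_measurable) auto
      then show ?thesis by measurable
    qed
    have "(CLINT \<omega>|uniform_measure P ?E. iexp (\<Sum>p\<in>{..<Nr} \<times> {..<Suc Nt}. Re (cnj (a p) * whitened T \<omega> p)))
      = (CLINT \<omega>|P. indicator ?E \<omega> * iexp (\<Sum>p\<in>{..<Nr} \<times> {..<Suc Nt}. Re (cnj (a p) * whitened T \<omega> p))) / of_real (prob ?E)"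
      by (rule integral_uniform_measure_complex[OF m ev c])
    also have "\<dots> = (CLINT \<omega>|P. indicator ?E \<omega> *
      (iexp (\<Sum>m<Nr. Re (\<Sum>i<Nt. \<alpha> m i * H \<omega> $$ (m, i))) * iexp (Re (\<Sum>i<Nr. \<beta> i * \<xi> \<omega> $ i)))) / of_real (prob ?E)"
      unfolding e1 by (simp only: of_real_add distrib_left exp_add)
    also have "\<dots> = of_real (prob ?E * exp (- ((\<Sum>m<Nr. V m) + noise_var * (\<Sum>i<Nr. (cmod (\<beta> i))\<^sup>2)) / 4)) / of_real (prob ?E)"
      by (subst joint_char[OF k V]) (rule refl)
    also have "\<dots> = of_real (exp (- (\<Sum>p\<in>{..<Nr} \<times> {..<Suc Nt}. (cmod (a p))\<^sup>2) / 4))"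
      using c unfolding \<beta> sumK V_def by simp
    finally show "(CLINT \<omega>|uniform_measure P ?E. iexp (\<Sum>p\<in>{..<Nr} \<times> {..<Suc Nt}. Re (cnj (a p) * whitened T \<omega> p))) =
      of_real (exp (- (\<Sum>p\<in>{..<Nr} \<times> {..<Suc Nt}. (cmod (a p))\<^sup>2) / 4))" .
  qed simp
qed

end

section \<open>Zero-forcing and the precoder\<close>

lemma mat_inv_nonsingular:
  assumes A: "A \<in> carrier_mat n n" and det: "det A \<noteq> 0"
  shows "mat_inv A \<in> carrier_mat n n" "mat_inv A * A = 1\<^sub>m n" "A * mat_inv A = 1\<^sub>m n"
proof -
  have "mat_inverse A \<noteq> None"
    using mat_inverse(1)[OF A, where b = "()"] det_non_zero_imp_unit[OF A det, of "()"] by auto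
  then obtain B where B: "mat_inverse A = Some B" by auto
  then show "mat_inv A \<in> carrier_mat n n" "mat_inv A * A = 1\<^sub>m n" "A * mat_inv A = 1\<^sub>m n"
    using mat_inverse(2)[OF A B] by (auto simp: mat_inv_def)
qed

lemma mat_inv_singular:
  assumes A: "A \<in> carrier_mat n n" and det: "det A = 0"
  shows "mat_inv A = 0\<^sub>m n n"
proof (cases "mat_inverse A")
  case None
  then show ?thesis using A by (simp add: mat_inv_def)
next
  case (Some B)
  then have B: "A * B = 1\<^sub>m n" "B \<in> carrier_mat n n" using mat_inverse(2)[OF A Some] by auto
  have "det A * det B = 1" using det_mult[OF A B(2)] B(1) by simp
  then show ?thesis using det by simp
qed

lemma mat_mult_vec_index:
  assumes "A \<in> carrier_mat m n" "v \<in> carrier_vec n" "i < m"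
  shows "(A *\<^sub>v v) $ i = (\<Sum>l<n. A $$ (i, l) * v $ l)"
  using assms by (simp add: scalar_prod_def lessThan_atLeast0)

lemma gram_index:
  assumes "A \<in> carrier_mat m n" "a < n" "b < n"
  shows "(mat_adjoint A * A) $$ (a, b) = (\<Sum>i<m. cnj (A $$ (i, a)) * A $$ (i, b))"
  using assms by (subst mat_mult_index[OF mat_adjoint_carrier[OF assms(1)] assms(1)]) (auto simp: mat_adjoint_index)

lemma det_gram_zero:
  fixes A :: "complex mat"
  assumes A: "A \<in> carrier_mat m n" and x: "x \<in> carrier_vec n" "x \<noteq> 0\<^sub>v n" "A *\<^sub>v x = 0\<^sub>v m"
  shows "det (mat_adjoint A * A) = 0"
proof -
  note A' = mat_adjoint_carrier[OF A]
  have G: "mat_adjoint A * A \<in> carrier_mat n n" using A A' by simp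
  have "(mat_adjoint A * A) *\<^sub>v x = mat_adjoint A *\<^sub>v (A *\<^sub>v x)" by (rule assoc_mult_mat_vec[OF A' A x(1)])
  also have "\<dots> = 0\<^sub>v n" unfolding x(3) using A' by (intro eq_vecI) (auto simp: scalar_prod_def)
  finally show ?thesis using det_0_iff_vec_prod_zero_field[OF G] x by blast
qed

text \<open>A kernel vector \<open>x\<close> of the Gram matrix makes the squared length of
  \<open>A x\<close> vanish.\<close>

lemma det_gram_nonzero:
  fixes A :: "complex mat"
  assumes A: "A \<in> carrier_mat m n" and inj: "\<And>x. x \<in> carrier_vec n \<Longrightarrow> A *\<^sub>v x = 0\<^sub>v m \<Longrightarrow> x = 0\<^sub>v n"
  shows "det (mat_adjoint A * A) \<noteq> 0"
proof
  note A' = mat_adjoint_carrier[OF A]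
  have G: "mat_adjoint A * A \<in> carrier_mat n n" using A A' by simp
  assume "det (mat_adjoint A * A) = 0"
  then obtain x where x: "x \<in> carrier_vec n" "x \<noteq> 0\<^sub>v n" "(mat_adjoint A * A) *\<^sub>v x = 0\<^sub>v n"
    using det_0_iff_vec_prod_zero_field[OF G] by blast
  have Ax: "A *\<^sub>v x \<in> carrier_vec m" using A x by simp
  have "mat_adjoint A *\<^sub>v (A *\<^sub>v x) = 0\<^sub>v n" using x(3) assoc_mult_mat_vec[OF A' A x(1)] by simp
  then have z: "(\<Sum>i<m. cnj (A $$ (i, a)) * (A *\<^sub>v x) $ i) = 0" if "a < n" for a
    using mat_mult_vec_index[OF A' Ax that] that by (simp add: mat_adjoint_index[OF A])
  have "of_real (\<Sum>i<m. (cmod ((A *\<^sub>v x) $ i))\<^sup>2) = (\<Sum>i<m. cnj ((A *\<^sub>v x) $ i) * (A *\<^sub>v x) $ i)"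
    unfolding of_real_sum by (simp only: complex_norm_square mult.commute)
  also have "\<dots> = (\<Sum>i<m. \<Sum>a<n. cnj (x $ a) * (cnj (A $$ (i, a)) * (A *\<^sub>v x) $ i))"
  proof (rule sum.cong[OF refl])
    fix i assume "i \<in> {..<m}"
    then have "cnj ((A *\<^sub>v x) $ i) = (\<Sum>a<n. cnj (x $ a) * cnj (A $$ (i, a)))"
      using mat_mult_vec_index[OF A x(1), of i] by (simp add: mult.commute)
    then show "cnj ((A *\<^sub>v x) $ i) * (A *\<^sub>v x) $ i = (\<Sum>a<n. cnj (x $ a) * (cnj (A $$ (i, a)) * (A *\<^sub>v x) $ i))"
      by (simp only: sum_distrib_right mult.assoc)
  qed
  also have "\<dots> = (\<Sum>a<n. cnj (x $ a) * (\<Sum>i<m. cnj (A $$ (i, a)) * (A *\<^sub>v x) $ i))"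
    unfolding sum_distrib_left by (rule sum.swap)
  also have "\<dots> = 0" using z by simp
  finally have "(\<Sum>i<m. (cmod ((A *\<^sub>v x) $ i))\<^sup>2) = 0" by (simp only: of_real_eq_0_iff)
  then have "(A *\<^sub>v x) $ i = 0" if "i < m" for i
    using that by (subst (asm) sum_nonneg_eq_0_iff) auto
  then have "A *\<^sub>v x = 0\<^sub>v m" using Ax A by (intro eq_vecI) auto
  from inj[OF x(1) this] x(2) show False by simp
qed

text \<open>The dual vector of column \<open>j\<close>: it annihilates the earlier columns and has
  product 1 with column \<open>j\<close> itself, see \<open>gs_row_inner\<close>.\<close>

definition gs_row :: "nat \<Rightarrow> nat \<Rightarrow> (nat \<times> nat \<Rightarrow> complex) \<Rightarrow> nat \<Rightarrow> complex" where
  "gs_row N j z i = cnj (gs_resid N j z i) / of_real (gs_norm N j z)"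

lemma gs_row_inner:
  assumes "gs_norm N j z \<noteq> 0" "a \<le> j"
  shows "(\<Sum>i<N. gs_row N j z i * z (i, a)) = of_bool (a = j)"
proof -
  have "(\<Sum>i<N. gs_row N j z i * z (i, a)) = (\<Sum>i<N. cnj (gs_resid N j z i) * z (i, a)) / of_real (gs_norm N j z)"
    by (simp add: gs_row_def sum_divide_distrib)
  also have "\<dots> = of_bool (a = j)"
  proof (cases "a = j")
    case True
    then show ?thesis using assms by (simp add: gs_resid_inner_self)
  next
    case False
    then have "(\<Sum>i<N. cnj (gs_resid N j z i) * z (i, a)) = 0"
      using assms by (subst gs_resid_inner) (simp add: gs_proj_kills)
    then show ?thesis using False by simp
  qed
  finally show ?thesis .
qed

text \<open>The residual is column \<open>j\<close> corrected by earlier columns, hence the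
  coefficient 1.\<close>

lemma gs_resid_span:
  "\<exists>y. y j = 1 \<and> (\<forall>i<N. gs_resid N j z i = (\<Sum>a<Suc j. z (i, a) * y a))"
proof -
  obtain x where x: "\<And>i. i < N \<Longrightarrow> gs_resid N j z i = z (i, j) - (\<Sum>a<j. z (i, a) * x a)"
    using gs_proj_span[of N j z "\<lambda>l. z (l, j)"] unfolding gs_resid_def by auto
  have "gs_resid N j z i = (\<Sum>a<Suc j. z (i, a) * (if a = j then 1 else - x a))" if "i < N" for i
    unfolding x[OF that] by (simp add: sum_negf)
  then show ?thesis by (intro exI[of _ "\<lambda>a. if a = j then 1 else - x a"]) simp
qed

text \<open>Take the largest index \<open>j\<close> with \<open>x j\<close> nonzero and project away
  the columns before it: the earlier terms die, the later ones have coefficient 0, and what remains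
  is \<open>x j\<close> times a nonzero residual.\<close>

lemma gs_full_rank:
  assumes full: "\<And>a. a < n \<Longrightarrow> gs_norm N a z \<noteq> 0"
    and zero: "\<And>i. i < N \<Longrightarrow> (\<Sum>a<n. z (i, a) * x a) = 0" and a: "a < n"
  shows "x a = 0"
proof (rule ccontr)
  assume "x a \<noteq> 0"
  define j where "j = Max {j. j < n \<and> x j \<noteq> 0}"
  have "j \<in> {j. j < n \<and> x j \<noteq> 0}" unfolding j_def using a \<open>x a \<noteq> 0\<close> by (intro Max_in) auto
  then have j: "j < n" "x j \<noteq> 0" by auto
  have above: "x b = 0" if "j < b" "b < n" for b
  proof (rule ccontr)
    assume "x b \<noteq> 0"
    then have "b \<le> j" unfolding j_def using that by (intro Max_ge) auto
    then show False using that by simp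
  qed
  have "gs_resid N j z i = 0" if i: "i < N" for i
  proof -
    have "0 = (\<Sum>l<N. gs_proj N j z i l * (\<Sum>a<n. z (l, a) * x a))" using zero by simp
    also have "\<dots> = (\<Sum>a<n. (\<Sum>l<N. gs_proj N j z i l * z (l, a)) * x a)"
      unfolding sum_distrib_left sum_distrib_right mult.assoc by (rule sum.swap)
    also have "\<dots> = (\<Sum>a<n. if a = j then gs_resid N j z i * x j else 0)"
    proof (rule sum.cong[OF refl])
      fix a assume "a \<in> {..<n}"
      then show "(\<Sum>l<N. gs_proj N j z i l * z (l, a)) * x a = (if a = j then gs_resid N j z i * x j else 0)"
        using gs_proj_kills[of a j i N z] i above[of a] by (cases a j rule: linorder_cases) (auto simp: gs_resid_def)
    qed
    also have "\<dots> = gs_resid N j z i * x j" using j by simp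
    finally show ?thesis using j by simp
  qed
  then have "gs_norm N j z = 0" by (simp add: gs_norm_def)
  then show False using full j by simp
qed

section \<open>The zero-forcing matrix after a change of basis\<close>

context
  fixes Nr n k :: nat and z :: "nat \<times> nat \<Rightarrow> complex" and G N N' :: "complex mat" and \<rho> :: real
  assumes G: "G \<in> carrier_mat Nr n" and N: "N \<in> carrier_mat n n" "N' \<in> carrier_mat n n"
    and inv: "N * N' = 1\<^sub>m n" "N' * N = 1\<^sub>m n"
    and GZ: "\<And>i b. i < Nr \<Longrightarrow> b < n \<Longrightarrow> G $$ (i, b) = (\<Sum>a<n. z (i, a) * N $$ (a, b))"
    and k: "k < n" and row: "\<And>a. a < n \<Longrightarrow> N' $$ (k, a) = (if a = n - 1 then of_real \<rho> else 0)"
begin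

lemma inv_entries:
  "a < n \<Longrightarrow> b < n \<Longrightarrow> (\<Sum>c<n. N $$ (a, c) * N' $$ (c, b)) = of_bool (a = b)"
  "a < n \<Longrightarrow> b < n \<Longrightarrow> (\<Sum>c<n. N' $$ (a, c) * N $$ (c, b)) = of_bool (a = b)"
proof -
  assume ab: "a < n" "b < n"
  show "(\<Sum>c<n. N $$ (a, c) * N' $$ (c, b)) = of_bool (a = b)"
    unfolding mat_mult_index[OF N(1) N(2) ab, symmetric] inv(1) using ab by simp
  show "(\<Sum>c<n. N' $$ (a, c) * N $$ (c, b)) = of_bool (a = b)"
    unfolding mat_mult_index[OF N(2) N(1) ab, symmetric] inv(2) using ab by simp
qed

lemma column_entries: "i < Nr \<Longrightarrow> a < n \<Longrightarrow> z (i, a) = (\<Sum>b<n. G $$ (i, b) * N' $$ (b, a))"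
proof -
  assume i: "i < Nr" and a: "a < n"
  have "(\<Sum>b<n. G $$ (i, b) * N' $$ (b, a)) = (\<Sum>b<n. \<Sum>c<n. z (i, c) * (N $$ (c, b) * N' $$ (b, a)))"
    by (simp add: GZ[OF i] sum_distrib_right mult.assoc)
  also have "\<dots> = (\<Sum>c<n. z (i, c) * (\<Sum>b<n. N $$ (c, b) * N' $$ (b, a)))"
    unfolding sum_distrib_left by (rule sum.swap)
  also have "\<dots> = z (i, a)" using a by (simp add: inv_entries of_bool_def if_distrib[of "\<lambda>x. _ * x"] cong: if_cong)
  finally show ?thesis by simp
qed

text \<open>Row \<open>k\<close> of the zero-forcing matrix is the only left inverse row in the span
  of the rows of the adjoint of \<open>G\<close>. The scaled dual vector lies in this span, and it
  is a left inverse row because row \<open>k\<close> of \<open>N'\<close> is supported on the last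
  coordinate.\<close>

lemma zf_full:
  assumes full: "\<And>a. a < n \<Longrightarrow> gs_norm Nr a z \<noteq> 0"
  shows "det (mat_adjoint G * G) \<noteq> 0"
    and "\<And>i. i < Nr \<Longrightarrow> zf_matrix G $$ (k, i) = of_real \<rho> * gs_row Nr (n - 1) z i"
proof -
  have n: "n - 1 < n" "Suc (n - 1) = n" using k by auto
  note G' = mat_adjoint_carrier[OF G]
  show det: "det (mat_adjoint G * G) \<noteq> 0"
  proof (rule det_gram_nonzero[OF G])
    fix x assume x: "x \<in> carrier_vec n" "G *\<^sub>v x = 0\<^sub>v Nr"
    define y where "y a = (\<Sum>b<n. N $$ (a, b) * x $ b)" for a
    have "(\<Sum>a<n. z (i, a) * y a) = 0" if i: "i < Nr" for i
    proof -
      have "(\<Sum>a<n. z (i, a) * y a) = (\<Sum>a<n. \<Sum>b<n. z (i, a) * N $$ (a, b) * x $ b)"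
        by (simp add: y_def sum_distrib_left mult.assoc)
      also have "\<dots> = (\<Sum>b<n. G $$ (i, b) * x $ b)"
        by (subst sum.swap) (simp add: GZ[OF i] sum_distrib_right)
      also have "\<dots> = (G *\<^sub>v x) $ i" by (rule mat_mult_vec_index[OF G x(1) i, symmetric])
      finally show ?thesis using x(2) i by simp
    qed
    then have y0: "y a = 0" if "a < n" for a using gs_full_rank[of n Nr z y a] full that by blast
    have "x $ c = 0" if c: "c < n" for c
    proof -
      have "x $ c = (\<Sum>b<n. (\<Sum>a<n. N' $$ (c, a) * N $$ (a, b)) * x $ b)"
        using c by (simp add: inv_entries of_bool_def if_distrib[of "\<lambda>x. x * _"] cong: if_cong)
      also have "\<dots> = (\<Sum>a<n. N' $$ (c, a) * y a)"
        unfolding y_def sum_distrib_left sum_distrib_right mult.assoc by (rule sum.swap)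
      also have "\<dots> = 0" using y0 by simp
      finally show ?thesis .
    qed
    then show "x = 0\<^sub>v n" using x by (intro eq_vecI) auto
  qed
  define B where "B = mat_inv (mat_adjoint G * G)"
  have GG: "mat_adjoint G * G \<in> carrier_mat n n" using G G' by simp
  note B = mat_inv_nonsingular[OF GG det, folded B_def]
  obtain y where y: "\<And>i. i < Nr \<Longrightarrow> gs_resid Nr (n - 1) z i = (\<Sum>a<n. z (i, a) * y a)"
    using gs_resid_span[of "n - 1" Nr z] n by auto
  \<comment> \<open>Coefficients of the candidate in the rows of the adjoint of \<open>G\<close>:
    the residual is a combination \<open>y\<close> of the columns of \<open>z\<close>, and those are
    the columns of \<open>G\<close> times \<open>N'\<close>.\<close>
  define c where "c b = of_real \<rho> * (\<Sum>a<n. cnj (N' $$ (b, a) * y a)) / of_real (gs_norm Nr (n - 1) z)" for b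
  have u: "of_real \<rho> * gs_row Nr (n - 1) z i = (\<Sum>b<n. c b * cnj (G $$ (i, b)))" if i: "i < Nr" for i
  proof -
    have "gs_resid Nr (n - 1) z i = (\<Sum>a<n. \<Sum>b<n. G $$ (i, b) * (N' $$ (b, a) * y a))"
      unfolding y[OF i] using i by (simp add: column_entries sum_distrib_right mult.assoc)
    also have "\<dots> = (\<Sum>b<n. G $$ (i, b) * (\<Sum>a<n. N' $$ (b, a) * y a))"
      unfolding sum_distrib_left by (rule sum.swap)
    finally show ?thesis
      by (simp add: gs_row_def c_def sum_distrib_left sum_divide_distrib mult_ac)
  qed
  \<comment> \<open>So \<open>c\<close> times the Gram matrix is the \<open>k\<close>-th unit row,
    which forces \<open>c\<close> to be row \<open>k\<close> of the inverse.\<close>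
  have cG: "(\<Sum>b<n. c b * (mat_adjoint G * G) $$ (b, d)) = of_bool (k = d)" if d: "d < n" for d
  proof -
    have "(\<Sum>b<n. c b * (mat_adjoint G * G) $$ (b, d)) = (\<Sum>b<n. \<Sum>i<Nr. c b * cnj (G $$ (i, b)) * G $$ (i, d))"
      using d by (simp add: gram_index[OF G] sum_distrib_left mult.assoc)
    also have "\<dots> = (\<Sum>i<Nr. (of_real \<rho> * gs_row Nr (n - 1) z i) * G $$ (i, d))"
      by (subst sum.swap, rule sum.cong[OF refl], simp only: lessThan_iff u sum_distrib_right)
    also have "\<dots> = (\<Sum>i<Nr. \<Sum>a<n. of_real \<rho> * (gs_row Nr (n - 1) z i * z (i, a)) * N $$ (a, d))"
      using d by (simp add: GZ sum_distrib_left mult_ac)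
    also have "\<dots> = (\<Sum>a<n. of_real \<rho> * (\<Sum>i<Nr. gs_row Nr (n - 1) z i * z (i, a)) * N $$ (a, d))"
      unfolding sum_distrib_left sum_distrib_right by (rule sum.swap)
    also have "\<dots> = (\<Sum>a<n. N' $$ (k, a) * N $$ (a, d))"
    proof (rule sum.cong[OF refl])
      fix a assume "a \<in> {..<n}"
      then have a: "a < n" "a \<le> n - 1" by auto
      show "of_real \<rho> * (\<Sum>i<Nr. gs_row Nr (n - 1) z i * z (i, a)) * N $$ (a, d) = N' $$ (k, a) * N $$ (a, d)"
        unfolding gs_row_inner[OF full[OF n(1)] a(2)] row[OF a(1)] by simp
    qed
    also have "\<dots> = of_bool (k = d)" using k d by (rule inv_entries)
    finally show ?thesis .
  qed
  have cB: "c b = B $$ (k, b)" if b: "b < n" for b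
  proof -
    have "c b = (\<Sum>a<n. c a * ((mat_adjoint G * G) * B) $$ (a, b))"
      unfolding B(3) using b by (simp add: if_distrib[of "\<lambda>x. _ * x"] cong: if_cong)
    also have "\<dots> = (\<Sum>a<n. c a * (\<Sum>d<n. (mat_adjoint G * G) $$ (a, d) * B $$ (d, b)))"
    proof (rule sum.cong[OF refl])
      fix a assume "a \<in> {..<n}"
      then show "c a * ((mat_adjoint G * G) * B) $$ (a, b) = c a * (\<Sum>d<n. (mat_adjoint G * G) $$ (a, d) * B $$ (d, b))"
        by (subst mat_mult_index[OF GG B(1) _ b]) auto
    qed
    also have "\<dots> = (\<Sum>d<n. (\<Sum>a<n. c a * (mat_adjoint G * G) $$ (a, d)) * B $$ (d, b))"
      unfolding sum_distrib_left sum_distrib_right mult.assoc by (rule sum.swap)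
    also have "\<dots> = B $$ (k, b)"
      using k by (simp add: cG of_bool_def if_distrib[of "\<lambda>x. x * _"] cong: if_cong del: index_mult_mat)
    finally show ?thesis .
  qed
  show "zf_matrix G $$ (k, i) = of_real \<rho> * gs_row Nr (n - 1) z i" if i: "i < Nr" for i
  proof -
    have "zf_matrix G $$ (k, i) = (\<Sum>b<n. B $$ (k, b) * cnj (G $$ (i, b)))"
      unfolding zf_matrix_def B_def[symmetric] mat_mult_index[OF B(1) G' k i]
      using i by (intro sum.cong refl) (simp add: mat_adjoint_index[OF G])
    then show ?thesis unfolding u[OF i] by (simp add: cB)
  qed
qed

text \<open>A vanishing residual is a linear relation among the columns of \<open>z\<close>,
  transported by \<open>N'\<close> to a kernel vector of \<open>G\<close>. The totalized
  \<open>mat_inv\<close> then returns zero, which settles the output of the receiver on the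
  degenerate event as well.\<close>

lemma zf_not_full:
  assumes a: "a < n" "gs_norm Nr a z = 0"
  shows "zf_matrix G = 0\<^sub>m n Nr"
proof -
  obtain y where y: "y a = 1" "\<And>i. i < Nr \<Longrightarrow> gs_resid Nr a z i = (\<Sum>b<Suc a. z (i, b) * y b)"
    using gs_resid_span[of a Nr z] by auto
  \<comment> \<open>The relation has coefficient 1 at \<open>a\<close>, hence is nontrivial.\<close>
  define u where "u b = (if b \<le> a then y b else 0)" for b
  have u0: "(\<Sum>b<n. z (i, b) * u b) = 0" if i: "i < Nr" for i
  proof -
    have "(\<Sum>b<n. z (i, b) * u b) = (\<Sum>b<Suc a. z (i, b) * y b)"
      using a(1) by (intro sum.mono_neutral_cong_right) (auto simp: u_def)
    then show ?thesis using y(2)[OF i] gs_norm_eq_0[OF a(2) i] by simp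
  qed
  define x where "x = Matrix.vec n (\<lambda>c. \<Sum>b<n. N' $$ (c, b) * u b)"
  have x: "x \<in> carrier_vec n" by (simp add: x_def)
  have Nx: "(\<Sum>c<n. N $$ (b, c) * x $ c) = u b" if b: "b < n" for b
  proof -
    have "(\<Sum>c<n. N $$ (b, c) * x $ c) = (\<Sum>c<n. \<Sum>d<n. N $$ (b, c) * N' $$ (c, d) * u d)"
      by (simp add: x_def sum_distrib_left mult.assoc)
    also have "\<dots> = (\<Sum>d<n. (\<Sum>c<n. N $$ (b, c) * N' $$ (c, d)) * u d)"
      by (subst sum.swap) (simp add: sum_distrib_right)
    also have "\<dots> = u b" using b by (simp add: inv_entries of_bool_def if_distrib[of "\<lambda>x. x * _"] cong: if_cong)
    finally show ?thesis .
  qed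
  have x0: "x \<noteq> 0\<^sub>v n"
  proof
    assume "x = 0\<^sub>v n"
    then have "u a = 0" using Nx[OF a(1)] by simp
    then show False using y(1) by (simp add: u_def)
  qed
  have "(G *\<^sub>v x) $ i = 0" if i: "i < Nr" for i
  proof -
    have "(G *\<^sub>v x) $ i = (\<Sum>c<n. \<Sum>b<n. z (i, b) * (N $$ (b, c) * x $ c))"
      unfolding mat_mult_vec_index[OF G x i] by (simp add: GZ[OF i] sum_distrib_right mult.assoc)
    also have "\<dots> = (\<Sum>b<n. z (i, b) * (\<Sum>c<n. N $$ (b, c) * x $ c))"
      unfolding sum_distrib_left by (rule sum.swap)
    also have "\<dots> = 0" using u0[OF i] by (simp add: Nx)
    finally show ?thesis .
  qed
  then have Gx: "G *\<^sub>v x = 0\<^sub>v Nr" using G by (intro eq_vecI) auto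
  note G' = mat_adjoint_carrier[OF G]
  have GG: "mat_adjoint G * G \<in> carrier_mat n n" using G G' by simp
  show ?thesis
    unfolding zf_matrix_def mat_inv_singular[OF GG det_gram_zero[OF G x x0 Gx]]
    using G' by (rule left_mult_zero_mat)
qed

end

text \<open>A Householder reflection.\<close>
lemma orthonormal_extension:
  assumes l: "l < n" and y: "(\<Sum>i<n. (cmod (y i))\<^sup>2) = 1"
  obtains R :: "nat \<Rightarrow> nat \<Rightarrow> complex" where
    "\<And>a b. a < n \<Longrightarrow> b < n \<Longrightarrow> (\<Sum>i<n. cnj (R i a) * R i b) = of_bool (a = b)"
    "\<And>a b. a < n \<Longrightarrow> b < n \<Longrightarrow> (\<Sum>i<n. R a i * cnj (R b i)) = of_bool (a = b)"
    "\<And>i. i < n \<Longrightarrow> R i l = y i"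
proof -
  \<comment> \<open>A phase that makes \<open>cnj \<theta> * y l\<close> real, so that a reflection
    can carry the \<open>l\<close>-th unit vector to \<open>cnj \<theta> * y\<close>; the factor
    \<theta> in \<open>R\<close> undoes it.\<close>
  define \<theta> where "\<theta> = (if y l = 0 then 1 else sgn (y l))"
  have \<theta>: "cmod \<theta> = 1" by (simp add: \<theta>_def norm_sgn)
  have "\<theta> * cnj \<theta> = of_real ((cmod \<theta>)\<^sup>2)" by (simp only: complex_norm_square)
  then have \<theta>\<theta>: "\<theta> * cnj \<theta> = 1" "cnj \<theta> * \<theta> = 1" by (simp_all add: \<theta> mult.commute)
  have \<theta>y: "cnj \<theta> * y l = of_real (cmod (y l))"
  proof (cases "y l = 0")
    case False
    have "y l = \<theta> * of_real (cmod (y l))" using False by (simp add: \<theta>_def sgn_div_norm scaleR_conv_of_real)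
    then have "cnj \<theta> * y l = (cnj \<theta> * \<theta>) * of_real (cmod (y l))" by (metis mult.assoc)
    then show ?thesis by (simp add: \<theta>\<theta>)
  qed (simp add: \<theta>_def)
  define u where "u i = of_bool (i = l) - cnj \<theta> * y i" for i
  define s where "s = (\<Sum>i<n. (cmod (u i))\<^sup>2)"
  have s: "of_real s = (\<Sum>i<n. cnj (u i) * u i)"
    unfolding s_def of_real_sum by (simp only: complex_norm_square mult.commute)
  have ul: "u l = of_real (1 - cmod (y l))" by (simp add: u_def \<theta>y)
  have s2: "s = 2 * (1 - cmod (y l))"
  proof -
    have "(cmod (u i))\<^sup>2 = (cmod (y i))\<^sup>2 + (if i = l then 1 - 2 * cmod (y l) else 0)" for i
    proof (cases "i = l")
      case True
      then show ?thesis using ul by (simp add: power2_eq_square algebra_simps norm_of_real del: of_real_diff)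
    qed (simp add: u_def norm_mult \<theta>)
    then have "s = 1 + (1 - 2 * cmod (y l))" using l y by (simp add: s_def sum.distrib)
    then show ?thesis by simp
  qed
  \<comment> \<open>For \<open>s = 0\<close> the two vectors coincide; the quotient in
    \<open>h\<close> is then 0 and the reflection is the identity.\<close>
  have u0: "u i = 0" if "s = 0" "i < n" for i
    using that unfolding s_def by (subst (asm) sum_nonneg_eq_0_iff) auto
  define h where "h i j = of_bool (i = j) - 2 * u i * cnj (u j) / of_real s" for i j
  have hh: "(\<Sum>i<n. h a i * h i b) = of_bool (a = b)" if "a < n" "b < n" for a b
  proof (cases "s = 0")
    case True
    then show ?thesis using that by (simp add: h_def of_bool_def if_distrib[of "\<lambda>x. x * _"] cong: if_cong)
  next
    case False
    have "(\<Sum>i<n. h a i * h i b) = (\<Sum>i<n. of_bool (a = i) * of_bool (i = b)) - 2 * cnj (u b) / of_real s * (\<Sum>i<n. of_bool (a = i) * u i)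
       - 2 * u a / of_real s * (\<Sum>i<n. of_bool (i = b) * cnj (u i)) + (2 * u a / of_real s) * (2 * cnj (u b) / of_real s) * (\<Sum>i<n. cnj (u i) * u i)"
    proof -
      have alg: "(p - 2 * x * c / t) * (q - 2 * v * e / t) = p * q - 2 * e / t * (p * v) - 2 * x / t * (q * c) + (2 * x / t) * (2 * e / t) * (c * v)"
        for p q x c v e t :: complex by (simp add: algebra_simps diff_divide_distrib)
      show ?thesis unfolding h_def alg by (simp only: sum.distrib sum_subtractf sum_distrib_left)
    qed
    also have "\<dots> = of_bool (a = b)"
    proof -
      have d: "(\<Sum>i<n. of_bool (a = i) * of_bool (i = b)) = (of_bool (a = b) :: complex)"
        "(\<Sum>i<n. of_bool (a = i) * u i) = u a" "(\<Sum>i<n. of_bool (i = b) * cnj (u i)) = cnj (u b)"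
        using that by (simp_all add: of_bool_def if_distrib[of "\<lambda>x. x * _"] cong: if_cong)
      show ?thesis unfolding s[symmetric] d using False by (simp add: field_simps)
    qed
    finally show ?thesis .
  qed
  have hc: "cnj (h i j) = h j i" for i j by (cases "i = j") (auto simp: h_def mult_ac)
  define R where "R i j = \<theta> * h i j" for i j
  show thesis
  proof
    show "(\<Sum>i<n. cnj (R i a) * R i b) = of_bool (a = b)" if "a < n" "b < n" for a b
    proof -
      have "cnj (R i a) * R i b = (cnj \<theta> * \<theta>) * (h a i * h i b)" for i by (simp add: R_def hc mult_ac)
      then show ?thesis using hh[OF that] by (simp add: \<theta>\<theta>)
    qed
    show "(\<Sum>i<n. R a i * cnj (R b i)) = of_bool (a = b)" if "a < n" "b < n" for a b
    proof -
      have "R a i * cnj (R b i) = (\<theta> * cnj \<theta>) * (h a i * h i b)" for i by (simp add: R_def hc mult_ac)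
      then show ?thesis using hh[OF that] by (simp add: \<theta>\<theta>)
    qed
    show "R i l = y i" if "i < n" for i
    proof -
      have "2 * u i * cnj (u l) / of_real s = u i"
      proof (cases "s = 0")
        case False
        have "2 * cnj (u l) = of_real s" unfolding ul s2 by simp
        then have "2 * u i * cnj (u l) = u i * of_real s" by (metis mult.assoc mult.commute)
        then show ?thesis using False by (metis nonzero_mult_div_cancel_right of_real_eq_0_iff)
      qed (simp add: u0 that)
      then have "R i l = \<theta> * (cnj \<theta> * y i)" by (simp add: R_def h_def u_def)
      then show ?thesis by (simp add: mult.assoc[symmetric] \<theta>\<theta>)
    qed
  qed
qed

section \<open>The discrete Fourier matrix and the factorization of the precoder\<close>

lemma dft_index:
  assumes "a < n" "b < n"
  shows "dft_matrix n $$ (a, b) = cis (- (2 * pi * real a * real b / real n)) / of_real (sqrt (real n))"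
  using assms by (simp add: dft_matrix_def cis_conv_exp mult_ac)

text \<open>A geometric sum of powers of the root of unity \<open>w\<close>, which differs from 1
  because distinct indices differ by less than \<open>n\<close>.\<close>

lemma dft_orthogonal:
  assumes ab: "a < n" "b < n"
  shows "(\<Sum>c<n. dft_matrix n $$ (a, c) * cnj (dft_matrix n $$ (b, c))) = of_bool (a = b)"
proof -
  have n: "n > 0" using ab by simp
  define w where "w = cis (2 * pi * (real b - real a) / real n)"
  have entry: "dft_matrix n $$ (a, c) * cnj (dft_matrix n $$ (b, c)) = w ^ c / of_nat n" if "c < n" for c
  proof -
    have "dft_matrix n $$ (a, c) * cnj (dft_matrix n $$ (b, c)) =
      (cis (- (2 * pi * real a * real c / real n)) * cis (- (- (2 * pi * real b * real c / real n)))) / (of_real (sqrt (real n)) * of_real (sqrt (real n)))"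
      using ab that by (simp only: dft_index cis_cnj complex_cnj_divide complex_cnj_complex_of_real times_divide_times_eq)
    also have "of_real (sqrt (real n)) * of_real (sqrt (real n)) = (of_nat n :: complex)"
      by (simp flip: of_real_mult)
    also have "cis (- (2 * pi * real a * real c / real n)) * cis (- (- (2 * pi * real b * real c / real n))) = w ^ c"
      unfolding w_def Complex.DeMoivre cis_mult by (rule arg_cong[where f=cis]) (simp add: diff_divide_distrib right_diff_distrib mult_ac)
    finally show ?thesis .
  qed
  have total: "(\<Sum>c<n. dft_matrix n $$ (a, c) * cnj (dft_matrix n $$ (b, c))) = (\<Sum>c<n. w ^ c / of_nat n)"
    by (rule sum.cong[OF refl], simp only: lessThan_iff entry)
  show ?thesis
  proof (cases "a = b")
    case True
    then have "w = 1" by (simp add: w_def)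
    then show ?thesis using True n unfolding total by simp
  next
    case False
    have "w \<noteq> 1"
    proof
      assume "w = 1"
      then have "cos (2 * pi * (real b - real a) / real n) = 1" by (simp add: w_def complex_eq_iff)
      then obtain m :: int where m: "2 * pi * (real b - real a) / real n = of_int m * 2 * pi"
        using cos_one_2pi_int by auto
      then have "pi * (2 * (real b - real a)) = pi * (2 * (of_int m * real n))" using n by (simp add: field_simps)
      then have "real b - real a = of_int m * real n" by simp
      then have "real_of_int (int b - int a) = real_of_int (m * int n)" by simp
      then have eq: "int b - int a = m * int n" by (simp only: of_int_eq_iff)
      have "\<bar>int b - int a\<bar> < int n" using ab by simp
      then have "\<bar>m\<bar> * int n < 1 * int n" unfolding eq by (simp add: abs_mult)
      then have "\<bar>m\<bar> < 1" using n by simp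
      then show False using eq False by simp
    qed
    moreover have "w ^ n = 1"
    proof -
      have "w ^ n = cis (2 * pi * (real b - real a))" unfolding w_def Complex.DeMoivre using n by simp
      also have "\<dots> = cis (2 * pi * of_int (int b - int a))" by simp
      also have "\<dots> = 1" by (rule cis_multiple_2pi) simp
      finally show ?thesis .
    qed
    ultimately have "(\<Sum>c<n. w ^ c) = 0" by (simp add: geometric_sum)
    then show ?thesis using False unfolding total by (simp add: sum_divide_distrib[symmetric])
  qed
qed

lemma dft_symmetric: "a < n \<Longrightarrow> b < n \<Longrightarrow> dft_matrix n $$ (a, b) = dft_matrix n $$ (b, a)"
  by (simp add: dft_index mult_ac)

lemma dft_orthogonal':
  assumes "a < n" "b < n"
  shows "(\<Sum>c<n. cnj (dft_matrix n $$ (c, a)) * dft_matrix n $$ (c, b)) = of_bool (a = b)"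
proof -
  have "(\<Sum>c<n. cnj (dft_matrix n $$ (c, a)) * dft_matrix n $$ (c, b)) = (\<Sum>c<n. dft_matrix n $$ (b, c) * cnj (dft_matrix n $$ (a, c)))"
    using assms by (intro sum.cong refl) (simp add: dft_symmetric[of _ n a] dft_symmetric[of _ n b] mult.commute)
  also have "\<dots> = of_bool (b = a)" by (rule dft_orthogonal[OF assms(2,1)])
  finally show ?thesis by (cases "a = b") simp_all
qed

text \<open>Used to insert or remove the Fourier matrix and the unitary factor \<open>R\<close>
  inside a product.\<close>

lemma orthonormal_sandwich:
  fixes A E :: "nat \<Rightarrow> complex"
  assumes "\<And>i j. i < n \<Longrightarrow> j < n \<Longrightarrow> (\<Sum>a<n. B i a * C a j) = of_bool (i = j)"
  shows "(\<Sum>a<n. (\<Sum>i<n. A i * B i a) * (\<Sum>j<n. C a j * E j)) = (\<Sum>i<n. A i * E i)"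
proof -
  have "(\<Sum>a<n. (\<Sum>i<n. A i * B i a) * (\<Sum>j<n. C a j * E j)) = (\<Sum>a<n. \<Sum>i<n. \<Sum>j<n. A i * (B i a * C a j) * E j)"
    by (simp add: sum_product mult.assoc)
  also have "\<dots> = (\<Sum>i<n. \<Sum>j<n. \<Sum>a<n. A i * (B i a * C a j) * E j)"
    by (subst sum.swap, rule sum.cong[OF refl], rule sum.swap)
  also have "\<dots> = (\<Sum>i<n. \<Sum>j<n. A i * of_bool (i = j) * E j)"
    by (intro sum.cong refl) (simp add: assms sum_distrib_right[symmetric] sum_distrib_left[symmetric])
  also have "\<dots> = (\<Sum>i<n. A i * E i)"
    by (simp add: of_bool_def if_distrib[of "\<lambda>x. _ * x"] if_distrib[of "\<lambda>x. x * _"] cong: if_cong)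
  finally show ?thesis .
qed

text \<open>With \<open>c = 1 / sqrt t\<close>, the Fourier matrix \<open>V\<close> and a unitary
  \<open>R\<close>, the factors are \<open>W D^(-1/2) R\<close> for \<open>T\<close> and the adjoint
  of \<open>R\<close> times \<open>c D^(1/4) V\<close> for \<open>N\<close>. Row \<open>k\<close> of
  the inverse of \<open>c D^(1/4) V\<close> has length \<rho>; the last column \<open>y\<close> of
  \<open>R\<close> is the adjoint of that row divided by \<rho>. Multiplying the row by
  \<open>R\<close> therefore gives \<rho> in the last place and 0 elsewhere.\<close>

lemma precoder_factorization:
  assumes eig: "eigen_decomposition n A W d" and d: "\<And>i. i < n \<Longrightarrow> 0 < d i" and k: "k < n"
  obtains T N N' where
    "T \<in> carrier_mat n n" "N \<in> carrier_mat n n" "N' \<in> carrier_mat n n"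
    "N * N' = 1\<^sub>m n" "N' * N = 1\<^sub>m n" "precoder n W d = T * N"
    "\<And>a b. a < n \<Longrightarrow> b < n \<Longrightarrow> (\<Sum>p<n. \<Sum>q<n. cnj (T $$ (p, a)) * T $$ (q, b) * A $$ (p, q)) = of_bool (a = b)"
    "\<And>a. a < n \<Longrightarrow> N' $$ (k, a) = (if a = n - 1 then of_real ((\<Sum>i<n. 1 / sqrt (d i)) / sqrt (real n)) else 0)"
proof -
  have n: "n > 0" "n - 1 < n" using k by auto
  define V where "V a b = dft_matrix n $$ (a, b)" for a b
  have VV: "(\<Sum>c<n. V a c * cnj (V b c)) = of_bool (a = b)" "(\<Sum>c<n. cnj (V c a) * V c b) = of_bool (a = b)" if "a < n" "b < n" for a b
    unfolding V_def using that by (rule dft_orthogonal dft_orthogonal')+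
  have Vnorm: "(cmod (V i k))\<^sup>2 = 1 / real n" if "i < n" for i
    unfolding V_def using dft_index[OF that k] by (simp add: norm_divide power_divide)
  define t where "t = (\<Sum>i<n. 1 / sqrt (d i))"
  have t: "t > 0" unfolding t_def using d n by (intro sum_pos) auto
  \<comment> \<open>The squared length of row \<open>k\<close> is the sum of
    \<open>|V i k|^2 / (c * e i)^2\<close>, that is of \<open>(1 / n) * t / sqrt (d i)\<close>,
    which equals \<open>t^2 / n\<close>.\<close>
  define \<rho> where "\<rho> = t / sqrt (real n)"
  have \<rho>: "\<rho> > 0" using t n by (simp add: \<rho>_def)
  define e where "e i = d i powr (1 / 4)" for i
  have e: "e i > 0" "e i * e i = sqrt (d i)" "d i powr (- 1 / 4) = 1 / e i" "d i powr (- 1 / 2) = 1 / sqrt (d i)" if "i < n" for i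
  proof -
    have di: "d i > 0" using d that by simp
    then show "e i > 0" by (simp add: e_def)
    have "e i * e i = d i powr (1 / 2)" unfolding e_def powr_add[symmetric] by simp
    also have "\<dots> = sqrt (d i)" using di by (simp add: powr_half_sqrt)
    finally show "e i * e i = sqrt (d i)" .
    show "d i powr (- 1 / 4) = 1 / e i" unfolding e_def using powr_minus_divide[of "d i" "1 / 4"] by simp
    show "d i powr (- 1 / 2) = 1 / sqrt (d i)" using di powr_minus_divide[of "d i" "1 / 2"] by (simp add: powr_half_sqrt)
  qed
  define c where "c = 1 / sqrt t"
  have c: "c > 0" "c * c = 1 / t" using t by (auto simp: c_def)
  define y where "y i = V i k / (of_real (c * e i * \<rho>))" for i
  have "(\<Sum>i<n. (cmod (y i))\<^sup>2) = (\<Sum>i<n. (1 / sqrt (d i)) * (1 / t))"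
  proof (rule sum.cong[OF refl])
    fix i assume "i \<in> {..<n}"
    then have i: "i < n" by simp
    have "(cmod (y i))\<^sup>2 = (cmod (V i k))\<^sup>2 / ((c * c) * (e i * e i) * (\<rho> * \<rho>))"
      using c(1) e(1)[OF i] \<rho> by (simp add: y_def norm_divide norm_mult power_divide power_mult_distrib power2_eq_square mult_ac)
    also have "\<rho> * \<rho> = t * t / real n" using n by (simp add: \<rho>_def)
    also have "(cmod (V i k))\<^sup>2 / ((c * c) * (e i * e i) * (t * t / real n)) = (1 / sqrt (d i)) * (1 / t)"
      unfolding c(2) e(2)[OF i] Vnorm[OF i] using t n d[OF i] by (simp add: field_simps)
    finally show "(cmod (y i))\<^sup>2 = (1 / sqrt (d i)) * (1 / t)" .
  qed
  also have "\<dots> = 1" unfolding sum_distrib_right[symmetric] t_def[symmetric] using t by simp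
  finally have y1: "(\<Sum>i<n. (cmod (y i))\<^sup>2) = 1" .
  obtain R :: "nat \<Rightarrow> nat \<Rightarrow> complex" where
    R: "\<And>a b. a < n \<Longrightarrow> b < n \<Longrightarrow> (\<Sum>i<n. cnj (R i a) * R i b) = of_bool (a = b)"
      "\<And>a b. a < n \<Longrightarrow> b < n \<Longrightarrow> (\<Sum>i<n. R a i * cnj (R b i)) = of_bool (a = b)"
      "\<And>i. i < n \<Longrightarrow> R i (n - 1) = y i"
    using orthonormal_extension[OF n(2) y1] by blast
  note W = eigen_decompositionD[OF eig]
  define T where "T = mat n n (\<lambda>(p, a). \<Sum>i<n. (W $$ (p, i) / of_real (sqrt (d i))) * R i a)"
  define N where "N = mat n n (\<lambda>(a, b). \<Sum>i<n. cnj (R i a) * (of_real (c * e i) * V i b))"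
  define N' where "N' = mat n n (\<lambda>(a, b). \<Sum>i<n. cnj (V i a) * (R i b / of_real (c * e i)))"
  have TN[simp]: "T \<in> carrier_mat n n" "N \<in> carrier_mat n n" "N' \<in> carrier_mat n n"
    by (simp_all add: T_def N_def N'_def)
  show thesis
  proof
    show "N * N' = 1\<^sub>m n"
    proof (rule eq_matI)
      fix a b assume "a < dim_row (1\<^sub>m n :: complex mat)" "b < dim_col (1\<^sub>m n :: complex mat)"
      then have ab: "a < n" "b < n" by auto
      have "(N * N') $$ (a, b) = (\<Sum>j<n. (\<Sum>i<n. (cnj (R i a) * of_real (c * e i)) * V i j) * (\<Sum>i<n. cnj (V i j) * (R i b / of_real (c * e i))))"
        unfolding mat_mult_index[OF TN(2,3) ab] using ab by (intro sum.cong refl) (simp add: N_def N'_def mult.assoc)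
      also have "\<dots> = (\<Sum>i<n. (cnj (R i a) * of_real (c * e i)) * (R i b / of_real (c * e i)))"
        by (rule orthonormal_sandwich) (rule VV)
      also have "\<dots> = (\<Sum>i<n. cnj (R i a) * R i b)"
        using c e(1) by (intro sum.cong refl) (simp add: less_imp_neq[symmetric])
      finally show "(N * N') $$ (a, b) = 1\<^sub>m n $$ (a, b)" using ab R(1) by simp
    qed (simp_all add: carrier_matD[OF TN(2)] carrier_matD[OF TN(3)])
    show "N' * N = 1\<^sub>m n"
    proof (rule eq_matI)
      fix a b assume "a < dim_row (1\<^sub>m n :: complex mat)" "b < dim_col (1\<^sub>m n :: complex mat)"
      then have ab: "a < n" "b < n" by auto
      have "(N' * N) $$ (a, b) = (\<Sum>j<n. (\<Sum>i<n. (cnj (V i a) / of_real (c * e i)) * R i j) * (\<Sum>i<n. cnj (R i j) * (of_real (c * e i) * V i b)))"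
        unfolding mat_mult_index[OF TN(3,2) ab] using ab by (intro sum.cong refl) (simp add: N_def N'_def)
      also have "\<dots> = (\<Sum>i<n. (cnj (V i a) / of_real (c * e i)) * (of_real (c * e i) * V i b))"
        by (rule orthonormal_sandwich) (rule R(2))
      also have "\<dots> = (\<Sum>i<n. cnj (V i a) * V i b)"
        using c e(1) by (intro sum.cong refl) (simp add: less_imp_neq[symmetric])
      finally show "(N' * N) $$ (a, b) = 1\<^sub>m n $$ (a, b)" using ab VV(2) by simp
    qed (simp_all add: carrier_matD[OF TN(2)] carrier_matD[OF TN(3)])
    show "precoder n W d = T * N"
    proof (rule eq_matI)
      fix p b assume "p < dim_row (T * N)" "b < dim_col (T * N)"
      then have pb: "p < n" "b < n" using TN by auto
      have D: "diag_powr n d (- 1 / 4) \<in> carrier_mat n n" by (simp add: diag_powr_def)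
      have F: "dft_matrix n \<in> carrier_mat n n" by (simp add: dft_matrix_def)
      have WD: "W * diag_powr n d (- 1 / 4) \<in> carrier_mat n n" using W(1) D by simp
      have "(\<Sum>i<n. d i powr (- 1 / 2)) = t" unfolding t_def using e(4) by (intro sum.cong refl) simp
      then have "precoder n W d $$ (p, b) = of_real c * (W * diag_powr n d (- 1 / 4) * dft_matrix n) $$ (p, b)"
        unfolding precoder_def c_def
        using pb mult_carrier_mat[OF WD F] by (simp only: carrier_matD index_smult_mat(1))
      also have "(W * diag_powr n d (- 1 / 4) * dft_matrix n) $$ (p, b) = (\<Sum>i<n. W $$ (p, i) * of_real (1 / e i) * V i b)"
        unfolding mat_mult_index[OF WD F pb] V_def[symmetric]
        using pb W(1) by (intro sum.cong refl) (simp add: diag_powr_def mat_diag_mult_right[OF W(1)] e(3)[simplified] del: index_mult_mat(1))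
      also have "of_real c * (\<Sum>i<n. W $$ (p, i) * of_real (1 / e i) * V i b) = (\<Sum>i<n. (W $$ (p, i) / of_real (sqrt (d i))) * (of_real (c * e i) * V i b))"
        unfolding sum_distrib_left
      proof (rule sum.cong[OF refl])
        fix i assume "i \<in> {..<n}"
        then have i: "i < n" by simp
        have "1 / e i = e i / sqrt (d i)" unfolding e(2)[OF i, symmetric] using e(1)[OF i] by simp
        then have "of_real (1 / e i) = (of_real (e i) / of_real (sqrt (d i)) :: complex)" by (simp only: of_real_divide)
        then show "of_real c * (W $$ (p, i) * of_real (1 / e i) * V i b) = (W $$ (p, i) / of_real (sqrt (d i))) * (of_real (c * e i) * V i b)"
          by simp
      qed
      also have "\<dots> = (\<Sum>a<n. (\<Sum>i<n. (W $$ (p, i) / of_real (sqrt (d i))) * R i a) * (\<Sum>i<n. cnj (R i a) * (of_real (c * e i) * V i b)))"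
        by (rule orthonormal_sandwich[symmetric]) (rule R(2))
      also have "\<dots> = (T * N) $$ (p, b)"
        unfolding mat_mult_index[OF TN(1,2) pb] using pb by (intro sum.cong refl) (simp add: T_def N_def)
      finally show "precoder n W d $$ (p, b) = (T * N) $$ (p, b)" .
    qed (use W(1) in \<open>simp_all add: precoder_def dft_matrix_def carrier_matD[OF TN(1)] carrier_matD[OF TN(2)]\<close>)
    show "(\<Sum>p<n. \<Sum>q<n. cnj (T $$ (p, a)) * T $$ (q, b) * A $$ (p, q)) = of_bool (a = b)" if ab: "a < n" "b < n" for a b
    proof -
      have WT: "(\<Sum>q<n. T $$ (q, b) * cnj (W $$ (q, l))) = R l b / of_real (sqrt (d l))" if l: "l < n" and b: "b < n" for l b
      proof -
        have "(\<Sum>q<n. T $$ (q, b) * cnj (W $$ (q, l))) = (\<Sum>q<n. \<Sum>i<n. (R i b / of_real (sqrt (d i))) * (cnj (W $$ (q, l)) * W $$ (q, i)))"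
          using b by (simp add: T_def sum_distrib_right sum_distrib_left mult_ac)
        also have "\<dots> = (\<Sum>i<n. (R i b / of_real (sqrt (d i))) * (\<Sum>q<n. cnj (W $$ (q, l)) * W $$ (q, i)))"
          unfolding sum_distrib_left by (rule sum.swap)
        also have "\<dots> = R l b / of_real (sqrt (d l))"
          using l by (simp add: W(2) of_bool_def if_distrib[of "\<lambda>x. _ * x"] cong: if_cong)
        finally show ?thesis .
      qed
      have "(\<Sum>p<n. \<Sum>q<n. cnj (T $$ (p, a)) * T $$ (q, b) * A $$ (p, q)) =
        (\<Sum>p<n. \<Sum>q<n. \<Sum>l<n. of_real (d l) * (cnj (T $$ (p, a)) * W $$ (p, l)) * (T $$ (q, b) * cnj (W $$ (q, l))))"
        by (intro sum.cong refl) (simp add: W(4) sum_distrib_left mult_ac)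
      also have "\<dots> = (\<Sum>p<n. \<Sum>l<n. \<Sum>q<n. of_real (d l) * (cnj (T $$ (p, a)) * W $$ (p, l)) * (T $$ (q, b) * cnj (W $$ (q, l))))"
        by (rule sum.cong[OF refl], rule sum.swap)
      also have "\<dots> = (\<Sum>l<n. \<Sum>p<n. \<Sum>q<n. of_real (d l) * (cnj (T $$ (p, a)) * W $$ (p, l)) * (T $$ (q, b) * cnj (W $$ (q, l))))"
        by (rule sum.swap)
      also have "\<dots> = (\<Sum>l<n. of_real (d l) * cnj (\<Sum>p<n. T $$ (p, a) * cnj (W $$ (p, l))) * (\<Sum>q<n. T $$ (q, b) * cnj (W $$ (q, l))))"
        by (simp add: sum_distrib_left sum_distrib_right mult.assoc) (rule sum.cong[OF refl], rule sum.swap)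
      also have "\<dots> = (\<Sum>l<n. cnj (R l a) * R l b)"
      proof (rule sum.cong[OF refl])
        fix l assume "l \<in> {..<n}"
        then have l: "l < n" by simp
        have "of_real (d l) = (of_real (sqrt (d l)) * of_real (sqrt (d l)) :: complex)" using d[OF l] by (simp flip: of_real_mult)
        moreover have "of_real (sqrt (d l)) \<noteq> (0 :: complex)" using d[OF l] by simp
        ultimately show "of_real (d l) * cnj (\<Sum>p<n. T $$ (p, a) * cnj (W $$ (p, l))) * (\<Sum>q<n. T $$ (q, b) * cnj (W $$ (q, l))) = cnj (R l a) * R l b"
          unfolding WT[OF l ab(1)] WT[OF l ab(2)] by simp
      qed
      also have "\<dots> = of_bool (a = b)" by (rule R(1)[OF ab])
      finally show ?thesis .
    qed
    show "N' $$ (k, a) = (if a = n - 1 then of_real ((\<Sum>i<n. 1 / sqrt (d i)) / sqrt (real n)) else 0)" if a: "a < n" for a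
    proof -
      have "N' $$ (k, a) = (\<Sum>i<n. of_real \<rho> * (cnj (R i (n - 1)) * R i a))"
      proof -
        have "cnj (V i k) * (R i a / of_real (c * e i)) = of_real \<rho> * (cnj (R i (n - 1)) * R i a)" if i: "i < n" for i
          unfolding R(3)[OF i] y_def using \<rho> by (simp add: field_simps)
        then show ?thesis using a k by (simp add: N'_def)
      qed
      also have "\<dots> = of_real \<rho> * of_bool (n - 1 = a)"
        unfolding sum_distrib_left[symmetric] R(1)[OF n(2) a] ..
      finally show ?thesis by (auto simp: \<rho>_def t_def)
    qed
  qed simp_all
qed

section \<open>Symbol error probabilities in Gaussian noise\<close>

text \<open>The tie-breaking choice depends on the set of minimizers alone. There are finitely many
  possible sets, and each occurs on a Borel set of points.\<close>

lemma measurable_nearest: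
  assumes S: "finite S"
  shows "nearest S \<in> borel_measurable borel"
proof (rule borel_measurableI)
  fix X :: "complex set" assume "open X"
  define A where "A z = {x \<in> S. \<forall>y\<in>S. (cmod (z - x))\<^sup>2 \<le> (cmod (z - y))\<^sup>2}" for z
  have near: "nearest S z = (SOME x. x \<in> A z)" for z
    unfolding nearest_def arg_min_on_def arg_min_def is_arg_min_def A_def
    by (rule arg_cong[where f=Eps]) (auto simp: fun_eq_iff not_less)
  have "nearest S -` X = (\<Union>B\<in>{B \<in> Pow S. (SOME x. x \<in> B) \<in> X}. {z. A z = B})"
    unfolding near vimage_def by (auto simp: A_def)
  also have "\<dots> \<in> sets borel"
  proof (rule sets.finite_UN)
    show "finite {B \<in> Pow S. (SOME x. x \<in> B) \<in> X}" using S by simp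
    fix B assume "B \<in> {B \<in> Pow S. (SOME x. x \<in> B) \<in> X}"
    then have "{z. A z = B} = {z \<in> space borel. \<forall>x\<in>S. (\<forall>y\<in>S. (cmod (z - x))\<^sup>2 \<le> (cmod (z - y))\<^sup>2) \<longleftrightarrow> x \<in> B}"
      by (auto simp: A_def)
    also have "\<dots> \<in> sets borel"
    proof (rule sets.sets_Collect_finite_All[OF _ S])
      fix x assume "x \<in> S"
      have m: "{z \<in> space borel. \<forall>y\<in>S. (cmod (z - x))\<^sup>2 \<le> (cmod (z - y))\<^sup>2} \<in> sets borel"
        by (intro sets.sets_Collect_finite_All S borel_measurable_le) measurable
      show "{z \<in> space borel. (\<forall>y\<in>S. (cmod (z - x))\<^sup>2 \<le> (cmod (z - y))\<^sup>2) \<longleftrightarrow> x \<in> B} \<in> sets borel"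
        using m sets.sets_Collect_neg[OF m] by (cases "x \<in> B") simp_all
    qed
    finally show "{z. A z = B} \<in> sets borel" .
  qed
  finally show "nearest S -` X \<inter> space borel \<in> sets borel" by simp
qed

text \<open>The argument \<open>x\<close> is the variance of the complex noise, which in the
  application is a function of the channel.\<close>

definition symbol_error :: "complex set \<Rightarrow> complex \<Rightarrow> real \<Rightarrow> real" where
  "symbol_error S c x = measure cgauss {w. nearest S (c + of_real (sqrt x) * w) \<noteq> c}"

definition sep :: "complex set \<Rightarrow> real \<Rightarrow> real" where
  "sep S x = (\<Sum>c\<in>S. symbol_error S c x) / real (card S)"

lemma symbol_error_bounds: "0 \<le> symbol_error S c x" "symbol_error S c x \<le> 1"
  unfolding symbol_error_def by simp_all

lemma sep_bounds: "0 \<le> sep S x" "sep S x \<le> 1"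
proof -
  show "0 \<le> sep S x" unfolding sep_def by (intro divide_nonneg_nonneg sum_nonneg symbol_error_bounds) simp
  have "(\<Sum>c\<in>S. symbol_error S c x) \<le> (\<Sum>c\<in>S. 1)" by (intro sum_mono symbol_error_bounds)
  then show "sep S x \<le> 1" unfolding sep_def by (cases "card S = 0") (auto simp: divide_le_eq)
qed

text \<open>The error sets for the various \<open>x\<close> are the sections of one measurable set
  in a product, and the measure of a section is measurable. This is what permits integration over
  the channel.\<close>

lemma measurable_symbol_error:
  assumes S: "finite S"
  shows "symbol_error S c \<in> borel_measurable borel"
proof -
  note [measurable] = measurable_nearest[OF S]
  have Q: "{p \<in> space (borel \<Otimes>\<^sub>M cgauss). nearest S (c + of_real (sqrt (fst p)) * snd p) \<noteq> c} \<in> sets (borel \<Otimes>\<^sub>M cgauss)"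
    by measurable
  have "(\<lambda>x. emeasure cgauss (Pair x -` {p \<in> space (borel \<Otimes>\<^sub>M cgauss). nearest S (c + of_real (sqrt (fst p)) * snd p) \<noteq> c})) \<in> borel_measurable borel"
    by (rule cgauss.measurable_emeasure_Pair[OF Q])
  moreover have "Pair x -` {p \<in> space (borel \<Otimes>\<^sub>M cgauss). nearest S (c + of_real (sqrt (fst p)) * snd p) \<noteq> c} = {w. nearest S (c + of_real (sqrt x) * w) \<noteq> c}" for x :: real
    by (auto simp: space_pair_measure)
  ultimately show ?thesis unfolding symbol_error_def[abs_def] measure_def by simp
qed

lemma measurable_sep:
  assumes S: "finite S"
  shows "sep S \<in> borel_measurable borel"
  unfolding sep_def[abs_def] by (intro borel_measurable_divide borel_measurable_sum measurable_symbol_error S borel_measurable_const)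


section \<open>Gaussian tails, half-planes and rectangles\<close>

lemma measure_half_normal_Ioi: "measure half_normal {y<..} = gaussian_Q (sqrt 2 * y)"
proof -
  have "measure half_normal {y<..} = measure std_normal_distribution {x. y < x / sqrt 2}"
    unfolding half_normal_eq_distr by (subst measure_distr) (auto simp: vimage_def greaterThan_def)
  also have "{x. y < x / sqrt 2} = {sqrt 2 * y<..}"
    by (auto simp: less_divide_eq mult.commute)
  also have "measure std_normal_distribution {sqrt 2 * y<..} = (LINT x|std_normal_distribution. indicator {sqrt 2 * y<..} x)"
    by simp
  also have "\<dots> = (LINT x|lborel. std_normal_density x * indicator {sqrt 2 * y<..} x)"
    by (subst integral_density) auto
  also have "\<dots> = (LINT x|lborel. 1 / sqrt (2 * pi) * (indicator {sqrt 2 * y..} x * exp (- x\<^sup>2 / 2)))"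
  proof (rule integral_cong_AE)
    have "AE x in lborel. x \<noteq> sqrt 2 * y" by (rule AE_lborel_singleton)
    then show "AE x in lborel. std_normal_density x * indicator {sqrt 2 * y<..} x = 1 / sqrt (2 * pi) * (indicator {sqrt 2 * y..} x * exp (- x\<^sup>2 / 2))"
      by eventually_elim (auto simp: std_normal_density_def indicator_def)
  qed measurable
  also have "\<dots> = gaussian_Q (sqrt 2 * y)"
    unfolding gaussian_Q_def set_lebesgue_integral_def by simp
  finally show ?thesis .
qed

lemma half_normal_atom: "measure half_normal {y} = 0"
proof -
  have "emeasure half_normal {y} = 0"
    unfolding half_normal_def by (subst emeasure_density) (auto simp: nn_integral_indicator_singleton)
  then show ?thesis by (simp add: measure_def)
qed

lemma measure_half_normal_Iio: "measure half_normal {..<-y} = gaussian_Q (sqrt 2 * y)"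
proof -
  have d: "distr half_normal borel uminus = half_normal"
  proof (rule Levy_uniqueness)
    show "real_distribution (distr half_normal borel uminus)"
      unfolding real_distribution_def real_distribution_axioms_def by (auto intro: half_normal.prob_space_distr)
    show "real_distribution half_normal" by (rule real_distribution_half_normal)
    have "char (distr half_normal borel uminus) t = char half_normal (- t)" for t
      unfolding char_def by (subst integral_distr) auto
    then show "char (distr half_normal borel uminus) = char half_normal"
      by (simp add: fun_eq_iff char_half_normal)
  qed
  have "measure half_normal {y<..} = measure (distr half_normal borel uminus) {y<..}" by (simp only: d)
  also have "\<dots> = measure half_normal {..<-y}"
    by (subst measure_distr) (auto simp: vimage_def greaterThan_def lessThan_def less_minus_iff)
  finally show ?thesis by (simp add: measure_half_normal_Ioi)
qed

text \<open>The tail is one minus the distribution function of a law without atoms.\<close>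

lemma isCont_gaussian_Q: "isCont gaussian_Q x"
proof -
  have "gaussian_Q y = 1 - cdf half_normal (y / sqrt 2)" for y
  proof -
    have "UNIV - {..y / sqrt 2} = {y / sqrt 2<..}" by auto
    then have "measure half_normal {y / sqrt 2<..} = 1 - cdf half_normal (y / sqrt 2)"
      unfolding cdf_def using half_normal.prob_compl[of "{..y / sqrt 2}"] by simp
    then show ?thesis by (simp add: measure_half_normal_Ioi)
  qed
  then have Q: "gaussian_Q = (\<lambda>y. 1 - cdf half_normal (y / sqrt 2))" by (intro ext)
  have c: "isCont (cdf half_normal) (x / sqrt 2)"
    by (simp add: half_normal.isCont_cdf half_normal_atom)
  have "isCont (\<lambda>y. y / sqrt 2) x" by (intro continuous_intros) auto
  from isCont_o2[OF this c] show ?thesis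
    unfolding Q by (intro continuous_diff continuous_const)
qed

lemma measure_cgauss_rectangle:
  assumes "A \<in> sets borel" "B \<in> sets borel"
  shows "measure cgauss {w. Re w \<in> A \<and> Im w \<in> B} = measure half_normal A * measure half_normal B"
proof -
  have m: "{w. Re w \<in> A \<and> Im w \<in> B} \<in> sets borel"
  proof -
    have "{w \<in> space borel. Re w \<in> A \<and> Im w \<in> B} \<in> sets (borel :: complex measure)"
      using assms by measurable
    then show ?thesis by simp
  qed
  have "measure cgauss {w. Re w \<in> A \<and> Im w \<in> B} = measure (half_normal \<Otimes>\<^sub>M half_normal) (A \<times> B)"
    unfolding cgauss_def using m
    by (subst measure_distr) (auto simp: space_pair_measure intro!: arg_cong2[where f = measure])
  also have "\<dots> = measure half_normal A * measure half_normal B"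
    using assms by (simp add: measure_def half_normal.emeasure_pair_measure_Times enn2real_mult)
  finally show ?thesis .
qed

lemma measure_cgauss_rotate:
  assumes c: "cmod c = 1" and A: "{w. Q w} \<in> sets borel"
  shows "measure cgauss {w. Q (c * w)} = measure cgauss {w. Q w}"
proof -
  have "measure cgauss {w. Q w} = measure (distr cgauss borel (\<lambda>z. c * z)) {w. Q w}"
    by (simp only: distr_cgauss_rotate[OF c])
  also have "\<dots> = measure cgauss {w. Q (c * w)}"
    using A by (subst measure_distr) (auto simp: vimage_def)
  finally show ?thesis by simp
qed

text \<open>A rotation makes the line vertical, and the real part has no atoms. This discards ties
  in the nearest-symbol decision.\<close>

lemma AE_cgauss_line:
  assumes a: "a \<noteq> 0"
  shows "AE w in cgauss. Re (cnj a * w) \<noteq> r"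
proof -
  define c where "c = cnj a / of_real (cmod a)"
  have c: "cmod c = 1" using a by (simp add: c_def norm_divide)
  have eq: "Re (cnj a * w) = cmod a * Re (c * w)" for w
    using a by (simp add: c_def)
  have m: "{w. Re w = r / cmod a} \<in> sets borel"
    using borel_closed[of "{w. Re w = r / cmod a}"] by (simp add: closed_Collect_eq continuous_on_Re)
  have "measure cgauss {w. Re (cnj a * w) = r} = measure cgauss {w. Re (c * w) = r / cmod a}"
    unfolding eq using a by (intro arg_cong[where f = "measure cgauss"]) (auto simp: field_simps)
  also have "\<dots> = measure cgauss {w. Re w \<in> {r / cmod a} \<and> Im w \<in> UNIV}"
    using measure_cgauss_rotate[OF c m] by simp
  also have "\<dots> = 0" by (subst measure_cgauss_rectangle) (auto simp: half_normal_atom)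
  finally have z: "measure cgauss {w. Re (cnj a * w) = r} = 0" .
  have "{w. Re (cnj a * w) = r} \<in> sets borel"
    by (intro borel_closed closed_Collect_eq continuous_intros)
  then have "{w. Re (cnj a * w) = r} \<in> null_sets cgauss"
    using z by (auto simp: null_sets_def cgauss.emeasure_eq_measure)
  then show ?thesis by (rule AE_I') auto
qed

text \<open>Ties fall on finitely many lines, a null set, so the choice made by
  \<open>nearest\<close> disappears and an error means that some symbol is strictly closer.
  Expanding the squared distances makes the condition linear in the noise.\<close>

lemma symbol_error_eq:
  assumes S: "finite S" and c: "c \<in> S" and x: "x > 0"
  shows "symbol_error S c x = measure cgauss {w. \<exists>c'\<in>S - {c}. (cmod (c' - c))\<^sup>2 < 2 * sqrt x * Re (cnj (c' - c) * w)}"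
    (is "_ = measure cgauss ?E")
proof -
  have dist: "(cmod (c + of_real (sqrt x) * w - c'))\<^sup>2 - (cmod (c + of_real (sqrt x) * w - c))\<^sup>2
    = (cmod (c' - c))\<^sup>2 - 2 * sqrt x * Re (cnj (c' - c) * w)" for w c'
    unfolding cmod_power2 by (simp add: power2_eq_square algebra_simps)
  have E: "?E \<in> sets borel"
  proof -
    have "?E = (\<Union>c'\<in>S - {c}. {w. (cmod (c' - c))\<^sup>2 < 2 * sqrt x * Re (cnj (c' - c) * w)})" by auto
    also have "\<dots> \<in> sets borel"
      using S by (intro sets.finite_UN borel_open open_Collect_less continuous_intros) auto
    finally show ?thesis .
  qed
  have L: "{w. nearest S (c + of_real (sqrt x) * w) \<noteq> c} \<in> sets borel"
  proof -
    note [measurable] = measurable_nearest[OF S]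
    have "{w \<in> space borel. nearest S (c + of_real (sqrt x) * w) \<noteq> c} \<in> sets borel" by measurable
    then show ?thesis by simp
  qed
  have "AE w in cgauss. \<forall>c'\<in>S - {c}. Re (cnj (c' - c) * w) \<noteq> (cmod (c' - c))\<^sup>2 / (2 * sqrt x)"
    using S by (intro AE_finite_allI AE_cgauss_line) auto
  then have "AE w in cgauss. w \<in> {w. nearest S (c + of_real (sqrt x) * w) \<noteq> c} \<longleftrightarrow> w \<in> ?E"
  proof eventually_elim
    case (elim w)
    let ?z = "c + of_real (sqrt x) * w"
    let ?f = "\<lambda>c'. (cmod (?z - c'))\<^sup>2"
    have n: "nearest S ?z \<in> S" "\<not> (\<exists>y\<in>S. ?f y < ?f (nearest S ?z))"
      unfolding nearest_def using arg_min_if_finite[OF S, of ?f] c by auto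
    have less: "?f c' < ?f c \<longleftrightarrow> (cmod (c' - c))\<^sup>2 < 2 * sqrt x * Re (cnj (c' - c) * w)" for c'
      using dist[of w c'] by linarith
    have ne: "?f c' \<noteq> ?f c" if "c' \<in> S - {c}" for c'
    proof
      assume "?f c' = ?f c"
      then have "(cmod (c' - c))\<^sup>2 = 2 * sqrt x * Re (cnj (c' - c) * w)" using dist[of w c'] by linarith
      then have "Re (cnj (c' - c) * w) = (cmod (c' - c))\<^sup>2 / (2 * sqrt x)" using x by (simp add: nonzero_eq_divide_eq mult.commute del: mult_cancel_left)
      then show False using elim that by blast
    qed
    have "nearest S ?z \<noteq> c \<longleftrightarrow> (\<exists>c'\<in>S - {c}. ?f c' < ?f c)"
    proof
      assume a: "nearest S ?z \<noteq> c"
      then have "nearest S ?z \<in> S - {c}" using n by simp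
      moreover have "?f (nearest S ?z) \<le> ?f c" using n(2) c by (meson not_le)
      ultimately show "\<exists>c'\<in>S - {c}. ?f c' < ?f c" using ne by (meson order_less_le)
    next
      assume "\<exists>c'\<in>S - {c}. ?f c' < ?f c"
      then show "nearest S ?z \<noteq> c" using n(2) by auto
    qed
    then show ?case unfolding less by simp
  qed
  then show ?thesis unfolding symbol_error_def
    using L E by (intro cgauss.finite_measure_eq_AE) auto
qed

section \<open>Equidistant levels: PAM and square QAM\<close>

definition level :: "real \<Rightarrow> nat \<Rightarrow> nat \<Rightarrow> real" where
  "level \<delta> L i = \<delta> * (2 * real i - 1 - real L)"

text \<open>The noise amplitudes for which the \<open>i\<close>-th of \<open>L\<close> equidistant levels remains a closest one, \<open>y\<close> being
  half the spacing: the two outer levels have a one-sided constraint only.\<close>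
definition band :: "nat \<Rightarrow> nat \<Rightarrow> real \<Rightarrow> real set" where
  "band L i y = {u. (i < L \<longrightarrow> u \<le> y) \<and> (1 < i \<longrightarrow> - y \<le> u)}"

lemma band_borel [measurable]: "band L i y \<in> sets borel"
proof -
  have "band L i y = (if i < L then {..y} else UNIV) \<inter> (if 1 < i then {-y..} else UNIV)"
    by (auto simp: band_def)
  then show ?thesis by simp
qed

text \<open>After division by the index distance, the bound set by a level grows with that distance,
  so the neighbour on each side decides. Neighbours are \<open>2 * \<delta>\<close> apart, and
  dividing half of it by the noise amplitude \<open>t\<close> expresses it in noise units.\<close>

lemma band_iff:
  assumes t: "t > 0" and \<delta>: "\<delta> > 0" and i: "i \<in> {1..L}"
  shows "u \<in> band L i (\<delta> / t) \<longleftrightarrow>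
    (\<forall>j\<in>{1..L}. 2 * t * ((level \<delta> L j - level \<delta> L i) * u) \<le> (level \<delta> L j - level \<delta> L i)\<^sup>2)"
proof -
  have step: "2 * t * ((level \<delta> L j - level \<delta> L i) * u) \<le> (level \<delta> L j - level \<delta> L i)\<^sup>2
    \<longleftrightarrow> (real j - real i) * (t * u) \<le> \<delta> * (real j - real i)\<^sup>2" for j
  proof -
    have d: "level \<delta> L j - level \<delta> L i = 2 * \<delta> * (real j - real i)"
      by (simp add: level_def algebra_simps)
    have e: "2 * t * ((level \<delta> L j - level \<delta> L i) * u) = 4 * \<delta> * ((real j - real i) * (t * u))"
      "(level \<delta> L j - level \<delta> L i)\<^sup>2 = 4 * \<delta> * (\<delta> * (real j - real i)\<^sup>2)"
      unfolding d by (simp_all add: power2_eq_square)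
    show ?thesis unfolding e by (rule mult_le_cancel_left_pos) (use \<delta> in simp)
  qed
  have b: "u \<in> band L i (\<delta> / t) \<longleftrightarrow> (i < L \<longrightarrow> t * u \<le> \<delta>) \<and> (1 < i \<longrightarrow> - \<delta> \<le> t * u)"
    using t by (simp add: band_def field_simps)
  show ?thesis
    unfolding step b
  proof (intro iffI ballI conjI impI)
    fix j assume h: "(i < L \<longrightarrow> t * u \<le> \<delta>) \<and> (1 < i \<longrightarrow> - \<delta> \<le> t * u)" and j: "j \<in> {1..L}"
    consider "j = i" | "i < j" | "j < i" by linarith
    then show "(real j - real i) * (t * u) \<le> \<delta> * (real j - real i)\<^sup>2"
    proof cases
      case 1 then show ?thesis by simp
    next
      case 2
      define e where "e = real j - real i"
      have e: "e \<ge> 1" using 2 by (simp add: e_def)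
      have "t * u \<le> \<delta>" using h 2 j by auto
      also have "\<delta> \<le> \<delta> * e" using e \<delta> by simp
      finally have "e * (t * u) \<le> e * (\<delta> * e)" using e by (intro mult_left_mono) auto
      then show ?thesis by (simp add: e_def power2_eq_square mult_ac)
    next
      case 3
      define e where "e = real i - real j"
      have e: "e \<ge> 1" using 3 by (simp add: e_def)
      have "- (t * u) \<le> \<delta>" using h 3 j by auto
      also have "\<delta> \<le> \<delta> * e" using e \<delta> by simp
      finally have "e * (- (t * u)) \<le> e * (\<delta> * e)" using e by (intro mult_left_mono) auto
      moreover have "real j - real i = - e" by (simp add: e_def)
      ultimately show ?thesis by (simp add: power2_eq_square mult_ac)
    qed
  next
    assume h: "\<forall>j\<in>{1..L}. (real j - real i) * (t * u) \<le> \<delta> * (real j - real i)\<^sup>2" and "i < L"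
    then show "t * u \<le> \<delta>" using bspec[OF h, of "Suc i"] by simp
  next
    assume h: "\<forall>j\<in>{1..L}. (real j - real i) * (t * u) \<le> \<delta> * (real j - real i)\<^sup>2" and i1: "1 < i"
    have "i - 1 \<in> {1..L}" using i i1 by auto
    moreover have "real (i - 1) - real i = - 1" using i1 by simp
    ultimately show "- \<delta> \<le> t * u" using bspec[OF h, of "i - 1"] by simp
  qed
qed

lemma measure_half_normal_band:
  assumes y: "y > 0"
  shows "measure half_normal (band L i y) = 1 - (of_bool (i < L) + of_bool (1 < i)) * gaussian_Q (sqrt 2 * y)"
proof -
  define U where "U = (if i < L then {y<..} else {})"
  define V where "V = (if 1 < i then {..<-y} else {})"
  have "band L i y = UNIV - (U \<union> V)" by (auto simp: band_def U_def V_def)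
  moreover have "U \<union> V \<in> sets half_normal" by (auto simp: U_def V_def)
  ultimately have "measure half_normal (band L i y) = 1 - measure half_normal (U \<union> V)"
    using half_normal.prob_compl[of "U \<union> V"] by simp
  also have "measure half_normal (U \<union> V) = measure half_normal U + measure half_normal V"
    using y by (intro half_normal.finite_measure_Union) (auto simp: U_def V_def)
  also have "measure half_normal U = of_bool (i < L) * gaussian_Q (sqrt 2 * y)"
    by (simp add: U_def measure_half_normal_Ioi)
  also have "measure half_normal V = of_bool (1 < i) * gaussian_Q (sqrt 2 * y)"
    by (simp add: V_def measure_half_normal_Iio)
  finally show ?thesis by (simp add: algebra_simps)
qed

text \<open>There are \<open>L - 1\<close> levels with a neighbour above and as many with one
  below.\<close>

lemma sum_half_normal_band:
  assumes y: "y > 0" and L: "1 \<le> L"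
  shows "(\<Sum>i\<in>{1..L}. measure half_normal (band L i y)) = real L - 2 * (real L - 1) * gaussian_Q (sqrt 2 * y)"
proof -
  have "(\<Sum>i\<in>{1..L}. of_bool (i < L) :: real) = real (card ({1..L} \<inter> {i. i < L}))"
    by (simp add: of_bool_def sum.If_cases)
  also have "{1..L} \<inter> {i. i < L} = {1..<L}" by auto
  finally have a: "(\<Sum>i\<in>{1..L}. of_bool (i < L) :: real) = real L - 1" using L by (simp add: of_nat_diff)
  have "(\<Sum>i\<in>{1..L}. of_bool (1 < i) :: real) = real (card ({1..L} \<inter> {i. 1 < i}))"
    by (simp add: of_bool_def sum.If_cases)
  also have "{1..L} \<inter> {i. 1 < i} = {2..L}" by auto
  finally have b: "(\<Sum>i\<in>{1..L}. of_bool (1 < i) :: real) = real L - 1" using L by (simp add: of_nat_diff)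
  show ?thesis
    unfolding measure_half_normal_band[OF y] sum_subtractf sum_distrib_right[symmetric] sum.distrib a b by simp
qed

lemma inj_level: "\<delta> > 0 \<Longrightarrow> level \<delta> L i = level \<delta> L j \<longleftrightarrow> i = j"
  by (auto simp: level_def)

lemma pam_eq: "pam M = (\<lambda>i. of_real (level (sqrt (3 / ((real M)\<^sup>2 - 1))) M i)) ` {1..M}"
  by (auto simp: pam_def level_def Let_def)

text \<open>The levels are real, so the decision depends on the real part of the noise alone and the
  imaginary part ranges over the whole line.\<close>

lemma sep_pam:
  assumes M: "2 \<le> M" and x: "x > 0"
  shows "sep (pam M) x = 2 * (real M - 1) / real M * gaussian_Q (sqrt (6 / (((real M)\<^sup>2 - 1) * x)))"
proof -
  have M2: "(real M)\<^sup>2 - 1 > 0" using M by (simp add: one_less_power)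
  define \<delta> where "\<delta> = sqrt (3 / ((real M)\<^sup>2 - 1))"
  have \<delta>: "\<delta> > 0" using M2 by (simp add: \<delta>_def)
  define c where "c i = complex_of_real (level \<delta> M i)" for i
  have pam: "pam M = c ` {1..M}" unfolding pam_eq c_def \<delta>_def ..
  have inj: "inj_on c {1..M}" using \<delta> by (auto simp: inj_on_def c_def inj_level)
  have card: "card (pam M) = M" unfolding pam using card_image[OF inj] by simp
  define y where "y = \<delta> / sqrt x"
  have y: "y > 0" using \<delta> x by (simp add: y_def)
  have "symbol_error (pam M) (c i) x = 1 - measure half_normal (band M i y)" if i: "i \<in> {1..M}" for i
  proof -
    have bi: "u \<in> band M i y \<longleftrightarrow> (\<forall>j\<in>{1..M}. 2 * sqrt x * ((level \<delta> M j - level \<delta> M i) * u) \<le> (level \<delta> M j - level \<delta> M i)\<^sup>2)" for u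
      unfolding y_def using x by (intro band_iff \<delta> i) simp
    have "{w. \<exists>c'\<in>pam M - {c i}. (cmod (c' - c i))\<^sup>2 < 2 * sqrt x * Re (cnj (c' - c i) * w)}
      = {w. \<exists>j\<in>{1..M}. (level \<delta> M j - level \<delta> M i)\<^sup>2 < 2 * sqrt x * ((level \<delta> M j - level \<delta> M i) * Re w)}"
    proof (rule Collect_cong)
      fix w
      have "(\<exists>c'\<in>pam M - {c i}. (cmod (c' - c i))\<^sup>2 < 2 * sqrt x * Re (cnj (c' - c i) * w)) \<longleftrightarrow>
        (\<exists>c'\<in>pam M. (cmod (c' - c i))\<^sup>2 < 2 * sqrt x * Re (cnj (c' - c i) * w))" by auto
      also have "\<dots> \<longleftrightarrow> (\<exists>j\<in>{1..M}. (cmod (c j - c i))\<^sup>2 < 2 * sqrt x * Re (cnj (c j - c i) * w))"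
        unfolding pam by simp
      also have "\<dots> \<longleftrightarrow> (\<exists>j\<in>{1..M}. (level \<delta> M j - level \<delta> M i)\<^sup>2 < 2 * sqrt x * ((level \<delta> M j - level \<delta> M i) * Re w))"
        unfolding c_def of_real_diff[symmetric] norm_of_real by simp
      finally show "(\<exists>c'\<in>pam M - {c i}. (cmod (c' - c i))\<^sup>2 < 2 * sqrt x * Re (cnj (c' - c i) * w)) \<longleftrightarrow>
        (\<exists>j\<in>{1..M}. (level \<delta> M j - level \<delta> M i)\<^sup>2 < 2 * sqrt x * ((level \<delta> M j - level \<delta> M i) * Re w))" .
    qed
    also have "\<dots> = UNIV - {w. Re w \<in> band M i y \<and> Im w \<in> UNIV}"
      by (auto simp: bi not_le)
    finally have "symbol_error (pam M) (c i) x = measure cgauss (UNIV - {w. Re w \<in> band M i y \<and> Im w \<in> UNIV})"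
      using i x by (subst symbol_error_eq) (auto simp: pam)
    also have "\<dots> = 1 - measure cgauss {w. Re w \<in> band M i y \<and> Im w \<in> UNIV}"
    proof -
      have "{w \<in> space borel. Re w \<in> band M i y} \<in> sets (borel :: complex measure)" by measurable
      then show ?thesis using cgauss.prob_compl[of "{w. Re w \<in> band M i y \<and> Im w \<in> UNIV}"] by simp
    qed
    also have "\<dots> = 1 - measure half_normal (band M i y)"
      by (subst measure_cgauss_rectangle) (auto simp: half_normal.prob_space[simplified])
    finally show ?thesis .
  qed
  then have se: "(\<Sum>i\<in>{1..M}. symbol_error (pam M) (c i) x) = (\<Sum>i\<in>{1..M}. 1 - measure half_normal (band M i y))"
    by (rule sum.cong[OF refl])
  have "(\<Sum>c\<in>pam M. symbol_error (pam M) c x) = (\<Sum>i\<in>{1..M}. symbol_error (pam M) (c i) x)"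
    using sum.reindex[OF inj, of "\<lambda>c. symbol_error (pam M) c x"] by (simp only: pam[symmetric] o_def)
  also have "\<dots> = (\<Sum>i\<in>{1..M}. 1 - measure half_normal (band M i y))" by (rule se)
  also have "\<dots> = 2 * (real M - 1) * gaussian_Q (sqrt 2 * y)"
    using sum_half_normal_band[OF y, of M] M by (simp add: sum_subtractf)
  finally have "sep (pam M) x = 2 * (real M - 1) / real M * gaussian_Q (sqrt 2 * y)"
    by (simp add: sep_def card)
  \<comment> \<open>The factor \<open>sqrt 2\<close> converts the standard deviation
    \<open>1 / sqrt 2\<close> of \<open>half_normal\<close> to that of the law behind
    \<open>gaussian_Q\<close>.\<close>
  also have "sqrt 2 * y = sqrt (6 / (((real M)\<^sup>2 - 1) * x))"
    unfolding y_def \<delta>_def by (simp add: real_sqrt_mult[symmetric] real_sqrt_divide[symmetric])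
  finally show ?thesis .
qed

lemma qam_eq:
  "qam (L\<^sup>2) = (\<lambda>(i, j). Complex (level (sqrt (3 / (2 * (real (L\<^sup>2) - 1)))) L i)
      (level (sqrt (3 / (2 * (real (L\<^sup>2) - 1)))) L j)) ` ({1..L} \<times> {1..L})"
proof -
  define \<delta> where "\<delta> = sqrt (3 / (2 * (real (L\<^sup>2) - 1)))"
  have "{\<delta> * (2 * real i - 1 - sqrt (real (L\<^sup>2))) |i::nat. 1 \<le> i \<and> real i \<le> sqrt (real (L\<^sup>2))} = level \<delta> L ` {1..L}"
    by (auto simp: level_def)
  then show ?thesis
    unfolding qam_def Let_def \<delta>_def[symmetric] by (auto simp: image_def)
qed

text \<open>A correct decision is a rectangle event, and the two coordinates of the noise are
  independent. Summed over all points, the success probabilities form the square of the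
  one-dimensional sum.\<close>

lemma sep_qam:
  assumes L: "2 \<le> L" and x: "x > 0"
  defines "q \<equiv> gaussian_Q (sqrt (3 / ((real (L\<^sup>2) - 1) * x)))"
  shows "sep (qam (L\<^sup>2)) x = 4 * (real L - 1) / real L * q - 4 * (real L - 1)\<^sup>2 / (real L)\<^sup>2 * q\<^sup>2"
proof -
  have M2: "real (L\<^sup>2) - 1 > 0" using L by (simp add: one_less_power)
  define \<delta> where "\<delta> = sqrt (3 / (2 * (real (L\<^sup>2) - 1)))"
  have \<delta>: "\<delta> > 0" using M2 by (simp add: \<delta>_def)
  define c where "c = (\<lambda>(i, j). Complex (level \<delta> L i) (level \<delta> L j))"
  have qam: "qam (L\<^sup>2) = c ` ({1..L} \<times> {1..L})" unfolding qam_eq c_def \<delta>_def ..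
  have inj: "inj_on c ({1..L} \<times> {1..L})" using \<delta> by (auto simp: inj_on_def c_def inj_level)
  have card: "card (qam (L\<^sup>2)) = L\<^sup>2"
    unfolding qam using card_image[OF inj] by (simp add: power2_eq_square)
  define y where "y = \<delta> / sqrt x"
  have y: "y > 0" using \<delta> x by (simp add: y_def)
  define b where "b i = measure half_normal (band L i y)" for i
  have "symbol_error (qam (L\<^sup>2)) (c p) x = 1 - b (fst p) * b (snd p)" if p: "p \<in> {1..L} \<times> {1..L}" for p
  proof -
    obtain i k where p_eq: "p = (i, k)" by (cases p)
    have i: "i \<in> {1..L}" and k: "k \<in> {1..L}" using p p_eq by auto
    define D where "D j j' = level \<delta> L j - level \<delta> L j'" for j j'
    have bi: "u \<in> band L m y \<longleftrightarrow> (\<forall>j\<in>{1..L}. 2 * sqrt x * (D j m * u) \<le> (D j m)\<^sup>2)" if "m \<in> {1..L}" for u m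
      unfolding y_def D_def using x by (intro band_iff \<delta> that) simp
    have "{w. \<exists>c'\<in>qam (L\<^sup>2) - {c p}. (cmod (c' - c p))\<^sup>2 < 2 * sqrt x * Re (cnj (c' - c p) * w)}
      = UNIV - {w. Re w \<in> band L i y \<and> Im w \<in> band L k y}"
    proof -
      have "(\<forall>c'\<in>qam (L\<^sup>2) - {c p}. 2 * sqrt x * Re (cnj (c' - c p) * w) \<le> (cmod (c' - c p))\<^sup>2)
        \<longleftrightarrow> Re w \<in> band L i y \<and> Im w \<in> band L k y" for w
      proof -
        have "(\<forall>c'\<in>qam (L\<^sup>2) - {c p}. 2 * sqrt x * Re (cnj (c' - c p) * w) \<le> (cmod (c' - c p))\<^sup>2) \<longleftrightarrow>
          (\<forall>c'\<in>qam (L\<^sup>2). 2 * sqrt x * Re (cnj (c' - c p) * w) \<le> (cmod (c' - c p))\<^sup>2)" by auto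
        also have "\<dots> \<longleftrightarrow> (\<forall>j\<in>{1..L}. \<forall>l\<in>{1..L}. 2 * sqrt x * (D j i * Re w) + 2 * sqrt x * (D l k * Im w) \<le> (D j i)\<^sup>2 + (D l k)\<^sup>2)"
        proof -
          have "2 * sqrt x * Re (cnj (c (j, l) - c p) * w) = 2 * sqrt x * (D j i * Re w) + 2 * sqrt x * (D l k * Im w)" for j l
            by (simp add: c_def p_eq D_def algebra_simps)
          moreover have "(cmod (c (j, l) - c p))\<^sup>2 = (D j i)\<^sup>2 + (D l k)\<^sup>2" for j l
            by (simp add: c_def p_eq D_def cmod_power2)
          ultimately show ?thesis unfolding qam by simp
        qed
        also have "\<dots> \<longleftrightarrow> Re w \<in> band L i y \<and> Im w \<in> band L k y"
        proof
          assume h: "\<forall>j\<in>{1..L}. \<forall>l\<in>{1..L}. 2 * sqrt x * (D j i * Re w) + 2 * sqrt x * (D l k * Im w) \<le> (D j i)\<^sup>2 + (D l k)\<^sup>2"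
          \<comment> \<open>Comparing with points that differ in one coordinate only makes the other
            difference 0 and separates the two conditions.\<close>
          have z: "D i i = 0" "D k k = 0" by (simp_all add: D_def)
          have "\<forall>j\<in>{1..L}. 2 * sqrt x * (D j i * Re w) \<le> (D j i)\<^sup>2"
          proof
            fix j assume "j \<in> {1..L}"
            from h[rule_format, OF this k] show "2 * sqrt x * (D j i * Re w) \<le> (D j i)\<^sup>2" by (simp add: z)
          qed
          moreover have "\<forall>l\<in>{1..L}. 2 * sqrt x * (D l k * Im w) \<le> (D l k)\<^sup>2"
          proof
            fix l assume "l \<in> {1..L}"
            from h[rule_format, OF i this] show "2 * sqrt x * (D l k * Im w) \<le> (D l k)\<^sup>2" by (simp add: z)
          qed
          ultimately show "Re w \<in> band L i y \<and> Im w \<in> band L k y"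
            unfolding bi[OF i] bi[OF k] by simp
        next
          assume "Re w \<in> band L i y \<and> Im w \<in> band L k y"
          then show "\<forall>j\<in>{1..L}. \<forall>l\<in>{1..L}. 2 * sqrt x * (D j i * Re w) + 2 * sqrt x * (D l k * Im w) \<le> (D j i)\<^sup>2 + (D l k)\<^sup>2"
            unfolding bi[OF i] bi[OF k] by (intro ballI add_mono) auto
        qed
        finally show ?thesis .
      qed
      then show ?thesis by (auto simp: not_le[symmetric] simp del: not_le)
    qed
    then have "symbol_error (qam (L\<^sup>2)) (c p) x = measure cgauss (UNIV - {w. Re w \<in> band L i y \<and> Im w \<in> band L k y})"
      using p x by (subst symbol_error_eq) (auto simp: qam)
    also have "\<dots> = 1 - measure cgauss {w. Re w \<in> band L i y \<and> Im w \<in> band L k y}"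
    proof -
      have "{w \<in> space borel. Re w \<in> band L i y \<and> Im w \<in> band L k y} \<in> sets (borel :: complex measure)" by measurable
      then show ?thesis using cgauss.prob_compl[of "{w. Re w \<in> band L i y \<and> Im w \<in> band L k y}"] by simp
    qed
    also have "\<dots> = 1 - b i * b k"
      by (subst measure_cgauss_rectangle) (auto simp: b_def)
    finally show ?thesis by (simp add: p_eq)
  qed
  then have se: "(\<Sum>p\<in>{1..L} \<times> {1..L}. symbol_error (qam (L\<^sup>2)) (c p) x) = (\<Sum>p\<in>{1..L} \<times> {1..L}. 1 - b (fst p) * b (snd p))"
    by (rule sum.cong[OF refl])
  have "(\<Sum>c\<in>qam (L\<^sup>2). symbol_error (qam (L\<^sup>2)) c x) = (\<Sum>p\<in>{1..L} \<times> {1..L}. symbol_error (qam (L\<^sup>2)) (c p) x)"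
    using sum.reindex[OF inj, of "\<lambda>c. symbol_error (qam (L\<^sup>2)) c x"] by (simp only: qam[symmetric] o_def)
  also have "\<dots> = (\<Sum>p\<in>{1..L} \<times> {1..L}. 1 - b (fst p) * b (snd p))" by (rule se)
  also have "\<dots> = (real L)\<^sup>2 - (\<Sum>i\<in>{1..L}. b i)\<^sup>2"
    by (simp add: sum_subtractf power2_eq_square sum_product sum.cartesian_product split_def)
  also have "(\<Sum>i\<in>{1..L}. b i) = real L - 2 * (real L - 1) * gaussian_Q (sqrt 2 * y)"
    unfolding b_def using L y by (intro sum_half_normal_band) auto
  also have "sqrt 2 * y = sqrt (3 / ((real (L\<^sup>2) - 1) * x))"
  proof -
    have "sqrt 2 * (sqrt (3 / (2 * K)) / sqrt x) = sqrt (3 / (K * x))" for K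
      unfolding real_sqrt_divide[symmetric] real_sqrt_mult[symmetric] by simp
    then show ?thesis unfolding y_def \<delta>_def .
  qed
  finally have "(\<Sum>c\<in>qam (L\<^sup>2). symbol_error (qam (L\<^sup>2)) c x) = (real L)\<^sup>2 - (real L - 2 * (real L - 1) * q)\<^sup>2"
    by (simp add: q_def)
  then have "sep (qam (L\<^sup>2)) x = ((real L)\<^sup>2 - (real L - 2 * (real L - 1) * q)\<^sup>2) / (real L)\<^sup>2"
    by (simp add: sep_def card)
  also have "\<dots> = 4 * (real L - 1) / real L * q - 4 * (real L - 1)\<^sup>2 / (real L)\<^sup>2 * q\<^sup>2"
  proof -
    have "(real L)\<^sup>2 - (real L - 2 * (real L - 1) * q)\<^sup>2 = real L * (4 * (real L - 1) * q) - 4 * (real L - 1)\<^sup>2 * q\<^sup>2"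
      by (simp add: power2_eq_square algebra_simps)
    moreover have "(real L * A - B) / (real L)\<^sup>2 = A / real L - B / (real L)\<^sup>2" for A B
      using L by (simp add: diff_divide_distrib power2_eq_square)
    ultimately show ?thesis by (simp only: times_divide_eq_left)
  qed
  finally show ?thesis .
qed

section \<open>PSK by averaging over the direction of the noise\<close>

lemma nn_integral_periodic_shift:
  fixes f :: "real \<Rightarrow> ennreal"
  assumes f[measurable]: "f \<in> borel_measurable borel" and per: "\<And>x. f (x + T) = f x" and s: "0 \<le> s" "s \<le> T"
  shows "(\<integral>\<^sup>+x. f (x + s) * indicator {a..<a + T} x \<partial>lborel) = (\<integral>\<^sup>+x. f x * indicator {a..<a + T} x \<partial>lborel)"
proof -
  have sh: "(\<integral>\<^sup>+x. f (x + t) * indicator {u..<v} x \<partial>lborel) = (\<integral>\<^sup>+x. f x * indicator {u + t..<v + t} x \<partial>lborel)" for t u v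
  proof -
    have "(\<integral>\<^sup>+x. f x * indicator {u + t..<v + t} x \<partial>lborel) = (\<integral>\<^sup>+x. f (t + 1 * x) * indicator {u + t..<v + t} (t + 1 * x) \<partial>lborel)"
      by (subst nn_integral_real_affine[where c = 1 and t = t]) auto
    also have "\<dots> = (\<integral>\<^sup>+x. f (x + t) * indicator {u..<v} x \<partial>lborel)"
      by (intro nn_integral_cong) (auto simp: indicator_def add.commute)
    finally show ?thesis by simp
  qed
  have split: "(\<integral>\<^sup>+x. f x * indicator {u..<w} x \<partial>lborel) =
    (\<integral>\<^sup>+x. f x * indicator {u..<v} x \<partial>lborel) + (\<integral>\<^sup>+x. f x * indicator {v..<w} x \<partial>lborel)" if "u \<le> v" "v \<le> w" for u v w
    by (subst nn_integral_add[symmetric]) (use that in \<open>auto intro!: nn_integral_cong simp: indicator_def\<close>)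
  have "(\<integral>\<^sup>+x. f (x + s) * indicator {a..<a + T} x \<partial>lborel) = (\<integral>\<^sup>+x. f x * indicator {a + s..<a + T + s} x \<partial>lborel)"
    by (rule sh)
  also have "\<dots> = (\<integral>\<^sup>+x. f x * indicator {a + s..<a + T} x \<partial>lborel) + (\<integral>\<^sup>+x. f x * indicator {a + T..<a + T + s} x \<partial>lborel)"
    using s by (intro split) auto
  also have "(\<integral>\<^sup>+x. f x * indicator {a + T..<a + T + s} x \<partial>lborel) = (\<integral>\<^sup>+x. f x * indicator {a..<a + s} x \<partial>lborel)"
    using sh[of T a "a + s"] by (simp add: per add_ac)
  also have "(\<integral>\<^sup>+x. f x * indicator {a + s..<a + T} x \<partial>lborel) + (\<integral>\<^sup>+x. f x * indicator {a..<a + s} x \<partial>lborel)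
    = (\<integral>\<^sup>+x. f x * indicator {a..<a + T} x \<partial>lborel)"
    using split[of a "a + s" "a + T"] s by (simp add: add.commute)
  finally show ?thesis .
qed

text \<open>Rotation invariance lets \<theta> be averaged over a full turn; the phase of
  \<open>w\<close> is then absorbed by a shift of \<theta>, and only the modulus of \<open>w\<close>
  stays random. This takes the place of polar coordinates.\<close>

lemma emeasure_cgauss_angular_average:
  assumes A: "A \<in> sets borel"
  shows "ennreal (2 * pi) * emeasure cgauss A =
    (\<integral>\<^sup>+\<theta>. emeasure cgauss {w. of_real (cmod w) * cis \<theta> \<in> A} * indicator {-pi..<pi} \<theta> \<partial>lborel)"
proof -
  note [measurable] = A
  have cis[measurable]: "cis \<in> borel_measurable borel"
    by (intro borel_measurable_continuous_onI continuous_intros)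
  interpret L: pair_sigma_finite lborel cgauss ..
  have "emeasure cgauss A = emeasure cgauss {w. cis \<theta> * w \<in> A}" for \<theta>
    using measure_cgauss_rotate[of "cis \<theta>" "\<lambda>w. w \<in> A"] A by (simp add: cgauss.emeasure_eq_measure)
  also have "emeasure cgauss {w. cis \<theta> * w \<in> A} = (\<integral>\<^sup>+w. indicator A (cis \<theta> * w) \<partial>cgauss)" for \<theta>
  proof -
    have "{w \<in> space cgauss. cis \<theta> * w \<in> A} \<in> sets cgauss" by measurable
    then have "emeasure cgauss {w. cis \<theta> * w \<in> A} = (\<integral>\<^sup>+w. indicator {w. cis \<theta> * w \<in> A} w \<partial>cgauss)" by simp
    then show ?thesis by (simp add: indicator_def)
  qed
  finally have rot: "emeasure cgauss A = (\<integral>\<^sup>+w. indicator A (cis \<theta> * w) \<partial>cgauss)" for \<theta> .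
  have "ennreal (2 * pi) * emeasure cgauss A = (\<integral>\<^sup>+\<theta>. emeasure cgauss A * indicator {-pi..<pi} \<theta> \<partial>lborel)"
    by (subst nn_integral_cmult_indicator) (auto simp: mult.commute)
  also have "\<dots> = (\<integral>\<^sup>+\<theta>. (\<integral>\<^sup>+w. indicator A (cis \<theta> * w) * indicator {-pi..<pi} \<theta> \<partial>cgauss) \<partial>lborel)"
  proof (intro nn_integral_cong)
    fix \<theta>
    have "(\<lambda>w. indicator A (cis \<theta> * w) :: ennreal) \<in> borel_measurable cgauss" by measurable
    then show "emeasure cgauss A * indicator {-pi..<pi} \<theta> = (\<integral>\<^sup>+w. indicator A (cis \<theta> * w) * indicator {-pi..<pi} \<theta> \<partial>cgauss)"
      by (simp only: nn_integral_multc rot[of \<theta>, symmetric])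
  qed
  also have "\<dots> = (\<integral>\<^sup>+w. (\<integral>\<^sup>+\<theta>. indicator A (cis \<theta> * w) * indicator {-pi..<pi} \<theta> \<partial>lborel) \<partial>cgauss)"
    by (rule L.Fubini'[symmetric]) measurable
  also have "\<dots> = (\<integral>\<^sup>+w. (\<integral>\<^sup>+\<theta>. indicator A (of_real (cmod w) * cis \<theta>) * indicator {-pi..<pi} \<theta> \<partial>lborel) \<partial>cgauss)"
  proof (rule nn_integral_cong)
    fix w :: complex
    have w: "w = of_real (cmod w) * cis (Arg2pi w)"
      using Arg2pi_eq[of w] by (simp add: cis_conv_exp)
    have "cis \<theta> * w = of_real (cmod w) * cis (\<theta> + Arg2pi w)" for \<theta>
      by (subst w) (simp add: cis_mult mult.left_commute del: Arg2pi_eq)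
    moreover have "(\<integral>\<^sup>+\<theta>. indicator A (of_real (cmod w) * cis (\<theta> + Arg2pi w)) * indicator {-pi..<-pi + 2 * pi} \<theta> \<partial>lborel)
      = (\<integral>\<^sup>+\<theta>. indicator A (of_real (cmod w) * cis \<theta>) * indicator {-pi..<-pi + 2 * pi} \<theta> \<partial>lborel :: ennreal)"
    proof (rule nn_integral_periodic_shift)
      show "(\<lambda>\<theta>. indicator A (of_real (cmod w) * cis \<theta>) :: ennreal) \<in> borel_measurable borel" by measurable
      show "(indicator A (of_real (cmod w) * cis (\<theta> + 2 * pi)) :: ennreal) = indicator A (of_real (cmod w) * cis \<theta>)" for \<theta>
        by (simp add: cis_mult[symmetric])
      show "0 \<le> Arg2pi w" by (rule Arg2pi_ge_0)
      show "Arg2pi w \<le> 2 * pi" using Arg2pi_lt_2pi[of w] by simp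
    qed
    ultimately show "(\<integral>\<^sup>+\<theta>. indicator A (cis \<theta> * w) * indicator {-pi..<pi} \<theta> \<partial>lborel)
      = (\<integral>\<^sup>+\<theta>. indicator A (of_real (cmod w) * cis \<theta>) * indicator {-pi..<pi} \<theta> \<partial>lborel :: ennreal)"
      by simp
  qed
  also have "\<dots> = (\<integral>\<^sup>+\<theta>. (\<integral>\<^sup>+w. indicator A (of_real (cmod w) * cis \<theta>) * indicator {-pi..<pi} \<theta> \<partial>cgauss) \<partial>lborel)"
    by (rule L.Fubini') measurable
  also have "\<dots> = (\<integral>\<^sup>+\<theta>. emeasure cgauss {w. of_real (cmod w) * cis \<theta> \<in> A} * indicator {-pi..<pi} \<theta> \<partial>lborel)"
  proof (intro nn_integral_cong)
    fix \<theta>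
    have m: "(\<lambda>w. indicator A (of_real (cmod w) * cis \<theta>) :: ennreal) \<in> borel_measurable cgauss" by measurable
    have "{w \<in> space cgauss. of_real (cmod w) * cis \<theta> \<in> A} \<in> sets cgauss" by measurable
    then have "emeasure cgauss {w. of_real (cmod w) * cis \<theta> \<in> A} = (\<integral>\<^sup>+w. indicator {w. of_real (cmod w) * cis \<theta> \<in> A} w \<partial>cgauss)" by simp
    also have "\<dots> = (\<integral>\<^sup>+w. indicator A (of_real (cmod w) * cis \<theta>) \<partial>cgauss)" by (simp add: indicator_def)
    finally show "(\<integral>\<^sup>+w. indicator A (of_real (cmod w) * cis \<theta>) * indicator {-pi..<pi} \<theta> \<partial>cgauss)
      = emeasure cgauss {w. of_real (cmod w) * cis \<theta> \<in> A} * indicator {-pi..<pi} \<theta>"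
      by (simp only: nn_integral_multc[OF m])
  qed
  finally show ?thesis .
qed

text \<open>In a fixed direction \<open>\<theta>\<close> of the noise, one of the two neighbouring symbols is always the first to
  become closer than the transmitted one.\<close>
lemma psk_sector:
  assumes M: "2 \<le> M" and r: "0 \<le> r" and \<theta>: "- pi \<le> \<theta>" "\<theta> < pi"
  shows "(\<exists>j\<in>{1..<M}. sin (pi * real j / real M) < r * sin (\<theta> - pi * real j / real M))
    \<longleftrightarrow> sin (pi / real M) < r * sin (\<bar>\<theta>\<bar> - pi / real M)"
proof
  define a where "a = pi / real M"
  have a: "0 < a" "a < pi" using M by (simp_all add: a_def divide_less_eq)
  assume "\<exists>j\<in>{1..<M}. sin (pi * real j / real M) < r * sin (\<theta> - pi * real j / real M)"
  then obtain j where j: "1 \<le> j" "j < M" and h: "sin (pi * real j / real M) < r * sin (\<theta> - pi * real j / real M)" by auto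
  define \<alpha> where "\<alpha> = pi * real j / real M"
  have \<alpha>: "a \<le> \<alpha>" "\<alpha> + a \<le> pi"
  proof -
    have "\<alpha> = a * real j" by (simp add: \<alpha>_def a_def)
    moreover have "a * 1 \<le> a * real j" using a j by (intro mult_left_mono) auto
    moreover have "a * (real j + 1) \<le> a * real M" using a j by (intro mult_left_mono) auto
    moreover have "a * real M = pi" using M by (simp add: a_def)
    ultimately show "a \<le> \<alpha>" "\<alpha> + a \<le> pi" by (simp_all add: distrib_left)
  qed
  have s: "sin a > 0" "sin \<alpha> > 0" using a \<alpha> by (auto intro!: sin_gt_zero)
  \<comment> \<open>For either sign of \<theta> the difference of the two sides is a product of two
    sines of angles between 0 and \<open>pi\<close>; it compares symbol \<open>j\<close> with the
    neighbour on the side of \<theta>.\<close>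
  have key: "sin a * sin (\<theta> - \<alpha>) \<le> sin \<alpha> * sin (\<bar>\<theta>\<bar> - a)"
  proof (cases "\<theta> \<ge> 0")
    case True
    have "sin \<alpha> * sin (\<theta> - a) - sin a * sin (\<theta> - \<alpha>) = sin \<theta> * sin (\<alpha> - a)"
      by (simp add: sin_diff algebra_simps)
    moreover have "0 \<le> sin \<theta> * sin (\<alpha> - a)"
      using True \<theta> \<alpha> a by (intro mult_nonneg_nonneg sin_ge_zero) auto
    ultimately show ?thesis using True by simp
  next
    case False
    have "sin \<alpha> * sin (- \<theta> - a) - sin a * sin (\<theta> - \<alpha>) = sin (- \<theta>) * sin (\<alpha> + a)"
      by (simp add: sin_diff sin_add algebra_simps)
    moreover have "0 \<le> sin (- \<theta>) * sin (\<alpha> + a)"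
      using False \<theta> \<alpha> a by (intro mult_nonneg_nonneg sin_ge_zero) auto
    ultimately show ?thesis using False by simp
  qed
  have "sin \<alpha> * sin a < sin a * (r * sin (\<theta> - \<alpha>))"
    using h s by (subst mult.commute) (simp add: \<alpha>_def)
  also have "\<dots> = r * (sin a * sin (\<theta> - \<alpha>))" by simp
  also have "\<dots> \<le> r * (sin \<alpha> * sin (\<bar>\<theta>\<bar> - a))" using key r by (intro mult_left_mono)
  also have "\<dots> = sin \<alpha> * (r * sin (\<bar>\<theta>\<bar> - a))" by simp
  finally have "sin a < r * sin (\<bar>\<theta>\<bar> - a)" using s by simp
  then show "sin (pi / real M) < r * sin (\<bar>\<theta>\<bar> - pi / real M)" by (simp add: a_def)
next
  assume h: "sin (pi / real M) < r * sin (\<bar>\<theta>\<bar> - pi / real M)"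
  show "\<exists>j\<in>{1..<M}. sin (pi * real j / real M) < r * sin (\<theta> - pi * real j / real M)"
  proof (cases "\<theta> \<ge> 0")
    case True
    then show ?thesis using h M by (intro bexI[of _ 1]) auto
  next
    case False
    have j: "pi * real (M - 1) / real M = pi - pi / real M"
      using M by (simp add: of_nat_diff field_simps)
    have "sin (\<theta> - (pi - pi / real M)) = sin (- \<theta> - pi / real M)"
    proof -
      have "sin (\<theta> - (pi - pi / real M)) = sin ((\<theta> + pi / real M) - pi)" by (simp add: algebra_simps)
      also have "\<dots> = - sin (\<theta> + pi / real M)" by (simp only: sin_diff[of _ pi]) simp
      also have "\<dots> = sin (- \<theta> - pi / real M)" by (simp only: sin_minus[symmetric]) (simp add: algebra_simps)
      finally show ?thesis .
    qed
    then have "sin (pi * real (M - 1) / real M) < r * sin (\<theta> - pi * real (M - 1) / real M)"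
      unfolding j using h False by (simp only: sin_pi_minus abs_if) simp
    then show ?thesis using M by (intro bexI[of _ "M - 1"]) auto
  qed
qed

text \<open>As the group of roots of unity, the constellation is visibly closed under multiplication
  and division by its elements.\<close>

lemma psk_eq_roots_of_unity: "0 < M \<Longrightarrow> psk M = {z. z ^ M = 1}"
  using Complex.bij_betw_roots_unity[of M] by (auto simp: psk_def bij_betw_def)

lemma card_psk: "0 < M \<Longrightarrow> card (psk M) = M"
  using bij_betw_same_card[OF Complex.bij_betw_roots_unity, of M] by (simp add: psk_eq_roots_of_unity)

lemma psk_minus_one:
  assumes "0 < M"
  shows "psk M - {1} = (\<lambda>k. cis (2 * pi * real k / real M)) ` {1..<M}"
proof -
  let ?f = "\<lambda>k. cis (2 * pi * real k / real M)"
  have b: "inj_on ?f {..<M}" "psk M = ?f ` {..<M}"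
    using Complex.bij_betw_roots_unity[OF assms] by (auto simp: bij_betw_def psk_eq_roots_of_unity[OF assms])
  have "{..<M} - {0} = {1..<M}" by auto
  moreover have "?f ` ({..<M} - {0}) = ?f ` {..<M} - ?f ` {0}"
    using assms by (intro inj_on_image_set_diff[OF b(1)]) auto
  ultimately show ?thesis using b(2) by simp
qed

text \<open>Multiplication by \<open>c\<close> permutes the constellation and preserves the noise
  law, which reduces the claim to \<open>c = 1\<close>. With \<open>\<alpha> = pi * j / M\<close>
  the difference between symbol \<open>j\<close> and 1 is
  \<open>2 * \<i> * sin \<alpha> * cis \<alpha>\<close>, and the positive factor
  \<open>4 * sin \<alpha>\<close> cancels from the inequality.\<close>

lemma symbol_error_psk:
  assumes M: "2 \<le> M" and x: "x > 0" and c: "c \<in> psk M"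
  shows "symbol_error (psk M) c x = measure cgauss
    {w. \<exists>j\<in>{1..<M}. sin (pi * real j / real M) < sqrt x * Im (cis (- (pi * real j / real M)) * w)}"
proof -
  have M0: "0 < M" using M by simp
  have fin: "finite (psk M)" by (rule card_ge_0_finite) (simp add: card_psk M0)
  define Q where "Q w \<longleftrightarrow> (\<exists>u\<in>psk M - {1}. (cmod (u - 1))\<^sup>2 < 2 * sqrt x * Re (cnj (u - 1) * w))" for w
  have c1: "cmod c = 1" "c \<noteq> 0" using c by (auto simp: psk_def)
  have Q: "{w. Q w} \<in> sets borel"
  proof -
    have "{w. Q w} = (\<Union>u\<in>psk M - {1}. {w. (cmod (u - 1))\<^sup>2 < 2 * sqrt x * Re (cnj (u - 1) * w)})" by (auto simp: Q_def)
    also have "\<dots> \<in> sets borel"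
      using fin by (intro sets.finite_UN borel_open open_Collect_less continuous_intros) auto
    finally show ?thesis .
  qed
  have img: "psk M - {c} = (\<lambda>u. c * u) ` (psk M - {1})"
  proof -
    have "psk M = (\<lambda>u. c * u) ` psk M"
    proof
      show "psk M \<subseteq> (\<lambda>u. c * u) ` psk M"
      proof
        fix v assume "v \<in> psk M"
        then have "v / c \<in> psk M" using c by (simp add: psk_eq_roots_of_unity[OF M0] power_divide)
        then show "v \<in> (\<lambda>u. c * u) ` psk M" using c1 by (intro image_eqI[of _ _ "v / c"]) auto
      qed
      show "(\<lambda>u. c * u) ` psk M \<subseteq> psk M"
        using c by (auto simp: psk_eq_roots_of_unity[OF M0] power_mult_distrib)
    qed
    moreover have "(\<lambda>u. c * u) ` (psk M - {1}) = (\<lambda>u. c * u) ` psk M - {c}"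
      using c1 by auto
    ultimately show ?thesis by simp
  qed
  have "(\<exists>c'\<in>psk M - {c}. (cmod (c' - c))\<^sup>2 < 2 * sqrt x * Re (cnj (c' - c) * w)) \<longleftrightarrow> Q (cnj c * w)" for w
  proof -
    have ni: "cmod (c * u - c) = cmod (u - 1)" "cnj (c * u - c) * w = cnj (u - 1) * (cnj c * w)" for u
    proof -
      have e: "c * u - c = c * (u - 1)" by (simp add: algebra_simps)
      show "cmod (c * u - c) = cmod (u - 1)" unfolding e norm_mult c1 by simp
      show "cnj (c * u - c) * w = cnj (u - 1) * (cnj c * w)" unfolding e by simp
    qed
    have im: "(\<exists>c'\<in>(\<lambda>u. c * u) ` U. R c') \<longleftrightarrow> (\<exists>u\<in>U. R (c * u))" for U R by auto
    show ?thesis unfolding img Q_def im ni ..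
  qed
  then have "symbol_error (psk M) c x = measure cgauss {w. Q (cnj c * w)}"
    by (subst symbol_error_eq[OF fin c x]) simp
  also have "\<dots> = measure cgauss {w. Q w}"
    using c1 by (intro measure_cgauss_rotate Q) simp
  also have "{w. Q w} = {w. \<exists>j\<in>{1..<M}. sin (pi * real j / real M) < sqrt x * Im (cis (- (pi * real j / real M)) * w)}"
  proof (rule Collect_cong)
    fix w
    have "(cmod (cis (2 * pi * real j / real M) - 1))\<^sup>2 < 2 * sqrt x * Re (cnj (cis (2 * pi * real j / real M) - 1) * w)
      \<longleftrightarrow> sin (pi * real j / real M) < sqrt x * Im (cis (- (pi * real j / real M)) * w)" if j: "j \<in> {1..<M}" for j
    proof -
      define \<alpha> where "\<alpha> = pi * real j / real M"
      have s: "sin \<alpha> > 0"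
      proof (rule sin_gt_zero)
        show "0 < \<alpha>" using j by (simp add: \<alpha>_def)
        have "pi * real j < pi * real M" using j by simp
        then show "\<alpha> < pi" using M0 by (simp add: \<alpha>_def divide_less_eq)
      qed
      have "cis (2 * \<alpha>) - 1 = 2 * \<i> * of_real (sin \<alpha>) * cis \<alpha>"
        by (simp add: complex_eq_iff cos_double_sin sin_double power2_eq_square)
      then have e: "cis (2 * pi * real j / real M) - 1 = 2 * \<i> * of_real (sin \<alpha>) * cis \<alpha>"
        by (simp add: \<alpha>_def mult.assoc)
      have n: "(cmod (2 * \<i> * of_real (sin \<alpha>) * cis \<alpha>))\<^sup>2 = 4 * sin \<alpha> * sin \<alpha>"
        by (simp add: norm_mult power_mult_distrib power2_eq_square)
      have i: "Re (cnj (2 * \<i> * of_real (sin \<alpha>) * cis \<alpha>) * w) = 2 * sin \<alpha> * Im (cis (- \<alpha>) * w)"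
        by (simp add: algebra_simps)
      have "4 * sin \<alpha> * sin \<alpha> < 2 * sqrt x * (2 * sin \<alpha> * Im (cis (- \<alpha>) * w)) \<longleftrightarrow>
        (4 * sin \<alpha>) * sin \<alpha> < (4 * sin \<alpha>) * (sqrt x * Im (cis (- \<alpha>) * w))" by (simp add: mult_ac)
      also have "\<dots> \<longleftrightarrow> sin \<alpha> < sqrt x * Im (cis (- \<alpha>) * w)"
        by (rule mult_less_cancel_left_pos) (use s in simp)
      finally show ?thesis unfolding e n i by (simp only: \<alpha>_def)
    qed
    note eq = this
    have im: "(\<exists>u\<in>f ` U. R u) \<longleftrightarrow> (\<exists>j\<in>U. R (f j))" for f :: "nat \<Rightarrow> complex" and U R by auto
    show "Q w \<longleftrightarrow> (\<exists>j\<in>{1..<M}. sin (pi * real j / real M) < sqrt x * Im (cis (- (pi * real j / real M)) * w))"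
      unfolding Q_def psk_minus_one[OF M0] im by (rule bex_cong[OF refl eq])
  qed
  finally show ?thesis .
qed

text \<open>The closed form of the theorem as a function of the noise variance \<open>x\<close>.
  Division by zero gives the integrand the value 1 at \<open>\<theta> = 0\<close>, on a null
  set.\<close>

definition psk_integral :: "nat \<Rightarrow> real \<Rightarrow> real" where
  "psk_integral M x = 1 / pi * (LINT \<theta>:{0..(real M - 1) * pi / real M}|lborel.
     exp (- ((sin (pi / real M))\<^sup>2 / (x * (sin \<theta>)\<^sup>2))))"

text \<open>In direction \<theta> an error means that the modulus of the noise exceeds
  \<open>sin a / (sqrt x * sin (|\<theta>| - a))\<close>, and the squared modulus is exponential.
  Directions with \<open>|\<theta>|\<close> at most \<open>a\<close> never produce an error; on the
  others the substitution \<open>u = |\<theta>| - a\<close> gives the same integral for both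
  signs.\<close>

lemma sep_psk:
  assumes M: "2 \<le> M" and x: "x > 0"
  shows "sep (psk M) x = psk_integral M x"
proof -
  have M0: "0 < M" using M by simp
  define E where "E = {w. \<exists>j\<in>{1..<M}. sin (pi * real j / real M) < sqrt x * Im (cis (- (pi * real j / real M)) * w)}"
  have E: "E \<in> sets borel"
  proof -
    have "E = (\<Union>j\<in>{1..<M}. {w. sin (pi * real j / real M) < sqrt x * Im (cis (- (pi * real j / real M)) * w)})" by (auto simp: E_def)
    also have "\<dots> \<in> sets borel"
      by (intro sets.finite_UN borel_open open_Collect_less continuous_intros) auto
    finally show ?thesis .
  qed
  define a where "a = pi / real M"
  define b where "b = (real M - 1) * pi / real M"
  have a: "0 < a" "a < pi" and b: "b = pi - a" "0 < b"
    using M by (simp_all add: a_def b_def field_simps)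
  have sa: "sin a > 0" using a by (rule sin_gt_zero)
  define h where "h u = exp (- ((sin a)\<^sup>2 / (x * (sin u)\<^sup>2)))" for u
  have [measurable]: "h \<in> borel_measurable borel" unfolding h_def[abs_def] by measurable
  define g where "g t = emeasure cgauss {w. sin a < sqrt x * cmod w * sin (t - a)}" for t
  have g0: "g t = 0" if "0 \<le> t" "t \<le> a" for t
  proof -
    have "sin (a - t) \<ge> 0" using that a by (intro sin_ge_zero) auto
    moreover have "sin (t - a) = - sin (a - t)" by (metis minus_diff_eq sin_minus)
    ultimately have "sqrt x * cmod w * sin (t - a) \<le> 0" for w
      using x by (intro mult_nonneg_nonpos) auto
    then have "{w. sin a < sqrt x * cmod w * sin (t - a)} = {}"
      using sa by (auto simp: not_less intro: order_trans less_imp_le)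
    then show ?thesis by (simp add: g_def)
  qed
  have g1: "g t = ennreal (h (t - a))" if "a < t" "t < pi + a" for t
  proof -
    have s: "sin (t - a) > 0" using that by (intro sin_gt_zero) auto
    have "{w. sin a < sqrt x * cmod w * sin (t - a)} = {w. (sin a)\<^sup>2 / (x * (sin (t - a))\<^sup>2) < (cmod w)\<^sup>2}"
    proof (rule Collect_cong)
      fix w
      have "sin a < sqrt x * cmod w * sin (t - a) \<longleftrightarrow> (sin a)\<^sup>2 < (sqrt x * cmod w * sin (t - a))\<^sup>2"
      proof -
        have "0 \<le> sqrt x * cmod w * sin (t - a)" using s x by simp
        then show ?thesis
          using abs_le_square_iff[of "sqrt x * cmod w * sin (t - a)" "sin a"] sa by linarith
      qed
      also have "(sqrt x * cmod w * sin (t - a))\<^sup>2 = (cmod w)\<^sup>2 * (x * (sin (t - a))\<^sup>2)"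
        using x by (simp add: power_mult_distrib)
      also have "(sin a)\<^sup>2 < (cmod w)\<^sup>2 * (x * (sin (t - a))\<^sup>2) \<longleftrightarrow> (sin a)\<^sup>2 / (x * (sin (t - a))\<^sup>2) < (cmod w)\<^sup>2"
        using s x by (subst pos_divide_less_eq) auto
      finally show "sin a < sqrt x * cmod w * sin (t - a) \<longleftrightarrow> (sin a)\<^sup>2 / (x * (sin (t - a))\<^sup>2) < (cmod w)\<^sup>2" .
    qed
    then show ?thesis
      using x by (simp add: g_def h_def cgauss.emeasure_eq_measure measure_cgauss_radial_less)
  qed
  \<comment> \<open>The share of the directions of one sign; the two shares together cancel the 2 in
    \<open>2 * pi\<close>.\<close>
  define I where "I = (\<integral>\<^sup>+u. ennreal (h u) * indicator {0<..b} u \<partial>lborel)"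
  have "ennreal (2 * pi) * emeasure cgauss E =
    (\<integral>\<^sup>+\<theta>. emeasure cgauss {w. of_real (cmod w) * cis \<theta> \<in> E} * indicator {-pi..<pi} \<theta> \<partial>lborel)"
    by (rule emeasure_cgauss_angular_average[OF E])
  also have "\<dots> = (\<integral>\<^sup>+\<theta>. g \<bar>\<theta>\<bar> * indicator {-pi..<pi} \<theta> \<partial>lborel)"
  proof (intro nn_integral_cong)
    fix \<theta>
    show "emeasure cgauss {w. of_real (cmod w) * cis \<theta> \<in> E} * indicator {-pi..<pi} \<theta> = g \<bar>\<theta>\<bar> * indicator {-pi..<pi} \<theta>"
    proof (cases "\<theta> \<in> {-pi..<pi}")
      case True
      have "{w. of_real (cmod w) * cis \<theta> \<in> E} = {w. sin a < sqrt x * cmod w * sin (\<bar>\<theta>\<bar> - a)}"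
      proof (rule Collect_cong)
        fix w :: complex
        have "Im (cis (- \<alpha>) * (of_real (cmod w) * cis \<theta>)) = cmod w * sin (\<theta> - \<alpha>)" for \<alpha>
          by (simp add: sin_diff algebra_simps)
        then have "of_real (cmod w) * cis \<theta> \<in> E \<longleftrightarrow>
          (\<exists>j\<in>{1..<M}. sin (pi * real j / real M) < (sqrt x * cmod w) * sin (\<theta> - pi * real j / real M))"
          unfolding E_def mem_Collect_eq by (simp only: mult.assoc)
        also have "\<dots> \<longleftrightarrow> sin a < sqrt x * cmod w * sin (\<bar>\<theta>\<bar> - a)"
          unfolding a_def using M True x by (intro psk_sector) auto
        finally show "of_real (cmod w) * cis \<theta> \<in> E \<longleftrightarrow> sin a < sqrt x * cmod w * sin (\<bar>\<theta>\<bar> - a)" .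
      qed
      then show ?thesis by (simp add: g_def)
    qed simp
  qed
  also have "\<dots> = (\<integral>\<^sup>+\<theta>. ennreal (h (-a + 1 * \<theta>)) * indicator {0<..b} (-a + 1 * \<theta>)
      + ennreal (h (-a + (-1) * \<theta>)) * indicator {0<..b} (-a + (-1) * \<theta>) \<partial>lborel)"
  proof (rule nn_integral_cong_AE)
    have "AE \<theta> in lborel. \<theta> \<noteq> pi" by (rule AE_lborel_singleton)
    then show "AE \<theta> in lborel. g \<bar>\<theta>\<bar> * indicator {-pi..<pi} \<theta> = ennreal (h (-a + 1 * \<theta>)) * indicator {0<..b} (-a + 1 * \<theta>)
      + ennreal (h (-a + (-1) * \<theta>)) * indicator {0<..b} (-a + (-1) * \<theta>)"
    proof eventually_elim
      case (elim \<theta>)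
      consider "\<theta> < - pi" | "- pi \<le> \<theta>" "\<theta> < - a" | "- a \<le> \<theta>" "\<theta> \<le> a" | "a < \<theta>" "\<theta> < pi" | "pi < \<theta>"
        using elim by linarith
      then show ?case
      proof cases
        case 1 then show ?thesis using a b by (auto simp: indicator_def)
      next
        case 2
        then have "g \<bar>\<theta>\<bar> = ennreal (h (\<bar>\<theta>\<bar> - a))" using a by (intro g1) auto
        then show ?thesis using 2 a b by (auto simp: indicator_def abs_if add.commute)
      next
        case 3
        then have "g \<bar>\<theta>\<bar> = 0" by (intro g0) auto
        then show ?thesis using 3 a b by (auto simp: indicator_def)
      next
        case 4
        then have "g \<bar>\<theta>\<bar> = ennreal (h (\<bar>\<theta>\<bar> - a))" using a by (intro g1) auto
        then show ?thesis using 4 a b by (auto simp: indicator_def)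
      next
        case 5 then show ?thesis using a b by (auto simp: indicator_def)
      qed
    qed
  qed
  also have "\<dots> = (\<integral>\<^sup>+\<theta>. ennreal (h (-a + 1 * \<theta>)) * indicator {0<..b} (-a + 1 * \<theta>) \<partial>lborel)
      + (\<integral>\<^sup>+\<theta>. ennreal (h (-a + (-1) * \<theta>)) * indicator {0<..b} (-a + (-1) * \<theta>) \<partial>lborel)"
    by (rule nn_integral_add) measurable
  also have "\<dots> = I + I"
  proof -
    have m: "(\<lambda>u. ennreal (h u) * indicator {0<..b} u) \<in> borel_measurable borel" by measurable
    have "I = (\<integral>\<^sup>+\<theta>. ennreal (h (-a + 1 * \<theta>)) * indicator {0<..b} (-a + 1 * \<theta>) \<partial>lborel)"
      unfolding I_def using nn_integral_real_affine[OF m, of 1 "-a"] by simp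
    moreover have "I = (\<integral>\<^sup>+\<theta>. ennreal (h (-a + (-1) * \<theta>)) * indicator {0<..b} (-a + (-1) * \<theta>) \<partial>lborel)"
      unfolding I_def using nn_integral_real_affine[OF m, of "-1" "-a"] by simp
    ultimately show ?thesis by simp
  qed
  finally have two: "ennreal (2 * pi) * emeasure cgauss E = I + I" .
  have "I = (\<integral>\<^sup>+u. ennreal (indicator {0..b} u * h u) \<partial>lborel)"
    unfolding I_def
  proof (rule nn_integral_cong_AE)
    have "AE u in lborel. u \<noteq> (0::real)" by (rule AE_lborel_singleton)
    then show "AE u in lborel. ennreal (h u) * indicator {0<..b} u = ennreal (indicator {0..b} u * h u)"
      by eventually_elim (auto simp: indicator_def)
  qed
  also have "\<dots> = ennreal (LINT u:{0..b}|lborel. h u)"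
    unfolding set_lebesgue_integral_def real_scaleR_def
  proof (rule nn_integral_eq_integral)
    have i: "integrable lborel (indicator {0..b} :: real \<Rightarrow> real)"
      by (rule integrable_real_indicator) (auto simp: emeasure_lborel_Icc_eq)
    show "integrable lborel (\<lambda>u. indicator {0..b} u * h u)"
      by (rule Bochner_Integration.integrable_bound[OF i]) (use x in \<open>auto simp: h_def indicator_def\<close>)
  qed (auto simp: h_def)
  finally have I: "I = ennreal (LINT u:{0..b}|lborel. h u)" .
  have J: "0 \<le> (LINT u:{0..b}|lborel. h u)"
    unfolding set_lebesgue_integral_def by (intro integral_nonneg_AE) (auto simp: h_def)
  have "ennreal (2 * pi * measure cgauss E) = ennreal (2 * (LINT u:{0..b}|lborel. h u))"
    using two J by (simp add: I cgauss.emeasure_eq_measure ennreal_mult ennreal_plus[symmetric] del: ennreal_plus)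
  then have "2 * pi * measure cgauss E = 2 * (LINT u:{0..b}|lborel. h u)"
    using J by (subst (asm) ennreal_inj) auto
  then have "measure cgauss E = psk_integral M x"
    by (simp add: psk_integral_def b_def h_def a_def field_simps)
  moreover have "(\<Sum>c\<in>psk M. symbol_error (psk M) c x) = (\<Sum>c\<in>psk M. measure cgauss E)"
    unfolding E_def by (intro sum.cong refl symbol_error_psk M x)
  ultimately show ?thesis using M0 by (simp add: sep_def card_psk)
qed

lemma isCont_psk_integral:
  assumes x: "x > 0"
  shows "isCont (psk_integral M) x"
  unfolding continuous_at_sequentially
proof (intro allI impI)
  fix X :: "nat \<Rightarrow> real" assume X: "X \<longlonglongrightarrow> x"
  define B where "B = {0..(real M - 1) * pi / real M}"
  define f where "f y \<theta> = indicator B \<theta> * exp (- ((sin (pi / real M))\<^sup>2 / (y * (sin \<theta>)\<^sup>2)))" for y \<theta> :: real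
  have pos: "\<forall>\<^sub>F n in sequentially. X n > 0" using X x by (rule order_tendstoD)
  \<comment> \<open>Domination of the integrand by 1 rests on a positive noise variance, so the
    sequence is shifted by \<open>N\<close>.\<close>
  then obtain N where N: "\<And>n. n \<ge> N \<Longrightarrow> X n > 0" by (auto simp: eventually_sequentially)
  have B[measurable]: "B \<in> sets borel" by (simp add: B_def)
  have "(\<lambda>n. LINT \<theta>|lborel. f (X (n + N)) \<theta>) \<longlonglongrightarrow> (LINT \<theta>|lborel. f x \<theta>)"
  proof (rule integral_dominated_convergence)
    show "f x \<in> borel_measurable lborel" unfolding f_def[abs_def] by measurable
    show "f (X (n + N)) \<in> borel_measurable lborel" for n unfolding f_def[abs_def] by measurable
    show "integrable lborel (indicator B :: real \<Rightarrow> real)"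
      unfolding B_def by (rule integrable_real_indicator) (auto simp: emeasure_lborel_Icc_eq)
    show "AE \<theta> in lborel. (\<lambda>n. f (X (n + N)) \<theta>) \<longlonglongrightarrow> f x \<theta>"
    proof (rule AE_I2)
      fix \<theta> :: real
      define K where "K = (sin (pi / real M))\<^sup>2 / (sin \<theta>)\<^sup>2"
      have f: "f y \<theta> = indicator B \<theta> * exp (- (K / y))" for y
        by (simp add: f_def K_def mult.commute[of y])
      have "(\<lambda>n. K / X (n + N)) \<longlonglongrightarrow> K / x"
        using x by (intro tendsto_divide[OF tendsto_const LIMSEQ_ignore_initial_segment[OF X]]) simp
      then show "(\<lambda>n. f (X (n + N)) \<theta>) \<longlonglongrightarrow> f x \<theta>"
        unfolding f by (intro tendsto_mult[OF tendsto_const tendsto_exp[OF tendsto_minus]])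
    qed
    show "AE \<theta> in lborel. norm (f (X (n + N)) \<theta>) \<le> indicator B \<theta>" for n
    proof (rule AE_I2)
      fix \<theta> :: real
      have "0 \<le> (sin (pi / real M))\<^sup>2 / (X (n + N) * (sin \<theta>)\<^sup>2)" using N[of "n + N"] by simp
      then show "norm (f (X (n + N)) \<theta>) \<le> indicator B \<theta>" by (simp add: f_def indicator_def)
    qed
  qed
  then have "(\<lambda>n. LINT \<theta>|lborel. f (X n) \<theta>) \<longlonglongrightarrow> (LINT \<theta>|lborel. f x \<theta>)"
    by (rule LIMSEQ_offset)
  then have "(\<lambda>n. 1 / pi * (LINT \<theta>|lborel. f (X n) \<theta>)) \<longlonglongrightarrow> 1 / pi * (LINT \<theta>|lborel. f x \<theta>)"
    by (rule tendsto_mult_left)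
  then show "(psk_integral M \<circ> X) \<longlonglongrightarrow> psk_integral M x"
    unfolding o_def psk_integral_def set_lebesgue_integral_def real_scaleR_def f_def B_def .
qed

section \<open>The limit of the average error probability\<close>

lemma gs_row_norm:
  assumes "gs_norm N j z \<noteq> 0"
  shows "(\<Sum>i<N. (cmod (gs_row N j z i))\<^sup>2) = 1 / gs_norm N j z"
proof -
  have "(\<Sum>i<N. (cmod (gs_row N j z i))\<^sup>2) = (\<Sum>i<N. (cmod (gs_resid N j z i))\<^sup>2) / (gs_norm N j z)\<^sup>2"
    by (simp add: gs_row_def norm_divide power_divide sum_divide_distrib)
  also have "\<dots> = gs_norm N j z / (gs_norm N j z)\<^sup>2" by (simp only: gs_norm_def)
  finally show ?thesis using assms by (simp add: power2_eq_square)
qed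

section \<open>The error probability of one symbol in a finite system\<close>

context mimo_system
begin

text \<open>\<open>distr_whitened\<close> read as a conditional probability, each symbol having
  probability \<open>1 / card S\<close>.\<close>

lemma conditional_law:
  assumes nv: "0 < noise_var"
    and T: "\<And>a b. a < Nt \<Longrightarrow> b < Nt \<Longrightarrow> (\<Sum>p<Nt. \<Sum>q<Nt. cnj (T $$ (p, a)) * T $$ (q, b) * \<Sigma> $$ (p, q)) = of_bool (a = b)"
    and k: "k < Nt" and S: "finite S" and c: "c \<in> S" and B: "B \<in> sets (cgmat Nr (Suc Nt))"
  shows "prob {\<omega> \<in> space P. s \<omega> $ k = c \<and> (\<lambda>p\<in>{..<Nr} \<times> {..<Suc Nt}. whitened T \<omega> p) \<in> B} = measure (cgmat Nr (Suc Nt)) B / real (card S)"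
proof -
  let ?E = "{\<omega> \<in> space P. s \<omega> $ k = c}" and ?Y = "\<lambda>\<omega>. \<lambda>p\<in>{..<Nr} \<times> {..<Suc Nt}. whitened T \<omega> p"
  have cS: "card S > 0" using S c by (auto simp: card_gt_0_iff)
  have pE: "prob ?E = 1 / real (card S)" by (rule symbols_uniform[OF k c])
  then have pE0: "prob ?E > 0" using cS by simp
  have ev: "?E \<in> events" using s_entry_measurable[OF k] by (auto intro!: borel_measurable_eq)
  have sets: "sets (Pi\<^sub>M ({..<Nr} \<times> {..<Suc Nt}) (\<lambda>_. borel)) = sets (cgmat Nr (Suc Nt))"
    by (rule sets_PiM_cong) auto
  have Ym: "?Y \<in> measurable P (Pi\<^sub>M ({..<Nr} \<times> {..<Suc Nt}) (\<lambda>_. borel))"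
    by (rule measurable_restrict) (rule whitened_measurable)
  have B': "B \<in> sets (Pi\<^sub>M ({..<Nr} \<times> {..<Suc Nt}) (\<lambda>_. borel))" using B sets by simp
  have YB: "?Y -` B \<inter> space P \<in> events" by (rule measurable_sets[OF Ym B'])
  have "measure (cgmat Nr (Suc Nt)) B = measure (distr (uniform_measure P ?E) (Pi\<^sub>M ({..<Nr} \<times> {..<Suc Nt}) (\<lambda>_. borel)) ?Y) B"
    by (subst distr_whitened[OF nv T k pE0]) auto
  also have "\<dots> = measure (uniform_measure P ?E) (?Y -` B \<inter> space P)"
    using Ym B' by (subst measure_distr) auto
  also have "\<dots> = prob (?E \<inter> (?Y -` B \<inter> space P)) / prob ?E"
    using ev YB pE0 by (subst measure_uniform_measure) (auto simp: emeasure_eq_measure)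
  also have "?E \<inter> (?Y -` B \<inter> space P) = {\<omega> \<in> space P. s \<omega> $ k = c \<and> ?Y \<omega> \<in> B}" by auto
  finally show ?thesis using pE cS by (simp add: field_simps)
qed

text \<open>Given the first \<open>Nt\<close> columns, the noise in symbol \<open>k\<close> is a
  linear form of the last column with squared length
  \<open>noise_var * \<kappa>^2 / gs_norm\<close>, hence a scaled standard Gaussian. The law of the
  matrix given the symbol is the same for every symbol, so the average over the constellation can be
  taken inside the integral, where it becomes \<open>sep\<close>.\<close>

lemma error_probability:
  assumes nv: "0 < noise_var" and NN: "Nt \<le> Nr"
    and eig: "eigen_decomposition Nt \<Sigma> W d" and d: "\<And>i. i < Nt \<Longrightarrow> 0 < d i"
    and k: "k < Nt" and S: "finite S" "S \<noteq> {}"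
  shows "prob {\<omega> \<in> space P. nearest S (zf_output (H \<omega>) (precoder Nt W d) (s \<omega>) (\<xi> \<omega>) $ k) \<noteq> s \<omega> $ k}
    = (LINT z|cgmat Nr Nt. sep S (noise_var * ((\<Sum>i<Nt. 1 / sqrt (d i)) / sqrt (real Nt))\<^sup>2 / gs_norm Nr (Nt - 1) z))"
proof -
  define \<kappa> where "\<kappa> = (\<Sum>i<Nt. 1 / sqrt (d i)) / sqrt (real Nt)"
  have \<kappa>: "\<kappa> > 0" unfolding \<kappa>_def using d k by (intro divide_pos_pos sum_pos) auto
  define F where "F = precoder Nt W d"
  obtain T N N' where TN: "T \<in> carrier_mat Nt Nt" "N \<in> carrier_mat Nt Nt" "N' \<in> carrier_mat Nt Nt"
    "N * N' = 1\<^sub>m Nt" "N' * N = 1\<^sub>m Nt" "F = T * N"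
    and T: "\<And>a b. a < Nt \<Longrightarrow> b < Nt \<Longrightarrow> (\<Sum>p<Nt. \<Sum>q<Nt. cnj (T $$ (p, a)) * T $$ (q, b) * \<Sigma> $$ (p, q)) = of_bool (a = b)"
    and row: "\<And>a. a < Nt \<Longrightarrow> N' $$ (k, a) = (if a = Nt - 1 then of_real \<kappa> else 0)"
    unfolding \<kappa>_def F_def
  proof (rule precoder_factorization[OF eig d k], assumption)
    fix T N N' :: "complex mat"
    assume A: "T \<in> carrier_mat Nt Nt" "N \<in> carrier_mat Nt Nt" "N' \<in> carrier_mat Nt Nt"
      "N * N' = 1\<^sub>m Nt" "N' * N = 1\<^sub>m Nt" "precoder Nt W d = T * N"
      "\<And>a b. a < Nt \<Longrightarrow> b < Nt \<Longrightarrow> (\<Sum>p<Nt. \<Sum>q<Nt. cnj (T $$ (p, a)) * T $$ (q, b) * \<Sigma> $$ (p, q)) = of_bool (a = b)"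
      "\<And>a. a < Nt \<Longrightarrow> N' $$ (k, a) = (if a = Nt - 1 then of_real ((\<Sum>i<Nt. 1 / sqrt (d i)) / sqrt (real Nt)) else 0)"
    show thesis by (rule that[unfolded \<kappa>_def F_def, OF A])
  qed
  define Y where "Y \<omega> = (\<lambda>p\<in>{..<Nr} \<times> {..<Suc Nt}. whitened T \<omega> p)" for \<omega>
  define full where "full z \<longleftrightarrow> (\<forall>a<Nt. gs_norm Nr a z \<noteq> 0)" for z
  \<comment> \<open>The noise after zero-forcing, as a function of the Gaussian matrix alone; column
    \<open>Nt\<close> carries the noise.\<close>
  define out where "out z = (\<Sum>i<Nr. of_real (\<kappa> * sqrt noise_var) * gs_row Nr (Nt - 1) z i * z (i, Nt))" for z
  \<comment> \<open>Output 0 on degenerate matrices agrees with the totalized inverse, so this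
    description of the receiver is valid at every sample point.\<close>
  define dec where "dec c z = nearest S (if full z then c + out z else 0)" for c z
  have Fc: "F \<in> carrier_mat Nt Nt" using TN by simp
  have zf: "zf_output (H \<omega>) F (s \<omega>) (\<xi> \<omega>) $ k = (if full (Y \<omega>) then s \<omega> $ k + out (Y \<omega>) else 0)"
    if \<omega>: "\<omega> \<in> space P" for \<omega>
  proof -
    have Hc: "H \<omega> \<in> carrier_mat Nr Nt" by (rule H_carrier[OF \<omega>])
    have sc: "s \<omega> \<in> carrier_vec Nt" using measurable_space[OF s_measurable \<omega>] by simp
    have xc: "\<xi> \<omega> \<in> carrier_vec Nr" using measurable_space[OF \<xi>_measurable \<omega>] by simp
    define G where "G = H \<omega> * F"
    have G: "G \<in> carrier_mat Nr Nt" using Hc Fc by (simp add: G_def)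
    have HT: "H \<omega> * T \<in> carrier_mat Nr Nt" using Hc TN by simp
    have GZ: "G $$ (i, b) = (\<Sum>a<Nt. Y \<omega> (i, a) * N $$ (a, b))" if i: "i < Nr" and b: "b < Nt" for i b
    proof -
      have "G = (H \<omega> * T) * N" unfolding G_def TN(6) by (rule assoc_mult_mat[OF Hc TN(1,2), symmetric])
      then have "G $$ (i, b) = (\<Sum>a<Nt. (H \<omega> * T) $$ (i, a) * N $$ (a, b))"
        using mat_mult_index[OF HT TN(2) i b] by simp
      also have "\<dots> = (\<Sum>a<Nt. Y \<omega> (i, a) * N $$ (a, b))"
      proof (rule sum.cong[OF refl])
        fix a assume "a \<in> {..<Nt}"
        then have a: "a < Nt" by simp
        show "(H \<omega> * T) $$ (i, a) * N $$ (a, b) = Y \<omega> (i, a) * N $$ (a, b)"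
          unfolding mat_mult_index[OF Hc TN(1) i a] using i a by (simp add: Y_def whitened_def)
      qed
      finally show ?thesis .
    qed
    have out_eq: "zf_output (H \<omega>) F (s \<omega>) (\<xi> \<omega>) = zf_matrix G *\<^sub>v (G *\<^sub>v s \<omega> + \<xi> \<omega>)"
      by (simp add: zf_output_def received_def G_def)
    show ?thesis
    proof (cases "full (Y \<omega>)")
      case False
      then obtain a where "a < Nt" "gs_norm Nr a (Y \<omega>) = 0" by (auto simp: full_def)
      then have z: "zf_matrix G = 0\<^sub>m Nt Nr"
        by (intro zf_not_full[OF G TN(2,3,4,5) _ k]) (simp_all add: GZ row)
      have "G *\<^sub>v s \<omega> + \<xi> \<omega> \<in> carrier_vec Nr" using G sc xc by simp
      then show ?thesis unfolding out_eq z
        using False k by (simp add: mat_mult_vec_index[OF zero_carrier_mat])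
    next
      case True
      then have full: "\<And>a. a < Nt \<Longrightarrow> gs_norm Nr a (Y \<omega>) \<noteq> 0" by (simp add: full_def)
      have det: "det (mat_adjoint G * G) \<noteq> 0"
        by (rule zf_full(1)[OF G TN(2,3,4,5) _ k]) (rule GZ row full; assumption)+
      have zfi: "zf_matrix G $$ (k, i) = of_real \<kappa> * gs_row Nr (Nt - 1) (Y \<omega>) i" if "i < Nr" for i
        by (rule zf_full(2)[OF G TN(2,3,4,5) _ k, where z = "Y \<omega>"]) ((rule GZ row full; assumption) | rule that)+
      note G' = mat_adjoint_carrier[OF G]
      have GG: "mat_adjoint G * G \<in> carrier_mat Nt Nt" using G G' by simp
      note B = mat_inv_nonsingular[OF GG det]
      have zc: "zf_matrix G \<in> carrier_mat Nt Nr" unfolding zf_matrix_def using B(1) G' by simp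
      have "zf_matrix G * G = mat_inv (mat_adjoint G * G) * (mat_adjoint G * G)"
        unfolding zf_matrix_def by (rule assoc_mult_mat[OF B(1) G' G])
      then have one: "zf_matrix G * G = 1\<^sub>m Nt" using B(2) by simp
      have Gs: "G *\<^sub>v s \<omega> \<in> carrier_vec Nr" using G sc by simp
      have "zf_output (H \<omega>) F (s \<omega>) (\<xi> \<omega>) = zf_matrix G *\<^sub>v (G *\<^sub>v s \<omega>) + zf_matrix G *\<^sub>v \<xi> \<omega>"
        unfolding out_eq by (rule mult_add_distrib_mat_vec[OF zc Gs xc])
      also have "zf_matrix G *\<^sub>v (G *\<^sub>v s \<omega>) = (zf_matrix G * G) *\<^sub>v s \<omega>"
        by (rule assoc_mult_mat_vec[OF zc G sc, symmetric])
      also have "\<dots> = s \<omega>" unfolding one using sc by simp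
      finally have "zf_output (H \<omega>) F (s \<omega>) (\<xi> \<omega>) $ k = s \<omega> $ k + (zf_matrix G *\<^sub>v \<xi> \<omega>) $ k"
        using zc k by simp
      also have "(zf_matrix G *\<^sub>v \<xi> \<omega>) $ k = (\<Sum>i<Nr. zf_matrix G $$ (k, i) * \<xi> \<omega> $ i)"
        by (rule mat_mult_vec_index[OF zc xc k])
      also have "\<dots> = out (Y \<omega>)"
        unfolding out_def
      proof (rule sum.cong[OF refl])
        fix i assume "i \<in> {..<Nr}"
        then have i: "i < Nr" by simp
        have "\<xi> \<omega> $ i = of_real (sqrt noise_var) * Y \<omega> (i, Nt)"
          using i nv by (simp add: Y_def whitened_def)
        then show "zf_matrix G $$ (k, i) * \<xi> \<omega> $ i = of_real (\<kappa> * sqrt noise_var) * gs_row Nr (Nt - 1) (Y \<omega>) i * Y \<omega> (i, Nt)"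
          unfolding zfi[OF i] by simp
      qed
      finally show ?thesis using True by simp
    qed
  qed
  have m_norm[measurable]: "gs_norm Nr a \<in> borel_measurable (cgmat Nr (Suc Nt))" if "a < Nt" for a
    using that by (intro measurable_gs_norm) simp
  have full_m: "{z \<in> space (cgmat Nr (Suc Nt)). full z} \<in> sets (cgmat Nr (Suc Nt))"
  proof -
    have "{z \<in> space (cgmat Nr (Suc Nt)). full z} = {z \<in> space (cgmat Nr (Suc Nt)). \<forall>a\<in>{..<Nt}. gs_norm Nr a z \<noteq> 0}"
      by (auto simp: full_def)
    also have "\<dots> \<in> sets (cgmat Nr (Suc Nt))"
      by (intro sets.sets_Collect_finite_All) (auto intro!: borel_measurable_neq m_norm)
    finally show ?thesis .
  qed
  have out_m: "out \<in> borel_measurable (cgmat Nr (Suc Nt))"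
  proof -
    have r: "(\<lambda>z. gs_row Nr (Nt - 1) z i) \<in> borel_measurable (cgmat Nr (Suc Nt))" for i
      unfolding gs_row_def using k
      by (intro borel_measurable_divide measurable_compose[OF measurable_gs_resid borel_measurable_cnj]
         measurable_compose[OF m_norm borel_measurable_of_real]) auto
    have "(\<lambda>z. z (i, Nt)) \<in> borel_measurable (cgmat Nr (Suc Nt))" if "i < Nr" for i
      using that by (intro measurable_PiM_cgauss) auto
    then have "(\<lambda>z. out z) \<in> borel_measurable (cgmat Nr (Suc Nt))"
      unfolding out_def by (intro borel_measurable_sum borel_measurable_times borel_measurable_const r) auto
    then show ?thesis by simp
  qed
  have dec_m: "dec c \<in> borel_measurable (cgmat Nr (Suc Nt))" for c
    unfolding dec_def[abs_def]
    by (intro measurable_compose[OF _ measurable_nearest[OF S(1)]] measurable_If borel_measurable_add borel_measurable_const out_m full_m)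
  define D where "D c = {z \<in> space (cgmat Nr (Suc Nt)). dec c z \<noteq> c}" for c
  have Dm: "D c \<in> sets (cgmat Nr (Suc Nt))" for c
  proof -
    note [measurable] = dec_m[of c]
    show ?thesis unfolding D_def by measurable
  qed
  let ?x = "\<lambda>z. noise_var * \<kappa>\<^sup>2 / gs_norm Nr (Nt - 1) z"
  have xm: "(\<lambda>z. symbol_error S c (?x z)) \<in> borel_measurable (cgmat Nr Nt)" for c
  proof -
    have [measurable]: "gs_norm Nr (Nt - 1) \<in> borel_measurable (cgmat Nr Nt)" using k by (intro measurable_gs_norm) simp
    have "(\<lambda>z. ?x z) \<in> borel_measurable (cgmat Nr Nt)" by measurable
    then show ?thesis by (rule measurable_compose[OF _ measurable_symbol_error[OF S(1)]])
  qed
  have mD: "measure (cgmat Nr (Suc Nt)) (D c) = (LINT z|cgmat Nr Nt. symbol_error S c (?x z))" for c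
  proof -
    have "emeasure (cgmat Nr (Suc Nt)) (D c) = (\<integral>\<^sup>+z. ennreal (symbol_error S c (?x z)) \<partial>cgmat Nr Nt)"
      unfolding emeasure_cgmat_Suc[OF Dm]
    proof (rule nn_integral_cong_AE)
      have "AE z in cgmat Nr Nt. \<forall>a<Nt. gs_norm Nr a z \<noteq> 0" using NN by (rule AE_gs_norm_nonzero)
      then show "AE z in cgmat Nr Nt. emeasure (cgvec Nr) {y \<in> space (cgvec Nr). add_col Nr Nt z y \<in> D c} = ennreal (symbol_error S c (?x z))"
        using AE_space
      proof eventually_elim
        case (elim z)
        define v where "v i = of_real (\<kappa> * sqrt noise_var) * gs_row Nr (Nt - 1) z i" for i
        have q: "gs_norm Nr (Nt - 1) z > 0" 
        proof -
          have "gs_norm Nr (Nt - 1) z \<noteq> 0" using elim(1)[rule_format, of "Nt - 1"] k by simp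
          then show ?thesis using gs_norm_nonneg[of Nr "Nt - 1" z] by (rule_tac le_neq_trans) auto
        qed
        have "(\<Sum>i<Nr. (cmod (v i))\<^sup>2) = (\<kappa> * sqrt noise_var)\<^sup>2 * (\<Sum>i<Nr. (cmod (gs_row Nr (Nt - 1) z i))\<^sup>2)"
          by (simp add: v_def norm_mult power_mult_distrib sum_distrib_left)
        also have "\<dots> = ?x z" using q nv by (simp add: gs_row_norm power_mult_distrib)
        finally have vt: "(\<Sum>i<Nr. (cmod (v i))\<^sup>2) = (sqrt (?x z))\<^sup>2" using nv q by simp
        have t: "sqrt (?x z) > 0" using nv q \<kappa> by simp
        define B where "B = {w. nearest S (c + w) \<noteq> c}"
        have B: "B \<in> sets borel"
        proof -
          note [measurable] = measurable_nearest[OF S(1)]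
          have "{w \<in> space borel. nearest S (c + w) \<noteq> c} \<in> sets borel" by measurable
          then show ?thesis by (simp add: B_def)
        qed
        have zcol: "full (add_col Nr Nt z y)" for y using elim(1) by (simp add: full_def gs_add_col)
        have ocol: "out (add_col Nr Nt z y) = (\<Sum>i<Nr. v i * y i)" for y
          unfolding out_def v_def using k
          by (intro sum.cong refl) (simp add: gs_row_def gs_add_col add_col_simps)
        have "add_col Nr Nt z y \<in> space (cgmat Nr (Suc Nt))" for y
          by (simp add: add_col_def space_PiM)
        then have "{y \<in> space (cgvec Nr). add_col Nr Nt z y \<in> D c} = {y \<in> space (cgvec Nr). (\<Sum>i<Nr. v i * y i) \<in> B}"
          by (auto simp: D_def dec_def zcol ocol B_def)
        then have "emeasure (cgvec Nr) {y \<in> space (cgvec Nr). add_col Nr Nt z y \<in> D c} = emeasure cgauss {w. of_real (sqrt (?x z)) * w \<in> B}"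
          using emeasure_cgvec_linear[OF vt t B] by simp
        then show ?case by (simp add: B_def symbol_error_def cgauss.emeasure_eq_measure)
      qed
    qed
    then show ?thesis
      unfolding measure_def
      by (subst integral_eq_nn_integral[OF xm]) (auto simp: symbol_error_bounds)
  qed
  define E where "E = {\<omega> \<in> space P. dec (s \<omega> $ k) (Y \<omega>) \<noteq> s \<omega> $ k}"
  have E_eq: "{\<omega> \<in> space P. nearest S (zf_output (H \<omega>) F (s \<omega>) (\<xi> \<omega>) $ k) \<noteq> s \<omega> $ k} = E"
    unfolding E_def dec_def by (rule Collect_cong) (simp only: zf cong: conj_cong)
  have Ym: "Y \<in> measurable P (cgmat Nr (Suc Nt))"
  proof -
    have "(\<lambda>\<omega>. \<lambda>p\<in>{..<Nr} \<times> {..<Suc Nt}. whitened T \<omega> p) \<in> measurable P (cgmat Nr (Suc Nt))"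
      by (rule measurable_restrict) (use whitened_measurable in \<open>simp add: measurable_cong_sets[OF refl sets_cgauss]\<close>)
    then show ?thesis by (simp add: Y_def[abs_def])
  qed
  have Em: "E \<in> events"
  proof -
    have "{\<omega> \<in> space P. full (Y \<omega>)} = Y -` {z \<in> space (cgmat Nr (Suc Nt)). full z} \<inter> space P"
      using measurable_space[OF Ym] by auto
    then have fm: "{\<omega> \<in> space P. full (Y \<omega>)} \<in> events" using measurable_sets[OF Ym full_m] by simp
    have [measurable]: "(\<lambda>\<omega>. nearest S (if full (Y \<omega>) then s \<omega> $ k + out (Y \<omega>) else 0)) \<in> borel_measurable P"
      by (intro measurable_compose[OF _ measurable_nearest[OF S(1)]] measurable_If borel_measurable_add borel_measurable_const
          s_entry_measurable[OF k] measurable_compose[OF Ym out_m] fm)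
    note [measurable] = s_entry_measurable[OF k]
    show ?thesis unfolding E_def dec_def by measurable
  qed
  define Ec where "Ec c = {\<omega> \<in> space P. s \<omega> $ k = c}" for c
  have Ecm: "Ec c \<in> events" for c
  proof -
    note [measurable] = s_entry_measurable[OF k]
    show ?thesis unfolding Ec_def by measurable
  qed
  have disj: "disjoint_family_on Ec S" by (auto simp: disjoint_family_on_def Ec_def)
  \<comment> \<open>The uniform probabilities add up to 1, so the symbol lies in \<open>S\<close>
    almost surely.\<close>
  have "prob (\<Union>c\<in>S. Ec c) = (\<Sum>c\<in>S. prob (Ec c))"
    using S disj Ecm by (intro finite_measure_finite_Union) auto
  also have "\<dots> = (\<Sum>c\<in>S. 1 / real (card S))"
    unfolding Ec_def by (intro sum.cong refl symbols_uniform k)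
  also have "\<dots> = 1" using S by simp
  finally have one: "prob (\<Union>c\<in>S. Ec c) = 1" .
  have "prob E = prob (E \<inter> (\<Union>c\<in>S. Ec c))"
  proof (rule finite_measure_eq_AE)
    have "AE \<omega> in P. \<omega> \<in> (\<Union>c\<in>S. Ec c)" using one Ecm S by (intro AE_prob_1) auto
    then show "AE \<omega> in P. \<omega> \<in> E \<longleftrightarrow> \<omega> \<in> E \<inter> (\<Union>c\<in>S. Ec c)" by eventually_elim auto
  qed (use Em Ecm S in auto)
  also have "E \<inter> (\<Union>c\<in>S. Ec c) = (\<Union>c\<in>S. E \<inter> Ec c)" by auto
  also have "prob (\<Union>c\<in>S. E \<inter> Ec c) = (\<Sum>c\<in>S. prob (E \<inter> Ec c))"
    using S Em Ecm disj by (intro finite_measure_finite_Union) (auto simp: disjoint_family_on_def)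
  also have "\<dots> = (\<Sum>c\<in>S. (LINT z|cgmat Nr Nt. symbol_error S c (?x z)) / real (card S))"
  proof (rule sum.cong[OF refl])
    fix c assume c: "c \<in> S"
    have "E \<inter> Ec c = {\<omega> \<in> space P. s \<omega> $ k = c \<and> (\<lambda>p\<in>{..<Nr} \<times> {..<Suc Nt}. whitened T \<omega> p) \<in> D c}"
      using measurable_space[OF Ym] by (auto simp: E_def Ec_def D_def Y_def)
    then show "prob (E \<inter> Ec c) = (LINT z|cgmat Nr Nt. symbol_error S c (?x z)) / real (card S)"
      using conditional_law[OF nv T k S(1) c Dm] mD by simp
  qed
  also have "\<dots> = (LINT z|cgmat Nr Nt. sep S (?x z))"
  proof -
    have i: "integrable (cgmat Nr Nt) (\<lambda>z. symbol_error S c (?x z))" for c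
      by (rule finite_measure.integrable_const_bound[OF prob_space.finite_measure[OF prob_space_cgmat], of _ 1])
        (use xm in \<open>auto simp: symbol_error_bounds\<close>)
    show ?thesis
      unfolding sep_def integral_divide_zero
      by (subst Bochner_Integration.integral_sum[OF i]) (simp add: sum_divide_distrib)
  qed
  finally show ?thesis unfolding E_eq[symmetric] F_def \<kappa>_def .
qed

end

text \<open>\<open>sep\<close> takes values in [0, 1] and is continuous at the limiting noise
  variance. Where \<open>gs_norm\<close> is close to its mean the argument is close to
  \<open>x0\<close>; elsewhere the integrand deviates by at most 1, on an event of small
  probability.\<close>

lemma sep_limit:
  fixes nr :: "nat \<Rightarrow> nat" and F :: "nat filter"
  assumes S: "finite S" and cont: "isCont (sep S) x0"
    and nr: "\<forall>\<^sub>F n in F. 0 < n \<and> n \<le> nr n"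
    and r: "filterlim (\<lambda>n. real (nr n) - real (n - 1)) at_top F"
    and a: "((\<lambda>n. a n / (real (nr n) - real (n - 1))) \<longlongrightarrow> x0) F"
  shows "((\<lambda>n. (LINT z|cgmat (nr n) n. sep S (a n / gs_norm (nr n) (n - 1) z))) \<longlongrightarrow> sep S x0) F"
proof (rule tendstoI)
  fix e :: real assume e: "e > 0"
  obtain \<delta> where \<delta>: "\<delta> > 0" "\<And>x. dist x x0 < \<delta> \<Longrightarrow> dist (sep S x) (sep S x0) < e / 3"
    using cont[unfolded continuous_at_eps_delta] e by (metis divide_pos_pos zero_less_numeral)
  \<comment> \<open>The noise variance is written as the quotient of \<open>a n / R\<close> and
    \<open>gs_norm / R\<close>, which are close to \<open>x0\<close> and to 1.\<close>
  have "isCont (\<lambda>p::real \<times> real. fst p / snd p) (x0, 1)"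
    by (intro continuous_intros) auto
  then obtain \<eta> where \<eta>: "\<eta> > 0" "\<And>p. dist p (x0, 1) < \<eta> \<Longrightarrow> dist (fst p / snd p) (x0 / 1) < \<delta>"
    unfolding continuous_at_eps_delta using \<delta>(1) by (metis fst_conv snd_conv)
  define \<epsilon> where "\<epsilon> = \<eta> / 2"
  have \<epsilon>: "\<epsilon> > 0" using \<eta> by (simp add: \<epsilon>_def)
  have ratio: "dist (u / v) x0 < \<delta>" if "\<bar>u - x0\<bar> < \<epsilon>" "\<bar>v - 1\<bar> < \<epsilon>" for u v
  proof -
    have "dist (u, v) (x0, 1) \<le> \<bar>u - x0\<bar> + \<bar>v - 1\<bar>"
      unfolding dist_Pair_Pair dist_real_def by (rule sqrt_sum_squares_le_sum_abs[THEN order_trans]) simp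
    then have "dist (u, v) (x0, 1) < \<eta>" using that by (simp add: \<epsilon>_def)
    from \<eta>(2)[OF this] show ?thesis by simp
  qed
  \<comment> \<open>For a rank \<open>R\<close> beyond this bound the estimate
    \<open>1 / (\<epsilon>^2 * R)\<close> of \<open>gs_norm_concentration\<close> is below
    \<open>e / 3\<close>.\<close>
  have ev_r: "\<forall>\<^sub>F n in F. 3 / (e * \<epsilon>\<^sup>2) < real (nr n) - real (n - 1)"
    using r by (rule filterlim_at_top_dense[THEN iffD1, rule_format])
  have ev_a: "\<forall>\<^sub>F n in F. \<bar>a n / (real (nr n) - real (n - 1)) - x0\<bar> < \<epsilon>"
    using tendstoD[OF a \<epsilon>] by (simp add: dist_real_def)
  show "\<forall>\<^sub>F n in F. dist (LINT z|cgmat (nr n) n. sep S (a n / gs_norm (nr n) (n - 1) z)) (sep S x0) < e"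
    using ev_r ev_a nr
  proof eventually_elim
    case (elim n)
    define N where "N = nr n"
    define j where "j = n - 1"
    have j: "Suc j = n" "j < N" using elim by (auto simp: j_def N_def)
    define R where "R = real N - real j"
    have R: "R > 3 / (e * \<epsilon>\<^sup>2)" "R > 0" using elim(1) j(2) by (simp_all add: R_def N_def j_def)
    let ?M = "cgmat N n" and ?q = "gs_norm N j"
    have PM: "prob_space ?M" by (rule prob_space_cgmat)
    have qm: "?q \<in> borel_measurable ?M" using j by (intro measurable_gs_norm) simp
    define f where "f z = sep S (a n / ?q z)" for z
    have fm: "f \<in> borel_measurable ?M"
    proof -
      have "(\<lambda>z. a n / ?q z) \<in> borel_measurable ?M" using qm by measurable
      then have "(\<lambda>z. f z) \<in> borel_measurable ?M" unfolding f_def by (rule measurable_compose[OF _ measurable_sep[OF S]])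
      then show ?thesis by simp
    qed
    have fi: "integrable ?M f"
      by (rule finite_measure.integrable_const_bound[OF prob_space.finite_measure[OF PM], of _ 1]) (auto simp: f_def sep_bounds fm)
    define bad where "bad = {z \<in> space ?M. \<epsilon> * R \<le> \<bar>?q z - R\<bar>}"
    have bad_m: "bad \<in> sets ?M" unfolding bad_def using qm by measurable
    have bad: "measure ?M bad \<le> 1 / (\<epsilon>\<^sup>2 * R)"
      using gs_norm_concentration[OF j(2) \<epsilon>] unfolding bad_def R_def j(1) .
    have "1 / (\<epsilon>\<^sup>2 * R) < e / 3"
    proof -
      have "3 < R * (e * \<epsilon>\<^sup>2)" using R(1) e \<epsilon> by (simp add: divide_less_eq)
      then have "3 < e * (\<epsilon>\<^sup>2 * R)" by (simp add: mult_ac)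
      then show ?thesis using R(2) \<epsilon> by (simp add: divide_less_eq)
    qed
    then have bad: "measure ?M bad < e / 3" using bad by simp
    have "\<bar>(LINT z|?M. f z) - sep S x0\<bar> = \<bar>LINT z|?M. f z - sep S x0\<bar>"
      using fi by (subst Bochner_Integration.integral_diff)
        (auto simp: prob_space.prob_space[OF PM] intro: finite_measure.integrable_const prob_space.finite_measure PM)
    also have "\<dots> \<le> (LINT z|?M. \<bar>f z - sep S x0\<bar>)" by (rule integral_abs_bound)
    also have "\<dots> \<le> (LINT z|?M. e / 3 + indicator bad z)"
    proof (rule integral_mono)
      show "integrable ?M (\<lambda>z. \<bar>f z - sep S x0\<bar>)"
        using fi by (intro integrable_abs Bochner_Integration.integrable_diff finite_measure.integrable_const prob_space.finite_measure PM)
      show "integrable ?M (\<lambda>z. e / 3 + indicator bad z)"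
        by (intro Bochner_Integration.integrable_add finite_measure.integrable_const prob_space.finite_measure PM
          integrable_real_indicator bad_m) (simp add: finite_measure.emeasure_finite[OF prob_space.finite_measure[OF PM]] less_top[symmetric])
      fix z assume z: "z \<in> space ?M"
      show "\<bar>f z - sep S x0\<bar> \<le> e / 3 + indicator bad z"
      proof (cases "z \<in> bad")
        case True
        have "\<bar>f z - sep S x0\<bar> \<le> 1"
          using sep_bounds[of S "a n / ?q z"] sep_bounds[of S x0] unfolding f_def by linarith
        then show ?thesis using True e by simp
      next
        case False
        then have "\<bar>?q z - R\<bar> < \<epsilon> * R" using z by (auto simp: bad_def)
        then have "\<bar>?q z / R - 1\<bar> < \<epsilon>"
          using R(2) by (simp add: abs_less_iff field_simps)
        moreover have "\<bar>a n / R - x0\<bar> < \<epsilon>" using elim(2) by (simp add: R_def N_def j_def)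
        ultimately have "dist ((a n / R) / (?q z / R)) x0 < \<delta>" by (intro ratio)
        then have "dist (a n / ?q z) x0 < \<delta>" using R(2) by simp
        then have "dist (f z) (sep S x0) < e / 3" unfolding f_def by (rule \<delta>)
        then show ?thesis using False by (simp add: dist_real_def)
      qed
    qed
    also have "\<dots> = e / 3 + measure ?M bad"
      using bad_m by (subst Bochner_Integration.integral_add)
        (auto simp: prob_space.prob_space[OF PM] finite_measure.emeasure_finite[OF prob_space.finite_measure[OF PM]] less_top[symmetric]
          intro: finite_measure.integrable_const prob_space.finite_measure PM)
    also have "\<dots> < e" using bad e by simp
    finally show ?case by (simp add: dist_real_def f_def N_def j_def)
  qed
qed

text \<open>Any real number strictly between 0 and the essential infimum serves as lower
  bound.\<close>

lemma toeplitz_symbol_of_essinf: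
  assumes f: "has_fourier_coeffs f \<sigma>" and pos: "0 < essinf circ (\<lambda>\<omega>. ereal (f \<omega>))"
  obtains m where "toeplitz_symbol f \<sigma> m"
proof -
  define e where "e = essinf circ (\<lambda>\<omega>. ereal (f \<omega>))"
  obtain m where m: "0 < ereal m" "ereal m < e"
    using ereal_dense2[OF pos[folded e_def]] by auto
  have "AE \<omega> in circ. - ereal (f \<omega>) \<le> esssup circ (\<lambda>\<omega>. - ereal (f \<omega>))" by (rule esssup_AE)
  then have "AE \<omega> in circ. m \<le> f \<omega>"
  proof eventually_elim
    case (elim \<omega>)
    then have "e \<le> ereal (f \<omega>)" unfolding e_def essinf_def by (simp only: ereal_uminus_le_reorder)
    from less_le_trans[OF m(2) this] have "ereal m < ereal (f \<omega>)" .
    then show ?case by simp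
  qed
  then have "toeplitz_symbol f \<sigma> m" using f m(1) by unfold_locales auto
  then show thesis by (rule that)
qed

lemma size_filter_le: "size_filter \<beta> \<le> sequentially"
  by (simp add: size_filter_def)

lemma eventually_admissible: "\<forall>\<^sub>F n in size_filter \<beta>. n \<in> admissible \<beta>"
  by (simp add: size_filter_def eventually_inf_principal)

text \<open>The integral in \<open>error_probability\<close> does not depend on \<open>k\<close>, so
  averaging over \<open>k\<close> returns it. The closed form \<open>g\<close> agrees with
  \<open>sep S\<close> near the limit point, which transfers its continuity.\<close>

lemma avg_sep_limit:
  fixes P :: "nat \<Rightarrow> 'a measure"
    and H :: "nat \<Rightarrow> 'a \<Rightarrow> complex mat"
    and s \<xi> :: "nat \<Rightarrow> 'a \<Rightarrow> complex vec"
    and W :: "nat \<Rightarrow> complex mat" and ev :: "nat \<Rightarrow> nat \<Rightarrow> real"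
    and f g :: "real \<Rightarrow> real" and \<beta> noise_var \<Lambda> :: real
  assumes beta: "1 < \<beta>" and nv: "0 < noise_var"
    and symbol: "has_fourier_coeffs f \<sigma>"
    and essinf_pos: "0 < essinf circ (\<lambda>\<omega>. ereal (f \<omega>))"
    and Lambda: "\<Lambda> = 1 / (2 * pi) * (LINT \<omega>|circ. 1 / sqrt (f \<omega>))"
    and model: "\<And>n. n \<in> admissible \<beta> \<Longrightarrow>
          mimo_system (P n) (rx_antennas \<beta> n) n (toeplitz \<sigma> n) noise_var S (H n) (s n) (\<xi> n)"
    and eigen: "\<And>n. n \<in> admissible \<beta> \<Longrightarrow> eigen_decomposition n (toeplitz \<sigma> n) (W n) (ev n)"
    and S: "finite S" "S \<noteq> {}"
    and g: "\<And>x. 0 < x \<Longrightarrow> sep S x = g x" "\<And>x. 0 < x \<Longrightarrow> isCont g x"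
  shows "((\<lambda>n. avg_sep (P n) n S (H n) (s n) (\<xi> n) (precoder n (W n) (ev n))) \<longlongrightarrow>
    g (noise_var * \<Lambda>\<^sup>2 / (\<beta> - 1))) (size_filter \<beta>)"
proof -
  obtain m where "toeplitz_symbol f \<sigma> m" using symbol essinf_pos by (rule toeplitz_symbol_of_essinf)
  then interpret toeplitz_symbol f \<sigma> m .
  have Lam: "\<Lambda> = inv_sqrt_mean" by (simp add: Lambda inv_sqrt_mean_def)
  then have Lpos: "\<Lambda> > 0" by (simp add: inv_sqrt_mean_pos)
  define x0 where "x0 = noise_var * \<Lambda>\<^sup>2 / (\<beta> - 1)"
  have x0: "x0 > 0" using nv Lpos beta by (simp add: x0_def)
  have cont: "isCont (sep S) x0"
  proof -
    have "\<forall>\<^sub>F x in nhds x0. 0 < x"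
      using eventually_nhds_in_open[of "{0<..}" x0] x0 by simp
    then have "\<forall>\<^sub>F x in nhds x0. sep S x = g x" by eventually_elim (rule g)
    then show ?thesis using g(2)[OF x0] by (subst isCont_cong)
  qed
  let ?F = "size_filter \<beta>"
  define nr where "nr = rx_antennas \<beta>"
  define t where "t n = (\<Sum>i<n. 1 / sqrt (ev n i))" for n
  define a where "a n = noise_var * (t n / sqrt (real n))\<^sup>2" for n
  have adm: "0 < n" "real (nr n) = \<beta> * real n" "n \<le> nr n" if "n \<in> admissible \<beta>" for n
  proof -
    show n: "0 < n" using that by (simp add: admissible_def)
    show r: "real (nr n) = \<beta> * real n" unfolding nr_def by (rule real_rx_antennas[OF that])
    have "real n \<le> \<beta> * real n" using beta n by simp
    then show "n \<le> nr n" unfolding r[symmetric] by simp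
  qed
  have avg: "avg_sep (P n) n S (H n) (s n) (\<xi> n) (precoder n (W n) (ev n))
      = (LINT z|cgmat (nr n) n. sep S (a n / gs_norm (nr n) (n - 1) z))" if n: "n \<in> admissible \<beta>" for n
  proof -
    interpret mimo_system "P n" "rx_antennas \<beta> n" n "toeplitz \<sigma> n" noise_var S "H n" "s n" "\<xi> n"
      by (rule model[OF n])
    have d: "0 < ev n i" if "i < n" for i
      using eigenvalue_ge[OF eigen[OF n] that] m_pos by linarith
    have "measure (P n) {\<omega> \<in> space (P n). nearest S (zf_output (H n \<omega>) (precoder n (W n) (ev n)) (s n \<omega>) (\<xi> n \<omega>) $ k) \<noteq> s n \<omega> $ k}
        = (LINT z|cgmat (nr n) n. sep S (a n / gs_norm (nr n) (n - 1) z))" if k: "k < n" for k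
      unfolding nr_def a_def t_def
      by (rule error_probability[OF nv adm(3)[OF n, unfolded nr_def] eigen[OF n] d k S])
    then show ?thesis using adm(1)[OF n] by (simp add: avg_sep_def)
  qed
  \<comment> \<open>The last of \<open>n\<close> columns has index \<open>n - 1\<close>, so the rank
    is \<open>Nr - n + 1\<close>; the extra 1 disappears after division by \<open>n\<close>.\<close>
  have nr1: "real (nr n) - real (n - 1) = (\<beta> - 1) * real n + 1" if "n \<in> admissible \<beta>" for n
    using adm[OF that] by (simp add: of_nat_diff algebra_simps)
  have "((\<lambda>n. (LINT z|cgmat (nr n) n. sep S (a n / gs_norm (nr n) (n - 1) z))) \<longlongrightarrow> sep S x0) ?F"
  proof (rule sep_limit[OF S(1) cont])
    show "\<forall>\<^sub>F n in ?F. 0 < n \<and> n \<le> nr n"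
      using eventually_admissible by eventually_elim (simp add: adm)
    have "filterlim (\<lambda>n. (\<beta> - 1) * real n) at_top sequentially"
      using beta by (intro filterlim_tendsto_pos_mult_at_top[OF tendsto_const] filterlim_real_sequentially) simp
    then have lin: "filterlim (\<lambda>n. (\<beta> - 1) * real n) at_top ?F"
      by (rule filterlim_mono[OF _ order_refl size_filter_le])
    show "filterlim (\<lambda>n. real (nr n) - real (n - 1)) at_top ?F"
    proof (rule filterlim_at_top_mono[OF lin])
      show "\<forall>\<^sub>F n in ?F. (\<beta> - 1) * real n \<le> real (nr n) - real (n - 1)"
        using eventually_admissible
      proof eventually_elim
        case (elim n)
        show ?case unfolding nr1[OF elim] by simp
      qed
    qed
    have inv: "((\<lambda>n. 1 / real n) \<longlongrightarrow> 0) ?F"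
      using lim_1_over_n by (rule tendsto_mono[OF size_filter_le])
    have sz: "((\<lambda>n. t n / real n) \<longlongrightarrow> \<Lambda>) ?F"
      unfolding t_def Lam
    proof (rule szego_inverse_sqrt[OF size_filter_le])
      show "\<forall>\<^sub>F n in ?F. eigen_decomposition n (toeplitz \<sigma> n) (W n) (ev n)"
        using eventually_admissible by eventually_elim (rule eigen)
    qed
    have "((\<lambda>n. noise_var * (t n / real n)\<^sup>2 / ((\<beta> - 1) + 1 / real n)) \<longlongrightarrow> noise_var * \<Lambda>\<^sup>2 / ((\<beta> - 1) + 0)) ?F"
      using beta
      by (intro tendsto_divide[OF tendsto_mult[OF tendsto_const tendsto_power[OF sz]] tendsto_add[OF tendsto_const inv]]) simp
    moreover have "\<forall>\<^sub>F n in ?F. noise_var * (t n / real n)\<^sup>2 / ((\<beta> - 1) + 1 / real n) = a n / (real (nr n) - real (n - 1))"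
      using eventually_admissible
    proof eventually_elim
      case (elim n)
      have n: "real n > 0" using adm(1)[OF elim] by simp
      have "(\<beta> - 1) + 1 / real n = ((\<beta> - 1) * real n + 1) / real n"
        using n by (simp add: add_divide_distrib)
      moreover have "noise_var * (t n / real n)\<^sup>2 = a n / real n"
        using n by (simp add: a_def power_divide power2_eq_square)
      ultimately show ?case unfolding nr1[OF elim] using n by simp
    qed
    ultimately have "((\<lambda>n. a n / (real (nr n) - real (n - 1))) \<longlongrightarrow> noise_var * \<Lambda>\<^sup>2 / ((\<beta> - 1) + 0)) ?F"
      by (rule Lim_transform_eventually)
    then show "((\<lambda>n. a n / (real (nr n) - real (n - 1))) \<longlongrightarrow> x0) ?F"
      by (simp only: x0_def add_0_right)
  qed
  moreover have "\<forall>\<^sub>F n in ?F. (LINT z|cgmat (nr n) n. sep S (a n / gs_norm (nr n) (n - 1) z))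
      = avg_sep (P n) n S (H n) (s n) (\<xi> n) (precoder n (W n) (ev n))"
    using eventually_admissible by eventually_elim (simp add: avg)
  ultimately have "((\<lambda>n. avg_sep (P n) n S (H n) (s n) (\<xi> n) (precoder n (W n) (ev n))) \<longlongrightarrow> sep S x0) ?F"
    by (rule Lim_transform_eventually)
  then show ?thesis unfolding x0_def[symmetric] g(1)[OF x0] .
qed

lemma isCont_gaussian_Q_sqrt:
  assumes x: "0 < x" and K: "K \<noteq> 0"
  shows "isCont (\<lambda>x. gaussian_Q (sqrt (c / (K * x)))) x"
proof -
  have "isCont (\<lambda>x. sqrt (c / (K * x))) x" using x K by (intro continuous_intros) auto
  then show ?thesis by (rule isCont_o2[OF _ isCont_gaussian_Q])
qed

theorem theorem2:
  fixes P :: "nat \<Rightarrow> 'a measure"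
    and H :: "nat \<Rightarrow> 'a \<Rightarrow> complex mat"
    and s \<xi> :: "nat \<Rightarrow> 'a \<Rightarrow> complex vec"
    and W :: "nat \<Rightarrow> complex mat" and ev :: "nat \<Rightarrow> nat \<Rightarrow> real"
    and \<sigma> :: "int \<Rightarrow> complex" and s\<^sub>\<Sigma> :: "real \<Rightarrow> real"
    and S :: "complex set" and M :: nat
    and \<beta> \<eta> noise_var \<Lambda> :: real
  assumes beta: "1 < \<beta>"
    and snr: "0 < noise_var" "\<eta> = 1 / noise_var"
    and hermitian: "\<And>k. \<sigma> (- k) = cnj (\<sigma> k)"
    and square_summable: "summable (\<lambda>k::nat. (cmod (\<sigma> (int k)))\<^sup>2)"
    and symbol: "has_fourier_coeffs s\<^sub>\<Sigma> \<sigma>"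
    and essinf_pos: "0 < essinf (lebesgue_on {0..2 * pi}) (\<lambda>\<omega>. ereal (s\<^sub>\<Sigma> \<omega>))"
    and Lambda: "\<Lambda> = 1 / (2 * pi) * (LINT \<omega>|lebesgue_on {0..2 * pi}. 1 / sqrt (s\<^sub>\<Sigma> \<omega>))"
    and model: "\<And>n. n \<in> admissible \<beta> \<Longrightarrow>
          mimo_system (P n) (rx_antennas \<beta> n) n (toeplitz \<sigma> n) noise_var S (H n) (s n) (\<xi> n)"
    and eigen: "\<And>n. n \<in> admissible \<beta> \<Longrightarrow> eigen_decomposition n (toeplitz \<sigma> n) (W n) (ev n)"
  shows "(2 \<le> M \<and> S = pam M \<longrightarrow>
            ((\<lambda>n. avg_sep (P n) n S (H n) (s n) (\<xi> n) (precoder n (W n) (ev n))) \<longlongrightarrow>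
              2 * (real M - 1) / real M *
                gaussian_Q (sqrt (6 * \<eta> * (\<beta> - 1) / (((real M)\<^sup>2 - 1) * \<Lambda>\<^sup>2)))) (size_filter \<beta>))
       \<and> (2 \<le> M \<and> S = psk M \<longrightarrow>
            ((\<lambda>n. avg_sep (P n) n S (H n) (s n) (\<xi> n) (precoder n (W n) (ev n))) \<longlongrightarrow>
              1 / pi * (LINT \<theta>:{0..(real M - 1) * pi / real M}|lborel.
                exp (- (\<eta> * (\<beta> - 1) * (sin (pi / real M))\<^sup>2 / (\<Lambda>\<^sup>2 * (sin \<theta>)\<^sup>2))))) (size_filter \<beta>))
       \<and> ((\<exists>L::nat. 2 \<le> L \<and> M = L\<^sup>2) \<and> S = qam M \<longrightarrow>
            ((\<lambda>n. avg_sep (P n) n S (H n) (s n) (\<xi> n) (precoder n (W n) (ev n))) \<longlongrightarrow>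
              4 * (sqrt (real M) - 1) / sqrt (real M) *
                gaussian_Q (sqrt (3 * \<eta> * (\<beta> - 1) / ((real M - 1) * \<Lambda>\<^sup>2)))
              - 4 * (sqrt (real M) - 1)\<^sup>2 / real M *
                (gaussian_Q (sqrt (3 * \<eta> * (\<beta> - 1) / ((real M - 1) * \<Lambda>\<^sup>2))))\<^sup>2) (size_filter \<beta>))"
proof -
  \<comment> \<open>The limiting effective noise variance; with
    \<open>\<eta> = 1 / noise_var\<close> its reciprocal is the factor
    \<open>\<eta> * (\<beta> - 1) / \<Lambda>^2\<close> of the three formulas.\<close>
  let ?x = "noise_var * \<Lambda>\<^sup>2 / (\<beta> - 1)"
  note limit = avg_sep_limit[OF beta snr(1) symbol essinf_pos Lambda model eigen]
  have "((\<lambda>n. avg_sep (P n) n S (H n) (s n) (\<xi> n) (precoder n (W n) (ev n))) \<longlongrightarrow>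
      2 * (real M - 1) / real M * gaussian_Q (sqrt (6 * \<eta> * (\<beta> - 1) / (((real M)\<^sup>2 - 1) * \<Lambda>\<^sup>2)))) (size_filter \<beta>)"
    if M: "2 \<le> M" and S: "S = pam M"
  proof -
    have K: "(real M)\<^sup>2 - 1 \<noteq> 0" using M one_less_power[of "real M" 2] by linarith
    have fin: "finite S" "S \<noteq> {}" using M by (auto simp: S pam_eq)
    have "((\<lambda>n. avg_sep (P n) n S (H n) (s n) (\<xi> n) (precoder n (W n) (ev n))) \<longlongrightarrow>
        2 * (real M - 1) / real M * gaussian_Q (sqrt (6 / (((real M)\<^sup>2 - 1) * ?x)))) (size_filter \<beta>)"
    proof (rule limit[OF _ _ fin])
      show "sep S x = 2 * (real M - 1) / real M * gaussian_Q (sqrt (6 / (((real M)\<^sup>2 - 1) * x)))" if "0 < x" for x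
        unfolding S by (rule sep_pam[OF M that])
      show "isCont (\<lambda>x. 2 * (real M - 1) / real M * gaussian_Q (sqrt (6 / (((real M)\<^sup>2 - 1) * x)))) x" if "0 < x" for x
        by (intro continuous_mult continuous_const isCont_gaussian_Q_sqrt that K)
    qed
    moreover have "6 / (k * ?x) = 6 * \<eta> * (\<beta> - 1) / (k * \<Lambda>\<^sup>2)" for k
      by (simp add: snr(2) mult_ac)
    ultimately show ?thesis by simp
  qed
  moreover have "((\<lambda>n. avg_sep (P n) n S (H n) (s n) (\<xi> n) (precoder n (W n) (ev n))) \<longlongrightarrow>
      1 / pi * (LINT \<theta>:{0..(real M - 1) * pi / real M}|lborel.
        exp (- (\<eta> * (\<beta> - 1) * (sin (pi / real M))\<^sup>2 / (\<Lambda>\<^sup>2 * (sin \<theta>)\<^sup>2))))) (size_filter \<beta>)"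
    if M: "2 \<le> M" and S: "S = psk M"
  proof -
    have "card S = M" using M by (simp add: S card_psk)
    then have fin: "finite S" "S \<noteq> {}" using M by (auto intro: card_ge_0_finite)
    have "((\<lambda>n. avg_sep (P n) n S (H n) (s n) (\<xi> n) (precoder n (W n) (ev n))) \<longlongrightarrow> psk_integral M ?x) (size_filter \<beta>)"
    proof (rule limit[OF _ _ fin])
      show "sep S x = psk_integral M x" if "0 < x" for x unfolding S by (rule sep_psk[OF M that])
      show "isCont (psk_integral M) x" if "0 < x" for x by (rule isCont_psk_integral[OF that])
    qed
    moreover have "k / (?x * l) = \<eta> * (\<beta> - 1) * k / (\<Lambda>\<^sup>2 * l)" for k l
      by (simp add: snr(2) mult_ac)
    ultimately show ?thesis by (simp only: psk_integral_def)
  qed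
  moreover have "((\<lambda>n. avg_sep (P n) n S (H n) (s n) (\<xi> n) (precoder n (W n) (ev n))) \<longlongrightarrow>
      4 * (sqrt (real M) - 1) / sqrt (real M) * gaussian_Q (sqrt (3 * \<eta> * (\<beta> - 1) / ((real M - 1) * \<Lambda>\<^sup>2)))
      - 4 * (sqrt (real M) - 1)\<^sup>2 / real M * (gaussian_Q (sqrt (3 * \<eta> * (\<beta> - 1) / ((real M - 1) * \<Lambda>\<^sup>2))))\<^sup>2) (size_filter \<beta>)"
    if L: "2 \<le> L" and M: "M = L\<^sup>2" and S: "S = qam M" for L
  proof -
    have K: "real M - 1 \<noteq> 0" using L one_less_power[of "real L" 2] by (simp only: M of_nat_power) linarith
    have sq: "sqrt (real M) = real L" "real M = (real L)\<^sup>2" by (simp_all add: M)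
    have fin: "finite S" "S \<noteq> {}" using L unfolding S M qam_eq by auto
    define g where "g x = 4 * (real L - 1) / real L * gaussian_Q (sqrt (3 / ((real M - 1) * x)))
        - 4 * (real L - 1)\<^sup>2 / (real L)\<^sup>2 * (gaussian_Q (sqrt (3 / ((real M - 1) * x))))\<^sup>2" for x
    have "((\<lambda>n. avg_sep (P n) n S (H n) (s n) (\<xi> n) (precoder n (W n) (ev n))) \<longlongrightarrow> g ?x) (size_filter \<beta>)"
    proof (rule limit[OF _ _ fin])
      show "sep S x = g x" if "0 < x" for x unfolding S M g_def by (rule sep_qam[OF L that])
      show "isCont g x" if "0 < x" for x
        unfolding g_def[abs_def]
        by (intro continuous_diff continuous_mult continuous_power continuous_const isCont_gaussian_Q_sqrt that K)
    qed
    moreover have "3 / (k * ?x) = 3 * \<eta> * (\<beta> - 1) / (k * \<Lambda>\<^sup>2)" for k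
      by (simp add: snr(2) mult_ac)
    ultimately show ?thesis by (simp only: g_def sq(1)) (simp only: sq(2))
  qed
  ultimately show ?thesis by blast
qed

end
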